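(* (1) For any $\phi\in\mathbf B$ and $\beta>0$, there exists a positive random variable $\mathbb F_\beta(\phi)$ whose distribution is determined by $$\mathbb E\left[\mathbb F_\beta(\phi)^{z}\right]=\frac{\Gamma(1-\frac z\beta)\,\Gamma(\frac z\beta+1)}{W_\phi(\frac z\beta+1)},\qquad -\underline{\mathfrak m}_{\mathbb F}<\Re(z)<\overline{\mathfrak m}_{\mathbb F},$$ where $\underline{\mathfrak m}_{\mathbb F}=\beta(\mathfrak a_\phi\mathbb I_{\{\phi(0)=0\}}+1)$ and $\overline{\mathfrak m}_{\mathbb F}=\beta$. (2) Moreover, its law is absolutely continuous with a density $f_{\mathbb F_\beta(\phi)}\in\mathtt C_0^\infty(\mathbb R^+)$ which admits an analytical extension to the sector $S_\phi=\{z\in\mathbb C:\ |\arg(z)|<\pi-\overline\Theta_\phi\}$ given, for any $c\in\left(-\frac{\underline{\mathfrak m}_{\mathbb F}-1}{\beta},\frac{\overline{\mathfrak m}_{\mathbb F}+1}{\beta}\right)$, by the Mellin–Barnes integral $$f_{\mathbb F_\beta(\phi)}(t)=\frac{\beta}{2\pi i}\int_{c-i\infty}^{c+i\infty}t^{-z\beta}\,\frac{\Gamma(-z+1+\frac1\beta)\,\Gamma(z+1-\frac1\beta)}{W_\phi(z+1-\frac1\beta)}\,dz,$$ which expands, for $|t|>\phi(\infty)^{-\frac1\beta}$, as $$f_{\mathbb F_\beta(\phi)}(t)=\beta t^{-\beta-1}\,\mathrm I_\phi(e^{i\pi}t^{-\beta}),\qquad\text{where } \mathrm I_\phi(z)=\sum_{n=0}^\infty\frac{n+1}{\phi(n+1)}\frac{z^n}{W_\phi(n+1)},\quad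 |z|<\phi(\infty).$$
   Context: $\mathbf B$ is the set of (not identically zero) Bernstein functions $\phi(u)=\phi(0)+\mathrm d u+\int_0^\infty(1-e^{-uy})\vartheta(dy)$, with $\phi(0)\ge0$, $\mathrm d\ge0$ and $\vartheta$ a measure on $(0,\infty)$ with $\int_0^\infty(1\wedge y)\vartheta(dy)<\infty$; the formula is extended to all complex $u$ for which the integral converges absolutely. $\phi(\infty)=\lim_{u\to\infty}\phi(u)\in(0,\infty]$, with $\infty^{-1/\beta}=0$. For $\phi\in\mathbf B$, $\mathfrak a_\phi=\sup\{u\ge0:|\phi(-u)|<\infty\}$ and $\mathfrak a^*_\phi=\sup\{u\ge0:0\le\phi(-u)<\infty\}$, both in $[0,\infty]$. $W_\phi$ is the unique function which is the Mellin transform of a positive measure and solves $W_\phi(z+1)=\phi(z)W_\phi(z)$, $W_\phi(1)=1$, for $\Re(z)>-\mathfrak a^*_\phi$; thus $W_\phi(n+1)=\prod_{k=1}^n\phi(k)$ for integers $n\ge0$. The quotient $z\mapsto\Gamma(z)/W_\phi(z)$ is understood through its analytic extension, to $\Re(z)>-\mathfrak a_\phi$ when $\phi(0)=0$. $\overline\Theta_\phi=\limsup_{|b|\to\infty}\frac{1}{|b|}\int_0^{|b|}\arg\phi(1+iu)\,du\in[0,\frac\pi2]$. $\mathtt C_0^\infty(\mathbb R^+)$ is the space of infinitely continuously differentiable functions on $\mathbb R^+$ vanishing at $\infty$ along with their derivatives.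
   Formalization: For β>1 the sector S_φ is replaced by those t in S_φ with β|arg t|<π−Θ̄_φ, for the extension, the Mellin–Barnes formula and the expansion; the original sector fails for φ=1, β=2, where the density 2t/(1+t²)² has poles at ±i. *)

theory Defs
  imports "HOL-Probability.Probability"
begin

text \<open>
  A Bernstein function is given by its characteristics: the killing rate \<^term>\<open>\<phi>(0)\<close>, the drift
  and the Levy measure.  They determine the extension of the function to complex arguments and
  the set of arguments at which it is finite.
\<close>

record bernstein =
  killing :: real
  drift :: real
  levy :: "real measure"

definition bern_finite :: "bernstein \<Rightarrow> complex \<Rightarrow> bool" where
  "bern_finite \<phi> u \<longleftrightarrow> integrable (levy \<phi>) (\<lambda>y. 1 - exp (- u * complex_of_real y))"

text \<open>Only meaningful at those \<open>u\<close> for which \<^term>\<open>bern_finite \<phi> u\<close>; elsewhere the value is an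
  artefact of the totality of the Bochner integral.\<close>

definition bern :: "bernstein \<Rightarrow> complex \<Rightarrow> complex" where
  "bern \<phi> u = complex_of_real (killing \<phi>) + complex_of_real (drift \<phi>) * u
     + (\<integral>y. (1 - exp (- u * complex_of_real y)) \<partial>(levy \<phi>))"

text \<open>Measures on \<open>(0,\<infinity>)\<close> are Borel measures on the real line that do not charge \<open>(-\<infinity>,0]\<close>.\<close>

definition Bernstein_functions :: "bernstein set" where
  "Bernstein_functions = {\<phi>.
      0 \<le> killing \<phi> \<and> 0 \<le> drift \<phi> \<and>
      sets (levy \<phi>) = sets borel \<and> emeasure (levy \<phi>) {..0} = 0 \<and>
      (\<integral>\<^sup>+y. ennreal (min 1 y) \<partial>(levy \<phi>)) < \<infinity> \<and>
      (\<exists>u::real. 0 \<le> u \<and> bern \<phi> (complex_of_real u) \<noteq> 0)}"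

definition bern_infty :: "bernstein \<Rightarrow> ereal" where
  "bern_infty \<phi> = Lim at_top (\<lambda>u::real. ereal (Re (bern \<phi> (complex_of_real u))))"

definition a_bern :: "bernstein \<Rightarrow> ereal" where
  "a_bern \<phi> = Sup {ereal u |u. 0 \<le> u \<and> bern_finite \<phi> (complex_of_real (- u))}"

definition a_star_bern :: "bernstein \<Rightarrow> ereal" where
  "a_star_bern \<phi> = Sup {ereal u |u. 0 \<le> u \<and> bern_finite \<phi> (complex_of_real (- u)) \<and>
                                      0 \<le> Re (bern \<phi> (complex_of_real (- u)))}"

definition is_bernstein_gamma :: "bernstein \<Rightarrow> (complex \<Rightarrow> complex) \<Rightarrow> bool" where
  "is_bernstein_gamma \<phi> W \<longleftrightarrow>
     (\<exists>\<nu>::real measure. sets \<nu> = sets borel \<and> emeasure \<nu> {..0} = 0 \<and>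
        (\<forall>z. - a_star_bern \<phi> < ereal (Re z) \<longrightarrow>
           integrable \<nu> (\<lambda>y. complex_of_real y powr (z - 1)) \<and>
           W z = (\<integral>y. complex_of_real y powr (z - 1) \<partial>\<nu>))) \<and>
     (\<forall>z. - a_star_bern \<phi> < ereal (Re z) \<longrightarrow> W (z + 1) = bern \<phi> z * W z) \<and>
     W 1 = 1"

text \<open>The value \<open>0\<close> outside the half-plane of definition is a convention that makes the total
  function unique; likewise in \<open>Gamma_over_W\<close> below.\<close>

definition W_bern :: "bernstein \<Rightarrow> complex \<Rightarrow> complex" where
  "W_bern \<phi> = (THE W. is_bernstein_gamma \<phi> W \<and>
                       (\<forall>z. ereal (Re z) \<le> - a_star_bern \<phi> \<longrightarrow> W z = 0))"

definition a_killed :: "bernstein \<Rightarrow> ereal" where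
  "a_killed \<phi> = (if bern \<phi> 0 = 0 then a_bern \<phi> else 0)"

text \<open>The analytic extension of \<open>\<Gamma>/W\<^sub>\<phi>\<close> to \<open>Re w > -\<aa>\<^sub>\<phi>\<close> if \<open>\<phi>(0) = 0\<close>, and to \<open>Re w > 0\<close> otherwise.
  Evaluating \<open>Gamma w / W_bern \<phi> w\<close> directly would be wrong for \<open>Re w \<le> 0\<close>, where \<open>W_bern\<close> need not
  be defined.\<close>

definition Gamma_over_W :: "bernstein \<Rightarrow> complex \<Rightarrow> complex" where
  "Gamma_over_W \<phi> = (THE h.
      h holomorphic_on {w. - a_killed \<phi> < ereal (Re w)} \<and>
      (\<forall>w. 0 < Re w \<longrightarrow> h w = Gamma w / W_bern \<phi> w) \<and>
      (\<forall>w. ereal (Re w) \<le> - a_killed \<phi> \<longrightarrow> h w = 0))"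

definition m_lower :: "bernstein \<Rightarrow> real \<Rightarrow> ereal" where
  "m_lower \<phi> \<beta> = ereal \<beta> * (a_killed \<phi> + 1)"

definition m_upper :: "real \<Rightarrow> ereal" where
  "m_upper \<beta> = ereal \<beta>"

definition is_F :: "bernstein \<Rightarrow> real \<Rightarrow> 'a measure \<Rightarrow> ('a \<Rightarrow> real) \<Rightarrow> bool" where
  "is_F \<phi> \<beta> M X \<longleftrightarrow>
     prob_space M \<and> X \<in> borel_measurable M \<and> (AE \<omega> in M. 0 < X \<omega>) \<and>
     (\<forall>z. - m_lower \<phi> \<beta> < ereal (Re z) \<and> ereal (Re z) < m_upper \<beta> \<longrightarrow>
        integrable M (\<lambda>\<omega>. complex_of_real (X \<omega>) powr z) \<and>
        (\<integral>\<omega>. complex_of_real (X \<omega>) powr z \<partial>M) =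
          Gamma (1 - z / complex_of_real \<beta>) * Gamma_over_W \<phi> (z / complex_of_real \<beta> + 1))"

definition Theta_upper :: "bernstein \<Rightarrow> real" where
  "Theta_upper \<phi> = real_of_ereal (Limsup at_infinity (\<lambda>b::real.
      ereal (1 / \<bar>b\<bar> * integral {0..\<bar>b\<bar>} (\<lambda>u. Arg (bern \<phi> (1 + \<i> * complex_of_real u))))))"

definition S_bern :: "bernstein \<Rightarrow> complex set" where
  "S_bern \<phi> = {z. z \<noteq> 0 \<and> \<bar>Arg z\<bar> < pi - Theta_upper \<phi>}"

text \<open>
  For \<open>\<beta> \<le> 1\<close> this is all of \<^term>\<open>S_bern \<phi>\<close>.  Along \<open>z = c + i b\<close> the Mellin--Barnes integrand is only
  known to decay like \<open>exp (- (\<pi> - \<Theta> - \<beta> \<bar>arg t\<bar>) \<bar>b\<bar>)\<close>, up to a subexponential factor and with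
  \<open>\<Theta> = Theta_upper \<phi>\<close>.  So for \<open>\<beta> > 1\<close> the variable that ranges over the sector is \<open>t\<^sup>\<beta>\<close>, not \<open>t\<close>, and
  the larger sector is impossible: if \<open>\<phi> = 1\<close> (so that \<open>W\<^sub>\<phi> = 1\<close>, \<open>\<Theta> = 0\<close>) and \<open>\<beta> = 2\<close>, the density is
  \<open>2 t / (1 + t\<^sup>2)\<^sup>2\<close>, whose poles \<open>i\<close>, \<open>-i\<close> lie in \<open>S_bern \<phi>\<close>.
\<close>

definition S_sector :: "bernstein \<Rightarrow> real \<Rightarrow> complex set" where
  "S_sector \<phi> \<beta> = {t \<in> S_bern \<phi>. \<beta> * \<bar>Arg t\<bar> < pi - Theta_upper \<phi>}"

text \<open>Smooth on \<open>(0,\<infinity>)\<close>, all derivatives vanishing at \<open>+\<infinity>\<close>; there is no condition at \<open>0\<close>.\<close>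

definition C0_infty :: "(real \<Rightarrow> real) set" where
  "C0_infty = {f. \<forall>n. (\<forall>t>0. (deriv ^^ n) f field_differentiable at t) \<and>
                      (((deriv ^^ n) f) \<longlongrightarrow> 0) at_top}"

definition MB_integrand :: "bernstein \<Rightarrow> real \<Rightarrow> complex \<Rightarrow> complex \<Rightarrow> complex" where
  "MB_integrand \<phi> \<beta> t z =
     t powr (- z * complex_of_real \<beta>) *
     (Gamma (- z + 1 + 1 / complex_of_real \<beta>) * Gamma_over_W \<phi> (z + 1 - 1 / complex_of_real \<beta>))"

definition vertical_integrable :: "real \<Rightarrow> (complex \<Rightarrow> complex) \<Rightarrow> bool" where
  "vertical_integrable c g \<longleftrightarrow> integrable lborel (\<lambda>b. g (Complex c b))"

text \<open>The factor \<open>\<i>\<close> is the derivative of the parametrisation \<open>b \<mapsto> c + i b\<close>.\<close>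

definition vertical_integral :: "real \<Rightarrow> (complex \<Rightarrow> complex) \<Rightarrow> complex" where
  "vertical_integral c g = (\<integral>b. g (Complex c b) * \<i> \<partial>lborel)"

definition I_coeff :: "bernstein \<Rightarrow> nat \<Rightarrow> complex" where
  "I_coeff \<phi> n = of_nat (n + 1) / bern \<phi> (of_nat (n + 1)) * (1 / W_bern \<phi> (of_nat (n + 1)))"

definition I_bern :: "bernstein \<Rightarrow> complex \<Rightarrow> complex" where
  "I_bern \<phi> z = (\<Sum>n. I_coeff \<phi> n * z ^ n)"

definition expansion_radius :: "bernstein \<Rightarrow> real \<Rightarrow> real" where
  "expansion_radius \<phi> \<beta> =
     (if bern_infty \<phi> = \<infinity> then 0 else real_of_ereal (bern_infty \<phi>) powr (- 1 / \<beta>))"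

end

theory Submission
  imports Defs "HOL-Complex_Analysis.Complex_Analysis" "HOL-Real_Asymp.Real_Asymp"
begin

text \<open>
  The law is that of \<open>F = (I / e) powr (1 / \<beta>)\<close>, where \<open>e\<close> is a standard exponential variable and \<open>I\<close> is
  an independent positive variable with moments \<open>E(I powr s) = \<Gamma>(s + 1) / W(s + 1)\<close>, the exponential
  functional attached to \<open>\<phi>\<close>.  Since \<open>E(e powr (- w)) = \<Gamma>(1 - w)\<close>, the variable \<open>F\<close> has the required
  Mellin transform at \<open>z = \<beta> w\<close>, and conditioning on \<open>I\<close> gives its density
  \<open>\<beta> t powr (- \<beta> - 1) E(I exp (- I t powr (- \<beta>)))\<close>.  Everything else is read off from these formulas.

  The existence of \<open>W\<close> and of \<open>I\<close> comes from one construction.  The function \<open>W(z + 1)\<close> is the limit of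
  the Gauss products \<open>\<phi>(n) powr z * (\<Prod>k = 1..n. \<phi>(k) / \<phi>(k + z))\<close>; they converge because
  \<open>log \<phi>\<close> has derivatives of order \<open>1 / Re z\<close> and \<open>1 / (Re z)\<^sup>2\<close>, exactly as the logarithm has
  (\<open>gauss_tail_converges\<close>).  Each factor \<open>\<phi>(k) / \<phi>(k + z)\<close> is the Laplace transform of a
  probability law, as a limit of geometric compounds (\<open>laplace_inverse_bern\<close>), and Laplace
  transforms are stable under products and under limits (\<open>laplace_continuity\<close>).  Hence \<open>W\<close> is a Mellin
  transform; uniqueness holds because its integer moments grow at most like \<open>C ^ n n!\<close>
  (\<open>moment_determinate\<close>).  The exponential functional arises in the same way from the factors
  \<open>Q(k + z) / Q(k)\<close> with \<open>Q(u) = \<phi>(u) / u\<close>, whose product is the Gauss product of the gamma function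
  divided by that of \<open>\<phi>\<close> (\<open>laplace_Q_ratio\<close>, \<open>exists_exponential_functional\<close>).  The function \<open>Q\<close>
  has no singularity at \<open>0\<close> when \<open>\<phi>(0) = 0\<close>, and so the moments of \<open>I\<close> provide the analytic
  extension of \<open>\<Gamma> / W\<close> (\<open>Gamma_over_W_eq\<close>).

  The width of the sector is a Stirling-type estimate: \<open>log |W(a) / W(a + i b)|\<close> is the limit of the sums
  of \<open>log |\<phi>(a + j + i b) / \<phi>(a + j)|\<close> over \<open>j < n\<close>, which the midpoint rule turns into a difference of values of a
  primitive of \<open>log \<phi>\<close>, and that difference is the integral of \<open>arg \<phi>\<close> along a vertical line up to
  a logarithm (\<open>BG_decay\<close>).  Together with the reflection formula for \<open>\<Gamma>\<close>, the Mellin transform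
  decays faster than \<open>exp (- \<kappa> |b|)\<close> for every \<open>\<kappa> < \<pi> - \<Theta>\<close> (\<open>Mel_decay\<close>).  So the Mellin-Barnes
  integral converges and is holomorphic on the sector; on the positive axis it is the density by
  Mellin inversion (\<open>mellin_inversion\<close>, \<open>dens_mellin_barnes\<close>), hence it is the analytic extension and
  does not depend on the line of integration.

  Finally, \<open>E(I powr (n + 1)) / n!\<close> is the coefficient of the series \<open>I_bern\<close>, so that its value at \<open>- s\<close>
  is the Taylor series of \<open>E(I exp (- s I))\<close> (\<open>laplace_I_series\<close>); its radius of convergence is
  \<open>\<phi>(\<infinity>)\<close> by the ratio test, and the identity theorem carries the expansion from the axis to the
  sector (\<open>dens_ext_expansion\<close>).
\<close>


section \<open>Holomorphic parameter integrals\<close>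

text \<open>
  A local integrable bound for the integrand also bounds its difference quotients, by Cauchy's
  inequality on slightly smaller discs; dominated convergence then differentiates under the
  integral.
\<close>

lemma holomorphic_on_integral:
  fixes f :: "complex \<Rightarrow> 'a \<Rightarrow> complex"
  assumes S: "open S"
    and meas: "\<And>z. z \<in> S \<Longrightarrow> f z \<in> borel_measurable M"
    and hol: "\<And>y. y \<in> space M \<Longrightarrow> (\<lambda>z. f z y) holomorphic_on S"
    and bound: "\<And>z. z \<in> S \<Longrightarrow> \<exists>r>0. \<exists>B. cball z r \<subseteq> S \<and> integrable M B \<and>
        (AE y in M. \<forall>w\<in>cball z r. norm (f w y) \<le> B y)"
  shows "(\<lambda>z. \<integral>y. f z y \<partial>M) holomorphic_on S"
proof (rule holomorphic_onI)
  fix z assume z: "z \<in> S"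
  then obtain r B where r: "r > 0" "cball z r \<subseteq> S" and B: "integrable M B"
    and fB: "AE y in M. \<forall>w\<in>cball z r. norm (f w y) \<le> B y"
    using bound by blast
  define f' where "f' y = deriv (\<lambda>z. f z y) z" for y
  have intg: "integrable M (f w)" if "w \<in> cball z r" for w
  proof (rule Bochner_Integration.integrable_bound[OF B])
    show "f w \<in> borel_measurable M" using meas that r by auto
    show "AE y in M. norm (f w y) \<le> norm (B y)" using fB
      by eventually_elim (use that in fastforce)
  qed
  have quot: "norm ((f w y - f z y) / (w - z)) \<le> B y / (r/2)"
    if y: "y \<in> space M" and b: "\<forall>w\<in>cball z r. norm (f w y) \<le> B y" and w: "w \<in> ball z (r/2)" "w \<noteq> z" for w y
  proof -
    have hf: "(\<lambda>z. f z y) holomorphic_on S" using hol y by blast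
    have "norm (f w y - f z y) \<le> (B y / (r/2)) * norm (w - z)"
    proof (rule field_differentiable_bound[where S="ball z (r/2)" and f'="\<lambda>w. deriv (\<lambda>z. f z y) w"])
      fix u assume u: "u \<in> ball z (r/2)"
      have sub: "cball u (r/2) \<subseteq> cball z r"
        using u by (intro subsetI) (smt (verit) dist_commute dist_triangle field_sum_of_halves mem_ball mem_cball)
      have uS: "u \<in> S" using u r by (auto simp: subset_iff)
      show "((\<lambda>z. f z y) has_field_derivative deriv (\<lambda>z. f z y) u) (at u within ball z (r/2))"
        using holomorphic_derivI[OF hf S uS] DERIV_subset by blast
      have "norm ((deriv ^^ 1) (\<lambda>z. f z y) u) \<le> fact 1 * B y / (r/2) ^ 1"
      proof (rule Cauchy_inequality)
        show "(\<lambda>z. f z y) holomorphic_on ball u (r/2)"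
          using hf sub r by (meson ball_subset_cball holomorphic_on_subset subset_trans)
        show "continuous_on (cball u (r/2)) (\<lambda>z. f z y)"
          using hf sub r by (meson holomorphic_on_imp_continuous_on holomorphic_on_subset subset_trans)
        show "norm (f x y) \<le> B y" if "norm (u - x) = r/2" for x
          using that sub b by (auto simp: subset_iff dist_norm)
      qed (use r in auto)
      thus "norm (deriv (\<lambda>z. f z y) u) \<le> B y / (r/2)" by simp
    qed (use w r in auto)
    thus ?thesis using w r by (simp add: norm_divide divide_simps)
  qed
  have "((\<lambda>z. \<integral>y. f z y \<partial>M) has_field_derivative (\<integral>y. f' y \<partial>M)) (at z)"
    unfolding has_field_derivative_iff tendsto_at_iff_sequentially
  proof (intro allI impI)
    fix X :: "nat \<Rightarrow> complex"
    assume X: "\<forall>i. X i \<in> UNIV - {z}" "X \<longlonglongrightarrow> z"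
    obtain N where N: "\<And>n. n \<ge> N \<Longrightarrow> X n \<in> ball z (r/2)"
      using X(2) r unfolding lim_sequentially by (metis dist_commute half_gt_zero mem_ball)
    have XS: "X n \<in> S" if "n \<ge> N" for n
      using N[OF that] r by (auto simp: subset_iff)
    have lim: "(\<lambda>n. (f (X (n+N)) y - f z y) / (X (n+N) - z)) \<longlonglongrightarrow> f' y" if y: "y \<in> space M" for y
    proof -
      have "((\<lambda>z. f z y) has_field_derivative f' y) (at z)"
        unfolding f'_def using holomorphic_derivI[OF hol[OF y] S z] .
      hence "((\<lambda>n. (f (X n) y - f z y) / (X n - z)) \<longlonglongrightarrow> f' y)"
        unfolding has_field_derivative_iff tendsto_at_iff_sequentially using X by (auto simp: o_def)
      thus ?thesis by (rule LIMSEQ_ignore_initial_segment)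
    qed
    have m[measurable]: "(\<lambda>y. (f (X (n+N)) y - f z y) / (X (n+N) - z)) \<in> borel_measurable M" for n
      using meas XS[of "n+N"] z by (intro borel_measurable_divide borel_measurable_diff) auto
    have f'm: "f' \<in> borel_measurable M"
      by (rule borel_measurable_LIMSEQ_metric[OF m lim])
    have "(\<lambda>n. \<integral>y. (f (X (n+N)) y - f z y) / (X (n+N) - z) \<partial>M) \<longlonglongrightarrow> (\<integral>y. f' y \<partial>M)"
    proof (rule integral_dominated_convergence[where w="\<lambda>y. B y / (r/2)"])
      show "AE y in M. (\<lambda>n. (f (X (n+N)) y - f z y) / (X (n+N) - z)) \<longlonglongrightarrow> f' y"
        using lim by auto
      show "AE y in M. norm ((f (X (n+N)) y - f z y) / (X (n+N) - z)) \<le> B y / (r/2)" for n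
        using fB quot[OF _ _ N[of "n+N"]] X(1) by (auto elim!: AE_mp)
    qed (use B m f'm in auto)
    moreover have "(\<integral>y. (f (X (n+N)) y - f z y) / (X (n+N) - z) \<partial>M) =
        ((\<integral>y. f (X (n+N)) y \<partial>M) - (\<integral>y. f z y \<partial>M)) / (X (n+N) - z)" for n
      using intg[of "X (n+N)"] intg[of z] N[of "n+N"] r by (simp add: Bochner_Integration.integral_diff)
    moreover have "X (n+N) \<noteq> z" for n using X(1) by auto
    ultimately have "(\<lambda>n. ((\<integral>y. f (X (n+N)) y \<partial>M) - (\<integral>y. f z y \<partial>M)) / (X (n+N) - z)) \<longlonglongrightarrow> (\<integral>y. f' y \<partial>M)"
      by simp
    thus "((\<lambda>w. ((\<integral>y. f w y \<partial>M) - (\<integral>y. f z y \<partial>M)) / (w - z)) \<circ> X) \<longlonglongrightarrow> (\<integral>y. f' y \<partial>M)"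
      unfolding o_def by (rule LIMSEQ_offset)
  qed
  thus "(\<lambda>z. \<integral>y. f z y \<partial>M) field_differentiable at z within S"
    using field_differentiable_at_within field_differentiable_def by blast
qed

section \<open>Laplace transforms of probability laws on the line\<close>

definition has_laplace :: "real measure \<Rightarrow> complex \<Rightarrow> complex \<Rightarrow> bool" where
  "has_laplace \<mu> z v \<longleftrightarrow> has_bochner_integral \<mu> (\<lambda>y. exp (- z * complex_of_real y)) v"

lemma has_laplace_real:
  assumes "has_laplace \<mu> (complex_of_real s) v"
  shows "has_bochner_integral \<mu> (\<lambda>y. exp (- s * y)) (Re v)"
proof -
  have "exp (- complex_of_real s * complex_of_real y) = complex_of_real (exp (- s * y))" for y
    by (simp flip: exp_of_real)
  hence "has_bochner_integral \<mu> (\<lambda>y. complex_of_real (exp (- s * y))) v"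
    using assms by (simp add: has_laplace_def)
  from has_bochner_integral_Re[OF this] show ?thesis by simp
qed

lemma has_bochner_integral_pair_mult:
  fixes f :: "'a \<Rightarrow> complex" and g :: "'b \<Rightarrow> complex"
  assumes "sigma_finite_measure M" "sigma_finite_measure N"
    and f: "has_bochner_integral M f a" and g: "has_bochner_integral N g b"
  shows "has_bochner_integral (M \<Otimes>\<^sub>M N) (\<lambda>(x, y). f x * g y) (a * b)"
proof -
  interpret M: sigma_finite_measure M by fact
  interpret N: sigma_finite_measure N by fact
  interpret P: pair_sigma_finite M N ..
  note [measurable] = borel_measurable_has_bochner_integral[OF f] borel_measurable_has_bochner_integral[OF g]
  have fi: "integrable M f" "integral\<^sup>L M f = a" and gi: "integrable N g" "integral\<^sup>L N g = b"
    using f g by (auto simp: has_bochner_integral_iff)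
  have int: "integrable (M \<Otimes>\<^sub>M N) (\<lambda>(x, y). f x * g y)"
  proof (rule P.Fubini_integrable)
    show "integrable M (\<lambda>x. \<integral>y. norm (case (x, y) of (x, y) \<Rightarrow> f x * g y) \<partial>N)"
      using fi by (simp add: norm_mult)
    show "AE x in M. integrable N (\<lambda>y. case (x, y) of (x, y) \<Rightarrow> f x * g y)"
      using gi by simp
  qed measurable
  have "(\<integral>(x, y). f x * g y \<partial>(M \<Otimes>\<^sub>M N)) = (\<integral>x. (\<integral>y. f x * g y \<partial>N) \<partial>M)"
    using P.integral_fst[OF int] by simp
  also have "\<dots> = a * b" using fi gi by simp
  finally show ?thesis using int by (simp add: has_bochner_integral_iff)
qed

lemma has_laplace_distr:
  assumes "X \<in> borel_measurable M"
  shows "has_laplace (distr M borel X) z v \<longleftrightarrow> has_bochner_integral M (\<lambda>w. exp (- z * complex_of_real (X w))) v"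
  using assms by (simp add: has_laplace_def has_bochner_integral_iff integrable_distr_eq integral_distr)

lemma real_distribution_distr:
  assumes "prob_space M" "X \<in> borel_measurable M"
  shows "real_distribution (distr M borel X)"
  using assms by (simp add: real_distribution_def real_distribution_axioms_def prob_space.prob_space_distr)

lemma real_distribution_convolution:
  assumes "real_distribution \<mu>" "real_distribution \<nu>"
  shows "\<exists>\<rho>. real_distribution \<rho> \<and>
      (\<forall>z v w. has_laplace \<mu> z v \<longrightarrow> has_laplace \<nu> z w \<longrightarrow> has_laplace \<rho> z (v * w))"
proof (intro exI[of _ "distr (\<mu> \<Otimes>\<^sub>M \<nu>) borel (\<lambda>(x, y). x + y)"] conjI allI impI)
  interpret M: real_distribution \<mu> by fact
  interpret N: real_distribution \<nu> by fact
  interpret P: pair_prob_space \<mu> \<nu> ..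
  have [measurable]: "(\<lambda>(x, y). x + y) \<in> borel_measurable (\<mu> \<Otimes>\<^sub>M \<nu>)" by measurable
  show "real_distribution (distr (\<mu> \<Otimes>\<^sub>M \<nu>) borel (\<lambda>(x, y). x + y))"
    by (intro real_distribution_distr P.prob_space_axioms) simp
  fix z v w assume "has_laplace \<mu> z v" "has_laplace \<nu> z w"
  from has_bochner_integral_pair_mult[OF M.sigma_finite_measure_axioms N.sigma_finite_measure_axioms
      this[unfolded has_laplace_def]]
  show "has_laplace (distr (\<mu> \<Otimes>\<^sub>M \<nu>) borel (\<lambda>(x, y). x + y)) z (v * w)"
    unfolding has_laplace_distr[OF \<open>(\<lambda>(x, y). x + y) \<in> _\<close>]
    by (simp add: exp_add[symmetric] algebra_simps case_prod_beta')
qed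

text \<open>
  Toss a coin with success probability \<open>p\<close> and keep one of two independent variables.
\<close>

lemma real_distribution_mixture:
  assumes "real_distribution \<mu>" "real_distribution \<nu>" and p: "0 \<le> p" "p \<le> 1"
  shows "\<exists>\<rho>. real_distribution \<rho> \<and> (\<forall>z v w. has_laplace \<mu> z v \<longrightarrow> has_laplace \<nu> z w \<longrightarrow>
      has_laplace \<rho> z (complex_of_real p * v + complex_of_real (1 - p) * w))"
proof -
  interpret M: real_distribution \<mu> by fact
  interpret N: real_distribution \<nu> by fact
  interpret P: pair_prob_space \<mu> \<nu> ..
  define B where "B = measure_pmf (bernoulli_pmf p)"
  interpret B: prob_space B unfolding B_def by (rule prob_space_measure_pmf)
  interpret PP: prob_space "\<mu> \<Otimes>\<^sub>M \<nu>" by (rule P.prob_space_axioms)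
  interpret Q: pair_prob_space B "\<mu> \<Otimes>\<^sub>M \<nu>" ..
  define X where "X = (\<lambda>(b::bool, x::real, y::real). if b then x else y)"
  have sB: "sets B = sets (count_space UNIV)" by (simp add: B_def)
  note sB[measurable_cong]
  have X[measurable]: "X \<in> borel_measurable (B \<Otimes>\<^sub>M (\<mu> \<Otimes>\<^sub>M \<nu>))"
    unfolding X_def case_prod_beta' by measurable
  have b1: "has_bochner_integral B (\<lambda>b. if b then 1 else 0 :: complex) (complex_of_real p)"
   and b2: "has_bochner_integral B (\<lambda>b. if b then 0 else 1 :: complex) (complex_of_real (1 - p))"
    using p by (auto simp: has_bochner_integral_iff B_def integrable_measure_pmf_finite
        integral_measure_pmf[of UNIV] UNIV_bool scaleR_conv_of_real)
  have one: "has_bochner_integral \<mu> (\<lambda>x. 1::complex) 1" "has_bochner_integral \<nu> (\<lambda>x. 1::complex) 1"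
    by (auto simp: has_bochner_integral_iff M.prob_space[simplified] N.prob_space[simplified])
  show ?thesis
  proof (intro exI[of _ "distr (B \<Otimes>\<^sub>M (\<mu> \<Otimes>\<^sub>M \<nu>)) borel X"] conjI allI impI)
    show "real_distribution (distr (B \<Otimes>\<^sub>M (\<mu> \<Otimes>\<^sub>M \<nu>)) borel X)"
      by (intro real_distribution_distr Q.prob_space_axioms X)
    fix z v w assume v: "has_laplace \<mu> z v" and w: "has_laplace \<nu> z w"
    note pm = has_bochner_integral_pair_mult
    have 1: "has_bochner_integral (\<mu> \<Otimes>\<^sub>M \<nu>) (\<lambda>(x, y). exp (- z * complex_of_real x) * 1) (v * 1)"
      by (intro pm one M.sigma_finite_measure_axioms N.sigma_finite_measure_axioms v[unfolded has_laplace_def])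
    have 2: "has_bochner_integral (\<mu> \<Otimes>\<^sub>M \<nu>) (\<lambda>(x, y). 1 * exp (- z * complex_of_real y)) (1 * w)"
      by (intro pm one M.sigma_finite_measure_axioms N.sigma_finite_measure_axioms w[unfolded has_laplace_def])
    have "has_bochner_integral (B \<Otimes>\<^sub>M (\<mu> \<Otimes>\<^sub>M \<nu>))
        (\<lambda>u. (case u of (b, xy) \<Rightarrow> (if b then 1 else 0) * (case xy of (x, y) \<Rightarrow> exp (- z * complex_of_real x) * 1)) +
             (case u of (b, xy) \<Rightarrow> (if b then 0 else 1) * (case xy of (x, y) \<Rightarrow> 1 * exp (- z * complex_of_real y))))
        (complex_of_real p * (v * 1) + complex_of_real (1 - p) * (1 * w))"
      by (intro has_bochner_integral_add pm b1 b2 1 2 B.sigma_finite_measure_axioms P.sigma_finite_measure_axioms)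
    also have "(\<lambda>u. (case u of (b, xy) \<Rightarrow> (if b then 1 else 0) * (case xy of (x, y) \<Rightarrow> exp (- z * complex_of_real x) * 1)) +
             (case u of (b, xy) \<Rightarrow> (if b then 0 else 1) * (case xy of (x, y) \<Rightarrow> 1 * exp (- z * complex_of_real y)))) =
        (\<lambda>u. exp (- z * complex_of_real (X u)))"
      by (auto simp: X_def fun_eq_iff)
    finally show "has_laplace (distr (B \<Otimes>\<^sub>M (\<mu> \<Otimes>\<^sub>M \<nu>)) borel X) z (complex_of_real p * v + complex_of_real (1 - p) * w)"
      unfolding has_laplace_distr[OF X] by simp
  qed
qed


text \<open>
  Exponential moments slightly to the left and to the right of \<open>0\<close> stay bounded, which
  makes the sequence tight. Along a weakly convergent subsequence, a continuous cut-off at level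
  \<open>K\<close> leaves a bounded test function, and the part beyond \<open>K\<close> is at most
  \<open>exp (- \<delta> K)\<close> times neighbouring exponential moments, uniformly along the
  sequence. The laws need to have a transform at \<open>z\<close> only from an index on that depends
  on \<open>z\<close>: approximations of a Bernstein function are positive at a given point only
  eventually.
\<close>

lemma laplace_continuity:
  fixes \<mu> :: "nat \<Rightarrow> real measure" and F :: "nat \<Rightarrow> complex \<Rightarrow> complex" and T :: "real set"
  assumes T: "open T" "0 \<in> T" and rd: "\<And>n. real_distribution (\<mu> n)"
    and ev: "\<And>z. Re z \<in> T \<Longrightarrow> \<forall>\<^sub>F n in sequentially. has_laplace (\<mu> n) z (F n z)"
    and lim: "\<And>z. Re z \<in> T \<Longrightarrow> (\<lambda>n. F n z) \<longlonglongrightarrow> f z"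
  shows "\<exists>\<nu>. real_distribution \<nu> \<and> (\<forall>z. Re z \<in> T \<longrightarrow> has_laplace \<nu> z (f z))"
proof -
  have bdd: "\<forall>\<^sub>F n in sequentially. norm (F n z) \<le> norm (f z) + 1" if "Re z \<in> T" for z
  proof -
    have "(\<lambda>n. norm (F n z)) \<longlonglongrightarrow> norm (f z)" using lim[OF that] by (rule tendsto_norm)
    hence "\<forall>\<^sub>F n in sequentially. norm (F n z) < norm (f z) + 1" by (rule order_tendstoD) simp
    thus ?thesis by eventually_elim simp
  qed
  \<comment> \<open>E controls both tails of exp (- s y): the exponents s - \<delta> and s + \<delta> dominate on opposite half-lines.\<close>
  define E where "E s \<delta> n = (\<integral>y. exp (- (s - \<delta>) * y) + exp (- (s + \<delta>) * y) \<partial>\<mu> n)" for s \<delta> n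
  define C where "C s \<delta> = norm (f (of_real (s - \<delta>))) + norm (f (of_real (s + \<delta>))) + 2" for s \<delta>
  have evE: "\<forall>\<^sub>F n in sequentially. integrable (\<mu> n) (\<lambda>y. exp (- (s - \<delta>) * y) + exp (- (s + \<delta>) * y)) \<and>
      E s \<delta> n \<le> C s \<delta>" if "s - \<delta> \<in> T" "s + \<delta> \<in> T" for s \<delta>
  proof -
    have T': "Re (of_real (s - \<delta>)) \<in> T" "Re (of_real (s + \<delta>)) \<in> T" using that by auto
    show ?thesis
      using ev[OF T'(1)] ev[OF T'(2)] bdd[OF T'(1)] bdd[OF T'(2)]
    proof eventually_elim
      case (elim n)
      note 1 = has_bochner_integral_add[OF has_laplace_real[OF elim(1)] has_laplace_real[OF elim(2)]]
      have "Re (F n (of_real (s - \<delta>))) \<le> norm (f (of_real (s - \<delta>))) + 1"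
           "Re (F n (of_real (s + \<delta>))) \<le> norm (f (of_real (s + \<delta>))) + 1"
        using elim(3,4) complex_Re_le_cmod order_trans by blast+
      thus ?case using 1 unfolding E_def C_def by (auto simp: has_bochner_integral_iff)
    qed
  qed
  \<comment> \<open>A continuous function that equals 1 on [-K, K] and 0 outside [-K - 1, K + 1].\<close>
  define cut where "cut K y = max 0 (min 1 (real K + 1 - \<bar>y\<bar>))" for K and y :: real
  have chi: "0 \<le> cut K y" "cut K y \<le> 1" "\<bar>y\<bar> \<le> K \<Longrightarrow> cut K y = 1" "\<bar>y\<bar> \<ge> K + 1 \<Longrightarrow> cut K y = 0" for K y
    by (auto simp: cut_def)
  have tail: "exp (- s * y) * t \<le> exp (- \<delta> * K) * (exp (- (s - \<delta>) * y) + exp (- (s + \<delta>) * y))"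
    if \<delta>: "\<delta> > 0" and t: "0 \<le> t" "t \<le> 1" "\<bar>y\<bar> \<le> K \<Longrightarrow> t = 0" for s y \<delta> t K :: real
  proof (cases "\<bar>y\<bar> \<le> K")
    case True thus ?thesis using t by simp
  next
    case False
    have "exp (- s * y) \<le> exp (- \<delta> * K) * exp (- (s - \<delta>) * y) \<or> exp (- s * y) \<le> exp (- \<delta> * K) * exp (- (s + \<delta>) * y)"
    proof (cases "y \<ge> 0")
      case True
      hence "\<delta> * K \<le> \<delta> * y" using False \<delta> by simp
      thus ?thesis by (simp add: exp_add[symmetric] algebra_simps)
    next
      case f: False
      hence "\<delta> * K \<le> \<delta> * (-y)" using False \<delta> by (intro mult_left_mono) auto
      thus ?thesis by (simp add: exp_add[symmetric] algebra_simps)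
    qed
    hence "exp (- s * y) \<le> exp (- \<delta> * K) * exp (- (s - \<delta>) * y) + exp (- \<delta> * K) * exp (- (s + \<delta>) * y)"
      by (smt (verit) exp_gt_zero mult_pos_pos)
    moreover have "exp (- s * y) * t \<le> exp (- s * y)" using t by (simp add: mult_le_cancel_left1)
    ultimately show ?thesis unfolding distrib_left mult.assoc[symmetric] by (rule order_trans[rotated])
  qed
  obtain s0 where s0: "s0 > 0" "s0 \<in> T" "-s0 \<in> T"
  proof -
    obtain e where e: "e > 0" "ball 0 e \<subseteq> T" using T openE by blast
    show ?thesis by (rule that[of "e/2"]) (use e in \<open>auto simp: subset_iff\<close>)
  qed
  obtain N where N: "\<And>n. n \<ge> N \<Longrightarrow> integrable (\<mu> n) (\<lambda>y. exp (- (0 - s0) * y) + exp (- (0 + s0) * y))"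
      "\<And>n. n \<ge> N \<Longrightarrow> E 0 s0 n \<le> C 0 s0"
    using evE[of 0 s0] s0 unfolding eventually_sequentially by auto
  have C0: "C 0 s0 > 0" unfolding C_def by (smt (verit) norm_ge_zero)
  have "tight (\<lambda>n. \<mu> (n + N))"
    unfolding tight_def
  proof (intro conjI allI impI)
    fix \<epsilon> :: real assume \<epsilon>: "\<epsilon> > 0"
    have "((\<lambda>K. exp (- s0 * K) * C 0 s0) \<longlongrightarrow> 0) at_top"
      using s0(1) by real_asymp
    hence "\<forall>\<^sub>F K in at_top. exp (- s0 * K) * C 0 s0 < \<epsilon>" using \<epsilon> by (auto dest: order_tendstoD)
    hence "\<forall>\<^sub>F K in at_top. exp (- s0 * K) * C 0 s0 < \<epsilon> \<and> K > 0"
      using eventually_gt_at_top[of 0] by eventually_elim simp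
    then obtain K where K: "exp (- s0 * K) * C 0 s0 < \<epsilon>" "K > 0"
      using eventually_happens[of _ "at_top :: real filter"] by auto
    show "\<exists>a b. a < b \<and> (\<forall>n. 1 - \<epsilon> < measure (\<mu> (n + N)) {a<..b})"
    proof (rule exI[of _ "-K-1"], rule exI[of _ K], intro conjI allI)
      fix n
      interpret M: real_distribution "\<mu> (n + N)" by (rule rd)
      have "1 - measure (\<mu> (n + N)) {-K-1<..K} = (\<integral>y. 1 - indicator {-K-1<..K} y \<partial>\<mu> (n + N))"
        by (subst Bochner_Integration.integral_diff) (auto simp: M.prob_space[simplified] M.emeasure_eq_measure)
      also have "\<dots> \<le> (\<integral>y. exp (- s0 * K) * (exp (- (0 - s0) * y) + exp (- (0 + s0) * y)) \<partial>\<mu> (n + N))"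
      proof (rule integral_mono)
        show "integrable (\<mu> (n + N)) (\<lambda>y. exp (- s0 * K) * (exp (- (0 - s0) * y) + exp (- (0 + s0) * y)))"
          using N(1)[of "n+N"] by (intro integrable_mult_right) auto
        fix y
        show "1 - indicator {-K-1<..K} y \<le> exp (- s0 * K) * (exp (- (0 - s0) * y) + exp (- (0 + s0) * y))"
          using tail[of s0 "1 - indicator {-K-1<..K} y" y K 0] s0 by (auto simp: indicator_def)
      qed (intro Bochner_Integration.integrable_diff; simp add: M.emeasure_eq_measure)
      also have "\<dots> = exp (- s0 * K) * E 0 s0 (n + N)"
        unfolding E_def by (rule integral_mult_right_zero)
      also have "\<dots> \<le> exp (- s0 * K) * C 0 s0" using N(2)[of "n+N"] by simp
      finally show "1 - \<epsilon> < measure (\<mu> (n + N)) {-K-1<..K}" using K by simp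
    qed (use K in auto)
  qed (rule rd)
  from tight_imp_convergent_subsubsequence[OF this strict_mono_id]
  obtain r \<nu> where r: "strict_mono r" and \<nu>: "real_distribution \<nu>"
    and wc: "weak_conv_m (\<lambda>n. \<mu> (r n + N)) \<nu>" by (auto simp: o_def)
  define q where "q n = r n + N" for n
  have q: "filterlim q at_top sequentially"
    unfolding q_def using filterlim_compose[OF filterlim_add_const_nat_at_top filterlim_subseq[OF r]] .
  interpret \<nu>: real_distribution \<nu> by fact
  interpret m: real_distribution "\<mu> n" for n by (rule rd)
  have key: "norm ((\<integral>y. exp (- z * complex_of_real y) * complex_of_real (cut K y) \<partial>\<nu>) - f z)
       \<le> exp (- \<delta> * K) * C (Re z) \<delta>"
    if z: "Re z \<in> T" "Re z - \<delta> \<in> T" "Re z + \<delta> \<in> T" "\<delta> > 0" for z \<delta> K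
  proof (rule tendsto_upperbound)
    have nz: "norm (exp (- z * complex_of_real y) * complex_of_real (cut K y)) \<le> exp (\<bar>Re z\<bar> * (K + 1))" for y
    proof (cases "\<bar>y\<bar> \<le> K + 1")
      case True
      have "- (Re z * y) \<le> \<bar>Re z * y\<bar>" by (rule abs_ge_minus_self)
          also have "\<dots> \<le> \<bar>Re z\<bar> * (K + 1)"
        using True unfolding abs_mult by (intro mult_left_mono) auto
          finally have "- (Re z * y) \<le> \<bar>Re z\<bar> * (K + 1)" .
      hence "exp (- (Re z * y)) * cut K y \<le> exp (\<bar>Re z\<bar> * (K + 1)) * 1"
        using chi by (intro mult_mono) auto
      thus ?thesis using chi by (simp add: norm_mult)
    next
      case False thus ?thesis using chi by simp
    qed
    have "(\<lambda>n. \<integral>y. exp (- z * complex_of_real y) * complex_of_real (cut K y) \<partial>\<mu> (q n)) \<longlonglongrightarrow>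
       (\<integral>y. exp (- z * complex_of_real y) * complex_of_real (cut K y) \<partial>\<nu>)"
      unfolding q_def
      by (rule weak_conv_imp_integral_bdd_continuous_conv[OF rd \<nu> wc _ nz])
         (auto simp: cut_def intro!: continuous_intros)
    moreover have "(\<lambda>n. F (q n) z) \<longlonglongrightarrow> f z" using lim[OF z(1)] q by (rule filterlim_compose)
    ultimately show "(\<lambda>n. norm ((\<integral>y. exp (- z * complex_of_real y) * complex_of_real (cut K y) \<partial>\<mu> (q n)) - F (q n) z))
       \<longlonglongrightarrow> norm ((\<integral>y. exp (- z * complex_of_real y) * complex_of_real (cut K y) \<partial>\<nu>) - f z)"
      by (intro tendsto_intros)
    have "\<forall>\<^sub>F n in sequentially. norm ((\<integral>y. exp (- z * complex_of_real y) * complex_of_real (cut K y) \<partial>\<mu> n) - F n z)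
      \<le> exp (- \<delta> * K) * C (Re z) \<delta>"
      using evE[OF z(2,3)] ev[OF z(1)]
    proof eventually_elim
      case (elim n)
      have 1: "integrable (\<mu> n) (\<lambda>y. exp (- z * complex_of_real y))" "F n z = (\<integral>y. exp (- z * complex_of_real y) \<partial>\<mu> n)"
        using elim(2) by (auto simp: has_laplace_def has_bochner_integral_iff)
      have [measurable]: "(\<lambda>y. complex_of_real (cut K y)) \<in> borel_measurable (\<mu> n)"
        unfolding cut_def by measurable
      have 2: "integrable (\<mu> n) (\<lambda>y. exp (- z * complex_of_real y) * complex_of_real (cut K y))"
        by (rule Bochner_Integration.integrable_bound[OF 1(1)])
           (use chi in \<open>auto simp: norm_mult mult_le_cancel_left1\<close>)
      have "(\<integral>y. exp (- z * complex_of_real y) * complex_of_real (cut K y) \<partial>\<mu> n) - F n z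
         = (\<integral>y. exp (- z * complex_of_real y) * complex_of_real (cut K y) - exp (- z * complex_of_real y) \<partial>\<mu> n)"
        using 1 2 by simp
      also have "norm \<dots> \<le> (\<integral>y. exp (- \<delta> * K) * (exp (- (Re z - \<delta>) * y) + exp (- (Re z + \<delta>) * y)) \<partial>\<mu> n)"
      proof (rule Bochner_Integration.integral_norm_bound_integral)
        show "integrable (\<mu> n) (\<lambda>y. exp (- \<delta> * K) * (exp (- (Re z - \<delta>) * y) + exp (- (Re z + \<delta>) * y)))"
          using elim(1) by (intro integrable_mult_right) auto
        fix y
        have "norm (exp (- z * complex_of_real y) * complex_of_real (cut K y) - exp (- z * complex_of_real y))
          = norm (exp (- z * complex_of_real y) * complex_of_real (cut K y - 1))"
          by (simp add: algebra_simps)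
        also have "\<dots> = exp (- Re z * y) * (1 - cut K y)"
          using chi(2)[where K=K and y=y] by (simp only: norm_mult norm_of_real norm_exp_eq_Re) simp
        also have "\<dots> \<le> exp (- \<delta> * K) * (exp (- (Re z - \<delta>) * y) + exp (- (Re z + \<delta>) * y))"
          using chi[where K=K and y=y] chi(3)[where K=K and y=y] z by (intro tail) auto
        finally show "norm (exp (- z * complex_of_real y) * complex_of_real (cut K y) - exp (- z * complex_of_real y)) \<le> \<dots>" .
      qed (use 1 2 in auto)
      also have "\<dots> = exp (- \<delta> * K) * E (Re z) \<delta> n" unfolding E_def by (rule integral_mult_right_zero)
      also have "\<dots> \<le> exp (- \<delta> * K) * C (Re z) \<delta>" using elim by simp
      finally show ?case .
    qed
    thus "\<forall>\<^sub>F n in sequentially. norm ((\<integral>y. exp (- z * complex_of_real y) * complex_of_real (cut K y) \<partial>\<mu> (q n)) - F (q n) z)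
      \<le> exp (- \<delta> * K) * C (Re z) \<delta>"
      using q by (rule eventually_compose_filterlim)
  qed simp
  have conv: "(\<lambda>K. \<integral>y. exp (- z * complex_of_real y) * complex_of_real (cut K y) \<partial>\<nu>) \<longlonglongrightarrow> f z" if z: "Re z \<in> T" for z
  proof -
    obtain e where e: "e > 0" "ball (Re z) e \<subseteq> T" using T z openE by blast
    have d: "Re z - e/2 \<in> T" "Re z + e/2 \<in> T" using e by (auto simp: subset_iff dist_norm)
    have "(\<lambda>K. exp (- (e/2) * real K) * C (Re z) (e/2)) \<longlonglongrightarrow> 0" using e(1) by real_asymp
    hence "(\<lambda>K. (\<integral>y. exp (- z * complex_of_real y) * complex_of_real (cut K y) \<partial>\<nu>) - f z) \<longlonglongrightarrow> 0"
      by (rule Lim_null_comparison[rotated]) (use key[OF z d] e in auto)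
    thus ?thesis by (simp add: LIM_zero_iff)
  qed
  have chi_lim: "(\<lambda>K. cut K y) \<longlonglongrightarrow> 1" for y
  proof (rule tendsto_eventually)
    show "\<forall>\<^sub>F K in sequentially. cut K y = 1"
      using eventually_ge_at_top[of "nat \<lceil>\<bar>y\<bar>\<rceil>"] by eventually_elim (auto intro!: chi simp: nat_le_iff ceiling_le_iff)
  qed
  have [measurable]: "cut K \<in> borel_measurable borel" for K unfolding cut_def by measurable
  have intr: "integrable \<nu> (\<lambda>y. exp (- s * y))" if s: "s \<in> T" for s
  proof (rule integral_monotone_convergence_nonneg)
    have e: "exp (- complex_of_real s * complex_of_real y) * complex_of_real (cut K y) = complex_of_real (exp (- s * y) * cut K y)" for y K
      by (simp flip: exp_of_real)
    show int: "integrable \<nu> (\<lambda>y. exp (- s * y) * cut K y)" for K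
    proof (rule \<nu>.integrable_const_bound)
      show "AE y in \<nu>. norm (exp (- s * y) * cut K y) \<le> exp (\<bar>s\<bar> * (K + 1))"
      proof (intro AE_I2)
        fix y
        show "norm (exp (- s * y) * cut K y) \<le> exp (\<bar>s\<bar> * (K + 1))"
        proof (cases "\<bar>y\<bar> \<le> K + 1")
          case True
          have "- (s * y) \<le> \<bar>s * y\<bar>" by (rule abs_ge_minus_self)
          also have "\<dots> \<le> \<bar>s\<bar> * (K + 1)"
            using True unfolding abs_mult by (intro mult_left_mono) auto
          finally have "- (s * y) \<le> \<bar>s\<bar> * (K + 1)" .
          hence "exp (- (s * y)) * cut K y \<le> exp (\<bar>s\<bar> * (K + 1)) * 1"
            using chi by (intro mult_mono) auto
          thus ?thesis using chi by (simp add: abs_mult)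
        next
          case False thus ?thesis using chi by simp
        qed
      qed
    qed measurable
    have "(\<lambda>K. Re (\<integral>y. exp (- complex_of_real s * complex_of_real y) * complex_of_real (cut K y) \<partial>\<nu>)) \<longlonglongrightarrow> Re (f (of_real s))"
      using conv[of "of_real s"] s by (intro tendsto_Re) auto
    thus "(\<lambda>K. \<integral>y. exp (- s * y) * cut K y \<partial>\<nu>) \<longlonglongrightarrow> Re (f (of_real s))"
      by (simp only: e integral_complex_of_real Re_complex_of_real)
    show "AE y in \<nu>. mono (\<lambda>K. exp (- s * y) * cut K y)"
      by (intro AE_I2 monoI mult_left_mono) (auto simp: cut_def)
    show "AE y in \<nu>. (\<lambda>K. exp (- s * y) * cut K y) \<longlonglongrightarrow> exp (- s * y)"
      by (intro AE_I2) (use tendsto_mult[OF tendsto_const chi_lim] in force)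
  qed (use chi in auto)
  show ?thesis
  proof (intro exI[of _ \<nu>] conjI allI impI \<nu>)
    fix z assume z: "Re z \<in> T"
    have int: "integrable \<nu> (\<lambda>y. exp (- z * complex_of_real y))"
      by (rule Bochner_Integration.integrable_bound[OF intr[OF z]]) auto
    have "(\<lambda>K. \<integral>y. exp (- z * complex_of_real y) * complex_of_real (cut K y) \<partial>\<nu>) \<longlonglongrightarrow> (\<integral>y. exp (- z * complex_of_real y) \<partial>\<nu>)"
    proof (rule integral_dominated_convergence[where w="\<lambda>y. exp (- Re z * y)"])
      show "AE y in \<nu>. (\<lambda>K. exp (- z * complex_of_real y) * complex_of_real (cut K y)) \<longlonglongrightarrow> exp (- z * complex_of_real y)"
        by (intro AE_I2) (use tendsto_mult[OF tendsto_const tendsto_of_real[OF chi_lim]] in force)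
      show "AE y in \<nu>. norm (exp (- z * complex_of_real y) * complex_of_real (cut K y)) \<le> exp (- Re z * y)" for K
        using chi by (auto simp: norm_mult mult_le_cancel_left2)
    qed (use intr z in auto)
    from LIMSEQ_unique[OF this conv[OF z]] int
    show "has_laplace \<nu> z (f z)" by (simp add: has_laplace_def has_bochner_integral_iff)
  qed
qed

text \<open>
  The quotient is the transform of a sum of a geometric number of independent copies. The truncated
  geometric series \<open>G\<close> satisfies \<open>G (n + 1) = p \<psi> G n + (1 - p)\<close>,
  which is a mixture of the point mass at \<open>0\<close> and a convolution, so closure of
  transforms under the two operations suffices.
\<close>

lemma laplace_geometric:
  fixes \<mu> :: "real measure" and \<psi> :: "complex \<Rightarrow> complex"
  assumes T: "open T" "0 \<in> T" and \<mu>: "real_distribution \<mu>" and p: "0 \<le> p" "p \<le> 1"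
    and lap: "\<And>z. Re z \<in> T \<Longrightarrow> has_laplace \<mu> z (\<psi> z)"
    and small: "\<And>z. Re z \<in> T \<Longrightarrow> norm (complex_of_real p * \<psi> z) < 1"
  shows "\<exists>\<nu>. real_distribution \<nu> \<and>
      (\<forall>z. Re z \<in> T \<longrightarrow> has_laplace \<nu> z (complex_of_real (1 - p) / (1 - complex_of_real p * \<psi> z)))"
proof -
  have d0: "real_distribution (return borel 0)" "has_laplace (return borel 0) z 1" for z
    by (auto simp: real_distribution_def real_distribution_axioms_def prob_space_return has_laplace_def
       has_bochner_integral_iff integrable_iff_bounded nn_integral_return integral_return)
  define G where "G n z = (complex_of_real p * \<psi> z) ^ n + (\<Sum>j<n. complex_of_real (1 - p) * (complex_of_real p * \<psi> z) ^ j)" for n z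
  have "\<exists>\<nu>. real_distribution \<nu> \<and> (\<forall>z. Re z \<in> T \<longrightarrow> has_laplace \<nu> z (G n z))" for n
  proof (induction n)
    case 0 show ?case unfolding G_def using d0 by (intro exI[of _ "return borel 0"]) auto
  next
    case (Suc n)
    then obtain \<nu> where \<nu>: "real_distribution \<nu>" "\<And>z. Re z \<in> T \<Longrightarrow> has_laplace \<nu> z (G n z)" by blast
    obtain \<rho> where \<rho>: "real_distribution \<rho>" "\<And>z. Re z \<in> T \<Longrightarrow> has_laplace \<rho> z (\<psi> z * G n z)"
      using real_distribution_convolution[OF \<mu> \<nu>(1)] lap \<nu>(2) by blast
    obtain \<kappa> where \<kappa>: "real_distribution \<kappa>"
       "\<And>z. Re z \<in> T \<Longrightarrow> has_laplace \<kappa> z (complex_of_real p * (\<psi> z * G n z) + complex_of_real (1 - p) * 1)"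
      using real_distribution_mixture[OF \<rho>(1) d0(1) p] d0(2) \<rho>(2) by blast
    have "complex_of_real p * (\<psi> z * G n z) + complex_of_real (1 - p) * 1 = G (Suc n) z" for z
      unfolding G_def sum.lessThan_Suc_shift by (simp add: sum_distrib_left algebra_simps)
    thus ?case using \<kappa> by metis
  qed
  then obtain \<nu> where \<nu>: "\<And>n. real_distribution (\<nu> n)" "\<And>n z. Re z \<in> T \<Longrightarrow> has_laplace (\<nu> n) z (G n z)" by metis
  have "(\<lambda>n. G n z) \<longlonglongrightarrow> complex_of_real (1 - p) / (1 - complex_of_real p * \<psi> z)" if z: "Re z \<in> T" for z
  proof -
    have "(\<lambda>n. G n z) \<longlonglongrightarrow> 0 + complex_of_real (1 - p) * (1 / (1 - complex_of_real p * \<psi> z))"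
      unfolding G_def sum_distrib_left[symmetric] using geometric_sums[OF small[OF z]] small[OF z]
      by (intro tendsto_intros LIMSEQ_power_zero) (auto simp: sums_def)
    thus ?thesis by simp
  qed
  thus ?thesis using laplace_continuity[OF T, of \<nu> G] \<nu> by auto
qed


section \<open>Bernstein functions on the right half-plane\<close>

locale bernstein_function =
  fixes \<phi> :: bernstein
  assumes bernstein: "\<phi> \<in> Bernstein_functions"
begin

definition \<phi>\<^sub>r :: "real \<Rightarrow> real" where "\<phi>\<^sub>r x = Re (bern \<phi> (complex_of_real x))"

lemma killing_nonneg: "0 \<le> killing \<phi>" and drift_nonneg: "0 \<le> drift \<phi>"
  and sets_levy[measurable_cong]: "sets (levy \<phi>) = sets borel"
  and levy_null: "emeasure (levy \<phi>) {..0} = 0"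
  and levy_min: "(\<integral>\<^sup>+y. ennreal (min 1 y) \<partial>(levy \<phi>)) < \<infinity>"
  and bern_not_zero: "\<exists>u\<ge>0. bern \<phi> (complex_of_real u) \<noteq> 0"
  using bernstein by (auto simp: Bernstein_functions_def)

lemma AE_levy_pos: "AE y in levy \<phi>. 0 < y"
  by (rule AE_I[where N="{..0}"]) (use levy_null sets_levy in auto)

lemma integrable_levy_min: "integrable (levy \<phi>) (min 1)"
proof (rule integrableI_bounded)
  have "(\<integral>\<^sup>+y. ennreal (norm (min 1 y)) \<partial>(levy \<phi>)) = (\<integral>\<^sup>+y. ennreal (min 1 y) \<partial>(levy \<phi>))"
    by (rule nn_integral_cong_AE) (use AE_levy_pos in \<open>eventually_elim, auto\<close>)
  thus "(\<integral>\<^sup>+y. ennreal (norm (min 1 y)) \<partial>(levy \<phi>)) < \<infinity>" using levy_min by simp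
qed measurable

lemma integrable_levy_tail:
  assumes n: "n \<ge> (1::nat)"
  shows "integrable (levy \<phi>) (indicator {1 / real n<..} :: real \<Rightarrow> real)"
proof (rule Bochner_Integration.integrable_bound[OF integrable_mult_right[OF integrable_levy_min, of "real n"]])
  show "AE y in levy \<phi>. norm (indicator {1 / real n<..} y :: real) \<le> norm (real n * min 1 y)"
    using AE_levy_pos
  proof eventually_elim
    case (elim y)
    show ?case
    proof (cases "1 / real n < y")
      case True
      hence "1 \<le> real n * y" using n by (simp add: field_simps)
      thus ?thesis using True elim n by (auto simp: min_def)
    qed auto
  qed
qed measurable

text \<open>
  Jumps longer than \<open>1 / n\<close> have finite total mass, so that the exponential can be
  recovered from \<open>1 - exp\<close>.
\<close>

lemma integrable_levy_tail_exp:
  assumes n: "n \<ge> (1::nat)" and u: "bern_finite \<phi> u"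
  shows "integrable (levy \<phi>) (\<lambda>y. indicator {1 / real n<..} y *\<^sub>R exp (- u * complex_of_real y))"
proof -
  have 1: "integrable (levy \<phi>) (\<lambda>y. complex_of_real (indicator {1 / real n<..} y))"
    by (rule integrable_of_real[OF integrable_levy_tail[OF n]])
  have 2: "integrable (levy \<phi>) (\<lambda>y. indicator {1 / real n<..} y *\<^sub>R (1 - exp (- u * complex_of_real y)))"
    by (rule Bochner_Integration.integrable_bound[OF u[unfolded bern_finite_def]]) (auto simp: indicator_def)
  show ?thesis
    by (rule Bochner_Integration.integrable_cong[THEN iffD1, OF refl _ Bochner_Integration.integrable_diff[OF 1 2]])
       (auto simp: indicator_def)
qed

lemma integrable_levy_exp:
  assumes "bern_finite \<phi> (complex_of_real (- u))" "0 \<le> u"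
  shows "integrable (levy \<phi>) (\<lambda>y. min 1 y + (exp (u * y) - 1))"
proof (intro Bochner_Integration.integrable_add integrable_levy_min)
  have "integrable (levy \<phi>) (\<lambda>y. Re (1 - exp (- complex_of_real (- u) * complex_of_real y)))"
    using assms(1) unfolding bern_finite_def by (rule integrable_Re)
  moreover have "(\<lambda>y. Re (1 - exp (- complex_of_real (- u) * complex_of_real y))) = (\<lambda>y. - (exp (u * y) - 1))"
    by (simp add: fun_eq_iff exp_of_real flip: of_real_mult of_real_minus)
  ultimately have "integrable (levy \<phi>) (\<lambda>y. - (exp (u * y) - 1))" by simp
  from integrable_minus[OF this] show "integrable (levy \<phi>) (\<lambda>y. exp (u * y) - 1)" by simp
qed

text \<open>
  One integrable function bounds the integrands at all \<open>z\<close> with real part at least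
  \<open>- u\<close>: the term \<open>min 1 y\<close> controls the short jumps and \<open>exp (u y)
  - 1\<close> the long ones.
\<close>

lemma one_minus_exp_bound:
  fixes u y :: real and z :: complex
  assumes u: "0 \<le> u" "- u \<le> Re z" and y: "0 < y"
  shows "norm (1 - exp (- z * complex_of_real y)) \<le> (norm z * exp u + 2) * (min 1 y + (exp (u * y) - 1))"
proof (cases "y \<le> 1")
  case True
  have "norm (exp (- z * complex_of_real y) - exp 0) \<le> exp u * norm (- z * complex_of_real y - 0)"
  proof (rule field_differentiable_bound[where S="closed_segment 0 (- z * complex_of_real y)" and f'=exp])
    fix v assume "v \<in> closed_segment 0 (- z * complex_of_real y)"
    then obtain s where s: "0 \<le> s" "s \<le> 1" "v = complex_of_real s * (- z * complex_of_real y)"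
      unfolding closed_segment_def scaleR_conv_of_real by auto
    show "(exp has_field_derivative exp v) (at v within closed_segment 0 (- z * complex_of_real y))"
      by (rule DERIV_subset[OF DERIV_exp]) simp
    have "Re v = (s * y) * (- Re z)" using s by simp
    also have "\<dots> \<le> (s * y) * u" using u s y by (intro mult_left_mono) auto
    also have "\<dots> \<le> 1 * u" using u s y True by (intro mult_right_mono mult_le_one) auto
    finally show "norm (exp v) \<le> exp u" by simp
  qed auto
  hence "norm (1 - exp (- z * complex_of_real y)) \<le> exp u * (norm z * y)"
    using y by (simp add: norm_mult norm_minus_commute)
  also have "\<dots> \<le> (norm z * exp u + 2) * (y + (exp (u * y) - 1))"
  proof -
    have "exp u * (norm z * y) = (norm z * exp u) * y" by simp
    also have "\<dots> \<le> (norm z * exp u + 2) * (y + (exp (u * y) - 1))"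
      using y u by (intro mult_mono) auto
    finally show ?thesis .
  qed
  finally show ?thesis using True by simp
next
  case False
  have "norm (1 - exp (- z * complex_of_real y)) \<le> 1 + exp (- Re z * y)"
    by (rule order_trans[OF norm_triangle_ineq4]) simp
  also have "exp (- Re z * y) \<le> exp (u * y)"
    using mult_right_mono[of "- Re z" u y] u y by simp
  also have "1 + exp (u * y) \<le> 2 * (1 + (exp (u * y) - 1))" using u y by simp
  also have "\<dots> \<le> (norm z * exp u + 2) * (1 + (exp (u * y) - 1))" by (intro mult_right_mono) auto
  finally show ?thesis using False by simp
qed

lemma bern_finite_mono:
  assumes "bern_finite \<phi> (complex_of_real (- u))" "0 \<le> u" "- u \<le> Re z"
  shows "bern_finite \<phi> z"
  unfolding bern_finite_def
proof (rule Bochner_Integration.integrable_bound[OF integrable_mult_right[OF integrable_levy_exp[OF assms(1,2)], of "norm z * exp u + 2"]])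
  show "AE y in levy \<phi>. norm (1 - exp (- z * complex_of_real y)) \<le> norm ((norm z * exp u + 2) * (min 1 y + (exp (u * y) - 1)))"
    using AE_levy_pos
  proof eventually_elim
    case (elim y)
    show ?case unfolding real_norm_def
      by (rule order_trans[OF one_minus_exp_bound[OF assms(2,3) elim] abs_ge_self])
  qed
qed measurable

lemma bern_finite_0: "bern_finite \<phi> (complex_of_real (- 0))" by (simp add: bern_finite_def)

lemma bern_finite_Re_nonneg: "0 \<le> Re z \<Longrightarrow> bern_finite \<phi> z"
  using bern_finite_mono[OF bern_finite_0] by simp

lemma a_bern_witness:
  assumes "- a_bern \<phi> < ereal x"
  shows "\<exists>u\<ge>0. - u < x \<and> bern_finite \<phi> (complex_of_real (- u))"
proof -
  have "- ereal x < a_bern \<phi>" using assms by (metis ereal_minus_less_minus ereal_uminus_uminus)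
  then obtain e where "e \<in> {ereal u |u. 0 \<le> u \<and> bern_finite \<phi> (complex_of_real (- u))}" "- ereal x < e"
    unfolding a_bern_def less_Sup_iff by blast
  thus ?thesis by force
qed

lemma a_star_witness:
  assumes "- a_star_bern \<phi> < ereal x"
  shows "\<exists>u\<ge>0. - u < x \<and> bern_finite \<phi> (complex_of_real (- u)) \<and> 0 \<le> \<phi>\<^sub>r (- u)"
proof -
  have "- ereal x < a_star_bern \<phi>" using assms by (metis ereal_minus_less_minus ereal_uminus_uminus)
  then obtain e where "e \<in> {ereal u |u. 0 \<le> u \<and> bern_finite \<phi> (complex_of_real (- u)) \<and>
                                      0 \<le> Re (bern \<phi> (complex_of_real (- u)))}" "- ereal x < e"
    unfolding a_star_bern_def less_Sup_iff by blast
  thus ?thesis unfolding \<phi>\<^sub>r_def by force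
qed

lemma bern_finite_a_bern: "- a_bern \<phi> < ereal (Re z) \<Longrightarrow> bern_finite \<phi> z"
  using a_bern_witness[of "Re z"] bern_finite_mono by (metis less_imp_le)

lemma bern_0: "bern \<phi> 0 = complex_of_real (killing \<phi>)" by (simp add: bern_def)

lemma a_star_nonneg: "0 \<le> a_star_bern \<phi>"
  unfolding a_star_bern_def
  by (rule Sup_upper) (use bern_finite_0 killing_nonneg bern_0 in \<open>auto intro!: exI[of _ 0] simp: zero_ereal_def\<close>)

lemma a_bern_nonneg: "0 \<le> a_bern \<phi>"
  unfolding a_bern_def
  by (rule Sup_upper) (use bern_finite_0 in \<open>auto intro!: exI[of _ 0] simp: zero_ereal_def\<close>)

lemma bern_of_real: "bern \<phi> (complex_of_real x) = complex_of_real (\<phi>\<^sub>r x)"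
proof -
  have "(\<integral>y. (1 - exp (- complex_of_real x * complex_of_real y)) \<partial>(levy \<phi>)) =
        (\<integral>y. complex_of_real (1 - exp (- x * y)) \<partial>(levy \<phi>))"
    by (intro Bochner_Integration.integral_cong refl) (simp flip: exp_of_real)
  also have "\<dots> = complex_of_real (\<integral>y. 1 - exp (- x * y) \<partial>(levy \<phi>))" by (rule integral_complex_of_real)
  finally show ?thesis unfolding \<phi>\<^sub>r_def bern_def
    by (metis Re_complex_of_real of_real_add of_real_mult)
qed

lemma phi_r_eq: "\<phi>\<^sub>r x = killing \<phi> + drift \<phi> * x + (\<integral>y. 1 - exp (- x * y) \<partial>(levy \<phi>))"
proof -
  have "(\<integral>y. (1 - exp (- complex_of_real x * complex_of_real y)) \<partial>(levy \<phi>)) =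
        (\<integral>y. complex_of_real (1 - exp (- x * y)) \<partial>(levy \<phi>))"
    by (intro Bochner_Integration.integral_cong refl) (simp flip: exp_of_real)
  also have "\<dots> = complex_of_real (\<integral>y. 1 - exp (- x * y) \<partial>(levy \<phi>))" by (rule integral_complex_of_real)
  finally show ?thesis unfolding \<phi>\<^sub>r_def bern_def by simp
qed

lemma integrable_real:
  assumes "bern_finite \<phi> (complex_of_real x)"
  shows "integrable (levy \<phi>) (\<lambda>y. 1 - exp (- x * y))"
proof -
  have "integrable (levy \<phi>) (\<lambda>y. Re (1 - exp (- complex_of_real x * complex_of_real y)))"
    using assms unfolding bern_finite_def by (rule integrable_Re)
  moreover have "(\<lambda>y. Re (1 - exp (- complex_of_real x * complex_of_real y))) = (\<lambda>y. 1 - exp (- x * y))"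
    by (simp add: fun_eq_iff exp_of_real flip: of_real_mult of_real_minus)
  ultimately show ?thesis by simp
qed

text \<open>
  The real part of \<open>exp (- z y)\<close> is at most \<open>exp (- Re z y)\<close>.
\<close>

lemma Re_bern_ge:
  assumes "bern_finite \<phi> (complex_of_real (- u))" "0 \<le> u" "- u \<le> Re z"
  shows "\<phi>\<^sub>r (Re z) \<le> Re (bern \<phi> z)"
proof -
  have fz: "bern_finite \<phi> z" and fx: "bern_finite \<phi> (complex_of_real (Re z))"
    using bern_finite_mono[OF assms(1,2)] assms(3-) by auto
  have "(\<integral>y. 1 - exp (- Re z * y) \<partial>(levy \<phi>)) \<le> (\<integral>y. Re (1 - exp (- z * complex_of_real y)) \<partial>(levy \<phi>))"
  proof (rule integral_mono[OF integrable_real[OF fx]])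
    show "integrable (levy \<phi>) (\<lambda>y. Re (1 - exp (- z * complex_of_real y)))"
      using fz unfolding bern_finite_def by (rule integrable_Re)
    fix y
    show "1 - exp (- Re z * y) \<le> Re (1 - exp (- z * complex_of_real y))"
      using complex_Re_le_cmod[of "exp (- z * complex_of_real y)"] by simp
  qed
  also have "\<dots> = Re (\<integral>y. (1 - exp (- z * complex_of_real y)) \<partial>(levy \<phi>))"
    using fz unfolding bern_finite_def by (rule integral_Re)
  finally show ?thesis unfolding phi_r_eq bern_def by simp
qed

text \<open>
  Equality forces zero drift and a null Levy measure. Strict growth is what turns the weak
  inequality in the definition of \<open>a_star_bern\<close> into positivity.
\<close>

lemma phi_r_strict_or_const:
  assumes "bern_finite \<phi> (complex_of_real (- u))" "0 \<le> u" "- u < x"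
  shows "\<phi>\<^sub>r (- u) < \<phi>\<^sub>r x \<or> (killing \<phi> > 0 \<and> (\<forall>z. bern \<phi> z = complex_of_real (killing \<phi>)))"
proof (rule disjCI)
  assume not_const: "\<not> (killing \<phi> > 0 \<and> (\<forall>z. bern \<phi> z = complex_of_real (killing \<phi>)))"
  have fx: "bern_finite \<phi> (complex_of_real x)" using bern_finite_mono[OF assms(1,2)] assms(3) by simp
  have i: "integrable (levy \<phi>) (\<lambda>y. exp (u * y) - exp (- x * y))"
    using Bochner_Integration.integrable_diff[OF integrable_real[OF fx] integrable_real[OF assms(1)]] by simp
  have nn: "AE y in levy \<phi>. 0 \<le> exp (u * y) - exp (- x * y)"
    using AE_levy_pos
  proof eventually_elim
    case (elim y)
    have "- x * y \<le> u * y" using assms elim by (intro mult_right_mono) auto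
    thus ?case by simp
  qed
  have diff: "\<phi>\<^sub>r x - \<phi>\<^sub>r (- u) = drift \<phi> * (x + u) + (\<integral>y. exp (u * y) - exp (- x * y) \<partial>(levy \<phi>))"
    unfolding phi_r_eq using Bochner_Integration.integral_diff[OF integrable_real[OF fx] integrable_real[OF assms(1)]]
    by (simp add: algebra_simps)
  have "drift \<phi> * (x + u) + (\<integral>y. exp (u * y) - exp (- x * y) \<partial>(levy \<phi>)) > 0"
  proof (rule ccontr)
    assume "\<not> ?thesis"
    moreover have "drift \<phi> * (x + u) \<ge> 0" using drift_nonneg assms by simp
    moreover have "(\<integral>y. exp (u * y) - exp (- x * y) \<partial>(levy \<phi>)) \<ge> 0" using nn by (rule integral_nonneg_AE)
    moreover have "x + u > 0" using assms by simp
    ultimately have "drift \<phi> * (x + u) = 0" and z: "(\<integral>y. exp (u * y) - exp (- x * y) \<partial>(levy \<phi>)) = 0"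
      by linarith+
    hence d: "drift \<phi> = 0" using assms by simp
    have "AE y in levy \<phi>. exp (u * y) - exp (- x * y) = 0"
      using z integral_nonneg_eq_0_iff_AE[OF i nn] by simp
    hence "AE y in levy \<phi>. False"
      using AE_levy_pos
    proof eventually_elim
      case (elim y)
      hence "u * y = - x * y" by simp
      hence "(u + x) * y = 0" by (simp add: algebra_simps)
      thus False using elim assms by simp
    qed
    hence "bern \<phi> z = complex_of_real (killing \<phi>)" for z
    proof -
      have "(\<integral>y. (1 - exp (- z * complex_of_real y)) \<partial>(levy \<phi>)) = (\<integral>y. 0 \<partial>(levy \<phi>))"
        by (rule integral_cong_AE) (use \<open>AE y in levy \<phi>. False\<close> in auto)
      thus ?thesis unfolding bern_def using d by simp
    qed
    moreover have "killing \<phi> > 0" using bern_not_zero calculation killing_nonneg by (cases "killing \<phi> = 0") auto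
    ultimately show False using not_const by blast
  qed
  thus "\<phi>\<^sub>r (- u) < \<phi>\<^sub>r x" using diff by linarith
qed

lemma phi_r_pos: "- a_star_bern \<phi> < ereal x \<Longrightarrow> 0 < \<phi>\<^sub>r x"
proof -
  assume "- a_star_bern \<phi> < ereal x"
  then obtain u where u: "u \<ge> 0" "- u < x" "bern_finite \<phi> (complex_of_real (- u))" "0 \<le> \<phi>\<^sub>r (- u)"
    using a_star_witness by blast
  from phi_r_strict_or_const[OF u(3,1,2)] u(4) show ?thesis unfolding \<phi>\<^sub>r_def by auto
qed

lemma pos_gt_a_star: "0 < x \<Longrightarrow> - a_star_bern \<phi> < ereal x"
  using a_star_nonneg by (intro le_less_trans[of "- a_star_bern \<phi>" 0]) auto

lemma phi_r_pos': "0 < x \<Longrightarrow> 0 < \<phi>\<^sub>r x"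
  using phi_r_pos pos_gt_a_star by blast

lemma phi_r_mono:
  assumes "bern_finite \<phi> (complex_of_real (- u))" "0 \<le> u" "- u \<le> x" "x \<le> y"
  shows "\<phi>\<^sub>r x \<le> \<phi>\<^sub>r y"
proof -
  have f: "bern_finite \<phi> (complex_of_real x)" "bern_finite \<phi> (complex_of_real y)"
    using bern_finite_mono[OF assms(1,2)] assms(3-) by auto
  have "(\<integral>t. 1 - exp (- x * t) \<partial>(levy \<phi>)) \<le> (\<integral>t. 1 - exp (- y * t) \<partial>(levy \<phi>))"
    by (rule integral_mono_AE[OF f[THEN integrable_real]])
       (use AE_levy_pos assms in \<open>auto elim!: eventually_mono\<close>)
  thus ?thesis unfolding phi_r_eq using mult_left_mono[OF assms(4) drift_nonneg] by simp
qed

lemma phi_r_mono': "0 \<le> x \<Longrightarrow> x \<le> y \<Longrightarrow> \<phi>\<^sub>r x \<le> \<phi>\<^sub>r y"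
  using phi_r_mono[OF bern_finite_0] by simp

lemma Re_bern_pos: "- a_star_bern \<phi> < ereal (Re z) \<Longrightarrow> 0 < Re (bern \<phi> z)"
proof -
  assume a: "- a_star_bern \<phi> < ereal (Re z)"
  then obtain u where u: "u \<ge> 0" "- u < Re z" "bern_finite \<phi> (complex_of_real (- u))"
    using a_star_witness by blast
  have "\<phi>\<^sub>r (Re z) \<le> Re (bern \<phi> z)" using u by (intro Re_bern_ge) auto
  thus ?thesis using phi_r_pos[OF a] by simp
qed

lemma phi_r_le_norm_bern: "0 < Re z \<Longrightarrow> \<phi>\<^sub>r (Re z) \<le> norm (bern \<phi> z)"
  by (rule order_trans[OF Re_bern_ge[OF bern_finite_0] complex_Re_le_cmod]) auto

lemma bern_nonzero: "- a_star_bern \<phi> < ereal (Re z) \<Longrightarrow> bern \<phi> z \<noteq> 0"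
  using Re_bern_pos[of z] by auto

lemma bern_cnj: "bern \<phi> (cnj z) = cnj (bern \<phi> z)"
proof -
  have "(\<integral>y. (1 - exp (- cnj z * complex_of_real y)) \<partial>(levy \<phi>)) = (\<integral>y. cnj (1 - exp (- z * complex_of_real y)) \<partial>(levy \<phi>))"
    by (intro Bochner_Integration.integral_cong refl) (simp add: exp_cnj)
  also have "\<dots> = cnj (\<integral>y. (1 - exp (- z * complex_of_real y)) \<partial>(levy \<phi>))"
    by (rule Bochner_Integration.integral_cnj)
  finally show ?thesis by (simp add: bern_def)
qed

text \<open>
  The quantity \<open>(1 - exp (- m y)) / m\<close> is the integral of \<open>exp (- m s)\<close>
  over \<open>[0, y]\<close>; after integration against the Levy measure it becomes a Lipschitz
  constant that is expressed through \<open>\<phi>(m)\<close> alone.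
\<close>

lemma exp_diff_bound:
  fixes w z :: complex and m y :: real
  assumes m: "0 < m" "m \<le> Re w" "m \<le> Re z" and y: "0 < y"
  shows "norm (exp (- w * complex_of_real y) - exp (- z * complex_of_real y)) \<le> norm (w - z) * ((1 - exp (- m * y)) / m)"
proof -
  have "norm (exp (- w * complex_of_real y) - exp (- z * complex_of_real y)) \<le> (y * exp (- m * y)) * norm (w - z)"
  proof (rule field_differentiable_bound[where S="{v. m \<le> Re v}" and f'="\<lambda>v. - (complex_of_real y) * exp (- v * complex_of_real y)"])
    fix v assume v: "v \<in> {v. m \<le> Re v}"
    show "((\<lambda>v. exp (- v * complex_of_real y)) has_field_derivative - complex_of_real y * exp (- v * complex_of_real y)) (at v within {v. m \<le> Re v})"
      by (auto intro!: derivative_eq_intros)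
    show "norm (- complex_of_real y * exp (- v * complex_of_real y)) \<le> y * exp (- m * y)"
      using v y by (simp add: norm_mult)
  qed (use m convex_halfspace_Re_ge in auto)
  also have "y * exp (- m * y) \<le> (1 - exp (- m * y)) / m"
  proof -
    have "1 + m * y \<le> exp (m * y)" by (rule exp_ge_add_one_self)
    hence "(1 + m * y) * exp (- m * y) \<le> exp (m * y) * exp (- m * y)" by (rule mult_right_mono) simp
    also have "exp (m * y) * exp (- m * y) = 1" by (simp add: exp_minus)
    finally have "m * (y * exp (- m * y)) \<le> 1 - exp (- m * y)" by (simp add: distrib_right)
    thus ?thesis using m by (simp add: pos_le_divide_eq mult.commute mult.assoc)
  qed
  finally show ?thesis by (simp add: mult_right_mono mult.commute)
qed

lemma bern_lipschitz:
  assumes m: "0 < m" "m \<le> Re w" "m \<le> Re z"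
  shows "norm (bern \<phi> w - bern \<phi> z) \<le> norm (w - z) * (\<phi>\<^sub>r m / m)"
proof -
  have f: "bern_finite \<phi> w" "bern_finite \<phi> z" "bern_finite \<phi> (complex_of_real m)"
    using m by (auto intro: bern_finite_Re_nonneg)
  have i: "integrable (levy \<phi>) (\<lambda>y. exp (- w * complex_of_real y) - exp (- z * complex_of_real y))"
    using Bochner_Integration.integrable_diff[OF f(2,1)[unfolded bern_finite_def]] by simp
  have "norm (\<integral>y. exp (- w * complex_of_real y) - exp (- z * complex_of_real y) \<partial>(levy \<phi>)) \<le>
        (\<integral>y. norm (w - z) * ((1 - exp (- m * y)) / m) \<partial>(levy \<phi>))"
  proof (rule order_trans[OF integral_norm_bound integral_mono_AE])
    show "AE y in levy \<phi>. norm (exp (- w * complex_of_real y) - exp (- z * complex_of_real y)) \<le> norm (w - z) * ((1 - exp (- m * y)) / m)"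
      using AE_levy_pos by eventually_elim (rule exp_diff_bound[OF m])
  qed (use i integrable_real[OF f(3)] in auto)
  also have "\<dots> = norm (w - z) * ((\<integral>y. 1 - exp (- m * y) \<partial>(levy \<phi>)) / m)"
    by simp
  finally have 1: "norm (\<integral>y. exp (- w * complex_of_real y) - exp (- z * complex_of_real y) \<partial>(levy \<phi>)) \<le> \<dots>" .
  have "bern \<phi> w - bern \<phi> z = complex_of_real (drift \<phi>) * (w - z) - (\<integral>y. exp (- w * complex_of_real y) - exp (- z * complex_of_real y) \<partial>(levy \<phi>))"
    unfolding bern_def using Bochner_Integration.integral_diff[OF f(2,1)[unfolded bern_finite_def]]
    by (simp add: algebra_simps)
  also have "norm \<dots> \<le> norm (complex_of_real (drift \<phi>) * (w - z)) + norm (\<integral>y. exp (- w * complex_of_real y) - exp (- z * complex_of_real y) \<partial>(levy \<phi>))"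
    by (rule norm_triangle_ineq4)
  also have "\<dots> \<le> norm (w - z) * drift \<phi> + norm (w - z) * ((\<integral>y. 1 - exp (- m * y) \<partial>(levy \<phi>)) / m)"
    using 1 drift_nonneg by (simp add: norm_mult mult.commute)
  also have "\<dots> = norm (w - z) * (drift \<phi> + (\<integral>y. 1 - exp (- m * y) \<partial>(levy \<phi>)) / m)" by (simp add: algebra_simps)
  also have "\<dots> \<le> norm (w - z) * (\<phi>\<^sub>r m / m)"
    unfolding phi_r_eq using m killing_nonneg by (intro mult_left_mono) (auto simp: field_simps)
  finally show ?thesis .
qed

lemma bern_growth:
  assumes "0 < Re z"
  shows "norm (bern \<phi> z) \<le> \<phi>\<^sub>r (Re z) * (1 + \<bar>Im z\<bar> / Re z)"
proof -
  have "norm (z - complex_of_real (Re z)) = \<bar>Im z\<bar>" by (simp add: cmod_def)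
  hence "norm (bern \<phi> z - complex_of_real (\<phi>\<^sub>r (Re z))) \<le> \<bar>Im z\<bar> * (\<phi>\<^sub>r (Re z) / Re z)"
    using bern_lipschitz[of "Re z" z "complex_of_real (Re z)"] assms by (simp add: bern_of_real)
  moreover have "norm (bern \<phi> z) \<le> norm (complex_of_real (\<phi>\<^sub>r (Re z))) + norm (bern \<phi> z - complex_of_real (\<phi>\<^sub>r (Re z)))"
    by (rule norm_triangle_sub)
  ultimately show ?thesis using phi_r_pos'[OF assms] by (simp add: algebra_simps)
qed

lemma bern_holomorphic: "bern \<phi> holomorphic_on {z. 0 < Re z}"
proof -
  have "(\<lambda>z. \<integral>y. (1 - exp (- z * complex_of_real y)) \<partial>(levy \<phi>)) holomorphic_on {z. 0 < Re z}"
  proof (rule holomorphic_on_integral)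
    fix z :: complex assume z: "z \<in> {z. 0 < Re z}"
    have sub: "cball z (Re z / 2) \<subseteq> {z. 0 < Re z}"
    proof
      fix w assume "w \<in> cball z (Re z / 2)"
      hence "\<bar>Re z - Re w\<bar> \<le> Re z / 2" using abs_Re_le_cmod[of "z - w"] by (simp add: dist_norm)
      thus "w \<in> {z. 0 < Re z}" unfolding mem_Collect_eq using z[simplified] by linarith
    qed
    have "AE y in levy \<phi>. \<forall>w\<in>cball z (Re z / 2). norm (1 - exp (- w * complex_of_real y)) \<le> (norm z + Re z / 2 + 2) * min 1 y"
      using AE_levy_pos
    proof eventually_elim
      case (elim y)
      show ?case
      proof
        fix w assume w: "w \<in> cball z (Re z / 2)"
        have "norm (1 - exp (- w * complex_of_real y)) \<le> (norm w + 2) * min 1 y"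
          using one_minus_exp_bound[of 0 w y] elim w sub by (auto simp: subset_iff less_imp_le)
        also have "norm w \<le> norm z + Re z / 2" using w norm_triangle_sub[of w z] by (simp add: dist_norm norm_minus_commute)
        finally show "norm (1 - exp (- w * complex_of_real y)) \<le> (norm z + Re z / 2 + 2) * min 1 y"
          using elim by (simp add: mult_right_mono)
      qed
    qed
    moreover have "integrable (levy \<phi>) (\<lambda>y. (norm z + Re z / 2 + 2) * min 1 y)" using integrable_levy_min by simp
    ultimately show "\<exists>r>0. \<exists>B. cball z r \<subseteq> {z. 0 < Re z} \<and> integrable (levy \<phi>) B \<and>
        (AE y in levy \<phi>. \<forall>w\<in>cball z r. norm (1 - exp (- w * complex_of_real y)) \<le> B y)"
      using z sub by (intro exI[of _ "Re z / 2"] conjI exI[of _ "\<lambda>y. (norm z + Re z / 2 + 2) * min 1 y"]) auto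
  qed (auto intro!: holomorphic_intros open_halfspace_Re_gt)
  thus ?thesis unfolding bern_def[abs_def] by (intro holomorphic_intros)
qed

text \<open>
  The values of \<open>\<phi>\<close> have positive real part, so the principal branch is
  holomorphic.
\<close>

definition L :: "complex \<Rightarrow> complex" where "L z = Ln (bern \<phi> z)"

lemma Re_bern_pos': "0 < Re z \<Longrightarrow> 0 < Re (bern \<phi> z)"
  using Re_bern_pos pos_gt_a_star by blast

lemma bern_nonzero': "0 < Re z \<Longrightarrow> bern \<phi> z \<noteq> 0"
  using Re_bern_pos'[of z] by auto

lemma exp_L: "0 < Re z \<Longrightarrow> exp (L z) = bern \<phi> z"
  unfolding L_def using bern_nonzero' by simp

lemma L_of_real: "0 < x \<Longrightarrow> L (complex_of_real x) = complex_of_real (ln (\<phi>\<^sub>r x))"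
  unfolding L_def bern_of_real using phi_r_pos' by (simp add: Ln_of_real)

lemma L_holomorphic: "L holomorphic_on {z. 0 < Re z}"
  unfolding L_def[abs_def]
proof (rule holomorphic_on_Ln'[OF _ bern_holomorphic])
  fix z :: complex assume "z \<in> {z. 0 < Re z}"
  hence "0 < Re (bern \<phi> z)" using Re_bern_pos' by simp
  thus "bern \<phi> z \<notin> \<real>\<^sub>\<le>\<^sub>0" by (simp add: complex_nonpos_Reals_iff)
qed

text \<open>
  The Lipschitz constant is taken at half the abscissa, where \<open>\<phi>\<close> is still at most
  \<open>\<phi>(Re z)\<close>.
\<close>

lemma deriv_bern_bound:
  assumes z: "0 < Re z"
  shows "norm (deriv (bern \<phi>) z) \<le> 2 * \<phi>\<^sub>r (Re z) / Re z"
proof (rule tendsto_upperbound)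
  have "(bern \<phi> has_field_derivative deriv (bern \<phi>) z) (at z)"
    using holomorphic_derivI[OF bern_holomorphic open_halfspace_Re_gt] z by simp
  thus "((\<lambda>w. norm ((bern \<phi> w - bern \<phi> z) / (w - z))) \<longlongrightarrow> norm (deriv (bern \<phi>) z)) (at z)"
    unfolding has_field_derivative_iff by (rule tendsto_norm)
  have "\<forall>\<^sub>F w in at z. w \<in> ball z (Re z / 2)" using z by (intro eventually_at_in_open') auto
  moreover have "\<forall>\<^sub>F w in at z. w \<noteq> z" by (rule eventually_neq_at_within)
  ultimately show "\<forall>\<^sub>F w in at z. norm ((bern \<phi> w - bern \<phi> z) / (w - z)) \<le> 2 * \<phi>\<^sub>r (Re z) / Re z"
  proof eventually_elim
    case (elim w)
    hence "\<bar>Re z - Re w\<bar> < Re z / 2" using abs_Re_le_cmod[of "z - w"] by (simp add: dist_norm)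
    hence "norm (bern \<phi> w - bern \<phi> z) \<le> norm (w - z) * (\<phi>\<^sub>r (Re z / 2) / (Re z / 2))"
      using z by (intro bern_lipschitz) linarith+
    also have "\<dots> \<le> norm (w - z) * (\<phi>\<^sub>r (Re z) / (Re z / 2))"
      using z by (intro mult_left_mono divide_right_mono phi_r_mono') auto
    finally show ?case using elim z by (simp add: norm_divide divide_simps mult_ac)
  qed
qed simp

text \<open>
  This bound and the next show that \<open>log \<phi>\<close> is as flat at infinity as the
  logarithm. All estimates of Gauss products and of their growth rest on them.
\<close>

lemma deriv_L_bound:
  assumes z: "0 < Re z"
  shows "norm (deriv L z) \<le> 2 / Re z"
proof -
  have "(bern \<phi> has_field_derivative deriv (bern \<phi>) z) (at z)"
    using holomorphic_derivI[OF bern_holomorphic open_halfspace_Re_gt] z by simp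
  hence "(L has_field_derivative deriv (bern \<phi>) z / bern \<phi> z) (at z)"
    unfolding L_def[abs_def] using Re_bern_pos'[OF z]
    by (auto intro!: derivative_eq_intros simp: complex_nonpos_Reals_iff divide_inverse)
  hence "norm (deriv L z) = norm (deriv (bern \<phi>) z) / norm (bern \<phi> z)"
    by (simp add: DERIV_imp_deriv norm_divide)
  also have "\<dots> \<le> (2 * \<phi>\<^sub>r (Re z) / Re z) / \<phi>\<^sub>r (Re z)"
    using deriv_bern_bound[OF z] phi_r_le_norm_bern[OF z] phi_r_pos'[OF z] z by (intro frac_le) auto
  also have "\<dots> = 2 / Re z" using phi_r_pos'[OF z] by simp
  finally show ?thesis .
qed

lemma deriv2_L_bound:
  assumes z: "0 < Re z"
  shows "norm (deriv (deriv L) z) \<le> 8 / (Re z)\<^sup>2"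
proof -
  have sub: "cball z (Re z / 2) \<subseteq> {z. 0 < Re z}"
  proof
    fix w assume "w \<in> cball z (Re z / 2)"
    hence "\<bar>Re z - Re w\<bar> \<le> Re z / 2" using abs_Re_le_cmod[of "z - w"] by (simp add: dist_norm)
    thus "w \<in> {z. 0 < Re z}" unfolding mem_Collect_eq using z[simplified] by linarith
  qed
  have h: "deriv L holomorphic_on {z. 0 < Re z}"
    by (intro holomorphic_deriv L_holomorphic open_halfspace_Re_gt)
  have "norm ((deriv ^^ 1) (deriv L) z) \<le> fact 1 * (4 / Re z) / (Re z / 2) ^ 1"
  proof (rule Cauchy_inequality)
    show "deriv L holomorphic_on ball z (Re z / 2)"
      using h sub by (meson ball_subset_cball holomorphic_on_subset subset_trans)
    show "continuous_on (cball z (Re z / 2)) (deriv L)"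
      using h sub by (meson holomorphic_on_imp_continuous_on holomorphic_on_subset)
    fix x assume x: "norm (z - x) = Re z / 2"
    hence "\<bar>Re z - Re x\<bar> \<le> Re z / 2" using abs_Re_le_cmod[of "z - x"] by simp
    hence "Re x \<ge> Re z / 2" by linarith
    hence "2 / Re x \<le> 2 / (Re z / 2)" using z by (intro divide_left_mono mult_pos_pos) auto
    moreover have "norm (deriv L x) \<le> 2 / Re x" using \<open>Re x \<ge> Re z / 2\<close> z by (intro deriv_L_bound) auto
    ultimately show "norm (deriv L x) \<le> 4 / Re z" by simp
  qed (use z in auto)
  thus ?thesis by (simp add: power2_eq_square)
qed

end


section \<open>The Gauss product of a Bernstein function\<close>

text \<open>
  For \<open>N = 0\<close> this is Gauss's product for \<open>W(z + 1)\<close>. To the left of the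
  imaginary axis, finitely many factors may vanish or be meaningless; leaving out the first
  \<open>N\<close> of them separates convergence, which concerns large \<open>k\<close> only, from
  the behaviour of these factors.
\<close>

definition gauss_tail :: "bernstein \<Rightarrow> nat \<Rightarrow> nat \<Rightarrow> complex \<Rightarrow> complex" where
  "gauss_tail \<phi> N n z = bern \<phi> (of_nat n) powr z * (\<Prod>k\<in>{N<..n}. bern \<phi> (of_nat k) / bern \<phi> (of_nat k + z))"

context bernstein_function
begin

lemma L_taylor:
  assumes m: "0 < m" "m \<le> Re w" "m \<le> Re z"
  shows "norm (L z - L w - deriv L w * (z - w)) \<le> 8 / m\<^sup>2 * (norm (z - w))\<^sup>2"
proof -
  have "norm ((deriv ^^ 0) L z - (\<Sum>i\<le>1. (deriv ^^ i) L w * (z - w) ^ i / fact i)) \<le> 8 / m\<^sup>2 * norm (z - w) ^ Suc 1 / fact 1"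
  proof (rule complex_Taylor[where S="{v. m \<le> Re v}"])
    fix i :: nat and x assume x: "x \<in> {v. m \<le> Re v}"
    have "(deriv ^^ i) L holomorphic_on {z. 0 < Re z}"
      by (intro holomorphic_higher_deriv L_holomorphic open_halfspace_Re_gt)
    thus "((deriv ^^ i) L has_field_derivative (deriv ^^ Suc i) L x) (at x within {v. m \<le> Re v})"
      using holomorphic_derivI[OF _ open_halfspace_Re_gt, of "(deriv ^^ i) L" 0 x] x m by auto
  next
    fix x assume x: "x \<in> {v. m \<le> Re v}"
    have "8 / (Re x)\<^sup>2 \<le> 8 / m\<^sup>2" using x m by (intro divide_left_mono power_mono mult_pos_pos) auto
    thus "norm ((deriv ^^ Suc 1) L x) \<le> 8 / m\<^sup>2" using deriv2_L_bound[of x] x m by auto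
  qed (use m convex_halfspace_Re_ge in auto)
  thus ?thesis by (simp add: power2_eq_square algebra_simps)
qed

lemma bern_of_nat: "bern \<phi> (of_nat n) = complex_of_real (\<phi>\<^sub>r (real n))"
  using bern_of_real[of "real n"] by simp

text \<open>
  Consecutive products differ by a factor \<open>exp (t k)\<close>. In \<open>t k\<close> the first
  order Taylor terms of \<open>log \<phi>\<close> at \<open>k + 1\<close> cancel and a summable
  remainder of order \<open>1 / k\<^sup>2\<close> is left. An infinite product of exponentials has a
  limit different from \<open>0\<close>.
\<close>

lemma gauss_tail_converges:
  assumes N: "0 < Re z + real N + 1"
  shows "\<exists>l. l \<noteq> 0 \<and> (\<lambda>n. gauss_tail \<phi> N n z) \<longlonglongrightarrow> l"
proof -
  define t where "t k = z * (L (of_nat (Suc k)) - L (of_nat k)) + L (of_nat (Suc k)) - L (of_nat (Suc k) + z)" for k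
  \<comment> \<open>For k \<ge> M the points k + 1 + z keep a distance of at least k / 2 from the imaginary axis.\<close>
  obtain M :: nat where M: "real M \<ge> 2 * \<bar>Re z\<bar> + 2" "M \<ge> N" "M \<ge> 1"
    by (rule that[of "nat \<lceil>2 * \<bar>Re z\<bar> + 2\<rceil> + N + 1"]) linarith+
  have tb: "norm (t k) \<le> (8 * norm z + 32 * (norm z)\<^sup>2) * (inverse (real k ^ 2))" if k: "k \<ge> M" for k
  proof -
    have kM: "real k \<ge> real M" using k by simp
    have k1: "real k \<ge> 1" using M(3) k by linarith
    have "Re (of_nat (Suc k) + z) = real k + 1 + Re z" by simp
    hence re: "Re (of_nat (Suc k) + z) \<ge> real k / 2" using kM M(1) by linarith
    have a: "norm (L (of_nat k) - L (of_nat (Suc k)) - deriv L (of_nat (Suc k)) * (of_nat k - of_nat (Suc k))) \<le> 8 / (real k)\<^sup>2 * (norm (of_nat k - of_nat (Suc k) :: complex))\<^sup>2"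
      using k1 by (intro L_taylor) auto
    have b: "norm (L (of_nat (Suc k) + z) - L (of_nat (Suc k)) - deriv L (of_nat (Suc k)) * (of_nat (Suc k) + z - of_nat (Suc k))) \<le> 8 / (real k / 2)\<^sup>2 * (norm (of_nat (Suc k) + z - of_nat (Suc k) :: complex))\<^sup>2"
      using k1 re by (intro L_taylor) auto
    define A where "A = L (of_nat k) - L (of_nat (Suc k)) - deriv L (of_nat (Suc k)) * (of_nat k - of_nat (Suc k))"
    define B where "B = L (of_nat (Suc k) + z) - L (of_nat (Suc k)) - deriv L (of_nat (Suc k)) * (of_nat (Suc k) + z - of_nat (Suc k))"
    have A: "norm A \<le> 8 / (real k)\<^sup>2" using a unfolding A_def[symmetric] by simp
    have B: "norm B \<le> 32 / (real k)\<^sup>2 * (norm z)\<^sup>2" using b unfolding B_def[symmetric] by (simp add: power_divide)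
    have "t k = - z * A - B"
      unfolding t_def A_def B_def by (simp add: algebra_simps)
    also have "norm \<dots> \<le> norm (- z * A) + norm B" by (rule norm_triangle_ineq4)
    also have "\<dots> \<le> norm z * (8 / (real k)\<^sup>2) + 32 / (real k)\<^sup>2 * (norm z)\<^sup>2"
      using mult_left_mono[OF A norm_ge_zero[of z]] B by (intro add_mono) (simp_all add: norm_mult)
    also have "\<dots> = (8 * norm z + 32 * (norm z)\<^sup>2) * (inverse (real k ^ 2))"
      by (simp add: divide_inverse algebra_simps)
    finally show ?thesis .
  qed
  have "summable (\<lambda>k. (8 * norm z + 32 * (norm z)\<^sup>2) * (inverse (real k ^ 2)))"
    by (intro summable_mult inverse_power_summable) auto
  hence st: "summable t"
    by (rule summable_comparison_test'[of _ M]) (use tb in auto)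
  hence st': "summable (\<lambda>j. t (j + M))" by (rule summable_ignore_initial_segment)
  have pz: "bern \<phi> (of_nat k + z) \<noteq> 0" if "k > N" for k
  proof (rule bern_nonzero')
    have "real k \<ge> real N + 1" using that by linarith
    thus "0 < Re (of_nat k + z)" using N by simp
  qed
  have pn: "bern \<phi> (of_nat k) \<noteq> 0" if "k \<ge> 1" for k
    using that by (intro bern_nonzero') auto
  have eq: "gauss_tail \<phi> N (j + M) z = gauss_tail \<phi> N M z * exp (\<Sum>i<j. t (i + M))" for j
  proof (induction j)
    case (Suc j)
    define k where "k = j + M"
    have kM: "k \<ge> M" by (simp add: k_def)
    hence k1: "k \<ge> 1" using M by simp
    have Rz: "0 < Re (of_nat (Suc k) + z)"
    proof -
      have "real k \<ge> real M" using kM by simp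
      moreover have "Re (of_nat (Suc k) + z) = real k + 1 + Re z" by simp
      ultimately show ?thesis using M(1) by linarith
    qed
    have "gauss_tail \<phi> N (Suc k) z = bern \<phi> (of_nat (Suc k)) powr z * ((\<Prod>i\<in>{N<..k}. bern \<phi> (of_nat i) / bern \<phi> (of_nat i + z)) * (bern \<phi> (of_nat (Suc k)) / bern \<phi> (of_nat (Suc k) + z)))"
    proof -
      have "{N<..Suc k} = insert (Suc k) {N<..k}" using kM M by auto
      thus ?thesis unfolding gauss_tail_def by (simp add: mult_ac)
    qed
    also have "\<dots> = gauss_tail \<phi> N k z * exp (t k)"
    proof -
      have e1: "bern \<phi> (of_nat i) powr z = exp (z * L (of_nat i))" if "i \<ge> 1" for i
        using pn[OF that] by (simp add: powr_def L_def)
      have e2: "bern \<phi> (of_nat (Suc k)) = exp (L (of_nat (Suc k)))" "bern \<phi> (of_nat (Suc k) + z) = exp (L (of_nat (Suc k) + z))"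
        using Rz by (simp_all only: exp_L) (simp add: exp_L)
      have X: "exp (z * L (of_nat (Suc k))) * (bern \<phi> (of_nat (Suc k)) / bern \<phi> (of_nat (Suc k) + z)) = exp (z * L (of_nat k)) * exp (t k)"
        unfolding e2 t_def exp_add[symmetric] exp_diff[symmetric] by (simp add: algebra_simps)
      define Q where "Q = (\<Prod>i\<in>{N<..k}. bern \<phi> (of_nat i) / bern \<phi> (of_nat i + z))"
      have "exp (z * L (of_nat (Suc k))) * (Q * (bern \<phi> (of_nat (Suc k)) / bern \<phi> (of_nat (Suc k) + z)))
         = Q * (exp (z * L (of_nat (Suc k))) * (bern \<phi> (of_nat (Suc k)) / bern \<phi> (of_nat (Suc k) + z)))"
        by (simp only: mult_ac)
      also have "\<dots> = exp (z * L (of_nat k)) * Q * exp (t k)" unfolding X by (simp only: mult_ac)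
      finally show ?thesis unfolding gauss_tail_def e1[OF k1] e1[OF le_SucI[OF k1]] Q_def .
    qed
    finally have "gauss_tail \<phi> N (Suc j + M) z = gauss_tail \<phi> N k z * exp (t k)" by (simp add: k_def)
    also have "gauss_tail \<phi> N k z = gauss_tail \<phi> N M z * exp (\<Sum>i<j. t (i + M))" unfolding k_def by (rule Suc.IH)
    finally show ?case by (simp add: exp_add k_def mult.assoc)
  qed simp
  have "(\<lambda>j. gauss_tail \<phi> N (j + M) z) \<longlonglongrightarrow> gauss_tail \<phi> N M z * exp (\<Sum>j. t (j + M))"
    unfolding eq by (intro tendsto_intros summable_LIMSEQ st')
  hence "(\<lambda>j. gauss_tail \<phi> N j z) \<longlonglongrightarrow> gauss_tail \<phi> N M z * exp (\<Sum>j. t (j + M))"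
    by (rule LIMSEQ_offset)
  moreover have "gauss_tail \<phi> N M z * exp (\<Sum>j. t (j + M)) \<noteq> 0"
    unfolding gauss_tail_def using pn pz M by (auto simp: powr_def)
  ultimately show ?thesis by blast
qed

lemma gauss_tail_split:
  assumes "N \<le> n"
  shows "gauss_tail \<phi> 0 n z = (\<Prod>k\<in>{0<..N}. bern \<phi> (of_nat k) / bern \<phi> (of_nat k + z)) * gauss_tail \<phi> N n z"
proof -
  have "{0<..n} = {0<..N} \<union> {N<..n}" using assms by auto
  hence "(\<Prod>k\<in>{0<..n}. bern \<phi> (of_nat k) / bern \<phi> (of_nat k + z)) =
     (\<Prod>k\<in>{0<..N}. bern \<phi> (of_nat k) / bern \<phi> (of_nat k + z)) * (\<Prod>k\<in>{N<..n}. bern \<phi> (of_nat k) / bern \<phi> (of_nat k + z))"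
    by (simp add: prod.union_disjoint)
  thus ?thesis unfolding gauss_tail_def by (simp only: mult_ac)
qed

lemma gauss_product_converges:
  assumes z: "- a_star_bern \<phi> < ereal (Re z + 1)"
  shows "\<exists>l. l \<noteq> 0 \<and> (\<lambda>n. gauss_tail \<phi> 0 n z) \<longlonglongrightarrow> l"
proof -
  obtain N :: nat where N: "0 < Re z + real N + 1"
    by (rule that[of "nat \<lceil>\<bar>Re z\<bar>\<rceil>"]) linarith
  obtain l where l: "l \<noteq> 0" "(\<lambda>n. gauss_tail \<phi> N n z) \<longlonglongrightarrow> l" using gauss_tail_converges[OF N] by blast
  define P where "P = (\<Prod>k\<in>{0<..N}. bern \<phi> (of_nat k) / bern \<phi> (of_nat k + z))"
  have "(\<lambda>n. P * gauss_tail \<phi> N n z) \<longlonglongrightarrow> P * l" by (intro tendsto_intros l)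
  moreover have "\<forall>\<^sub>F n in sequentially. P * gauss_tail \<phi> N n z = gauss_tail \<phi> 0 n z"
    using eventually_ge_at_top[of N] by eventually_elim (simp add: gauss_tail_split P_def)
  ultimately have "(\<lambda>n. gauss_tail \<phi> 0 n z) \<longlonglongrightarrow> P * l" by (rule Lim_transform_eventually)
  moreover have "P \<noteq> 0"
  proof -
    have "bern \<phi> (of_nat k) \<noteq> 0 \<and> bern \<phi> (of_nat k + z) \<noteq> 0" if "k \<ge> 1" for k
    proof
      show "bern \<phi> (of_nat k) \<noteq> 0" using that by (intro bern_nonzero') auto
      have "ereal (Re z + 1) \<le> ereal (Re (of_nat k + z))" using that by simp
      thus "bern \<phi> (of_nat k + z) \<noteq> 0" by (intro bern_nonzero less_le_trans[OF z])
    qed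
    thus ?thesis by (auto simp: P_def)
  qed
  ultimately show ?thesis using l by (intro exI[of _ "P * l"]) auto
qed

text \<open>
  The Bernstein-gamma function \<open>W\<close>.
\<close>

definition BG :: "complex \<Rightarrow> complex" where "BG z = lim (\<lambda>n. gauss_tail \<phi> 0 n (z - 1))"

lemma BG_lim:
  assumes "- a_star_bern \<phi> < ereal (Re z)"
  shows "(\<lambda>n. gauss_tail \<phi> 0 n (z - 1)) \<longlonglongrightarrow> BG z" and BG_nonzero: "BG z \<noteq> 0"
proof -
  obtain l where l: "l \<noteq> 0" "(\<lambda>n. gauss_tail \<phi> 0 n (z - 1)) \<longlonglongrightarrow> l"
    using gauss_product_converges[of "z - 1"] assms by auto
  thus "(\<lambda>n. gauss_tail \<phi> 0 n (z - 1)) \<longlonglongrightarrow> BG z" "BG z \<noteq> 0" unfolding BG_def by (auto dest: limI)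
qed

lemma BG_1: "BG 1 = 1"
proof -
  have "\<forall>\<^sub>F n in sequentially. gauss_tail \<phi> 0 n 0 = 1"
    using eventually_gt_at_top[of 0]
  proof eventually_elim
    case (elim n)
    have "bern \<phi> (of_nat k) \<noteq> 0" if "k > 0" for k using that by (intro bern_nonzero') auto
    thus ?case using elim by (simp add: gauss_tail_def)
  qed
  hence "(\<lambda>n. gauss_tail \<phi> 0 n (1 - 1)) \<longlonglongrightarrow> 1" by (simp add: tendsto_eventually)
  thus ?thesis using BG_lim[of 1] pos_gt_a_star[of 1] by (auto dest: LIMSEQ_unique)
qed

lemma bern_ratio_tendsto_1: "(\<lambda>n. bern \<phi> (of_nat n + z) / bern \<phi> (of_nat n)) \<longlonglongrightarrow> 1"
proof -
  have "(\<lambda>n. bern \<phi> (of_nat n + z) / bern \<phi> (of_nat n) - 1) \<longlonglongrightarrow> 0"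
  proof (rule Lim_null_comparison)
    show "\<forall>\<^sub>F n in sequentially. norm (bern \<phi> (of_nat n + z) / bern \<phi> (of_nat n) - 1) \<le> 2 * norm z / real n"
      using eventually_ge_at_top[of "nat \<lceil>2 * \<bar>Re z\<bar> + 2\<rceil>"]
    proof eventually_elim
      case (elim n)
      hence n: "real n \<ge> 2 * \<bar>Re z\<bar> + 2" by linarith
      have n0: "real n > 0" using n by linarith
      have pos: "\<phi>\<^sub>r (real n) > 0" using n0 by (intro phi_r_pos') auto
      have "norm (bern \<phi> (of_nat n + z) - bern \<phi> (of_nat n)) \<le> norm (of_nat n + z - of_nat n) * (\<phi>\<^sub>r (real n / 2) / (real n / 2))"
      proof (intro bern_lipschitz)
        have "Re (of_nat n + z) = real n + Re z" by simp
        thus "real n / 2 \<le> Re (of_nat n + z)" using n by linarith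
      qed (use n0 in auto)
      also have "\<dots> \<le> norm z * (\<phi>\<^sub>r (real n) / (real n / 2))"
        using n0 by (intro mult_mono divide_right_mono phi_r_mono' divide_nonneg_nonneg less_imp_le[OF phi_r_pos']) auto
      finally have "norm (bern \<phi> (of_nat n + z) - bern \<phi> (of_nat n)) / \<phi>\<^sub>r (real n) \<le> 2 * norm z / real n"
        using pos n0 by (simp add: field_simps)
      moreover have "bern \<phi> (of_nat n + z) / bern \<phi> (of_nat n) - 1 = (bern \<phi> (of_nat n + z) - bern \<phi> (of_nat n)) / complex_of_real (\<phi>\<^sub>r (real n))"
        using pos by (simp add: bern_of_nat field_simps)
      ultimately show ?case using pos by (simp add: norm_divide)
    qed
    show "(\<lambda>n. 2 * norm z / real n) \<longlonglongrightarrow> 0" by real_asymp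
  qed
  thus ?thesis by (simp add: LIM_zero_iff)
qed

lemma gauss_tail_shift:
  assumes z: "- a_star_bern \<phi> < ereal (Re z)" and n: "n \<ge> 1"
  shows "gauss_tail \<phi> 0 n z * (bern \<phi> (of_nat n + z) / bern \<phi> (of_nat n)) = bern \<phi> z * gauss_tail \<phi> 0 n (z - 1)"
proof -
  have nz: "bern \<phi> (of_nat k + z) \<noteq> 0" for k
  proof -
    have "ereal (Re z) \<le> ereal (Re (of_nat k + z))" by simp
    thus ?thesis by (intro bern_nonzero less_le_trans[OF z])
  qed
  define P where "P n = (\<Prod>k\<in>{0<..n}. bern \<phi> (of_nat k) / bern \<phi> (of_nat k + z))" for n
  define R where "R n = (\<Prod>k\<in>{0<..n}. bern \<phi> (of_nat k) / bern \<phi> (of_nat k + (z - 1)))" for n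
  have "P n * bern \<phi> (of_nat n + z) = bern \<phi> z * R n"
  proof (induction n)
    case (Suc n)
    have i: "{0<..Suc n} = insert (Suc n) {0<..n}" by auto
    have P: "P (Suc n) = bern \<phi> (of_nat (Suc n)) / bern \<phi> (of_nat (Suc n) + z) * P n"
      and R: "R (Suc n) = bern \<phi> (of_nat (Suc n)) / bern \<phi> (of_nat n + z) * R n"
      unfolding P_def R_def i by (subst prod.insert; simp)+
    have "P (Suc n) * bern \<phi> (of_nat (Suc n) + z) = bern \<phi> (of_nat (Suc n)) * P n"
      using nz[of "Suc n"] unfolding P by simp
    also have "\<dots> = bern \<phi> (of_nat (Suc n)) / bern \<phi> (of_nat n + z) * (P n * bern \<phi> (of_nat n + z))"
      using nz[of n] by simp
    also have "\<dots> = bern \<phi> z * R (Suc n)" unfolding Suc.IH R by (simp only: mult_ac)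
    finally show ?case .
  qed (simp add: P_def R_def)
  moreover have "bern \<phi> (of_nat n) powr z / bern \<phi> (of_nat n) = bern \<phi> (of_nat n) powr (z - 1)"
  proof -
    have "bern \<phi> (of_nat n) \<noteq> 0" using n by (intro bern_nonzero') auto
    thus ?thesis by (simp add: powr_diff)
  qed
  moreover have "bern \<phi> (of_nat n) powr z * P n * (bern \<phi> (of_nat n + z) / bern \<phi> (of_nat n)) =
      (bern \<phi> (of_nat n) powr z / bern \<phi> (of_nat n)) * (P n * bern \<phi> (of_nat n + z))"
    by (simp only: times_divide_eq_left times_divide_eq_right mult_ac)
  ultimately have "bern \<phi> (of_nat n) powr z * P n * (bern \<phi> (of_nat n + z) / bern \<phi> (of_nat n)) =
      bern \<phi> z * (bern \<phi> (of_nat n) powr (z - 1) * R n)" by (simp only: mult_ac)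
  thus ?thesis unfolding gauss_tail_def P_def R_def .
qed

text \<open>
  Replacing \<open>z\<close> by \<open>z - 1\<close> shifts the product by one index, at the price
  of the factor \<open>\<phi>(n + z) / \<phi>(n)\<close>, which tends to \<open>1\<close>.
\<close>

lemma BG_rec:
  assumes z: "- a_star_bern \<phi> < ereal (Re z)"
  shows "BG (z + 1) = bern \<phi> z * BG z"
proof -
  have "ereal (Re z) \<le> ereal (Re (z + 1))" by simp
  from less_le_trans[OF z this] have "(\<lambda>n. gauss_tail \<phi> 0 n z) \<longlonglongrightarrow> BG (z + 1)"
    using BG_lim[of "z + 1"] by simp
  hence "(\<lambda>n. gauss_tail \<phi> 0 n z * (bern \<phi> (of_nat n + z) / bern \<phi> (of_nat n))) \<longlonglongrightarrow> BG (z + 1) * 1"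
    by (intro tendsto_mult bern_ratio_tendsto_1)
  moreover have "\<forall>\<^sub>F n in sequentially. gauss_tail \<phi> 0 n z * (bern \<phi> (of_nat n + z) / bern \<phi> (of_nat n)) = bern \<phi> z * gauss_tail \<phi> 0 n (z - 1)"
    using eventually_ge_at_top[of 1] by eventually_elim (rule gauss_tail_shift[OF z])
  ultimately have "(\<lambda>n. bern \<phi> z * gauss_tail \<phi> 0 n (z - 1)) \<longlonglongrightarrow> BG (z + 1)"
    using Lim_transform_eventually by fastforce
  moreover have "(\<lambda>n. bern \<phi> z * gauss_tail \<phi> 0 n (z - 1)) \<longlonglongrightarrow> bern \<phi> z * BG z"
    by (intro tendsto_intros BG_lim z)
  ultimately show ?thesis by (rule LIMSEQ_unique)
qed

end


section \<open>Laws given by products, masses and moments\<close>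

lemma has_laplace_return: "has_laplace (return borel a) z (exp (- z * complex_of_real a))"
  by (auto simp: has_laplace_def has_bochner_integral_iff integrable_iff_bounded nn_integral_return integral_return)

lemma real_distribution_return: "real_distribution (return borel a)"
  by (auto simp: real_distribution_def real_distribution_axioms_def prob_space_return)

lemma laplace_prod:
  assumes "\<And>k. 1 \<le> k \<Longrightarrow> \<exists>\<mu>. real_distribution \<mu> \<and> (\<forall>z\<in>S. has_laplace \<mu> z (f k z))"
  shows "\<exists>\<mu>. real_distribution \<mu> \<and> (\<forall>z\<in>S. has_laplace \<mu> z (\<Prod>k\<in>{0<..n::nat}. f k z))"
proof (induction n)
  case 0
  show ?case using has_laplace_return[of 0] real_distribution_return[of 0] by auto
next
  case (Suc n)
  then obtain \<mu> where \<mu>: "real_distribution \<mu>" "\<And>z. z \<in> S \<Longrightarrow> has_laplace \<mu> z (\<Prod>k\<in>{0<..n}. f k z)" by blast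
  obtain \<nu> where \<nu>: "real_distribution \<nu>" "\<And>z. z \<in> S \<Longrightarrow> has_laplace \<nu> z (f (Suc n) z)"
    using assms[of "Suc n"] by auto
  obtain \<rho> where \<rho>: "real_distribution \<rho>" "\<And>z v w. has_laplace \<nu> z v \<Longrightarrow> has_laplace \<mu> z w \<Longrightarrow> has_laplace \<rho> z (v * w)"
    using real_distribution_convolution[OF \<nu>(1) \<mu>(1)] by blast
  have i: "{0<..Suc n} = insert (Suc n) {0<..n}" by auto
  show ?case
  proof (intro exI[of _ \<rho>] conjI ballI \<rho>(1))
    fix z assume z: "z \<in> S"
    from \<rho>(2)[OF \<nu>(2)[OF z] \<mu>(2)[OF z]]
    show "has_laplace \<rho> z (\<Prod>k\<in>{0<..Suc n}. f k z)" unfolding i by (subst prod.insert) auto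
  qed
qed

text \<open>
  The value of the transform at \<open>0\<close> is the total mass.
\<close>

lemma has_laplace_normalize:
  assumes "sets \<rho> = sets borel" and A: "has_laplace \<rho> 0 (complex_of_real A)" "0 < A"
  shows "\<exists>\<mu>. real_distribution \<mu> \<and> (\<forall>z v. has_laplace \<rho> z v \<longrightarrow> has_laplace \<mu> z (v / complex_of_real A))"
proof (intro exI[of _ "density \<rho> (\<lambda>_. ennreal (1 / A))"] conjI allI impI)
  have "has_bochner_integral \<rho> (\<lambda>y. 1 :: real) A"
    using has_laplace_real[of \<rho> 0 "complex_of_real A"] A by simp
  hence "(\<integral>\<^sup>+y. ennreal 1 \<partial>\<rho>) = ennreal A"
    using nn_integral_eq_integral[of \<rho> "\<lambda>_. 1"] by (simp add: has_bochner_integral_iff)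
  hence e: "emeasure \<rho> (space \<rho>) = ennreal A" by simp
  show "real_distribution (density \<rho> (\<lambda>_. ennreal (1 / A)))"
  proof (intro real_distribution.intro real_distribution_axioms.intro prob_spaceI)
    have "emeasure (density \<rho> (\<lambda>_. ennreal (1 / A))) (space \<rho>) = ennreal (1 / A) * ennreal A"
      by (subst emeasure_density) (auto simp: nn_integral_cmult_indicator e)
    also have "\<dots> = 1" using A(2) by (simp flip: ennreal_mult'')
    finally show "emeasure (density \<rho> (\<lambda>_. ennreal (1 / A))) (space (density \<rho> (\<lambda>_. ennreal (1 / A)))) = 1" by simp
  qed (use assms in simp)
  fix z v assume "has_laplace \<rho> z v"
  thus "has_laplace (density \<rho> (\<lambda>_. ennreal (1 / A))) z (v / complex_of_real A)"
    using A(2) unfolding has_laplace_def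
    by (auto simp: has_bochner_integral_iff integrable_density integral_density scaleR_conv_of_real divide_inverse)
qed

text \<open>
  The moment bound makes the exponential series converge in \<open>L\<^sup>1\<close> on a disc. In
  particular the exponential moments of order less than \<open>1 / C\<close> are finite, and they
  dominate the integrand on the whole half-plane.
\<close>

lemma laplace_transform_of_moments:
  fixes \<nu> :: "real measure" and C :: real
  assumes \<nu>: "real_distribution \<nu>" and pos: "AE y in \<nu>. 0 \<le> y"
    and mom: "\<And>n. has_bochner_integral \<nu> (\<lambda>y. y ^ n) (m n)"
    and C: "0 < C" and bnd: "\<And>n. m n \<le> C ^ n * fact n"
  defines "h \<equiv> (\<lambda>z. \<integral>y. exp (- z * complex_of_real y) \<partial>\<nu>)"
  shows "h holomorphic_on {z. - (1 / C) < Re z}"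
    and "\<And>z. norm z < 1 / C \<Longrightarrow> h z = (\<Sum>n. (- z) ^ n / fact n * complex_of_real (m n))"
proof -
  interpret real_distribution \<nu> by fact
  have ser: "integrable \<nu> (\<lambda>y. exp (- z * complex_of_real y)) \<and> h z = (\<Sum>n. (- z) ^ n / fact n * complex_of_real (m n))"
    if z: "norm z < 1 / C" for z
  proof -
    define f where "f n y = (- z) ^ n / fact n * complex_of_real (y ^ n)" for n y
    have hf: "has_bochner_integral \<nu> (f n) ((- z) ^ n / fact n * complex_of_real (m n))" for n
      unfolding f_def by (intro has_bochner_integral_mult_right has_bochner_integral_of_real mom)
    hence fi: "integrable \<nu> (f n)" for n by (auto simp: has_bochner_integral_iff)
    have nf: "norm (f n y) = norm z ^ n / fact n * \<bar>y\<bar> ^ n" for n y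
      by (simp add: f_def norm_mult norm_divide norm_power power_abs)
    have e: "(\<lambda>n. f n y) sums exp (- z * complex_of_real y)" for y
    proof -
      have "(\<lambda>n. (- z * complex_of_real y) ^ n /\<^sub>R fact n) sums exp (- z * complex_of_real y)" by (rule exp_converges)
      also have "(\<lambda>n. (- z * complex_of_real y) ^ n /\<^sub>R fact n) = (\<lambda>n. f n y)"
        by (simp add: f_def fun_eq_iff scaleR_conv_of_real divide_inverse flip: power_mult_distrib)
      finally show ?thesis .
    qed
    have sn: "summable (\<lambda>n. norm (f n y))" for y
    proof -
      have "summable (\<lambda>n. (norm z * \<bar>y\<bar>) ^ n /\<^sub>R fact n)" by (rule summable_exp_generic)
      thus ?thesis by (simp add: nf power_mult_distrib divide_inverse mult_ac)
    qed
    have "(\<integral>y. norm (f n y) \<partial>\<nu>) = norm z ^ n / fact n * m n" for n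
    proof -
      have "(\<integral>y. norm (f n y) \<partial>\<nu>) = (\<integral>y. norm z ^ n / fact n * y ^ n \<partial>\<nu>)"
        unfolding nf
      proof (rule integral_cong_AE)
        show "AE y in \<nu>. norm z ^ n / fact n * \<bar>y\<bar> ^ n = norm z ^ n / fact n * y ^ n"
          using pos by eventually_elim simp
      qed auto
      thus ?thesis using mom[of n] by (simp add: has_bochner_integral_iff)
    qed
    hence le: "norm (\<integral>y. norm (f n y) \<partial>\<nu>) \<le> (norm z * C) ^ n" for n
    proof -
      have "norm z ^ n / fact n * m n \<le> norm z ^ n / fact n * (C ^ n * fact n)"
        by (intro mult_left_mono bnd) auto
      moreover have "0 \<le> (\<integral>y. norm (f n y) \<partial>\<nu>)" by simp
      ultimately show ?thesis using \<open>(\<integral>y. norm (f n y) \<partial>\<nu>) = _\<close> by (simp add: power_mult_distrib)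
    qed
    have si: "summable (\<lambda>n. \<integral>y. norm (f n y) \<partial>\<nu>)"
      by (rule summable_comparison_test'[OF summable_geometric[of "norm z * C"]])
         (use z C le in \<open>auto simp: field_simps\<close>)
    have "(\<lambda>y. \<Sum>n. f n y) = (\<lambda>y. exp (- z * complex_of_real y))" by (simp add: fun_eq_iff sums_unique[OF e, symmetric])
    moreover have "integrable \<nu> (\<lambda>y. \<Sum>n. f n y)" "(\<integral>y. (\<Sum>n. f n y) \<partial>\<nu>) = (\<Sum>n. integral\<^sup>L \<nu> (f n))"
      using integrable_suminf[OF fi _ si] integral_suminf[OF fi _ si] sn by auto
    moreover have "integral\<^sup>L \<nu> (f n) = (- z) ^ n / fact n * complex_of_real (m n)" for n
      using hf[of n] by (simp add: has_bochner_integral_iff)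
    ultimately show ?thesis unfolding h_def by simp
  qed
  show "\<And>z. norm z < 1 / C \<Longrightarrow> h z = (\<Sum>n. (- z) ^ n / fact n * complex_of_real (m n))" using ser by blast
  have er: "integrable \<nu> (\<lambda>y. exp (s * y))" if "0 \<le> s" "s < 1 / C" for s
  proof -
    have "integrable \<nu> (\<lambda>y. exp (- complex_of_real (- s) * complex_of_real y))"
      using ser[of "complex_of_real (- s)"] that by simp
    from integrable_norm[OF this] show ?thesis by simp
  qed
  show "h holomorphic_on {z. - (1 / C) < Re z}"
    unfolding h_def
  proof (rule holomorphic_on_integral)
    fix z :: complex assume z: "z \<in> {z. - (1 / C) < Re z}"
    define r where "r = (Re z + 1 / C) / 2"
    have r: "r > 0" using z by (simp add: r_def)
    have "0 < 1 / C" using C by simp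
    moreover have "r - Re z < 1 / C"
    proof -
      have "(Re z + e) / 2 - Re z < e" if "- e < Re z" for e using that by (simp add: field_simps)
      thus ?thesis unfolding r_def using z by simp
    qed
    ultimately have s': "0 \<le> max 0 (r - Re z)" "max 0 (r - Re z) < 1 / C" by auto
    have w: "- max 0 (r - Re z) \<le> Re w" if "w \<in> cball z r" for w
    proof -
      have "\<bar>Re z - Re w\<bar> \<le> r" using abs_Re_le_cmod[of "z - w"] that by (simp add: dist_norm)
      thus ?thesis by linarith
    qed
    have "AE y in \<nu>. \<forall>w\<in>cball z r. norm (exp (- w * complex_of_real y)) \<le> exp (max 0 (r - Re z) * y)"
      using pos
    proof eventually_elim
      case (elim y)
      show ?case
      proof
        fix v assume "v \<in> cball z r"
        from mult_right_mono[OF w[OF this] elim] show "norm (exp (- v * complex_of_real y)) \<le> exp (max 0 (r - Re z) * y)"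
          by simp
      qed
    qed
    moreover have "cball z r \<subseteq> {z. - (1 / C) < Re z}" 
    proof
      fix v assume "v \<in> cball z r"
      thus "v \<in> {z. - (1 / C) < Re z}" unfolding mem_Collect_eq using w[of v] s' by linarith
    qed
    ultimately show "\<exists>r>0. \<exists>B. cball z r \<subseteq> {z. - (1 / C) < Re z} \<and> integrable \<nu> B \<and>
        (AE y in \<nu>. \<forall>w\<in>cball z r. norm (exp (- w * complex_of_real y)) \<le> B y)"
      using r er[OF s'] by blast
  qed (auto intro!: holomorphic_intros open_halfspace_Re_gt)
qed

text \<open>
  Both Laplace transforms have the same Taylor series on a disc, and they are holomorphic on a
  half-plane that contains the imaginary axis; so the characteristic functions agree.
\<close>

lemma moment_determinate:
  fixes \<mu> \<nu> :: "real measure"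
  assumes \<mu>: "real_distribution \<mu>" "AE y in \<mu>. 0 \<le> y" "\<And>n. has_bochner_integral \<mu> (\<lambda>y. y ^ n) (m n)"
    and \<nu>: "real_distribution \<nu>" "AE y in \<nu>. 0 \<le> y" "\<And>n. has_bochner_integral \<nu> (\<lambda>y. y ^ n) (m n)"
    and C: "0 < C" "\<And>n. m n \<le> C ^ n * fact n"
  shows "\<mu> = \<nu>"
proof (rule Levy_uniqueness[OF \<mu>(1) \<nu>(1)])
  note 1 = laplace_transform_of_moments[OF \<mu> C] and 2 = laplace_transform_of_moments[OF \<nu> C]
  have eq: "(\<integral>y. exp (- z * complex_of_real y) \<partial>\<mu>) = (\<integral>y. exp (- z * complex_of_real y) \<partial>\<nu>)"
    if "- (1 / C) < Re z" for z
  proof (rule analytic_continuation_open[OF _ _ _ _ _ 1(1) 2(1)])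
    show "ball 0 (1 / C) \<subseteq> {z. - (1 / C) < Re z}"
    proof
      fix w :: complex assume "w \<in> ball 0 (1 / C)"
      thus "w \<in> {z. - (1 / C) < Re z}" using abs_Re_le_cmod[of w] by auto
    qed
    show "(\<integral>y. exp (- z * complex_of_real y) \<partial>\<mu>) = (\<integral>y. exp (- z * complex_of_real y) \<partial>\<nu>)" if "z \<in> ball 0 (1 / C)" for z
      using 1(2)[of z] 2(2)[of z] that by simp
    show "connected {z. - (1 / C) < Re z}" by (intro convex_connected convex_halfspace_Re_gt)
  qed (use C that in \<open>auto intro: open_halfspace_Re_gt\<close>)
  show "char \<mu> = char \<nu>"
  proof
    fix t show "char \<mu> t = char \<nu> t"
      unfolding char_def using eq[of "- \<i> * complex_of_real t"] C by (simp add: mult_ac)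
  qed
qed

context bernstein_function
begin

section \<open>The Bernstein-gamma function\<close>

text \<open>
  The function \<open>\<Phi>\<close> approximates \<open>z \<mapsto> \<phi>(k + z)\<close>: only
  jumps longer than \<open>1 / n\<close> are kept, and the drift is replaced by jumps of size
  \<open>1 / n\<close> at rate \<open>b\<close>. The jumps now form a finite measure. With
  \<open>\<psi>\<close> the transform of the normalised jump law, in which the kept jumps carry the
  weight \<open>exp (- k y)\<close>, the quotient is \<open>(1 - p) / (1 - p \<psi>)\<close>, a
  geometric compound. The unit added to \<open>drift * n\<close> keeps the rate positive in every
  case and has no effect in the limit \<open>n \<longlonglongrightarrow> \<infinity>\<close>.
\<close>

lemma laplace_inverse_bern_aux:
  fixes n k :: nat
  assumes n: "n \<ge> 1" and k: "k \<ge> 1"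
  defines "\<alpha> \<equiv> (\<lambda>z. \<integral>y. indicator {1 / real n<..} y *\<^sub>R exp (- (of_nat k + z) * complex_of_real y) \<partial>levy \<phi>)"
  defines "b \<equiv> drift \<phi> * real n + 1"
  defines "\<Phi> \<equiv> (\<lambda>z. bern \<phi> (of_nat k) + \<alpha> 0 - \<alpha> z + complex_of_real b * (1 - exp (- z / of_nat n)))"
  assumes x0: "x0 < 0" "bern_finite \<phi> (complex_of_real (real k + x0))" "0 < Re (\<Phi> (complex_of_real x0))"
  shows "\<exists>\<nu>. real_distribution \<nu> \<and> (\<forall>z x. x < Re z \<longrightarrow> bern_finite \<phi> (complex_of_real (real k + x)) \<longrightarrow>
     0 < Re (\<Phi> (complex_of_real x)) \<longrightarrow> has_laplace \<nu> z (bern \<phi> (of_nat k) / \<Phi> z))"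
proof -
  define c where "c = \<phi>\<^sub>r (real k)"
  have c: "c > 0" "bern \<phi> (of_nat k) = complex_of_real c" using k bern_of_nat by (auto simp: c_def phi_r_pos')
  have b: "b > 0" using drift_nonneg by (simp add: b_def add_nonneg_pos)
  have fin: "bern_finite \<phi> (of_nat k + z)" if "bern_finite \<phi> (complex_of_real (real k + x))" "x \<le> Re z" for x z
  proof (cases "real k + x < 0")
    case True
    have "bern_finite \<phi> (complex_of_real (- (- (real k + x))))" using that(1) by (simp only: minus_minus)
    thus ?thesis by (rule bern_finite_mono) (use that(2) True in auto)
  next
    case False
    thus ?thesis using that by (intro bern_finite_Re_nonneg) simp
  qed
  have \<alpha>i: "integrable (levy \<phi>) (\<lambda>y. indicator {1 / real n<..} y *\<^sub>R exp (- (of_nat k + z) * complex_of_real y))"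
    if "bern_finite \<phi> (of_nat k + z)" for z
    by (rule integrable_levy_tail_exp[OF n that])
  \<comment> \<open>The kept jumps, tilted so that the total mass is finite and k is absorbed.\<close>
  define \<rho> where "\<rho> = density (levy \<phi>) (\<lambda>y. ennreal (indicator {1 / real n<..} y * exp (- real k * y)))"
  have s\<rho>: "sets \<rho> = sets borel" by (simp add: \<rho>_def sets_levy)
  have lap: "has_laplace \<rho> z (\<alpha> z)" if "bern_finite \<phi> (of_nat k + z)" for z
  proof -
    have e: "(\<lambda>y. (indicator {1 / real n<..} y * exp (- real k * y)) *\<^sub>R exp (- z * complex_of_real y)) =
       (\<lambda>y. indicator {1 / real n<..} y *\<^sub>R exp (- (of_nat k + z) * complex_of_real y))"
      by (auto simp: fun_eq_iff indicator_def scaleR_conv_of_real exp_of_real[symmetric] exp_add[symmetric] algebra_simps)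
    show ?thesis
      using \<alpha>i[OF that] unfolding has_laplace_def \<rho>_def has_bochner_integral_iff \<alpha>_def e[symmetric]
      by (subst integrable_density integral_density; simp)+
  qed
  have \<alpha>r: "\<alpha> (complex_of_real x) = complex_of_real (Re (\<alpha> (complex_of_real x)))" "0 \<le> Re (\<alpha> (complex_of_real x))" for x
  proof -
    have "\<alpha> (complex_of_real x) = (\<integral>y. complex_of_real (indicator {1 / real n<..} y * exp (- (real k + x) * y)) \<partial>levy \<phi>)"
      unfolding \<alpha>_def by (intro Bochner_Integration.integral_cong refl) (simp add: scaleR_conv_of_real exp_of_real[symmetric])
    also have "\<dots> = complex_of_real (\<integral>y. indicator {1 / real n<..} y * exp (- (real k + x) * y) \<partial>levy \<phi>)"
      by (rule integral_complex_of_real)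
    finally have eq: "\<alpha> (complex_of_real x) = complex_of_real (\<integral>y. indicator {1 / real n<..} y * exp (- (real k + x) * y) \<partial>levy \<phi>)" .
    show "\<alpha> (complex_of_real x) = complex_of_real (Re (\<alpha> (complex_of_real x)))" "0 \<le> Re (\<alpha> (complex_of_real x))"
      unfolding eq by (auto intro!: Bochner_Integration.integral_nonneg)
  qed
  define A where "A = Re (\<alpha> 0)"
  have A: "\<alpha> 0 = complex_of_real A" "A \<ge> 0" using \<alpha>r[of 0] by (auto simp: A_def)
  have f0: "bern_finite \<phi> (of_nat k + 0)" by (rule bern_finite_Re_nonneg) simp
  define \<psi> where "\<psi> z = (\<alpha> z + complex_of_real b * exp (- z / of_nat n)) / complex_of_real (A + b)" for z
  obtain \<mu> where \<mu>: "real_distribution \<mu>" "\<And>z. bern_finite \<phi> (of_nat k + z) \<Longrightarrow> has_laplace \<mu> z (\<psi> z)"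
  proof (cases "A = 0")
    case True
    have z0: "\<alpha> z = 0" if "bern_finite \<phi> (of_nat k + z)" for z
    proof -
      have "has_bochner_integral \<rho> (\<lambda>y. 1 :: real) 0"
        using has_laplace_real[of \<rho> 0 "\<alpha> 0"] lap[OF f0] A True by simp
      hence "AE y in \<rho>. (1::real) = 0" by (subst integral_nonneg_eq_0_iff_AE[symmetric]) (auto simp: has_bochner_integral_iff)
      hence "(\<integral>y. exp (- z * complex_of_real y) \<partial>\<rho>) = (\<integral>y. 0 \<partial>\<rho>)"
        by (intro integral_cong_AE) (auto simp: s\<rho> cong: measurable_cong_sets)
      thus ?thesis using lap[OF that] by (simp add: has_laplace_def has_bochner_integral_iff)
    qed
    have "has_laplace (return borel (1 / real n)) z (\<psi> z)" if "bern_finite \<phi> (of_nat k + z)" for z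
      using has_laplace_return[of "1 / real n" z] b unfolding \<psi>_def z0[OF that] True by simp
    thus ?thesis using that real_distribution_return by blast
  next
    case False
    hence A0: "A > 0" using A by simp
    have "has_laplace \<rho> 0 (complex_of_real A)" using lap[OF f0] A by simp
    from has_laplace_normalize[OF s\<rho> this A0] obtain \<mu>1 where
      \<mu>1: "real_distribution \<mu>1" "\<And>z v. has_laplace \<rho> z v \<Longrightarrow> has_laplace \<mu>1 z (v / complex_of_real A)" by blast
    define p where "p = A / (A + b)"
    have p: "0 \<le> p" "p \<le> 1" using A0 b by (auto simp: p_def)
    from real_distribution_mixture[OF \<mu>1(1) real_distribution_return[of "1 / real n"] p] obtain \<mu>2 where
      \<mu>2: "real_distribution \<mu>2" "\<And>z v w. has_laplace \<mu>1 z v \<Longrightarrow> has_laplace (return borel (1 / real n)) z w \<Longrightarrow>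
         has_laplace \<mu>2 z (complex_of_real p * v + complex_of_real (1 - p) * w)" by blast
    have "has_laplace \<mu>2 z (\<psi> z)" if "bern_finite \<phi> (of_nat k + z)" for z
    proof -
      have "1 - p = b / (A + b)" using A0 b by (simp add: p_def field_simps)
      hence "complex_of_real p * (\<alpha> z / complex_of_real A) + complex_of_real (1 - p) * exp (- z * complex_of_real (1 / real n)) = \<psi> z"
        using A0 b by (simp add: p_def \<psi>_def add_divide_distrib)
      thus ?thesis using \<mu>2(2)[OF \<mu>1(2)[OF lap[OF that]] has_laplace_return] by metis
    qed
    thus ?thesis using that \<mu>2(1) by blast
  qed
  \<comment> \<open>With this p, the denominator 1 - p \<psi> is \<Phi> divided by its constant part c + A + b.\<close>
  define p where "p = (A + b) / (c + A + b)"
  have p: "0 \<le> p" "p \<le> 1" using A b c by (auto simp: p_def)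
  \<comment> \<open>Positivity at the real point x bounds p \<psi> by a number below 1 on the half-plane to the right of x.\<close>
  define T where "T = \<Union> {{x<..} |x. bern_finite \<phi> (complex_of_real (real k + x)) \<and> 0 < Re (\<Phi> (complex_of_real x))}"
  have T: "open T" "0 \<in> T" using x0 by (auto simp: T_def intro!: open_Union)
  have \<Phi>eq: "complex_of_real (1 - p) / (1 - complex_of_real p * \<psi> z) = bern \<phi> (of_nat k) / \<Phi> z" for z
  proof -
    have d: "complex_of_real (c + A + b) \<noteq> 0" "complex_of_real (A + b) \<noteq> 0"
      unfolding of_real_eq_0_iff using A b c by auto
    have 1: "complex_of_real (1 - p) = complex_of_real c / complex_of_real (c + A + b)"
    proof -
      have "1 - p = c / (c + A + b)" using A b c by (simp add: p_def field_simps)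
      thus ?thesis by simp
    qed
    have 2: "1 - complex_of_real p * \<psi> z = \<Phi> z / complex_of_real (c + A + b)"
    proof -
      have "complex_of_real p * \<psi> z = (\<alpha> z + complex_of_real b * exp (- z / of_nat n)) / complex_of_real (c + A + b)"
        using d by (simp add: p_def \<psi>_def)
      moreover have "1 = complex_of_real (c + A + b) / complex_of_real (c + A + b)" using d(1) by simp
      ultimately have "1 - complex_of_real p * \<psi> z = (complex_of_real (c + A + b) - (\<alpha> z + complex_of_real b * exp (- z / of_nat n))) / complex_of_real (c + A + b)"
        by (simp only: diff_divide_distrib)
      also have "complex_of_real (c + A + b) - (\<alpha> z + complex_of_real b * exp (- z / of_nat n)) = \<Phi> z"
        unfolding \<Phi>_def c A by (simp add: algebra_simps)
      finally show ?thesis .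
    qed
    show ?thesis unfolding 1 2 c(2) using d by simp
  qed
  have "\<exists>\<nu>. real_distribution \<nu> \<and> (\<forall>z. Re z \<in> T \<longrightarrow> has_laplace \<nu> z (complex_of_real (1 - p) / (1 - complex_of_real p * \<psi> z)))"
  proof (rule laplace_geometric[OF T \<mu>(1) p])
    fix z assume "Re z \<in> T"
    then obtain x where x: "x < Re z" "bern_finite \<phi> (complex_of_real (real k + x))" "0 < Re (\<Phi> (complex_of_real x))"
      by (auto simp: T_def)
    have fz: "bern_finite \<phi> (of_nat k + z)" and fx: "bern_finite \<phi> (of_nat k + complex_of_real x)"
      using fin[OF x(2)] x(1) by auto
    show lz: "has_laplace \<mu> z (\<psi> z)" by (rule \<mu>(2)[OF fz])
    have nn: "norm (\<alpha> z) \<le> Re (\<alpha> (complex_of_real x))"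
    proof -
      have "norm (\<alpha> z) \<le> (\<integral>y. Re (indicator {1 / real n<..} y *\<^sub>R exp (- (of_nat k + complex_of_real x) * complex_of_real y)) \<partial>levy \<phi>)"
        unfolding \<alpha>_def
      proof (rule order_trans[OF integral_norm_bound integral_mono_AE])
        show "AE y in levy \<phi>. norm (indicator {1 / real n<..} y *\<^sub>R exp (- (of_nat k + z) * complex_of_real y)) \<le>
            Re (indicator {1 / real n<..} y *\<^sub>R exp (- (of_nat k + complex_of_real x) * complex_of_real y))"
          using AE_levy_pos
        proof eventually_elim
          case (elim y)
          have "norm (exp (- (of_nat k + z) * complex_of_real y)) \<le> exp (- (real k + x) * y)"
            using elim x(1) by (simp add: mult_right_mono algebra_simps)
          also have "exp (- (real k + x) * y) = Re (exp (- (of_nat k + complex_of_real x) * complex_of_real y))"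
          proof -
            have "- (of_nat k + complex_of_real x) * complex_of_real y = complex_of_real (- (real k + x) * y)" by simp
            thus ?thesis by (simp only: exp_of_real Re_complex_of_real)
          qed
          finally show ?case by (auto simp: indicator_def)
        qed
      qed (intro integrable_norm integrable_Re \<alpha>i fz fx)+
      also have "\<dots> = Re (\<alpha> (complex_of_real x))" unfolding \<alpha>_def by (rule integral_Re[OF \<alpha>i[OF fx]])
      finally show ?thesis .
    qed
    have "norm (exp (- z / of_nat n)) \<le> exp (- x / real n)"
      using x(1) n by (simp add: divide_right_mono)
    hence "norm (\<alpha> z + complex_of_real b * exp (- z / of_nat n)) \<le> Re (\<alpha> (complex_of_real x)) + b * exp (- x / real n)"
      using b nn by (intro order_trans[OF norm_triangle_ineq] add_mono) (auto simp: norm_mult simp del: norm_exp_eq_Re)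
    also have "\<dots> < c + A + b"
    proof -
      have "exp (- complex_of_real x / of_nat n) = complex_of_real (exp (- x / real n))" by (simp flip: exp_of_real)
      hence "Re (\<Phi> (complex_of_real x)) = c + A - Re (\<alpha> (complex_of_real x)) + b * (1 - exp (- x / real n))"
        unfolding \<Phi>_def c A by simp
      thus ?thesis using x(3) by (simp add: algebra_simps)
    qed
    finally have "norm (\<alpha> z + complex_of_real b * exp (- z / of_nat n)) / (c + A + b) < 1" using A b c by simp
    moreover have "norm (complex_of_real p * \<psi> z) = norm (\<alpha> z + complex_of_real b * exp (- z / of_nat n)) / (c + A + b)"
      unfolding p_def \<psi>_def norm_mult norm_divide norm_of_real using A b c by (simp add: abs_of_pos)
    ultimately show "norm (complex_of_real p * \<psi> z) < 1" by simp
  qed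
  thus ?thesis unfolding \<Phi>eq by (auto simp: T_def)
qed

end


lemma compound_exp_tendsto: "(\<lambda>n. of_nat (Suc n) * (1 - exp (- z / of_nat (Suc n)))) \<longlonglongrightarrow> (z :: complex)"
proof -
  have "((\<lambda>h. 1 - exp (- z * h)) has_field_derivative z) (at 0)"
    by (auto intro!: derivative_eq_intros)
  hence "((\<lambda>h. (1 - exp (- z * h)) / h) \<longlongrightarrow> z) (at 0)"
    by (simp add: has_field_derivative_iff)
  moreover have "(\<lambda>n. 1 / of_nat (Suc n) :: complex) \<longlonglongrightarrow> 0"
    by (rule LIMSEQ_Suc[OF lim_1_over_n])
  hence "filterlim (\<lambda>n. 1 / of_nat (Suc n) :: complex) (at 0) sequentially"
    unfolding filterlim_at by (auto simp del: of_nat_Suc)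
  ultimately have "(\<lambda>n. (1 - exp (- z * (1 / of_nat (Suc n)))) / (1 / of_nat (Suc n))) \<longlonglongrightarrow> z"
    by (rule filterlim_compose)
  thus ?thesis by (simp add: mult.commute del: of_nat_Suc)
qed

context bernstein_function
begin

lemma open_a_star: "open {x. - a_star_bern \<phi> < ereal (x + c)}"
  by (rule open_Collect_less) (auto intro!: continuous_intros continuous_on_ereal)

lemma bern_finite_a_star: "- a_star_bern \<phi> < ereal (Re z) \<Longrightarrow> bern_finite \<phi> z"
  using a_star_witness[of "Re z"] bern_finite_mono by (metis less_imp_le)

text \<open>
  Let the approximations by compound laws become finer. A given approximation is a Laplace transform
  only where it is positive; positivity at \<open>- 1 / 2\<close>, which provides a neighbourhood of
  \<open>0\<close>, and positivity near any other point of the half-plane both hold eventually.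
\<close>

lemma laplace_inverse_bern:
  assumes k: "k \<ge> (1::nat)"
  shows "\<exists>\<mu>. real_distribution \<mu> \<and> (\<forall>z. - a_star_bern \<phi> < ereal (Re z + real k) \<longrightarrow>
      has_laplace \<mu> z (bern \<phi> (of_nat k) / bern \<phi> (of_nat k + z)))"
proof -
  define \<alpha> where "\<alpha> n z = (\<integral>y. indicator {1 / real n<..} y *\<^sub>R exp (- (of_nat k + z) * complex_of_real y) \<partial>levy \<phi>)" for n :: nat and z
  define \<Phi> where "\<Phi> n z = bern \<phi> (of_nat k) + \<alpha> n 0 - \<alpha> n z + complex_of_real (drift \<phi> * real n + 1) * (1 - exp (- z / of_nat n))" for n z
  have lim: "(\<lambda>m. \<Phi> (Suc m) z) \<longlonglongrightarrow> bern \<phi> (of_nat k + z)" if z: "bern_finite \<phi> (of_nat k + z)" for z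
  proof -
    have fk: "bern_finite \<phi> (of_nat k)" by (rule bern_finite_Re_nonneg) simp
    define D where "D y = exp (- of_nat k * complex_of_real y) - exp (- (of_nat k + z) * complex_of_real y)" for y
    have De: "D = (\<lambda>y. (1 - exp (- (of_nat k + z) * complex_of_real y)) - (1 - exp (- of_nat k * complex_of_real y)))"
      by (simp add: D_def fun_eq_iff)
    have Di: "integrable (levy \<phi>) D" "(\<integral>y. D y \<partial>levy \<phi>) = (\<integral>y. (1 - exp (- (of_nat k + z) * complex_of_real y)) \<partial>levy \<phi>) - (\<integral>y. (1 - exp (- of_nat k * complex_of_real y)) \<partial>levy \<phi>)"
      unfolding De by (rule Bochner_Integration.integrable_diff[OF z[unfolded bern_finite_def] fk[unfolded bern_finite_def]])
        (rule Bochner_Integration.integral_diff[OF z[unfolded bern_finite_def] fk[unfolded bern_finite_def]])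
    have \<alpha>i: "integrable (levy \<phi>) (\<lambda>y. indicator {1 / real n<..} y *\<^sub>R exp (- (of_nat k + z) * complex_of_real y))"
      if n: "n \<ge> 1" and "bern_finite \<phi> (of_nat k + z)" for z n
      by (rule integrable_levy_tail_exp[OF that])
    have "(\<lambda>m. \<integral>y. indicator {1 / real (Suc m)<..} y *\<^sub>R D y \<partial>levy \<phi>) \<longlonglongrightarrow> (\<integral>y. D y \<partial>levy \<phi>)"
    proof (rule integral_dominated_convergence[where w="\<lambda>y. norm (D y)"])
      show "AE y in levy \<phi>. (\<lambda>m. indicator {1 / real (Suc m)<..} y *\<^sub>R D y) \<longlonglongrightarrow> D y"
        using AE_levy_pos
      proof eventually_elim
        case (elim y)
        have "(\<lambda>m. 1 / real (Suc m)) \<longlonglongrightarrow> 0"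
          using LIMSEQ_inverse_real_of_nat by (simp add: divide_inverse)
        hence "\<forall>\<^sub>F m in sequentially. 1 / real (Suc m) < y" using elim by (rule order_tendstoD)
        hence "\<forall>\<^sub>F m in sequentially. indicator {1 / real (Suc m)<..} y *\<^sub>R D y = D y"
          by eventually_elim simp
        thus ?case by (rule tendsto_eventually)
      qed
    qed (use Di in \<open>auto simp: indicator_def\<close>)
    moreover have "(\<integral>y. indicator {1 / real (Suc m)<..} y *\<^sub>R D y \<partial>levy \<phi>) = \<alpha> (Suc m) 0 - \<alpha> (Suc m) z" for m
    proof -
      have f0: "bern_finite \<phi> (of_nat k + 0)" using fk by simp
      have "(\<lambda>y. indicator {1 / real (Suc m)<..} y *\<^sub>R D y) = (\<lambda>y. indicator {1 / real (Suc m)<..} y *\<^sub>R exp (- (of_nat k + 0) * complex_of_real y) - indicator {1 / real (Suc m)<..} y *\<^sub>R exp (- (of_nat k + z) * complex_of_real y))"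
        by (simp add: D_def fun_eq_iff scaleR_diff_right)
      thus ?thesis unfolding \<alpha>_def
        using Bochner_Integration.integral_diff[OF \<alpha>i[OF _ f0, of "Suc m"] \<alpha>i[OF _ z, of "Suc m"]] by simp
    qed
    ultimately have 1: "(\<lambda>m. \<alpha> (Suc m) 0 - \<alpha> (Suc m) z) \<longlonglongrightarrow> (\<integral>y. D y \<partial>levy \<phi>)" by simp
    have "(\<lambda>m. complex_of_real (drift \<phi>) * (of_nat (Suc m) * (1 - exp (- z / of_nat (Suc m)))) + (1 / of_nat (Suc m)) * (of_nat (Suc m) * (1 - exp (- z / of_nat (Suc m))))) \<longlonglongrightarrow> complex_of_real (drift \<phi>) * z + 0 * z"
    proof (intro tendsto_add tendsto_mult tendsto_const compound_exp_tendsto)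
      show "(\<lambda>n. 1 / of_nat (Suc n) :: complex) \<longlonglongrightarrow> 0"
        by (rule LIMSEQ_Suc[OF lim_1_over_n])
    qed
    moreover have "complex_of_real (drift \<phi>) * (of_nat (Suc m) * (1 - exp (- z / of_nat (Suc m)))) + (1 / of_nat (Suc m)) * (of_nat (Suc m) * (1 - exp (- z / of_nat (Suc m))))
       = complex_of_real (drift \<phi> * real (Suc m) + 1) * (1 - exp (- z / of_nat (Suc m)))" for m
      by (simp add: distrib_right del: of_nat_Suc)
    ultimately have 2: "(\<lambda>m. complex_of_real (drift \<phi> * real (Suc m) + 1) * (1 - exp (- z / of_nat (Suc m)))) \<longlonglongrightarrow> complex_of_real (drift \<phi>) * z"
      by simp
    have "(\<lambda>m. bern \<phi> (of_nat k) + (\<alpha> (Suc m) 0 - \<alpha> (Suc m) z) + complex_of_real (drift \<phi> * real (Suc m) + 1) * (1 - exp (- z / of_nat (Suc m)))) \<longlonglongrightarrow>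
      bern \<phi> (of_nat k) + (\<integral>y. D y \<partial>levy \<phi>) + complex_of_real (drift \<phi>) * z"
      by (intro tendsto_add tendsto_const 1 2)
    also have "bern \<phi> (of_nat k) + (\<integral>y. D y \<partial>levy \<phi>) + complex_of_real (drift \<phi>) * z = bern \<phi> (of_nat k + z)"
      unfolding Di(2) bern_def by (simp add: algebra_simps)
    finally show ?thesis unfolding \<Phi>_def by (simp add: add_diff_eq)
  qed
  \<comment> \<open>From k \<ge> 1 the point k - 1/2 lies in the right half-plane, where \<phi> is positive.\<close>
  define good where "good m \<longleftrightarrow> 0 < Re (\<Phi> (Suc m) (complex_of_real (- 1 / 2)))" for m
  have fh: "bern_finite \<phi> (complex_of_real (real k + - 1 / 2))"
    using k by (intro bern_finite_Re_nonneg) simp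
  have "\<forall>m. \<exists>\<nu>. real_distribution \<nu> \<and> (good m \<longrightarrow> (\<forall>z x. x < Re z \<longrightarrow> bern_finite \<phi> (complex_of_real (real k + x)) \<longrightarrow>
     0 < Re (\<Phi> (Suc m) (complex_of_real x)) \<longrightarrow> has_laplace \<nu> z (bern \<phi> (of_nat k) / \<Phi> (Suc m) z)))"
  proof
    fix m
    show "\<exists>\<nu>. real_distribution \<nu> \<and> (good m \<longrightarrow> (\<forall>z x. x < Re z \<longrightarrow> bern_finite \<phi> (complex_of_real (real k + x)) \<longrightarrow>
     0 < Re (\<Phi> (Suc m) (complex_of_real x)) \<longrightarrow> has_laplace \<nu> z (bern \<phi> (of_nat k) / \<Phi> (Suc m) z)))"
    proof (cases "good m")
      case True
      thus ?thesis
        using laplace_inverse_bern_aux[of "Suc m" k "- 1 / 2"] k fh unfolding good_def \<Phi>_def \<alpha>_def by simp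
    next
      case False
      thus ?thesis using real_distribution_return by blast
    qed
  qed
  then obtain \<mu> where \<mu>: "\<And>m. real_distribution (\<mu> m)"
     "\<And>m z x. good m \<Longrightarrow> x < Re z \<Longrightarrow> bern_finite \<phi> (complex_of_real (real k + x)) \<Longrightarrow>
     0 < Re (\<Phi> (Suc m) (complex_of_real x)) \<Longrightarrow> has_laplace (\<mu> m) z (bern \<phi> (of_nat k) / \<Phi> (Suc m) z)"
    by metis
  have pos_ev: "\<forall>\<^sub>F m in sequentially. 0 < Re (\<Phi> (Suc m) (complex_of_real x))" if x: "- a_star_bern \<phi> < ereal (real k + x)" for x
  proof -
    have e: "of_nat k + complex_of_real x = complex_of_real (real k + x)" by simp
    have "bern_finite \<phi> (of_nat k + complex_of_real x)" using x by (intro bern_finite_a_star) simp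
    from lim[OF this] have "(\<lambda>m. Re (\<Phi> (Suc m) (complex_of_real x))) \<longlonglongrightarrow> \<phi>\<^sub>r (real k + x)"
      unfolding e bern_of_real by (auto dest: tendsto_Re)
    thus ?thesis using phi_r_pos[OF x] by (rule order_tendstoD)
  qed
  have good_ev: "\<forall>\<^sub>F m in sequentially. good m"
    unfolding good_def by (rule pos_ev) (use k in \<open>intro pos_gt_a_star, simp\<close>)
  have "\<exists>\<nu>. real_distribution \<nu> \<and> (\<forall>z. Re z \<in> {x. - a_star_bern \<phi> < ereal (x + real k)} \<longrightarrow>
      has_laplace \<nu> z (bern \<phi> (of_nat k) / bern \<phi> (of_nat k + z)))"
  proof (rule laplace_continuity[OF open_a_star _ \<mu>(1)])
    show "0 \<in> {x. - a_star_bern \<phi> < ereal (x + real k)}" using k pos_gt_a_star[of "real k"] by simp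
  next
    fix z assume "Re z \<in> {x. - a_star_bern \<phi> < ereal (x + real k)}"
    hence z: "- a_star_bern \<phi> < ereal (Re z + real k)" by simp
    then obtain x' where x': "- a_star_bern \<phi> < ereal x'" "x' < Re z + real k"
      using ereal_dense2 by (metis ereal_less(2) less_ereal.simps(1) ereal_dense3)
    define x where "x = x' - real k"
    have x: "x < Re z" "- a_star_bern \<phi> < ereal (real k + x)" using x' by (auto simp: x_def)
    have fx: "bern_finite \<phi> (complex_of_real (real k + x))" using x(2) by (intro bern_finite_a_star) simp
    show "\<forall>\<^sub>F m in sequentially. has_laplace (\<mu> m) z (bern \<phi> (of_nat k) / \<Phi> (Suc m) z)"
      using good_ev pos_ev[OF x(2)]
    proof eventually_elim
      case (elim m)
      show ?case by (rule \<mu>(2)[OF elim(1) x(1) fx elim(2)])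
    qed
    have "bern_finite \<phi> (of_nat k + z)" using z by (intro bern_finite_a_star) (simp add: add.commute)
    moreover have "bern \<phi> (of_nat k + z) \<noteq> 0" using z by (intro bern_nonzero) (simp add: add.commute)
    ultimately show "(\<lambda>m. bern \<phi> (of_nat k) / \<Phi> (Suc m) z) \<longlonglongrightarrow> bern \<phi> (of_nat k) / bern \<phi> (of_nat k + z)"
      by (intro tendsto_divide tendsto_const lim)
  qed
  thus ?thesis by simp
qed

text \<open>
  The power \<open>\<phi>(n) powr z\<close> is the transform of a point mass.
\<close>

lemma laplace_gauss_product:
  assumes n: "n \<ge> 1"
  shows "\<exists>\<mu>. real_distribution \<mu> \<and> (\<forall>z. - a_star_bern \<phi> < ereal (Re z + 1) \<longrightarrow> has_laplace \<mu> z (gauss_tail \<phi> 0 n z))"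
proof -
  have "\<exists>\<mu>. real_distribution \<mu> \<and> (\<forall>z\<in>{z. - a_star_bern \<phi> < ereal (Re z + 1)}.
     has_laplace \<mu> z (\<Prod>k\<in>{0<..n}. bern \<phi> (of_nat k) / bern \<phi> (of_nat k + z)))"
  proof (rule laplace_prod)
    fix k :: nat assume k: "1 \<le> k"
    obtain \<nu> where \<nu>: "real_distribution \<nu>" "\<And>z. - a_star_bern \<phi> < ereal (Re z + real k) \<Longrightarrow>
      has_laplace \<nu> z (bern \<phi> (of_nat k) / bern \<phi> (of_nat k + z))"
      using laplace_inverse_bern[OF k] by blast
    have "- a_star_bern \<phi> < ereal (Re z + real k)" if "- a_star_bern \<phi> < ereal (Re z + 1)" for z :: complex
      by (rule less_le_trans[OF that]) (use k in simp)
    thus "\<exists>\<mu>. real_distribution \<mu> \<and> (\<forall>z\<in>{z. - a_star_bern \<phi> < ereal (Re z + 1)}.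
       has_laplace \<mu> z (bern \<phi> (of_nat k) / bern \<phi> (of_nat k + z)))"
      using \<nu> by blast
  qed
  then obtain \<mu> where \<mu>: "real_distribution \<mu>" "\<And>z. - a_star_bern \<phi> < ereal (Re z + 1) \<Longrightarrow>
     has_laplace \<mu> z (\<Prod>k\<in>{0<..n}. bern \<phi> (of_nat k) / bern \<phi> (of_nat k + z))" by blast
  define a where "a = - ln (\<phi>\<^sub>r (real n))"
  have pn: "\<phi>\<^sub>r (real n) > 0" using n by (intro phi_r_pos') auto
  have e: "exp (- z * complex_of_real a) = bern \<phi> (of_nat n) powr z" for z
    using pn by (simp add: a_def bern_of_nat powr_def Ln_of_real)
  obtain \<rho> where \<rho>: "real_distribution \<rho>" "\<And>z v w. has_laplace (return borel a) z v \<Longrightarrow> has_laplace \<mu> z w \<Longrightarrow> has_laplace \<rho> z (v * w)"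
    using real_distribution_convolution[OF real_distribution_return \<mu>(1)] by blast
  show ?thesis
    by (intro exI[of _ \<rho>] conjI allI impI \<rho>(1))
       (use \<rho>(2)[OF has_laplace_return \<mu>(2), unfolded e] in \<open>simp add: gauss_tail_def\<close>)
qed

lemma laplace_BG:
  "\<exists>\<mu>. real_distribution \<mu> \<and> (\<forall>z. - a_star_bern \<phi> < ereal (Re z + 1) \<longrightarrow> has_laplace \<mu> z (BG (z + 1)))"
proof -
  have "\<forall>n. \<exists>\<mu>. real_distribution \<mu> \<and> (\<forall>z. - a_star_bern \<phi> < ereal (Re z + 1) \<longrightarrow> has_laplace \<mu> z (gauss_tail \<phi> 0 (Suc n) z))"
    using laplace_gauss_product by simp
  then obtain \<mu> where \<mu>: "\<And>n. real_distribution (\<mu> n)" "\<And>n z. - a_star_bern \<phi> < ereal (Re z + 1) \<Longrightarrow> has_laplace (\<mu> n) z (gauss_tail \<phi> 0 (Suc n) z)"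
    by metis
  have "\<exists>\<nu>. real_distribution \<nu> \<and> (\<forall>z. Re z \<in> {x. - a_star_bern \<phi> < ereal (x + 1)} \<longrightarrow> has_laplace \<nu> z (BG (z + 1)))"
  proof (rule laplace_continuity[OF open_a_star _ \<mu>(1)])
    show "0 \<in> {x. - a_star_bern \<phi> < ereal (x + 1)}" using pos_gt_a_star[of 1] by simp
  next
    fix z assume "Re z \<in> {x. - a_star_bern \<phi> < ereal (x + 1)}"
    hence z: "- a_star_bern \<phi> < ereal (Re z + 1)" by simp
    show "\<forall>\<^sub>F n in sequentially. has_laplace (\<mu> n) z (gauss_tail \<phi> 0 (Suc n) z)"
      using \<mu>(2)[OF z] by simp
    show "(\<lambda>n. gauss_tail \<phi> 0 (Suc n) z) \<longlonglongrightarrow> BG (z + 1)"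
      using LIMSEQ_Suc[OF BG_lim(1)[of "z + 1"]] z by simp
  qed
  thus ?thesis by simp
qed

text \<open>
  A Laplace transform becomes a Mellin transform under \<open>y \<mapsto> exp (- y)\<close>.
\<close>

lemma BG_is_bernstein_gamma:
  "is_bernstein_gamma \<phi> (\<lambda>z. if - a_star_bern \<phi> < ereal (Re z) then BG z else 0)"
proof -
  obtain \<mu> where \<mu>: "real_distribution \<mu>" "\<And>z. - a_star_bern \<phi> < ereal (Re z + 1) \<Longrightarrow> has_laplace \<mu> z (BG (z + 1))"
    using laplace_BG by blast
  interpret real_distribution \<mu> by fact
  define \<nu> where "\<nu> = distr \<mu> borel (\<lambda>y. exp (- y))"
  have "sets \<nu> = sets borel" by (simp add: \<nu>_def)
  moreover have "emeasure \<nu> {..0} = 0"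
  proof -
    have "(\<lambda>y. exp (- y)) -` {..0} \<inter> space \<mu> = {}" by (auto simp: not_le)
    thus ?thesis unfolding \<nu>_def by (subst emeasure_distr) auto
  qed
  moreover have "integrable \<nu> (\<lambda>y. complex_of_real y powr (z - 1)) \<and> BG z = (\<integral>y. complex_of_real y powr (z - 1) \<partial>\<nu>)"
    if z: "- a_star_bern \<phi> < ereal (Re z)" for z
  proof -
    have e: "complex_of_real (exp (- y)) powr (z - 1) = exp (- (z - 1) * complex_of_real y)" for y
      by (simp add: powr_def Ln_of_real algebra_simps)
    have "has_laplace \<mu> (z - 1) (BG z)" using \<mu>(2)[of "z - 1"] z by simp
    thus ?thesis unfolding \<nu>_def has_laplace_def has_bochner_integral_iff
      by (subst integrable_distr_eq integral_distr; simp add: e)+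
  qed
  moreover have "- a_star_bern \<phi> < ereal (Re (z + 1))" if "- a_star_bern \<phi> < ereal (Re z)" for z
    by (rule less_le_trans[OF that]) simp
  ultimately show ?thesis unfolding is_bernstein_gamma_def
    using BG_rec BG_1 pos_gt_a_star[of 1] by (intro conjI exI[of _ \<nu>]) auto
qed

lemma phi_r_linear_bound: "1 \<le> x \<Longrightarrow> \<phi>\<^sub>r x \<le> \<phi>\<^sub>r 1 * x"
proof -
  assume x: "1 \<le> x"
  have "norm (bern \<phi> (complex_of_real x) - bern \<phi> (complex_of_real 1)) \<le> norm (complex_of_real x - complex_of_real 1) * (\<phi>\<^sub>r 1 / 1)"
    by (rule bern_lipschitz) (use x in auto)
  hence "\<bar>\<phi>\<^sub>r x - \<phi>\<^sub>r 1\<bar> \<le> (x - 1) * \<phi>\<^sub>r 1" unfolding bern_of_real of_real_diff[symmetric] norm_of_real using x by simp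
  thus ?thesis by (simp add: algebra_simps)
qed

text \<open>
  The recursion fixes the integer moments \<open>\<phi>(1) \<cdots> \<phi>(n)\<close>, which are at
  most \<open>\<phi>(1) ^ n n!\<close> because \<open>\<phi>\<close> grows at most linearly.
\<close>

lemma bernstein_gamma_unique:
  assumes "is_bernstein_gamma \<phi> V" "is_bernstein_gamma \<phi> W" and z: "- a_star_bern \<phi> < ereal (Re z)"
  shows "V z = W z"
proof -
  have key: "\<exists>\<nu>. real_distribution \<nu> \<and> (AE y in \<nu>. 0 \<le> y) \<and>
      (\<forall>n. has_bochner_integral \<nu> (\<lambda>y. y ^ n) (\<Prod>k\<in>{0<..n}. \<phi>\<^sub>r (real k))) \<and>
      (\<forall>z. - a_star_bern \<phi> < ereal (Re z) \<longrightarrow> V z = (\<integral>y. complex_of_real y powr (z - 1) \<partial>\<nu>))"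
    if V: "is_bernstein_gamma \<phi> V" for V
  proof -
    obtain \<nu> where \<nu>: "sets \<nu> = sets borel" "emeasure \<nu> {..0} = 0"
       "\<And>z. - a_star_bern \<phi> < ereal (Re z) \<Longrightarrow> integrable \<nu> (\<lambda>y. complex_of_real y powr (z - 1)) \<and> V z = (\<integral>y. complex_of_real y powr (z - 1) \<partial>\<nu>)"
      and rec: "\<And>z. - a_star_bern \<phi> < ereal (Re z) \<Longrightarrow> V (z + 1) = bern \<phi> z * V z" and V1: "V 1 = 1"
      using V unfolding is_bernstein_gamma_def by blast
    note [measurable_cong] = \<nu>(1)
    have pos: "AE y in \<nu>. 0 < y" by (rule AE_I[where N="{..0}"]) (use \<nu> in auto)
    have mom: "has_bochner_integral \<nu> (\<lambda>y. y ^ n) (Re (V (of_nat (Suc n))))" for n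
    proof -
      have "- a_star_bern \<phi> < ereal (Re (of_nat (Suc n)))" by (rule pos_gt_a_star) simp
      from \<nu>(3)[OF this] have "has_bochner_integral \<nu> (\<lambda>y. complex_of_real y powr (of_nat n)) (V (of_nat (Suc n)))"
        by (simp add: has_bochner_integral_iff)
      hence "has_bochner_integral \<nu> (\<lambda>y. Re (complex_of_real y powr (of_nat n))) (Re (V (of_nat (Suc n))))"
        by (rule has_bochner_integral_Re)
      moreover have "AE y in \<nu>. Re (complex_of_real y powr (of_nat n)) = y ^ n"
        using pos by eventually_elim (simp add: powr_nat' flip: of_real_power)
      ultimately show ?thesis
        by (subst has_bochner_integral_cong_AE[symmetric]) auto
    qed
    have Vn: "V (of_nat (Suc n)) = complex_of_real (\<Prod>k\<in>{0<..n}. \<phi>\<^sub>r (real k))" for n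
    proof (induction n)
      case 0 show ?case using V1 by simp
    next
      case (Suc n)
      have i: "{0<..Suc n} = insert (Suc n) {0<..n}" by auto
      have "V (of_nat (Suc n) + 1) = bern \<phi> (of_nat (Suc n)) * V (of_nat (Suc n))"
        by (rule rec, rule pos_gt_a_star) simp
      also have "\<dots> = complex_of_real (\<Prod>k\<in>{0<..Suc n}. \<phi>\<^sub>r (real k))"
        unfolding Suc.IH bern_of_nat i by (subst prod.insert) auto
      finally show ?case by (simp add: add.commute)
    qed
    have "real_distribution \<nu>"
    proof (intro real_distribution.intro real_distribution_axioms.intro prob_spaceI)
      have h: "has_bochner_integral \<nu> (\<lambda>y. 1 :: real) 1" using mom[of 0] Vn[of 0] by simp
      hence "(\<integral>\<^sup>+y. ennreal 1 \<partial>\<nu>) = ennreal 1"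
        using nn_integral_eq_integral[of \<nu> "\<lambda>_. 1"] by (simp add: has_bochner_integral_iff)
      thus "emeasure \<nu> (space \<nu>) = 1" by simp
    qed (use \<nu> in simp)
    moreover have "AE y in \<nu>. 0 \<le> y" using pos by eventually_elim simp
    moreover have "has_bochner_integral \<nu> (\<lambda>y. y ^ n) (\<Prod>k\<in>{0<..n}. \<phi>\<^sub>r (real k))" for n
      using mom[of n] unfolding Vn Re_complex_of_real .
    ultimately show ?thesis using \<nu>(3) by (intro exI[of _ \<nu>]) auto
  qed
  obtain \<mu> where \<mu>: "real_distribution \<mu>" "AE y in \<mu>. 0 \<le> y" "\<And>n. has_bochner_integral \<mu> (\<lambda>y. y ^ n) (\<Prod>k\<in>{0<..n}. \<phi>\<^sub>r (real k))"
      "\<And>z. - a_star_bern \<phi> < ereal (Re z) \<Longrightarrow> V z = (\<integral>y. complex_of_real y powr (z - 1) \<partial>\<mu>)"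
    using key[OF assms(1)] by blast
  obtain \<nu> where \<nu>: "real_distribution \<nu>" "AE y in \<nu>. 0 \<le> y" "\<And>n. has_bochner_integral \<nu> (\<lambda>y. y ^ n) (\<Prod>k\<in>{0<..n}. \<phi>\<^sub>r (real k))"
      "\<And>z. - a_star_bern \<phi> < ereal (Re z) \<Longrightarrow> W z = (\<integral>y. complex_of_real y powr (z - 1) \<partial>\<nu>)"
    using key[OF assms(2)] by blast
  have "(\<Prod>k\<in>{0<..n}. \<phi>\<^sub>r (real k)) \<le> \<phi>\<^sub>r 1 ^ n * fact n" for n
  proof -
    have "(\<Prod>k\<in>{0<..n}. \<phi>\<^sub>r (real k)) \<le> (\<Prod>k\<in>{0<..n}. \<phi>\<^sub>r 1 * real k)"
      by (intro prod_mono conjI phi_r_linear_bound less_imp_le[OF phi_r_pos']) auto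
    also have "\<dots> = \<phi>\<^sub>r 1 ^ n * fact n"
      by (simp add: prod.distrib fact_prod atLeastSucAtMost_greaterThanAtMost[symmetric] flip: of_nat_prod)
    finally show ?thesis .
  qed
  from moment_determinate[OF \<mu>(1-3) \<nu>(1-3) phi_r_pos' this] have "\<mu> = \<nu>" by simp
  thus ?thesis using \<mu>(4)[OF z] \<nu>(4)[OF z] by simp
qed

theorem W_bern_eq: "W_bern \<phi> = (\<lambda>z. if - a_star_bern \<phi> < ereal (Re z) then BG z else 0)"
  unfolding W_bern_def
proof (rule the_equality)
  show "is_bernstein_gamma \<phi> (\<lambda>z. if - a_star_bern \<phi> < ereal (Re z) then BG z else 0) \<and>
    (\<forall>z. ereal (Re z) \<le> - a_star_bern \<phi> \<longrightarrow> (if - a_star_bern \<phi> < ereal (Re z) then BG z else 0) = 0)"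
    using BG_is_bernstein_gamma by auto
  fix W assume W: "is_bernstein_gamma \<phi> W \<and> (\<forall>z. ereal (Re z) \<le> - a_star_bern \<phi> \<longrightarrow> W z = 0)"
  show "W = (\<lambda>z. if - a_star_bern \<phi> < ereal (Re z) then BG z else 0)"
  proof
    fix z show "W z = (if - a_star_bern \<phi> < ereal (Re z) then BG z else 0)"
      using W bernstein_gamma_unique[OF _ BG_is_bernstein_gamma, of W z] by (auto simp: not_less)
  qed
qed

lemma W_bern_BG: "0 < Re z \<Longrightarrow> W_bern \<phi> z = BG z"
  using pos_gt_a_star[of "Re z"] by (simp add: W_bern_eq)

end


section \<open>Positive combinations of Laplace transforms\<close>

text \<open>
  The convex cone generated by the Laplace transforms of probability laws. The set \<open>S\<close>
  of arguments is part of the notion because a sum is a transform only where both summands are.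
\<close>

definition laplace_cone :: "complex set \<Rightarrow> (complex \<Rightarrow> complex) \<Rightarrow> bool" where
  "laplace_cone S f \<longleftrightarrow> (\<exists>w \<mu>. 0 \<le> w \<and> real_distribution \<mu> \<and>
     (\<forall>z\<in>S. \<exists>g. has_laplace \<mu> z g \<and> f z = complex_of_real w * g))"

lemma laplace_coneI:
  "0 \<le> w \<Longrightarrow> real_distribution \<mu> \<Longrightarrow> (\<And>z. z \<in> S \<Longrightarrow> has_laplace \<mu> z (g z)) \<Longrightarrow>
   (\<And>z. z \<in> S \<Longrightarrow> f z = complex_of_real w * g z) \<Longrightarrow> laplace_cone S f"
  unfolding laplace_cone_def by blast

lemma laplace_cone_const: "0 \<le> w \<Longrightarrow> laplace_cone S (\<lambda>_. complex_of_real w)"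
  by (rule laplace_coneI[OF _ real_distribution_return[of 0], where g="\<lambda>_. 1"])
     (use has_laplace_return[of 0] in auto)

lemma laplace_cone_add:
  assumes "laplace_cone S f" "laplace_cone S g"
  shows "laplace_cone S (\<lambda>z. f z + g z)"
proof -
  obtain w \<mu> where w: "0 \<le> w" "real_distribution \<mu>" "\<forall>z\<in>S. \<exists>h. has_laplace \<mu> z h \<and> f z = complex_of_real w * h"
    using assms(1) unfolding laplace_cone_def by blast
  obtain v \<nu> where v: "0 \<le> v" "real_distribution \<nu>" "\<forall>z\<in>S. \<exists>h. has_laplace \<nu> z h \<and> g z = complex_of_real v * h"
    using assms(2) unfolding laplace_cone_def by blast
  show ?thesis
  proof (cases "w + v = 0")
    case True
    hence "w = 0" "v = 0" using w v by auto
    thus ?thesis unfolding laplace_cone_def using w v by (intro exI[of _ 0] exI[of _ \<mu>]) auto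
  next
    case False
    define p where "p = w / (w + v)"
    have p: "0 \<le> p" "p \<le> 1" using w v False by (auto simp: p_def)
    have wv: "complex_of_real w + complex_of_real v \<noteq> 0" using False by (metis of_real_add of_real_eq_0_iff)
    have pe: "complex_of_real (w + v) * complex_of_real p = complex_of_real w"
      "complex_of_real (w + v) * complex_of_real (1 - p) = complex_of_real v"
    proof -
      have "(w + v) * p = w" "(w + v) * (1 - p) = v" using False by (simp_all add: p_def field_simps)
      thus "complex_of_real (w + v) * complex_of_real p = complex_of_real w"
        "complex_of_real (w + v) * complex_of_real (1 - p) = complex_of_real v" by (metis of_real_mult)+
    qed
    from real_distribution_mixture[OF w(2) v(2) p] obtain \<rho> where \<rho>: "real_distribution \<rho>"
      "\<And>z a b. has_laplace \<mu> z a \<Longrightarrow> has_laplace \<nu> z b \<Longrightarrow> has_laplace \<rho> z (complex_of_real p * a + complex_of_real (1 - p) * b)"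
      by blast
    show ?thesis unfolding laplace_cone_def
    proof (intro exI[of _ "w + v"] exI[of _ \<rho>] conjI ballI \<rho>(1))
      fix z assume "z \<in> S"
      then obtain a b where a: "has_laplace \<mu> z a" "f z = complex_of_real w * a" and b: "has_laplace \<nu> z b" "g z = complex_of_real v * b"
        using w(3) v(3) by blast
      have "f z + g z = complex_of_real (w + v) * (complex_of_real p * a + complex_of_real (1 - p) * b)"
        unfolding a(2) b(2) distrib_left mult.assoc[symmetric] pe ..
      thus "\<exists>h. has_laplace \<rho> z h \<and> f z + g z = complex_of_real (w + v) * h" using \<rho>(2)[OF a(1) b(1)] by blast
    qed (use w v in auto)
  qed
qed

lemma laplace_cone_measure:
  assumes s: "sets \<rho> = sets borel" and lap: "\<And>z. z \<in> S \<Longrightarrow> has_laplace \<rho> z (f z)" and 0: "0 \<in> S"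
  shows "laplace_cone S f"
proof -
  define A where "A = Re (f 0)"
  have hA: "has_bochner_integral \<rho> (\<lambda>y. 1 :: real) A"
    using has_laplace_real[of \<rho> 0 "f 0"] lap[OF 0] by (simp add: A_def)
  have "A \<ge> 0" using hA Bochner_Integration.integral_nonneg[of \<rho> "\<lambda>_. 1"] by (simp add: has_bochner_integral_iff)
  have fA: "f 0 = complex_of_real A"
    using has_bochner_integral_eq[OF lap[OF 0, unfolded has_laplace_def]] has_bochner_integral_of_real[OF hA, where ?'a=complex] by simp
  show ?thesis
  proof (cases "A = 0")
    case True
    hence "AE y in \<rho>. (1::real) = 0" using hA by (subst integral_nonneg_eq_0_iff_AE[symmetric]) (auto simp: has_bochner_integral_iff)
    hence AE: "AE y in \<rho>. False" by simp
    have "f z = 0" if z: "z \<in> S" for z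
    proof -
      have "(\<integral>y. exp (- z * complex_of_real y) \<partial>\<rho>) = (\<integral>y. 0 \<partial>\<rho>)"
        by (intro integral_cong_AE) (use AE in \<open>auto simp: s cong: measurable_cong_sets\<close>)
      thus ?thesis using lap[OF z] by (simp add: has_laplace_def has_bochner_integral_iff)
    qed
    thus ?thesis using has_laplace_return[of 0] real_distribution_return
      by (intro laplace_coneI[of 0 "return borel 0" S "\<lambda>_. 1"]) auto
  next
    case False
    hence "A > 0" using \<open>A \<ge> 0\<close> by simp
    from has_laplace_normalize[OF s lap[OF 0, unfolded fA] this] obtain \<mu> where
      "real_distribution \<mu>" "\<And>z v. has_laplace \<rho> z v \<Longrightarrow> has_laplace \<mu> z (v / complex_of_real A)" by blast
    thus ?thesis using lap \<open>A > 0\<close> by (intro laplace_coneI[of A \<mu> S "\<lambda>z. f z / complex_of_real A"]) auto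
  qed
qed

lemma laplace_cone_prob:
  assumes "laplace_cone S f" and 0: "0 \<in> S" and f0: "f 0 \<noteq> 0"
  shows "\<exists>\<mu>. real_distribution \<mu> \<and> (\<forall>z\<in>S. has_laplace \<mu> z (f z / f 0))"
proof -
  obtain w \<mu> where w: "0 \<le> w" "real_distribution \<mu>" "\<forall>z\<in>S. \<exists>h. has_laplace \<mu> z h \<and> f z = complex_of_real w * h"
    using assms(1) unfolding laplace_cone_def by blast
  interpret real_distribution \<mu> by fact
  have f0w: "f 0 = complex_of_real w"
    using w(3) 0 by (auto simp: has_laplace_def has_bochner_integral_iff prob_space[simplified])
  show ?thesis
  proof (intro exI[of _ \<mu>] conjI ballI w(2))
    fix z assume "z \<in> S"
    then obtain h where "has_laplace \<mu> z h" "f z = complex_of_real w * h" using w(3) by blast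
    thus "has_laplace \<mu> z (f z / f 0)" using f0 unfolding f0w by simp
  qed
qed

section \<open>The gamma function as a Bernstein-gamma function\<close>

definition bern_id :: bernstein where
  "bern_id = \<lparr>killing = 0, drift = 1, levy = null_measure borel\<rparr>"

lemma bern_bern_id: "bern bern_id u = u"
  by (simp add: bern_def bern_id_def)

interpretation bern_id: bernstein_function bern_id
proof
  show "bern_id \<in> Bernstein_functions"
    unfolding Bernstein_functions_def bern_bern_id mem_Collect_eq
    by (auto simp: bern_id_def intro: exI[of _ 1])
qed

section \<open>For \<open>\<phi>(u) = u\<close> the product is \<open>z\<close> times Gauss's product for \<open>\<Gamma>(z)\<close>.\<close>

lemma gauss_tail_id_LIMSEQ:
  assumes "-1 < Re z"
  shows "(\<lambda>n. gauss_tail bern_id 0 n z) \<longlonglongrightarrow> Gamma (z + 1)"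
proof (cases "z = 0")
  case True
  have "\<forall>\<^sub>F n in sequentially. gauss_tail bern_id 0 n z = 1"
    by (rule eventually_sequentiallyI[of 1]) (simp add: True gauss_tail_def bern_bern_id)
  thus ?thesis using True by (simp add: tendsto_eventually)
next
  case False
  have eq: "gauss_tail bern_id 0 n z = z * Gamma_series z n" if n: "n \<ge> 1" for n
  proof -
    have "(\<Prod>k\<in>{0<..n}. of_nat k / (of_nat k + z)) = fact n / (\<Prod>k=1..n. z + of_nat k)"
      unfolding prod_dividef by (simp add: fact_prod atLeastSucAtMost_greaterThanAtMost[symmetric] add.commute)
    moreover have "pochhammer z (n + 1) = z * (\<Prod>k=1..n. z + of_nat k)"
    proof -
      have "pochhammer (z + 1) n = (\<Prod>k=1..n. z + of_nat k)"
        by (simp add: pochhammer_prod prod.atLeast1_atMost_eq atLeast0LessThan add_ac)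
      thus ?thesis using pochhammer_rec[of z n] by simp
    qed
    moreover have "of_nat n powr z = exp (z * of_real (ln (real n)))"
      using n Ln_of_nat[of n] by (simp add: powr_def)
    ultimately show ?thesis using False n
      by (simp add: gauss_tail_def bern_bern_id Gamma_series_def)
  qed
  have "(\<lambda>n. z * Gamma_series z n) \<longlonglongrightarrow> z * Gamma z" by (intro tendsto_intros)
  moreover have "\<forall>\<^sub>F n in sequentially. z * Gamma_series z n = gauss_tail bern_id 0 n z"
    using eventually_ge_at_top[of 1] by eventually_elim (simp add: eq)
  ultimately have "(\<lambda>n. gauss_tail bern_id 0 n z) \<longlonglongrightarrow> z * Gamma z" by (rule Lim_transform_eventually)
  moreover have "z * Gamma z = Gamma (z + 1)"
  proof -
    have "z \<notin> \<int>\<^sub>\<le>\<^sub>0"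
    proof
      assume "z \<in> \<int>\<^sub>\<le>\<^sub>0"
      then obtain n where "z = - of_nat n" by (elim nonpos_Ints_cases')
      thus False using assms False by (cases n) auto
    qed
    thus ?thesis by (simp add: Gamma_plus1)
  qed
  ultimately show ?thesis by simp
qed

section \<open>The quotient of a Bernstein function by its argument\<close>

text \<open>
  Filling in the removable singularity at \<open>u = 0\<close> allows \<open>\<phi>(u) / u\<close>
  to be continued across \<open>0\<close> when \<open>\<phi>(0) = 0\<close>.
\<close>

definition kern :: "complex \<Rightarrow> real \<Rightarrow> complex" where
  "kern u y = (if u = 0 then complex_of_real y else (1 - exp (- u * complex_of_real y)) / u)"

text \<open>
  As a function of \<open>u\<close>, the kernel is a mixture of exponentials \<open>exp (- u (y
  s))\<close>, \<open>0 \<le> s \<le> 1\<close>, with positive weights.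
\<close>

lemma kern_integral:
  assumes "0 < y"
  shows "has_bochner_integral lborel (\<lambda>s. indicator {0..1} s *\<^sub>R (complex_of_real y * exp (- u * complex_of_real (y * s)))) (kern u y)"
proof (cases "u = 0")
  case True
  have "has_bochner_integral lborel (\<lambda>s::real. indicator {0..1} s *\<^sub>R complex_of_real y) (complex_of_real (y * 1) - complex_of_real (y * 0))"
  proof (rule has_bochner_integral_FTC_Icc[where a=0 and b=1 and f="\<lambda>_. complex_of_real y" and F="\<lambda>s. complex_of_real (y * s)"])
    fix s :: real
    have "((\<lambda>s. y * s) has_real_derivative y) (at s within {0..1})" by (auto intro!: derivative_eq_intros)
    thus "((\<lambda>s. complex_of_real (y * s)) has_vector_derivative complex_of_real y) (at s within {0..1})"
      by (intro has_vector_derivative_of_real) (simp add: has_real_derivative_iff_has_vector_derivative)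
  qed auto
  thus ?thesis using True by (simp add: kern_def)
next
  case False
  have "has_bochner_integral lborel (\<lambda>s. indicator {0..1} s *\<^sub>R (complex_of_real y * exp (- u * complex_of_real (y * s))))
     (- exp (- u * complex_of_real (y * 1)) / u - (- exp (- u * complex_of_real (y * 0)) / u))"
  proof (rule has_bochner_integral_FTC_Icc[where F="\<lambda>s. - exp (- u * complex_of_real (y * s)) / u"])
    fix s :: real
    have "((\<lambda>s. - exp (- u * (complex_of_real y * s)) / u) has_field_derivative complex_of_real y * exp (- u * complex_of_real (y * s))) (at (complex_of_real s))"
      using False by (auto intro!: derivative_eq_intros simp: field_simps)
    hence "((\<lambda>s. - exp (- u * (complex_of_real y * complex_of_real s)) / u) has_vector_derivative complex_of_real y * exp (- u * complex_of_real (y * s))) (at s)"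
      by (rule has_vector_derivative_real_field)
    thus "((\<lambda>s. - exp (- u * complex_of_real (y * s)) / u) has_vector_derivative complex_of_real y * exp (- u * complex_of_real (y * s))) (at s within {0..1})"
      by (simp add: has_vector_derivative_at_within)
  qed (auto intro!: continuous_intros)
  thus ?thesis using False by (simp add: kern_def diff_divide_distrib)
qed

context bernstein_function
begin

lemma kern_integrable:
  assumes "- a_bern \<phi> < ereal (Re u) \<or> 0 < Re u"
  shows "integrable (levy \<phi>) (kern u)"
proof (cases "u = 0")
  case False
  have "bern_finite \<phi> u" using assms bern_finite_a_bern bern_finite_Re_nonneg by auto
  hence "integrable (levy \<phi>) (\<lambda>y. (1 - exp (- u * complex_of_real y)) / u)"
    unfolding bern_finite_def by simp
  thus ?thesis using False by (simp add: kern_def[abs_def])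
next
  case True
  then obtain v where v: "v \<ge> 0" "- v < 0" "bern_finite \<phi> (complex_of_real (- v))"
    using a_bern_witness[of 0] assms by auto
  have "integrable (levy \<phi>) complex_of_real"
  proof (rule Bochner_Integration.integrable_bound[OF integrable_mult_right[OF integrable_levy_exp[OF v(3,1)], of "1 / v"]])
    show "AE y in levy \<phi>. norm (complex_of_real y) \<le> norm (1 / v * (min 1 y + (exp (v * y) - 1)))"
      using AE_levy_pos
    proof eventually_elim
      case (elim y)
      have "1 + v * y \<le> exp (v * y)" by (rule exp_ge_add_one_self)
      moreover have "0 \<le> min 1 y" using elim by simp
      ultimately have "v * y \<le> min 1 y + (exp (v * y) - 1)" by linarith
      hence "y \<le> 1 / v * (min 1 y + (exp (v * y) - 1))" using v by (simp add: field_simps)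
      hence "\<bar>y\<bar> \<le> \<bar>1 / v * (min 1 y + (exp (v * y) - 1))\<bar>" using elim by linarith
      thus ?case by (simp only: norm_of_real real_norm_def)
    qed
  qed measurable
  thus ?thesis using True by (simp add: kern_def[abs_def])
qed

lemma sigma_finite_levy: "sigma_finite_measure (levy \<phi>)"
proof
  have fin: "emeasure (levy \<phi>) {1 / real (Suc n)<..} \<noteq> \<infinity>" for n
  proof -
    have "integrable (levy \<phi>) (indicator {1 / real (Suc n)<..} :: real \<Rightarrow> real)"
      by (rule integrable_levy_tail) simp
    thus ?thesis by (subst (asm) integrable_indicator_iff) (auto simp: sets_levy less_top)
  qed
  show "\<exists>A. countable A \<and> A \<subseteq> sets (levy \<phi>) \<and> \<Union> A = space (levy \<phi>) \<and> (\<forall>a\<in>A. emeasure (levy \<phi>) a \<noteq> \<infinity>)"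
  proof (intro exI[of _ "insert {..0} (range (\<lambda>n. {1 / real (Suc n)<..}))"] conjI)
    show "\<Union> (insert {..0} (range (\<lambda>n. {1 / real (Suc n)<..}))) = space (levy \<phi>)"
    proof -
      have "\<exists>n. 1 / real (Suc n) < y" if "0 < y" for y :: real
        using reals_Archimedean[OF that] by (simp add: divide_inverse)
      thus ?thesis using sets_eq_imp_space_eq[OF sets_levy] by (auto, meson not_le)
    qed
  qed (use fin levy_null in \<open>auto simp: sets_levy\<close>)
qed

text \<open>
  The function \<open>\<phi>(u) / u\<close>. For \<open>killing \<phi> = 0\<close> the value at
  \<open>u = 0\<close> is the continuous one, as \<open>0 / 0 = 0\<close>.
\<close>

definition Q :: "complex \<Rightarrow> complex" where
  "Q u = complex_of_real (drift \<phi>) + complex_of_real (killing \<phi>) / u + (\<integral>y. kern u y \<partial>levy \<phi>)"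

lemma Q_eq: "u \<noteq> 0 \<Longrightarrow> Q u = bern \<phi> u / u"
  by (simp add: Q_def bern_def kern_def add_divide_distrib)

lemma a_killed_cases: "killing \<phi> = 0 \<Longrightarrow> a_killed \<phi> = a_bern \<phi>" "killing \<phi> \<noteq> 0 \<Longrightarrow> a_killed \<phi> = 0"
  by (simp_all add: a_killed_def bern_0)

lemma a_killed_nonneg: "0 \<le> a_killed \<phi>"
  using a_bern_nonneg by (simp add: a_killed_def)

lemma a_killed_le: "a_killed \<phi> \<le> a_bern \<phi>"
  using a_bern_nonneg by (simp add: a_killed_def)

lemma pos_gt_a_killed: "0 < x \<Longrightarrow> - a_killed \<phi> < ereal x"
  using a_killed_nonneg by (intro le_less_trans[of "- a_killed \<phi>" 0]) auto

lemma gt_a_killed_a_bern: "- a_killed \<phi> < e \<Longrightarrow> - a_bern \<phi> < e"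
  using a_killed_le by (meson ereal_minus_le_minus le_less_trans)

text \<open>
  Each of the three parts of \<open>Q\<close> is the Laplace transform of a positive measure: the
  drift gives a point mass at \<open>0\<close>, the killing rate gives an exponential law, and the
  jumps give the image under \<open>(y, s) \<mapsto> y s\<close> of the Levy measure weighted by
  \<open>y\<close>, times the uniform law for \<open>s \<in> [0, 1]\<close>. The exponential law is
  responsible for the barrier at \<open>Re u = 0\<close> when \<open>\<phi>(0) > 0\<close>.
\<close>

lemma laplace_Q_ratio:
  assumes k: "k \<ge> (1::nat)"
  shows "\<exists>\<mu>. real_distribution \<mu> \<and> (\<forall>z. - a_killed \<phi> < ereal (Re z + real k) \<longrightarrow>
      has_laplace \<mu> z (Q (of_nat k + z) / Q (of_nat k)))"
proof -
  define S where "S = {z. - a_killed \<phi> < ereal (Re z + real k)}"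
  have S0: "0 \<in> S" using pos_gt_a_killed[of "real k"] k by (simp add: S_def)
  have "laplace_cone S (\<lambda>z. complex_of_real (killing \<phi>) / (of_nat k + z))"
  proof (cases "killing \<phi> = 0")
    case True
    thus ?thesis using laplace_cone_const[of 0 S] by simp
  next
    case False
    obtain \<mu> where \<mu>: "real_distribution \<mu>" "\<And>z. - a_star_bern bern_id < ereal (Re z + real k) \<Longrightarrow> has_laplace \<mu> z (of_nat k / (of_nat k + z))"
      using bern_id.laplace_inverse_bern[OF k] unfolding bern_bern_id by blast
    show ?thesis
    proof (rule laplace_coneI[of "killing \<phi> / real k" \<mu> S "\<lambda>z. of_nat k / (of_nat k + z)"])
      fix z assume "z \<in> S"
      hence "0 < Re z + real k" using False by (simp add: S_def a_killed_cases)
      thus "has_laplace \<mu> z (of_nat k / (of_nat k + z))" by (intro \<mu>(2) bern_id.pos_gt_a_star)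
    qed (use k \<mu> killing_nonneg in auto)
  qed
  moreover have "laplace_cone S (\<lambda>z. complex_of_real (drift \<phi>))" by (rule laplace_cone_const[OF drift_nonneg])
  moreover have "laplace_cone S (\<lambda>z. \<integral>y. kern (of_nat k + z) y \<partial>levy \<phi>)"
  proof -
    interpret T: sigma_finite_measure "levy \<phi>" by (rule sigma_finite_levy)
    interpret P: pair_sigma_finite "levy \<phi>" lborel ..
    \<comment> \<open>The mixture over the kernel, tilted by exp (- k y s), pushed forward by (y, s) \<mapsto> y s.\<close>
    define D where "D = density (levy \<phi> \<Otimes>\<^sub>M lborel) (\<lambda>(y, s). ennreal (indicator {0<..} y * indicator {0..1} s * (y * exp (- real k * (y * s)))))"
    define \<rho> where "\<rho> = distr D borel (\<lambda>(y, s). y * s)"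
    have sD[measurable_cong]: "sets D = sets (levy \<phi> \<Otimes>\<^sub>M lborel)" by (simp add: D_def)
    show ?thesis
    proof (rule laplace_cone_measure[of \<rho>, OF _ _ S0])
      fix z assume z: "z \<in> S"
      define u where "u = of_nat k + z"
      define F where "F = (\<lambda>(y, s). indicator {0<..} y *\<^sub>R indicator {0..1} s *\<^sub>R (complex_of_real y * exp (- u * complex_of_real (y * s))))"
      have [measurable]: "F \<in> borel_measurable (levy \<phi> \<Otimes>\<^sub>M lborel)" unfolding F_def by measurable
      have ku: "- a_bern \<phi> < ereal (Re u)" using z gt_a_killed_a_bern by (simp add: S_def u_def add.commute)
      have Fi: "has_bochner_integral lborel (\<lambda>s. F (y, s)) (kern u y)" if "0 < y" for y
        using kern_integral[OF that, of u] that by (simp add: F_def)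
      have Fn: "(\<integral>s. norm (F (y, s)) \<partial>lborel) = Re (kern (complex_of_real (Re u)) y)" if y: "0 < y" for y
      proof -
        have "norm (F (y, s)) = Re (indicator {0..1} s *\<^sub>R (complex_of_real y * exp (- complex_of_real (Re u) * complex_of_real (y * s))))" for s
        proof -
          have "exp (- complex_of_real (Re u) * complex_of_real (y * s)) = complex_of_real (exp (- Re u * (y * s)))"
            by (simp flip: exp_of_real)
          thus ?thesis using y by (auto simp: F_def norm_mult indicator_def)
        qed
        thus ?thesis using has_bochner_integral_Re[OF kern_integral[OF y, of "complex_of_real (Re u)"]]
          by (simp add: has_bochner_integral_iff)
      qed
      have intF: "integrable (levy \<phi> \<Otimes>\<^sub>M lborel) F"
      proof (rule P.Fubini_integrable)
        have "integrable (levy \<phi>) (\<lambda>y. Re (kern (complex_of_real (Re u)) y))"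
          by (intro integrable_Re kern_integrable) (use ku in simp)
        thus "integrable (levy \<phi>) (\<lambda>y. \<integral>s. norm (F (y, s)) \<partial>lborel)"
          by (rule integrable_cong_AE_imp) (use AE_levy_pos Fn in \<open>auto elim!: eventually_mono\<close>)
        show "AE y in levy \<phi>. integrable lborel (\<lambda>s. F (y, s))"
          using AE_levy_pos by eventually_elim (use Fi in \<open>auto simp: has_bochner_integral_iff\<close>)
      qed measurable
      have "(\<integral>x. F x \<partial>(levy \<phi> \<Otimes>\<^sub>M lborel)) = (\<integral>y. (\<integral>s. F (y, s) \<partial>lborel) \<partial>levy \<phi>)"
        using P.integral_fst'[OF intF] by simp
      also have "\<dots> = (\<integral>y. kern u y \<partial>levy \<phi>)"
      proof (rule integral_cong_AE)
        show "AE y in levy \<phi>. (\<integral>s. F (y, s) \<partial>lborel) = kern u y"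
          using AE_levy_pos by eventually_elim (use Fi in \<open>auto simp: has_bochner_integral_iff\<close>)
      qed (use kern_integrable[of u] ku in auto)
      finally have hF: "has_bochner_integral (levy \<phi> \<Otimes>\<^sub>M lborel) F (\<integral>y. kern u y \<partial>levy \<phi>)"
        using intF by (simp add: has_bochner_integral_iff)
      have Fe: "F = (\<lambda>x. (case x of (y, s) \<Rightarrow> indicator {0<..} y * indicator {0..1} s * (y * exp (- real k * (y * s)))) *\<^sub>R exp (- z * complex_of_real (case x of (y, s) \<Rightarrow> y * s)))"
      proof (rule ext)
        fix x :: "real \<times> real"
        obtain y s where x: "x = (y, s)" by (cases x)
        have "exp (- u * complex_of_real (y * s)) = complex_of_real (exp (- real k * (y * s))) * exp (- z * complex_of_real (y * s))"
          unfolding u_def exp_of_real[symmetric] exp_add[symmetric] by (simp add: algebra_simps)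
        thus "F x = (case x of (y, s) \<Rightarrow> indicator {0<..} y * indicator {0..1} s * (y * exp (- real k * (y * s)))) *\<^sub>R exp (- z * complex_of_real (case x of (y, s) \<Rightarrow> y * s))"
          unfolding x F_def prod.case by (simp only: scaleR_conv_of_real of_real_mult mult_ac)
      qed
      have "has_bochner_integral D (\<lambda>x. exp (- z * complex_of_real (case x of (y, s) \<Rightarrow> y * s))) (\<integral>y. kern u y \<partial>levy \<phi>)"
        unfolding D_def case_prod_unfold
        by (rule has_bochner_integral_density)
           (use hF[unfolded Fe] in \<open>auto simp: case_prod_unfold indicator_def\<close>)
      thus "has_laplace \<rho> z (\<integral>y. kern (of_nat k + z) y \<partial>levy \<phi>)"
        unfolding \<rho>_def u_def by (subst has_laplace_distr) (auto simp: case_prod_unfold)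
    qed (simp add: \<rho>_def)
  qed
  ultimately have "laplace_cone S (\<lambda>z. complex_of_real (drift \<phi>) + complex_of_real (killing \<phi>) / (of_nat k + z) + (\<integral>y. kern (of_nat k + z) y \<partial>levy \<phi>))"
    by (intro laplace_cone_add)
  hence "laplace_cone S (\<lambda>z. Q (of_nat k + z))" unfolding Q_def .
  moreover have "Q (of_nat k + 0) \<noteq> 0"
    using k bern_nonzero'[of "of_nat k"] by (simp add: Q_eq)
  ultimately show ?thesis using laplace_cone_prob[OF _ S0] by (force simp: S_def)
qed


section \<open>The exponential functional\<close>

text \<open>
  The Gauss product of the gamma function divided by that of \<open>\<phi>\<close>. Written with
  \<open>Q\<close>, the factors remain meaningful where \<open>k + z = 0\<close>.
\<close>

definition I_prod :: "nat \<Rightarrow> complex \<Rightarrow> complex" where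
  "I_prod n z = exp (- z * complex_of_real (ln (\<phi>\<^sub>r (real n) / real n))) * (\<Prod>k\<in>{0<..n}. Q (of_nat k + z) / Q (of_nat k))"

lemma Q_of_nat: "n \<ge> 1 \<Longrightarrow> Q (of_nat n) = complex_of_real (\<phi>\<^sub>r (real n) / real n)"
  by (simp add: Q_eq bern_of_nat)

lemma Q_of_nat_pos: "n \<ge> 1 \<Longrightarrow> 0 < \<phi>\<^sub>r (real n) / real n"
  by (simp add: phi_r_pos')

lemma I_prod_split:
  assumes N: "N \<le> n" "n \<ge> 1" "0 < Re z + real N + 1"
  shows "I_prod n z = (\<Prod>k\<in>{0<..N}. Q (of_nat k + z) / Q (of_nat k)) * (gauss_tail bern_id N n z / gauss_tail \<phi> N n z)"
proof -
  have U: "{0<..n} = {0<..N} \<union> {N<..n}" using N by auto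
  have "(\<Prod>k\<in>{0<..n}. Q (of_nat k + z) / Q (of_nat k)) =
     (\<Prod>k\<in>{0<..N}. Q (of_nat k + z) / Q (of_nat k)) * (\<Prod>k\<in>{N<..n}. Q (of_nat k + z) / Q (of_nat k))"
    unfolding U by (rule prod.union_disjoint) auto
  also have "(\<Prod>k\<in>{N<..n}. Q (of_nat k + z) / Q (of_nat k)) =
     (\<Prod>k\<in>{N<..n}. (of_nat k / (of_nat k + z)) / (bern \<phi> (of_nat k) / bern \<phi> (of_nat k + z)))"
  proof (rule prod.cong[OF refl])
    fix k assume k: "k \<in> {N<..n}"
    hence "real k \<ge> real N + 1" by auto
    hence "0 < Re (of_nat k + z)" using N by simp
    hence nz: "of_nat k + z \<noteq> 0" by (metis less_irrefl zero_complex.sel(1))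
    have kz: "k \<ge> 1" using k by auto
    show "Q (of_nat k + z) / Q (of_nat k) = (of_nat k / (of_nat k + z)) / (bern \<phi> (of_nat k) / bern \<phi> (of_nat k + z))"
      using kz Q_eq[OF nz] Q_eq[of "of_nat k"] by simp
  qed
  also have "\<dots> = (\<Prod>k\<in>{N<..n}. of_nat k / (of_nat k + z)) / (\<Prod>k\<in>{N<..n}. bern \<phi> (of_nat k) / bern \<phi> (of_nat k + z))"
    by (rule prod_dividef)
  finally have P: "(\<Prod>k\<in>{0<..n}. Q (of_nat k + z) / Q (of_nat k)) =
     (\<Prod>k\<in>{0<..N}. Q (of_nat k + z) / Q (of_nat k)) * ((\<Prod>k\<in>{N<..n}. of_nat k / (of_nat k + z)) / (\<Prod>k\<in>{N<..n}. bern \<phi> (of_nat k) / bern \<phi> (of_nat k + z)))" .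
  have pn: "\<phi>\<^sub>r (real n) > 0" using N by (intro phi_r_pos') auto
  have "exp (- z * complex_of_real (ln (\<phi>\<^sub>r (real n) / real n))) = of_nat n powr z / bern \<phi> (of_nat n) powr z"
  proof -
    have "of_nat n powr z = exp (z * complex_of_real (ln (real n)))"
      using N Ln_of_real[of "real n"] by (simp add: powr_def)
    moreover have "bern \<phi> (of_nat n) powr z = exp (z * complex_of_real (ln (\<phi>\<^sub>r (real n))))"
      using pn by (simp add: bern_of_nat powr_def Ln_of_real)
    moreover have L: "complex_of_real (ln (\<phi>\<^sub>r (real n) / real n)) = complex_of_real (ln (\<phi>\<^sub>r (real n))) - complex_of_real (ln (real n))"
      using pn N by (simp add: ln_divide_pos)
    ultimately show ?thesis unfolding L by (simp add: exp_diff[symmetric] algebra_simps)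
  qed
  thus ?thesis unfolding I_prod_def P gauss_tail_def bern_bern_id by simp
qed

lemma I_prod_converges: "convergent (\<lambda>n. I_prod n z)"
proof -
  obtain N :: nat where N: "0 < Re z + real N + 1"
    by (rule that[of "nat \<lceil>\<bar>Re z\<bar>\<rceil>"]) linarith
  obtain l where l: "l \<noteq> 0" "(\<lambda>n. gauss_tail \<phi> N n z) \<longlonglongrightarrow> l" using gauss_tail_converges[OF N] by blast
  obtain l' where l': "(\<lambda>n. gauss_tail bern_id N n z) \<longlonglongrightarrow> l'" using bern_id.gauss_tail_converges[OF N] by blast
  have "(\<lambda>n. (\<Prod>k\<in>{0<..N}. Q (of_nat k + z) / Q (of_nat k)) * (gauss_tail bern_id N n z / gauss_tail \<phi> N n z)) \<longlonglongrightarrow>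
     (\<Prod>k\<in>{0<..N}. Q (of_nat k + z) / Q (of_nat k)) * (l' / l)"
    by (intro tendsto_intros l l')
  moreover have "\<forall>\<^sub>F n in sequentially. (\<Prod>k\<in>{0<..N}. Q (of_nat k + z) / Q (of_nat k)) * (gauss_tail bern_id N n z / gauss_tail \<phi> N n z) = I_prod n z"
    using eventually_ge_at_top[of N] eventually_ge_at_top[of 1] by eventually_elim (simp add: I_prod_split[OF _ _ N])
  ultimately have "(\<lambda>n. I_prod n z) \<longlonglongrightarrow> (\<Prod>k\<in>{0<..N}. Q (of_nat k + z) / Q (of_nat k)) * (l' / l)"
    by (rule Lim_transform_eventually)
  thus ?thesis by (rule convergentI)
qed

text \<open>
  On the half-plane where they are finite, these are the moments of the exponential functional.
\<close>

definition IM :: "complex \<Rightarrow> complex" where "IM z = lim (\<lambda>n. I_prod n z)"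

lemma IM_LIMSEQ: "(\<lambda>n. I_prod n z) \<longlonglongrightarrow> IM z"
  unfolding IM_def by (rule convergent_LIMSEQ_iff[THEN iffD1, OF I_prod_converges])

lemma IM_Gamma:
  assumes "-1 < Re z"
  shows "IM z = Gamma (z + 1) / BG (z + 1)"
proof -
  have "- a_star_bern \<phi> < ereal (Re (z + 1))" using assms by (intro pos_gt_a_star) simp
  from BG_lim(1)[OF this] BG_nonzero[OF this]
  have "(\<lambda>n. gauss_tail bern_id 0 n z / gauss_tail \<phi> 0 n z) \<longlonglongrightarrow> Gamma (z + 1) / BG (z + 1)"
    by (intro tendsto_divide gauss_tail_id_LIMSEQ assms) auto
  moreover have "\<forall>\<^sub>F n in sequentially. gauss_tail bern_id 0 n z / gauss_tail \<phi> 0 n z = I_prod n z"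
    using eventually_ge_at_top[of 1] by eventually_elim (use assms in \<open>simp add: I_prod_split[of 0]\<close>)
  ultimately have "(\<lambda>n. I_prod n z) \<longlonglongrightarrow> Gamma (z + 1) / BG (z + 1)" by (rule Lim_transform_eventually)
  thus ?thesis using IM_LIMSEQ LIMSEQ_unique by blast
qed

lemma IM_0: "IM 0 = 1"
  by (simp add: IM_Gamma BG_1)

lemma Q_ratio_tendsto_1: "(\<lambda>n. Q (of_nat n + z) / Q (of_nat n)) \<longlonglongrightarrow> 1"
proof -
  have "(\<lambda>n. (bern \<phi> (of_nat n + z) / bern \<phi> (of_nat n)) / ((of_nat n + z) / of_nat n)) \<longlonglongrightarrow> 1 / 1"
    using bern_ratio_tendsto_1[of z] bern_id.bern_ratio_tendsto_1[of z, unfolded bern_bern_id] by (intro tendsto_divide) auto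
  moreover have "\<forall>\<^sub>F n in sequentially. (bern \<phi> (of_nat n + z) / bern \<phi> (of_nat n)) / ((of_nat n + z) / of_nat n) = Q (of_nat n + z) / Q (of_nat n)"
    using eventually_ge_at_top[of "nat \<lceil>\<bar>Re z\<bar>\<rceil> + 1"]
  proof eventually_elim
    case (elim n)
    hence "real n > \<bar>Re z\<bar>" by linarith
    hence "Re (of_nat n + z) > 0" by simp
    hence "of_nat n + z \<noteq> 0" by (metis less_irrefl zero_complex.sel(1))
    moreover have "(of_nat n :: complex) \<noteq> 0" using elim by simp
    ultimately show ?case by (simp add: Q_eq)
  qed
  ultimately show ?thesis using Lim_transform_eventually by fastforce
qed

text \<open>
  This recursion continues the moments to the left, one unit at a time.
\<close>

lemma IM_rec: "IM (z - 1) = Q z * IM z"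
proof -
  have eq: "I_prod n (z - 1) * (Q (of_nat n + z) / Q (of_nat n)) = Q z * I_prod n z" if n: "n \<ge> 1" for n
  proof -
    have nz: "Q (of_nat k) \<noteq> 0" if "k \<ge> 1" for k
      unfolding Q_of_nat[OF that] of_real_eq_0_iff using Q_of_nat_pos[OF that] by linarith
    have "(\<Prod>k\<in>{0<..n}. Q (of_nat k + (z - 1)) / Q (of_nat k)) * Q (of_nat n + z) = Q z * (\<Prod>k\<in>{0<..n}. Q (of_nat k + z) / Q (of_nat k))"
    proof (induction n)
      case (Suc n)
      have i: "{0<..Suc n} = insert (Suc n) {0<..n}" by auto
      have e: "of_nat (Suc n) + (z - 1) = of_nat n + z" by simp
      have P: "(\<Prod>k\<in>{0<..Suc n}. Q (of_nat k + (z - 1)) / Q (of_nat k)) = Q (of_nat n + z) / Q (of_nat (Suc n)) * (\<Prod>k\<in>{0<..n}. Q (of_nat k + (z - 1)) / Q (of_nat k))"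
        unfolding i by (subst prod.insert) (simp_all only: e, auto)
      have R: "(\<Prod>k\<in>{0<..Suc n}. Q (of_nat k + z) / Q (of_nat k)) = Q (of_nat (Suc n) + z) / Q (of_nat (Suc n)) * (\<Prod>k\<in>{0<..n}. Q (of_nat k + z) / Q (of_nat k))"
        unfolding i by (subst prod.insert) auto
      have "(\<Prod>k\<in>{0<..Suc n}. Q (of_nat k + (z - 1)) / Q (of_nat k)) * Q (of_nat (Suc n) + z) =
          ((\<Prod>k\<in>{0<..n}. Q (of_nat k + (z - 1)) / Q (of_nat k)) * Q (of_nat n + z)) * (Q (of_nat (Suc n) + z) / Q (of_nat (Suc n)))"
        unfolding P by (simp only: times_divide_eq_left times_divide_eq_right mult_ac)
      also have "\<dots> = Q z * (\<Prod>k\<in>{0<..Suc n}. Q (of_nat k + z) / Q (of_nat k))"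
        unfolding Suc.IH R by (simp only: mult_ac)
      finally show ?case .
    qed simp
    moreover have "exp (- (z - 1) * complex_of_real (ln (\<phi>\<^sub>r (real n) / real n))) = exp (- z * complex_of_real (ln (\<phi>\<^sub>r (real n) / real n))) * Q (of_nat n)"
    proof -
      have "exp (- (z - 1) * complex_of_real (ln (\<phi>\<^sub>r (real n) / real n))) = exp (- z * complex_of_real (ln (\<phi>\<^sub>r (real n) / real n))) * exp (complex_of_real (ln (\<phi>\<^sub>r (real n) / real n)))"
        unfolding exp_add[symmetric] by (simp add: algebra_simps)
      also have "exp (complex_of_real (ln (\<phi>\<^sub>r (real n) / real n))) = Q (of_nat n)"
        unfolding exp_of_real Q_of_nat[OF n] using Q_of_nat_pos[OF n] by (simp only: exp_ln)
      finally show ?thesis .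
    qed
    moreover have "(e * q * P) * (a / q) = b * (e * R)" if "P * a = b * R" "q \<noteq> 0" for e q P a b R :: complex
    proof -
      have "(e * q * P) * (a / q) = e * (P * a)" using that(2) by simp
      thus ?thesis unfolding that(1) by (simp only: mult_ac)
    qed
    ultimately show ?thesis unfolding I_prod_def using nz[OF n] by simp
  qed
  have "(\<lambda>n. I_prod n (z - 1) * (Q (of_nat n + z) / Q (of_nat n))) \<longlonglongrightarrow> IM (z - 1) * 1"
    by (intro tendsto_mult IM_LIMSEQ Q_ratio_tendsto_1)
  moreover have "\<forall>\<^sub>F n in sequentially. I_prod n (z - 1) * (Q (of_nat n + z) / Q (of_nat n)) = Q z * I_prod n z"
    using eventually_ge_at_top[of 1] by eventually_elim (rule eq)
  ultimately have "(\<lambda>n. Q z * I_prod n z) \<longlonglongrightarrow> IM (z - 1) * 1" by (rule Lim_transform_eventually)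
  moreover have "(\<lambda>n. Q z * I_prod n z) \<longlonglongrightarrow> Q z * IM z" by (intro tendsto_intros IM_LIMSEQ)
  ultimately show ?thesis using LIMSEQ_unique by fastforce
qed

lemma laplace_I_prod:
  assumes n: "n \<ge> 1"
  shows "\<exists>\<mu>. real_distribution \<mu> \<and> (\<forall>z. - a_killed \<phi> < ereal (Re z + 1) \<longrightarrow> has_laplace \<mu> z (I_prod n z))"
proof -
  have "\<exists>\<mu>. real_distribution \<mu> \<and> (\<forall>z\<in>{z. - a_killed \<phi> < ereal (Re z + 1)}.
     has_laplace \<mu> z (\<Prod>k\<in>{0<..n}. Q (of_nat k + z) / Q (of_nat k)))"
  proof (rule laplace_prod)
    fix k :: nat assume k: "1 \<le> k"
    obtain \<nu> where \<nu>: "real_distribution \<nu>" "\<And>z. - a_killed \<phi> < ereal (Re z + real k) \<Longrightarrow>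
      has_laplace \<nu> z (Q (of_nat k + z) / Q (of_nat k))"
      using laplace_Q_ratio[OF k] by blast
    have "- a_killed \<phi> < ereal (Re z + real k)" if "- a_killed \<phi> < ereal (Re z + 1)" for z :: complex
      by (rule less_le_trans[OF that]) (use k in simp)
    thus "\<exists>\<mu>. real_distribution \<mu> \<and> (\<forall>z\<in>{z. - a_killed \<phi> < ereal (Re z + 1)}.
       has_laplace \<mu> z (Q (of_nat k + z) / Q (of_nat k)))"
      using \<nu> by blast
  qed
  then obtain \<mu> where \<mu>: "real_distribution \<mu>" "\<And>z. - a_killed \<phi> < ereal (Re z + 1) \<Longrightarrow>
     has_laplace \<mu> z (\<Prod>k\<in>{0<..n}. Q (of_nat k + z) / Q (of_nat k))" by blast
  obtain \<rho> where \<rho>: "real_distribution \<rho>" "\<And>z v w. has_laplace (return borel (ln (\<phi>\<^sub>r (real n) / real n))) z v \<Longrightarrow> has_laplace \<mu> z w \<Longrightarrow> has_laplace \<rho> z (v * w)"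
    using real_distribution_convolution[OF real_distribution_return \<mu>(1)] by blast
  show ?thesis unfolding I_prod_def
    by (intro exI[of _ \<rho>] conjI allI impI \<rho>(1,2) has_laplace_return \<mu>(2))
qed

lemma open_a_killed: "open {x. - a_killed \<phi> < ereal (x + c)}"
  by (rule open_Collect_less) (auto intro!: continuous_intros continuous_on_ereal)

text \<open>
  The products are transforms of laws on the line, so their limit is one as well; the law sought is
  its image under \<open>y \<mapsto> exp (- y)\<close>.
\<close>

lemma exists_exponential_functional:
  "\<exists>\<mu>. real_distribution \<mu> \<and> (AE x in \<mu>. 0 < x) \<and>
     (\<forall>s. - a_killed \<phi> < ereal (Re s + 1) \<longrightarrow> has_bochner_integral \<mu> (\<lambda>x. complex_of_real x powr s) (IM s))"
proof -
  have "\<forall>n. \<exists>\<mu>. real_distribution \<mu> \<and> (\<forall>z. - a_killed \<phi> < ereal (Re z + 1) \<longrightarrow> has_laplace \<mu> z (I_prod (Suc n) z))"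
    using laplace_I_prod by simp
  then obtain \<mu> where \<mu>: "\<And>n. real_distribution (\<mu> n)" "\<And>n z. - a_killed \<phi> < ereal (Re z + 1) \<Longrightarrow> has_laplace (\<mu> n) z (I_prod (Suc n) z)"
    by metis
  have "\<exists>\<nu>. real_distribution \<nu> \<and> (\<forall>z. Re z \<in> {x. - a_killed \<phi> < ereal (x + 1)} \<longrightarrow> has_laplace \<nu> z (IM z))"
  proof (rule laplace_continuity[OF open_a_killed _ \<mu>(1)])
    show "0 \<in> {x. - a_killed \<phi> < ereal (x + 1)}" using pos_gt_a_killed[of 1] by simp
  next
    fix z assume "Re z \<in> {x. - a_killed \<phi> < ereal (x + 1)}"
    thus "\<forall>\<^sub>F n in sequentially. has_laplace (\<mu> n) z (I_prod (Suc n) z)" using \<mu>(2)[of z] by simp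
    show "(\<lambda>n. I_prod (Suc n) z) \<longlonglongrightarrow> IM z" by (rule LIMSEQ_Suc[OF IM_LIMSEQ])
  qed
  then obtain \<nu> where \<nu>: "real_distribution \<nu>" "\<And>z. - a_killed \<phi> < ereal (Re z + 1) \<Longrightarrow> has_laplace \<nu> z (IM z)" by auto
  interpret real_distribution \<nu> by fact
  show ?thesis
  proof (intro exI[of _ "distr \<nu> borel (\<lambda>y. exp (- y))"] conjI allI impI)
    show "real_distribution (distr \<nu> borel (\<lambda>y. exp (- y)))"
      by (rule real_distribution_distr) (auto intro: prob_space_axioms)
    show "AE x in distr \<nu> borel (\<lambda>y. exp (- y)). 0 < x" by (subst AE_distr_iff) auto
    fix s assume s: "- a_killed \<phi> < ereal (Re s + 1)"
    have e: "complex_of_real (exp (- y)) powr s = exp (- s * complex_of_real y)" for y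
      by (simp add: powr_def Ln_of_real algebra_simps)
    show "has_bochner_integral (distr \<nu> borel (\<lambda>y. exp (- y))) (\<lambda>x. complex_of_real x powr s) (IM s)"
      using \<nu>(2)[OF s] unfolding has_laplace_def has_bochner_integral_iff
      by (subst integrable_distr_eq integral_distr; simp add: e)+
  qed
qed

definition \<mu>\<^sub>I :: "real measure" where
  "\<mu>\<^sub>I = (SOME \<mu>. real_distribution \<mu> \<and> (AE x in \<mu>. 0 < x) \<and>
     (\<forall>s. - a_killed \<phi> < ereal (Re s + 1) \<longrightarrow> has_bochner_integral \<mu> (\<lambda>x. complex_of_real x powr s) (IM s)))"

lemma \<mu>\<^sub>I_distribution: "real_distribution \<mu>\<^sub>I" and \<mu>\<^sub>I_pos: "AE x in \<mu>\<^sub>I. 0 < x"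
  and \<mu>\<^sub>I_mellin: "- a_killed \<phi> < ereal (Re s + 1) \<Longrightarrow> has_bochner_integral \<mu>\<^sub>I (\<lambda>x. complex_of_real x powr s) (IM s)"
  using someI_ex[OF exists_exponential_functional] unfolding \<mu>\<^sub>I_def[symmetric] by auto

lemma norm_powr_pos: "0 < x \<Longrightarrow> norm (complex_of_real x powr s) = x powr Re s"
  by (simp add: norm_powr_real_powr)

lemma \<mu>\<^sub>I_real_moment:
  assumes "- a_killed \<phi> < ereal (c + 1)"
  shows "has_bochner_integral \<mu>\<^sub>I (\<lambda>x. x powr c) (Re (IM (complex_of_real c)))"
proof -
  have "has_bochner_integral \<mu>\<^sub>I (\<lambda>x. Re (complex_of_real x powr complex_of_real c)) (Re (IM (complex_of_real c)))"
    using \<mu>\<^sub>I_mellin[of "complex_of_real c"] assms by (intro has_bochner_integral_Re) simp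
  moreover have "AE x in \<mu>\<^sub>I. Re (complex_of_real x powr complex_of_real c) = x powr c"
    using \<mu>\<^sub>I_pos by eventually_elim (simp add: powr_of_real)
  moreover have "(\<lambda>x. x powr c) \<in> borel_measurable \<mu>\<^sub>I"
    using real_distribution.events_eq_borel[OF \<mu>\<^sub>I_distribution] by (simp cong: measurable_cong_sets)
  ultimately show ?thesis
    by (subst has_bochner_integral_cong_AE[symmetric]) (auto simp: has_bochner_integral_iff)
qed

lemma IM_holomorphic: "IM holomorphic_on {s. - a_killed \<phi> < ereal (Re s + 1)}"
proof -
  interpret real_distribution \<mu>\<^sub>I by (rule \<mu>\<^sub>I_distribution)
  define T where "T = {x. - a_killed \<phi> < ereal (x + 1)}"
  define S where "S = {s. - a_killed \<phi> < ereal (Re s + 1)}"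
  have ST: "s \<in> S \<longleftrightarrow> Re s \<in> T" for s by (simp add: S_def T_def)
  have oS: "open S"
  proof -
    have "S = Re -` T" by (auto simp: ST)
    thus ?thesis unfolding T_def using open_vimage[OF open_a_killed continuous_on_Re[OF continuous_on_id]] by simp
  qed
  have "(\<lambda>s. \<integral>x. (if 0 < x then complex_of_real x powr s else 0) \<partial>\<mu>\<^sub>I) holomorphic_on S"
  proof (rule holomorphic_on_integral[OF oS])
    fix s assume "s \<in> S"
    then obtain e where e: "e > 0" "ball s e \<subseteq> S" using oS openE by blast
    define r where "r = e / 2"
    have r: "r > 0" "cball s r \<subseteq> S" using e by (auto simp: r_def subset_iff)
    have ab: "- a_killed \<phi> < ereal ((Re s - r) + 1)" "- a_killed \<phi> < ereal ((Re s + r) + 1)"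
    proof -
      have "s - complex_of_real r \<in> S" "s + complex_of_real r \<in> S" using r by (auto simp: subset_iff dist_norm)
      thus "- a_killed \<phi> < ereal ((Re s - r) + 1)" "- a_killed \<phi> < ereal ((Re s + r) + 1)" by (simp_all add: S_def)
    qed
    have "norm (if 0 < x then complex_of_real x powr w else 0) \<le> x powr (Re s - r) + x powr (Re s + r)" if w: "w \<in> cball s r" for w x
    proof (cases "0 < x")
      case True
      have "\<bar>Re s - Re w\<bar> \<le> r" using abs_Re_le_cmod[of "s - w"] w by (simp add: dist_norm)
      hence R: "Re s - r \<le> Re w" "Re w \<le> Re s + r" by linarith+
      have "x powr Re w \<le> x powr (Re s - r) + x powr (Re s + r)"
      proof (cases "x \<ge> 1")
        case True
        hence "x powr Re w \<le> x powr (Re s + r)" using R by (intro powr_mono) auto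
        thus ?thesis by (simp add: add_increasing)
      next
        case False
        hence "x powr Re w \<le> x powr (Re s - r)" using R \<open>0 < x\<close> by (intro powr_mono') auto
        thus ?thesis by (simp add: add_increasing2)
      qed
      thus ?thesis using True by (simp add: norm_powr_pos)
    qed simp
    moreover have "integrable \<mu>\<^sub>I (\<lambda>x. x powr (Re s - r) + x powr (Re s + r))"
      using \<mu>\<^sub>I_real_moment[OF ab(1)] \<mu>\<^sub>I_real_moment[OF ab(2)] by (auto simp: has_bochner_integral_iff)
    ultimately show "\<exists>r>0. \<exists>B. cball s r \<subseteq> S \<and> integrable \<mu>\<^sub>I B \<and>
        (AE x in \<mu>\<^sub>I. \<forall>w\<in>cball s r. norm (if 0 < x then complex_of_real x powr w else 0) \<le> B x)"
      using r by blast
  next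
    fix x :: real
    show "(\<lambda>s. if 0 < x then complex_of_real x powr s else 0) holomorphic_on S"
      by (cases "0 < x") (auto intro!: holomorphic_intros)
  qed auto
  moreover have "(\<integral>x. (if 0 < x then complex_of_real x powr s else 0) \<partial>\<mu>\<^sub>I) = IM s" if s: "s \<in> S" for s
  proof -
    have "(\<integral>x. (if 0 < x then complex_of_real x powr s else 0) \<partial>\<mu>\<^sub>I) = (\<integral>x. complex_of_real x powr s \<partial>\<mu>\<^sub>I)"
      by (rule integral_cong_AE) (use \<mu>\<^sub>I_pos in \<open>auto elim: eventually_mono\<close>)
    thus ?thesis using \<mu>\<^sub>I_mellin[of s] s by (simp add: S_def has_bochner_integral_iff)
  qed
  ultimately show ?thesis unfolding S_def[symmetric] by (simp cong: holomorphic_cong)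
qed

text \<open>
  The moments of the exponential functional extend \<open>\<Gamma> / W\<close>, and the extension to
  the half-plane is unique by the identity theorem.
\<close>

lemma Gamma_over_W_eq: "Gamma_over_W \<phi> w = (if - a_killed \<phi> < ereal (Re w) then IM (w - 1) else 0)"
proof -
  define S where "S = {w. - a_killed \<phi> < ereal (Re w)}"
  define h where "h w = (if - a_killed \<phi> < ereal (Re w) then IM (w - 1) else 0)" for w
  have oS: "open S"
  proof -
    have "S = Re -` {x. - a_killed \<phi> < ereal (x + 0)}" by (auto simp: S_def)
    thus ?thesis using open_vimage[OF open_a_killed[of 0] continuous_on_Re[OF continuous_on_id]] by simp
  qed
  have cS: "connected S"
  proof (rule convex_connected, rule convexI)
    fix x y :: complex and u v :: real assume a: "x \<in> S" "y \<in> S" "0 \<le> u" "0 \<le> v" "u + v = 1"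
    have "min (Re x) (Re y) \<le> Re (u *\<^sub>R x + v *\<^sub>R y)"
    proof -
      have "u * min (Re x) (Re y) + v * min (Re x) (Re y) \<le> u * Re x + v * Re y"
        using a by (intro add_mono mult_left_mono) auto
      thus ?thesis using a(5) by (simp flip: distrib_right)
    qed
    moreover have "- a_killed \<phi> < ereal (min (Re x) (Re y))" using a by (simp add: S_def min_def)
    ultimately show "u *\<^sub>R x + v *\<^sub>R y \<in> S" unfolding S_def mem_Collect_eq by (meson ereal_less_eq(3) less_le_trans)
  qed
  have half: "{w. 0 < Re w} \<subseteq> S" using pos_gt_a_killed by (auto simp: S_def)
  have "Gamma_over_W \<phi> = h"
    unfolding Gamma_over_W_def
  proof (rule the_equality)
    have "(\<lambda>w. IM (w - 1)) holomorphic_on S"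
    proof -
      have "IM \<circ> (\<lambda>w. w - 1) holomorphic_on S"
        by (rule holomorphic_on_compose_gen[OF _ IM_holomorphic]) (auto intro!: holomorphic_intros simp: S_def)
      thus ?thesis by (simp add: o_def)
    qed
    moreover have "h w = IM (w - 1)" if "w \<in> S" for w using that by (simp add: h_def S_def)
    ultimately have hol: "h holomorphic_on S" by (simp cong: holomorphic_cong)
    have eq: "h w = Gamma w / W_bern \<phi> w" if "0 < Re w" for w
      using that half by (auto simp: h_def S_def W_bern_BG IM_Gamma[of "w - 1"])
    show hh: "h holomorphic_on {w. - a_killed \<phi> < ereal (Re w)} \<and> (\<forall>w. 0 < Re w \<longrightarrow> h w = Gamma w / W_bern \<phi> w) \<and>
       (\<forall>w. ereal (Re w) \<le> - a_killed \<phi> \<longrightarrow> h w = 0)"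
      using hol eq unfolding S_def by (auto simp: h_def not_less)
    fix g assume g: "g holomorphic_on {w. - a_killed \<phi> < ereal (Re w)} \<and> (\<forall>w. 0 < Re w \<longrightarrow> g w = Gamma w / W_bern \<phi> w) \<and>
       (\<forall>w. ereal (Re w) \<le> - a_killed \<phi> \<longrightarrow> g w = 0)"
    show "g = h"
    proof
      fix w show "g w = h w"
      proof (cases "w \<in> S")
        case True
        show ?thesis
        proof (rule analytic_continuation_open[OF open_halfspace_Re_gt[of 0] oS _ cS half _ hol _ True])
          show "{w::complex. 0 < Re w} \<noteq> {}" by (auto intro: exI[of _ 1])
        qed (use g eq in \<open>auto simp: S_def\<close>)
      next
        case False
        thus ?thesis using g hh by (auto simp: S_def not_less)
      qed
    qed
  qed
  thus ?thesis by (simp add: h_def)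
qed


section \<open>Growth of the Bernstein-gamma function on vertical lines\<close>

definition A\<^sub>\<phi> :: "real \<Rightarrow> real" where
  "A\<^sub>\<phi> b = integral {0..b} (\<lambda>u. Arg (bern \<phi> (1 + \<i> * complex_of_real u)))"

lemma L_primitive: "\<exists>F. \<forall>z. 0 < Re z \<longrightarrow> (F has_field_derivative L z) (at z)"
proof -
  obtain F where F: "\<And>z. z \<in> {z. 0 < Re z} \<Longrightarrow> (F has_field_derivative L z) (at z within {z. 0 < Re z})"
    using holomorphic_convex_primitive'[OF convex_halfspace_Re_gt open_halfspace_Re_gt L_holomorphic] by blast
  show ?thesis
  proof (intro exI allI impI)
    fix z assume "0 < Re z"
    thus "(F has_field_derivative L z) (at z)"
      using F[of z] at_within_open[OF _ open_halfspace_Re_gt, of z 0] by simp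
  qed
qed

text \<open>
  A primitive of \<open>log \<phi>\<close>; only its increments matter, so the choice is immaterial.
\<close>

definition F\<^sub>L :: "complex \<Rightarrow> complex" where
  "F\<^sub>L = (SOME F. \<forall>z. 0 < Re z \<longrightarrow> (F has_field_derivative L z) (at z))"

lemma F_L_deriv: "0 < Re z \<Longrightarrow> (F\<^sub>L has_field_derivative L z) (at z)"
  using someI_ex[OF L_primitive] unfolding F\<^sub>L_def by blast

lemma F_L_taylor:
  assumes m: "0 < m" "m \<le> Re w" "m \<le> Re z"
  shows "norm (F\<^sub>L z - F\<^sub>L w - L w * (z - w) - deriv L w * (z - w)\<^sup>2 / 2) \<le> 8 / m\<^sup>2 * norm (z - w) ^ 3 / 2"
    and "norm (F\<^sub>L z - F\<^sub>L w - L w * (z - w)) \<le> 2 / m * (norm (z - w))\<^sup>2"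
proof -
  define f where "f i = (if i = 0 then F\<^sub>L else (deriv ^^ (i - 1)) L)" for i :: nat
  have f: "(f i has_field_derivative f (Suc i) x) (at x within {v. m \<le> Re v})" if x: "m \<le> Re x" for i x
  proof (cases i)
    case 0
    thus ?thesis using F_L_deriv[of x] x m by (auto simp: f_def intro: has_field_derivative_at_within)
  next
    case (Suc j)
    have "(deriv ^^ j) L holomorphic_on {z. 0 < Re z}"
      by (intro holomorphic_higher_deriv L_holomorphic open_halfspace_Re_gt)
    thus ?thesis unfolding f_def
      using holomorphic_derivI[OF _ open_halfspace_Re_gt, of "(deriv ^^ j) L" 0 x] x m Suc by auto
  qed
  have "norm (f 0 z - (\<Sum>i\<le>2. f i w * (z - w) ^ i / fact i)) \<le> 8 / m\<^sup>2 * norm (z - w) ^ Suc 2 / fact 2"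
  proof (rule complex_Taylor[where S="{v. m \<le> Re v}"])
    fix x assume x: "x \<in> {v. m \<le> Re v}"
    have "8 / (Re x)\<^sup>2 \<le> 8 / m\<^sup>2" using x m by (intro divide_left_mono power_mono mult_pos_pos) auto
    thus "norm (f (Suc 2) x) \<le> 8 / m\<^sup>2" using deriv2_L_bound[of x] x m by (auto simp: f_def numeral_2_eq_2)
  qed (use m f convex_halfspace_Re_ge in auto)
  thus "norm (F\<^sub>L z - F\<^sub>L w - L w * (z - w) - deriv L w * (z - w)\<^sup>2 / 2) \<le> 8 / m\<^sup>2 * norm (z - w) ^ 3 / 2"
    by (simp add: f_def numeral_2_eq_2 numeral_3_eq_3 algebra_simps)
  have "norm (f 0 z - (\<Sum>i\<le>1. f i w * (z - w) ^ i / fact i)) \<le> 2 / m * norm (z - w) ^ Suc 1 / fact 1"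
  proof (rule complex_Taylor[where S="{v. m \<le> Re v}"])
    fix x assume x: "x \<in> {v. m \<le> Re v}"
    have "2 / Re x \<le> 2 / m" using x m by (intro divide_left_mono mult_pos_pos) auto
    thus "norm (f (Suc 1) x) \<le> 2 / m" using deriv_L_bound[of x] x m by (auto simp: f_def)
  qed (use m f convex_halfspace_Re_ge in auto)
  thus "norm (F\<^sub>L z - F\<^sub>L w - L w * (z - w)) \<le> 2 / m * (norm (z - w))\<^sup>2"
    by (simp add: f_def power2_eq_square algebra_simps)
qed

text \<open>
  The midpoint rule for the integral of \<open>log \<phi>\<close> over a unit segment. The second
  order terms cancel by symmetry, which leaves an error that is summable over \<open>z, z + 1, z +
  2, \<dots>\<close>.
\<close>

lemma midpoint_bound:
  assumes z: "1 \<le> Re z"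
  shows "norm (L z - (F\<^sub>L (z + 1/2) - F\<^sub>L (z - 1/2))) \<le> 4 / (Re z)\<^sup>2"
proof -
  define R where "R h = F\<^sub>L (z + h) - F\<^sub>L z - L z * h - deriv L z * h\<^sup>2 / 2" for h
  have b: "norm (R h) \<le> 2 / (Re z)\<^sup>2" if h: "h = 1/2 \<or> h = - 1/2" for h
  proof -
    have hn: "norm h = 1 / 2"
      using h by (elim disjE) (simp_all only: norm_divide norm_minus_cancel norm_one norm_numeral)
    have hr: "Re h \<ge> - 1 / 2" using abs_Re_le_cmod[of h] hn by linarith
    have "norm (F\<^sub>L (z + h) - F\<^sub>L z - L z * (z + h - z) - deriv L z * (z + h - z)\<^sup>2 / 2) \<le> 8 / (Re z / 2)\<^sup>2 * norm (z + h - z) ^ 3 / 2"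
    proof (rule F_L_taylor(1))
      show "Re z / 2 \<le> Re (z + h)" using z hr by simp
    qed (use z in auto)
    hence "norm (R h) \<le> 8 / (Re z / 2)\<^sup>2 * norm h ^ 3 / 2" by (simp add: R_def)
    also note hn
    finally show ?thesis by (simp add: power_divide eval_nat_numeral)
  qed
  have "L z - (F\<^sub>L (z + 1/2) - F\<^sub>L (z - 1/2)) = R (- 1/2) - R (1/2)"
    by (simp add: R_def field_simps)
  also have "norm \<dots> \<le> 2 / (Re z)\<^sup>2 + 2 / (Re z)\<^sup>2"
    using b[of "1/2"] b[of "- 1/2"] by (intro order_trans[OF norm_triangle_ineq4] add_mono) auto
  finally show ?thesis by simp
qed

text \<open>
  Minus the integral of \<open>arg \<phi>(x + i u)\<close> over \<open>0 \<le> u \<le> b\<close>.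
\<close>

definition H :: "real \<Rightarrow> real \<Rightarrow> real" where
  "H x b = Re (F\<^sub>L (Complex x b)) - Re (F\<^sub>L (complex_of_real x))"

text \<open>
  As \<open>log \<phi>(x)\<close> is real, the first order term along the vertical direction is
  purely imaginary.
\<close>

lemma H_small: "0 < x \<Longrightarrow> \<bar>H x b\<bar> \<le> 2 / x * b\<^sup>2"
proof -
  assume x: "0 < x"
  have "norm (F\<^sub>L (Complex x b) - F\<^sub>L (complex_of_real x) - L (complex_of_real x) * (Complex x b - complex_of_real x)) \<le> 2 / x * (norm (Complex x b - complex_of_real x))\<^sup>2"
    by (rule F_L_taylor(2)) (use x in auto)
  moreover have "Complex x b - complex_of_real x = \<i> * complex_of_real b" by (simp add: complex_eq_iff)
  moreover have "Re (F\<^sub>L (Complex x b) - F\<^sub>L (complex_of_real x) - L (complex_of_real x) * (\<i> * complex_of_real b)) = H x b"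
    using L_of_real[OF x] by (simp add: H_def)
  ultimately show ?thesis
    using abs_Re_le_cmod[of "F\<^sub>L (Complex x b) - F\<^sub>L (complex_of_real x) - L (complex_of_real x) * (\<i> * complex_of_real b)"]
    by (simp add: norm_mult power2_abs)
qed

lemma H_deriv:
  assumes x: "0 < x"
  shows "((\<lambda>x. H x b) has_real_derivative (ln (norm (bern \<phi> (Complex x b))) - ln (\<phi>\<^sub>r x))) (at x)"
proof -
  have "((\<lambda>v. F\<^sub>L (v + \<i> * complex_of_real b)) has_field_derivative L (complex_of_real x + \<i> * complex_of_real b)) (at (complex_of_real x))"
  proof -
    have 1: "(F\<^sub>L has_field_derivative L (complex_of_real x + \<i> * complex_of_real b)) (at (complex_of_real x + \<i> * complex_of_real b))"
      using x by (intro F_L_deriv) simp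
    have 2: "((\<lambda>v. v + \<i> * complex_of_real b) has_field_derivative 1) (at (complex_of_real x))"
      by (auto intro!: derivative_eq_intros)
    show ?thesis using DERIV_chain2[OF 1 2] by simp
  qed
  hence 1: "((\<lambda>v. F\<^sub>L (complex_of_real v + \<i> * complex_of_real b)) has_vector_derivative L (complex_of_real x + \<i> * complex_of_real b)) (at x)"
    by (rule has_vector_derivative_real_field)
  have 2: "((\<lambda>v. F\<^sub>L (complex_of_real v)) has_vector_derivative L (complex_of_real x)) (at x)"
    using F_L_deriv[of "complex_of_real x"] x by (intro has_vector_derivative_real_field) simp
  have "((\<lambda>v. Re (F\<^sub>L (complex_of_real v + \<i> * complex_of_real b)) - Re (F\<^sub>L (complex_of_real v))) has_real_derivative
     Re (L (complex_of_real x + \<i> * complex_of_real b)) - Re (L (complex_of_real x))) (at x)"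
    using bounded_linear.has_vector_derivative[OF bounded_linear_Re,OF 1] bounded_linear.has_vector_derivative[OF bounded_linear_Re,OF 2]
    by (intro DERIV_diff) (simp_all add: has_real_derivative_iff_has_vector_derivative)
  moreover have "Re (L (complex_of_real x + \<i> * complex_of_real b)) = ln (norm (bern \<phi> (Complex x b)))"
    using bern_nonzero'[of "Complex x b"] x by (simp add: L_def Complex_eq)
  moreover have "Re (L (complex_of_real x)) = ln (\<phi>\<^sub>r x)" using L_of_real[OF x] by simp
  ultimately show ?thesis by (simp add: H_def Complex_eq)
qed

lemma H_deriv_bounds:
  assumes x: "0 < x"
  shows "0 \<le> ln (norm (bern \<phi> (Complex x b))) - ln (\<phi>\<^sub>r x)"
    and "ln (norm (bern \<phi> (Complex x b))) - ln (\<phi>\<^sub>r x) \<le> ln (1 + \<bar>b\<bar> / x)"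
proof -
  have p: "\<phi>\<^sub>r x > 0" using x by (rule phi_r_pos')
  have le: "\<phi>\<^sub>r x \<le> norm (bern \<phi> (Complex x b))" using phi_r_le_norm_bern[of "Complex x b"] x by simp
  have "ln (\<phi>\<^sub>r x) \<le> ln (norm (bern \<phi> (Complex x b)))" using p le by (subst ln_le_cancel_iff) auto
  thus "0 \<le> ln (norm (bern \<phi> (Complex x b))) - ln (\<phi>\<^sub>r x)" by simp
  have "norm (bern \<phi> (Complex x b)) \<le> \<phi>\<^sub>r x * (1 + \<bar>b\<bar> / x)" using bern_growth[of "Complex x b"] x by simp
  hence "ln (norm (bern \<phi> (Complex x b))) \<le> ln (\<phi>\<^sub>r x * (1 + \<bar>b\<bar> / x))" using p le by (subst ln_le_cancel_iff) auto
  also have "\<dots> = ln (\<phi>\<^sub>r x) + ln (1 + \<bar>b\<bar> / x)"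
  proof (rule ln_mult_pos[OF p])
    show "0 < 1 + \<bar>b\<bar> / x" using x by (intro add_pos_nonneg) auto
  qed
  finally show "ln (norm (bern \<phi> (Complex x b))) - ln (\<phi>\<^sub>r x) \<le> ln (1 + \<bar>b\<bar> / x)" by simp
qed

lemma H_mono: "0 < x \<Longrightarrow> x \<le> y \<Longrightarrow> H x b \<le> H y b"
proof (rule DERIV_nonneg_imp_nondecreasing[of x y "\<lambda>x. H x b"])
  fix u assume "0 < x" "x \<le> u"
  hence "0 < u" by simp
  from H_deriv[OF this, of b] H_deriv_bounds(1)[OF this, of b]
  show "\<exists>d. ((\<lambda>x. H x b) has_real_derivative d) (at u) \<and> 0 \<le> d" by blast
qed

text \<open>
  \<open>H\<close> increases in \<open>x\<close> and vanishes as \<open>x \<longlonglongrightarrow>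
  \<infinity>\<close>.
\<close>

lemma H_nonpos: "0 < x \<Longrightarrow> H x b \<le> 0"
proof (rule tendsto_lowerbound[where F="at_top :: real filter" and f="\<lambda>y. 2 / y * b\<^sup>2"])
  assume x: "0 < x"
  show "((\<lambda>y. 2 / y * b\<^sup>2) \<longlongrightarrow> 0) at_top" by real_asymp
  show "\<forall>\<^sub>F y in at_top. H x b \<le> 2 / y * b\<^sup>2"
    using eventually_ge_at_top[of x]
  proof eventually_elim
    case (elim y)
    show ?case using H_mono[OF x elim, of b] H_small[of y b] x elim by linarith
  qed
qed simp

text \<open>
  Changing the abscissa changes \<open>H\<close> by at most a logarithm of \<open>|b|\<close>, hence
  does not affect exponential rates.
\<close>

lemma H_diff_bound:
  assumes x: "0 < x" "x \<le> y"
  shows "\<bar>H y b - H x b\<bar> \<le> (y - x) * ln (1 + \<bar>b\<bar> / x)"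
proof (cases "x = y")
  case False
  hence "x < y" using x by simp
  then obtain z where z: "z > x" "z < y" "H y b - H x b = (y - x) * (ln (norm (bern \<phi> (Complex z b))) - ln (\<phi>\<^sub>r z))"
    using MVT2[of x y "\<lambda>x. H x b" "\<lambda>z. ln (norm (bern \<phi> (Complex z b))) - ln (\<phi>\<^sub>r z)"] H_deriv x by force
  have z0: "0 < z" using z x by simp
  have "1 + \<bar>b\<bar> / z \<le> 1 + \<bar>b\<bar> / x" using z x by (intro add_left_mono divide_left_mono) auto
  moreover have "0 < 1 + \<bar>b\<bar> / z" using z0 by (intro add_pos_nonneg) auto
  ultimately have "ln (1 + \<bar>b\<bar> / z) \<le> ln (1 + \<bar>b\<bar> / x)" by (simp add: ln_le_cancel_iff)
  hence "\<bar>ln (norm (bern \<phi> (Complex z b))) - ln (\<phi>\<^sub>r z)\<bar> \<le> ln (1 + \<bar>b\<bar> / x)"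
    using H_deriv_bounds[OF z0, of b] by linarith
  thus ?thesis unfolding z(3) abs_mult using x by (intro mult_mono) auto
qed simp

lemma A_phi_H: "0 \<le> b \<Longrightarrow> A\<^sub>\<phi> b = - H 1 b"
proof -
  assume b: "0 \<le> b"
  have "((\<lambda>u. Arg (bern \<phi> (1 + \<i> * complex_of_real u))) has_integral - Re (F\<^sub>L (1 + \<i> * complex_of_real b)) - (- Re (F\<^sub>L (1 + \<i> * complex_of_real 0)))) {0..b}"
  proof (rule fundamental_theorem_of_calculus[OF b])
    fix u :: real
    have "((\<lambda>v. F\<^sub>L (1 + \<i> * v)) has_field_derivative L (1 + \<i> * complex_of_real u) * \<i>) (at (complex_of_real u))"
      using F_L_deriv[of "1 + \<i> * complex_of_real u"]
      by (intro DERIV_chain2[where g="\<lambda>v. 1 + \<i> * v"]) (auto intro!: derivative_eq_intros)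
    hence "((\<lambda>v. F\<^sub>L (1 + \<i> * complex_of_real v)) has_vector_derivative L (1 + \<i> * complex_of_real u) * \<i>) (at u)"
      by (rule has_vector_derivative_real_field)
    from has_vector_derivative_minus[OF bounded_linear.has_vector_derivative[OF bounded_linear_Re,OF this]]
    have "((\<lambda>v. - Re (F\<^sub>L (1 + \<i> * complex_of_real v))) has_vector_derivative Im (L (1 + \<i> * complex_of_real u))) (at u)" by simp
    moreover have "Im (L (1 + \<i> * complex_of_real u)) = Arg (bern \<phi> (1 + \<i> * complex_of_real u))"
      using bern_nonzero'[of "1 + \<i> * complex_of_real u"] by (simp add: L_def Arg_eq_Im_Ln)
    ultimately show "((\<lambda>v. - Re (F\<^sub>L (1 + \<i> * complex_of_real v))) has_vector_derivative Arg (bern \<phi> (1 + \<i> * complex_of_real u))) (at u within {0..b})"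
      by (simp add: has_vector_derivative_at_within)
  qed
  from integral_unique[OF this] show ?thesis unfolding A\<^sub>\<phi>_def H_def by (simp add: Complex_eq)
qed

lemma A_phi_nonneg: "0 \<le> b \<Longrightarrow> 0 \<le> A\<^sub>\<phi> b"
  using A_phi_H H_nonpos[of 1 b] by simp

lemma Arg_bern_bound: "\<bar>Arg (bern \<phi> (1 + \<i> * complex_of_real u))\<bar> < pi / 2"
  using Re_bern_pos'[of "1 + \<i> * complex_of_real u"] Re_Ln_pos_lt[of "bern \<phi> (1 + \<i> * complex_of_real u)"]
    bern_nonzero'[of "1 + \<i> * complex_of_real u"] by (simp add: Arg_eq_Im_Ln)

lemma A_phi_upper:
  assumes b: "0 \<le> b"
  shows "A\<^sub>\<phi> b \<le> pi / 2 * b"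
proof -
  have c: "continuous_on {0..b} (\<lambda>u. Arg (bern \<phi> (1 + \<i> * complex_of_real u)))"
  proof -
    have "continuous_on {0..b} (\<lambda>u. Im (L (1 + \<i> * complex_of_real u)))"
      by (intro continuous_intros continuous_on_compose2[OF holomorphic_on_imp_continuous_on[OF L_holomorphic]]) auto
    moreover have "Im (L (1 + \<i> * complex_of_real u)) = Arg (bern \<phi> (1 + \<i> * complex_of_real u))" for u
      using bern_nonzero'[of "1 + \<i> * complex_of_real u"] by (simp add: L_def Arg_eq_Im_Ln)
    ultimately show ?thesis by simp
  qed
  have "A\<^sub>\<phi> b \<le> integral {0..b} (\<lambda>u. pi / 2)"
    unfolding A\<^sub>\<phi>_def
  proof (rule integral_le)
    show "(\<lambda>u. Arg (bern \<phi> (1 + \<i> * complex_of_real u))) integrable_on {0..b}" by (rule integrable_continuous_real[OF c])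
    show "(\<lambda>u. pi / 2) integrable_on {0..b}" by (rule integrable_const_ivl)
    fix u show "Arg (bern \<phi> (1 + \<i> * complex_of_real u)) \<le> pi / 2" using Arg_bern_bound[of u] by linarith
  qed
  thus ?thesis using b by (simp add: mult.commute)
qed

lemma Theta_upper_eq:
  "ereal (Theta_upper \<phi>) = Limsup at_infinity (\<lambda>b::real. ereal (1 / \<bar>b\<bar> * A\<^sub>\<phi> \<bar>b\<bar>))"
  and Theta_nonneg: "0 \<le> Theta_upper \<phi>" and Theta_le: "Theta_upper \<phi> \<le> pi / 2"
proof -
  define l where "l = Limsup at_infinity (\<lambda>b::real. ereal (1 / \<bar>b\<bar> * A\<^sub>\<phi> \<bar>b\<bar>))"
  have nb: "(at_infinity :: real filter) \<noteq> bot" by (rule trivial_limit_at_infinity)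
  have up: "l \<le> ereal (pi / 2)"
    unfolding l_def
  proof (rule Limsup_bounded)
    show "\<forall>\<^sub>F b::real in at_infinity. ereal (1 / \<bar>b\<bar> * A\<^sub>\<phi> \<bar>b\<bar>) \<le> ereal (pi / 2)"
    proof (intro always_eventually allI)
      fix b :: real
      show "ereal (1 / \<bar>b\<bar> * A\<^sub>\<phi> \<bar>b\<bar>) \<le> ereal (pi / 2)"
        using A_phi_upper[of "\<bar>b\<bar>"] by (cases "b = 0") (auto simp: field_simps)
    qed
  qed
  have lo: "0 \<le> l"
    unfolding l_def
  proof (rule le_Limsup[OF nb])
    show "\<forall>\<^sub>F b::real in at_infinity. 0 \<le> ereal (1 / \<bar>b\<bar> * A\<^sub>\<phi> \<bar>b\<bar>)"
      by (intro always_eventually allI) (simp add: A_phi_nonneg)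
  qed
  have T: "Theta_upper \<phi> = real_of_ereal l" unfolding Theta_upper_def l_def A\<^sub>\<phi>_def ..
  obtain r where r: "l = ereal r" using up lo by (cases l) auto
  thus "ereal (Theta_upper \<phi>) = l" "0 \<le> Theta_upper \<phi>" "Theta_upper \<phi> \<le> pi / 2" using T up lo by auto
qed

lemma A_phi_growth:
  assumes d: "0 < d"
  shows "\<exists>C. \<forall>b\<ge>0. A\<^sub>\<phi> b \<le> C + (Theta_upper \<phi> + d) * b"
proof -
  have "Limsup at_infinity (\<lambda>b::real. ereal (1 / \<bar>b\<bar> * A\<^sub>\<phi> \<bar>b\<bar>)) < ereal (Theta_upper \<phi> + d)"
    unfolding Theta_upper_eq[symmetric] using d by simp
  hence "\<forall>\<^sub>F b::real in at_infinity. ereal (1 / \<bar>b\<bar> * A\<^sub>\<phi> \<bar>b\<bar>) < ereal (Theta_upper \<phi> + d)" by (rule Limsup_lessD)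
  then obtain B where B: "\<And>b::real. B \<le> norm b \<Longrightarrow> 1 / \<bar>b\<bar> * A\<^sub>\<phi> \<bar>b\<bar> < Theta_upper \<phi> + d"
    unfolding eventually_at_infinity by auto
  define C where "C = pi / 2 * (max B 1)"
  have "A\<^sub>\<phi> b \<le> C + (Theta_upper \<phi> + d) * b" if b: "0 \<le> b" for b
  proof (cases "b \<ge> max B 1")
    case True
    hence "A\<^sub>\<phi> b \<le> (Theta_upper \<phi> + d) * b" using B[of b] by (simp add: field_simps)
    moreover have "0 \<le> C" unfolding C_def by simp
    ultimately show ?thesis by simp
  next
    case False
    have "A\<^sub>\<phi> b \<le> pi / 2 * b" by (rule A_phi_upper[OF b])
    also have "\<dots> \<le> C" unfolding C_def using False by (intro mult_left_mono) auto
    finally show ?thesis using Theta_nonneg d b by (simp add: add_increasing2)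
  qed
  thus ?thesis by blast
qed

text \<open>
  By the midpoint rule, the sum telescopes.
\<close>

lemma gauss_sum_bound:
  assumes a: "1 \<le> a"
  shows "(\<Sum>j<n. Re (L (Complex (a + real j) b)) - Re (L (complex_of_real (a + real j)))) \<le>
      H (a + real n - 1/2) b - H (a - 1/2) b + (\<Sum>j<n. 8 / (a + real j)\<^sup>2)"
proof (induction n)
  case (Suc n)
  define x where "x = a + real n"
  have x: "1 \<le> x" using a by (simp add: x_def)
  have 1: "Re (L (Complex x b)) \<le> Re (F\<^sub>L (Complex (x + 1/2) b)) - Re (F\<^sub>L (Complex (x - 1/2) b)) + 4 / x\<^sup>2"
  proof -
    have "norm (L (Complex x b) - (F\<^sub>L (Complex x b + 1/2) - F\<^sub>L (Complex x b - 1/2))) \<le> 4 / x\<^sup>2"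
      using midpoint_bound[of "Complex x b", unfolded complex.sel, OF x] .
    moreover have "Complex x b + 1/2 = Complex (x + 1/2) b" "Complex x b - 1/2 = Complex (x - 1/2) b"
      by (simp_all add: complex_eq_iff)
    ultimately show ?thesis
      using complex_Re_le_cmod[of "L (Complex x b) - (F\<^sub>L (Complex (x + 1/2) b) - F\<^sub>L (Complex (x - 1/2) b))"]
      by (simp only: minus_complex.sel)
  qed
  have 2: "Re (F\<^sub>L (complex_of_real (x + 1/2))) - Re (F\<^sub>L (complex_of_real (x - 1/2))) - 4 / x\<^sup>2 \<le> Re (L (complex_of_real x))"
  proof -
    have "norm (L (complex_of_real x) - (F\<^sub>L (complex_of_real x + 1/2) - F\<^sub>L (complex_of_real x - 1/2))) \<le> 4 / x\<^sup>2"
      using midpoint_bound[of "complex_of_real x", unfolded Re_complex_of_real, OF x] .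
    moreover have "complex_of_real x + 1/2 = complex_of_real (x + 1/2)" "complex_of_real x - 1/2 = complex_of_real (x - 1/2)"
      by (simp_all add: complex_eq_iff)
    ultimately show ?thesis
      using abs_Re_le_cmod[of "L (complex_of_real x) - (F\<^sub>L (complex_of_real (x + 1/2)) - F\<^sub>L (complex_of_real (x - 1/2)))"]
      by (simp only: minus_complex.sel)
  qed
  have e: "a + real (Suc n) - 1/2 = x + 1/2" "a + real n - 1/2 = x - 1/2" by (simp_all add: x_def)
  show ?case
    using Suc.IH[unfolded e H_def] 1 2 unfolding sum.lessThan_Suc e x_def[symmetric] H_def by linarith
qed simp

text \<open>
  The logarithm of \<open>|W(a) / W(a + i b)|\<close> is the limit of the sums of \<open>log
  |\<phi>(a + j + i b)| - log \<phi>(a + j)\<close> over \<open>j < n\<close>, because the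
  prefactors of the Gauss products have the same modulus on a vertical line.
\<close>

lemma BG_lower_bound:
  assumes a: "1 \<le> a"
  shows "\<exists>c>0. \<forall>b. c * exp (H (a - 1/2) b) \<le> norm (BG (Complex a b))"
proof -
  have "summable (\<lambda>j. 8 * (inverse (real j ^ 2)))"
    by (intro summable_mult inverse_power_summable) auto
  hence "summable (\<lambda>j. 8 * (inverse (real (Suc j) ^ 2)))" by (subst summable_Suc_iff)
  hence sm: "summable (\<lambda>j. 8 / (a + real j)\<^sup>2)"
  proof (rule summable_comparison_test'[where N=0])
    fix j
    have "1 / (a + real j)\<^sup>2 \<le> 1 / (real (Suc j))\<^sup>2" using a by (intro divide_left_mono power_mono mult_pos_pos) auto
    thus "norm (8 / (a + real j)\<^sup>2) \<le> 8 * inverse (real (Suc j) ^ 2)" by (simp add: divide_inverse)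
  qed
  define K where "K = (\<Sum>j. 8 / (a + real j)\<^sup>2)"
  have K: "(\<Sum>j<n. 8 / (a + real j)\<^sup>2) \<le> K" for n
    unfolding K_def by (rule sum_le_suminf[OF sm]) auto
  have pos: "- a_star_bern \<phi> < ereal (Re (complex_of_real a))" "- a_star_bern \<phi> < ereal (Re (Complex a b))" for b
    using a by (auto intro!: pos_gt_a_star)
  define c where "c = norm (BG (complex_of_real a)) * exp (- K)"
  have "c > 0" using BG_nonzero[OF pos(1)] by (simp add: c_def)
  moreover have "c * exp (H (a - 1/2) b) \<le> norm (BG (Complex a b))" for b
  proof -
    have step: "norm (gauss_tail \<phi> 0 n (Complex a b - 1)) \<ge> norm (gauss_tail \<phi> 0 n (complex_of_real a - 1)) *
        exp (H (a - 1/2) b - K - H (a + real n - 1/2) b)" if n: "n \<ge> 1" for n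
    proof -
      define S where "S = (\<Sum>j<n. Re (L (Complex (a + real j) b)) - Re (L (complex_of_real (a + real j))))"
      have pn: "\<phi>\<^sub>r (real n) > 0" using n by (intro phi_r_pos') auto
      have nm: "norm (gauss_tail \<phi> 0 n (w - 1)) = \<phi>\<^sub>r (real n) powr (Re w - 1) * (\<Prod>k\<in>{0<..n}. \<phi>\<^sub>r (real k)) / exp (\<Sum>j<n. Re (L (of_nat j + w)))"
        if w: "0 < Re w" for w
      proof -
        have "norm (bern \<phi> (of_nat n) powr (w - 1)) = \<phi>\<^sub>r (real n) powr (Re w - 1)"
          unfolding bern_of_nat using norm_powr_pos[OF pn] by simp
        moreover have "norm (\<Prod>k\<in>{0<..n}. bern \<phi> (of_nat k) / bern \<phi> (of_nat k + (w - 1))) = (\<Prod>k\<in>{0<..n}. \<phi>\<^sub>r (real k)) / exp (\<Sum>j<n. Re (L (of_nat j + w)))"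
        proof -
          have "norm (\<Prod>k\<in>{0<..n}. bern \<phi> (of_nat k) / bern \<phi> (of_nat k + (w - 1))) = (\<Prod>k\<in>{0<..n}. \<phi>\<^sub>r (real k)) / (\<Prod>k\<in>{0<..n}. norm (bern \<phi> (of_nat k + (w - 1))))"
            unfolding prod_norm[symmetric] norm_divide prod_dividef
            by (intro arg_cong2[where f="(/)"] prod.cong refl) (auto simp: bern_of_nat intro!: abs_of_pos phi_r_pos')
          also have "(\<Prod>k\<in>{0<..n}. norm (bern \<phi> (of_nat k + (w - 1)))) = (\<Prod>j<n. norm (bern \<phi> (of_nat j + w)))"
          proof -
            have "(\<Prod>k\<in>{0<..n}. norm (bern \<phi> (of_nat k + (w - 1)))) = (\<Prod>k\<in>{1..n}. norm (bern \<phi> (of_nat k + (w - 1))))"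
              by (simp add: atLeastSucAtMost_greaterThanAtMost[symmetric])
            also have "\<dots> = (\<Prod>j<n. norm (bern \<phi> (of_nat j + w)))"
              unfolding One_nat_def prod.atLeast1_atMost_eq by (intro prod.cong refl) (simp add: add_ac)
            finally show ?thesis .
          qed
          also have "\<dots> = (\<Prod>j<n. exp (Re (L (of_nat j + w))))"
          proof (intro prod.cong refl)
            fix j
            have "0 < Re (of_nat j + w)" using w by simp
            from exp_L[OF this] show "norm (bern \<phi> (of_nat j + w)) = exp (Re (L (of_nat j + w)))"
              by (metis norm_exp_eq_Re)
          qed
          also have "\<dots> = exp (\<Sum>j<n. Re (L (of_nat j + w)))" by (simp add: exp_sum)
          finally show ?thesis .
        qed
        ultimately show ?thesis unfolding gauss_tail_def norm_mult by simp
      qed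
      have e: "of_nat j + Complex a b = Complex (a + real j) b" "of_nat j + complex_of_real a = complex_of_real (a + real j)" for j
        by (simp_all add: complex_eq_iff)
      have S_le: "S \<le> H (a + real n - 1/2) b - H (a - 1/2) b + K"
        unfolding S_def using gauss_sum_bound[OF a, of b n] K[of n] by linarith
      have "norm (gauss_tail \<phi> 0 n (Complex a b - 1)) = norm (gauss_tail \<phi> 0 n (complex_of_real a - 1)) * exp (- S)"
      proof -
        define X where "X = \<phi>\<^sub>r (real n) powr (a - 1) * (\<Prod>k\<in>{0<..n}. \<phi>\<^sub>r (real k))"
        define S1 where "S1 = (\<Sum>j<n. Re (L (Complex (a + real j) b)))"
        define S2 where "S2 = (\<Sum>j<n. Re (L (complex_of_real (a + real j))))"
        have "norm (gauss_tail \<phi> 0 n (Complex a b - 1)) = X / exp S1"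
          using nm[of "Complex a b"] a by (simp add: e X_def S1_def)
        moreover have "norm (gauss_tail \<phi> 0 n (complex_of_real a - 1)) = X / exp S2"
          using nm[of "complex_of_real a"] a unfolding e(2) X_def S2_def by simp
        moreover have "S = S1 - S2" by (simp add: S_def S1_def S2_def sum_subtractf)
        ultimately show ?thesis by (simp add: exp_diff)
      qed
      also have "\<dots> \<ge> norm (gauss_tail \<phi> 0 n (complex_of_real a - 1)) * exp (H (a - 1/2) b - K - H (a + real n - 1/2) b)"
        using S_le by (intro mult_left_mono) auto
      finally show ?thesis .
    qed
    have H0: "(\<lambda>n. H (a + real n - 1/2) b) \<longlonglongrightarrow> 0"
    proof (rule Lim_null_comparison)
      show "\<forall>\<^sub>F n in sequentially. norm (H (a + real n - 1/2) b) \<le> 2 / (a + real n - 1/2) * b\<^sup>2"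
        using a H_small by (intro always_eventually allI) auto
      show "(\<lambda>n. 2 / (a + real n - 1/2) * b\<^sup>2) \<longlonglongrightarrow> 0" by real_asymp
    qed
    have "norm (BG (complex_of_real a)) * exp (H (a - 1/2) b - K - 0) \<le> norm (BG (Complex a b))"
    proof (rule tendsto_le[OF trivial_limit_sequentially])
      show "(\<lambda>n. norm (gauss_tail \<phi> 0 n (Complex a b - 1))) \<longlonglongrightarrow> norm (BG (Complex a b))"
        by (intro tendsto_norm BG_lim pos)
      show "(\<lambda>n. norm (gauss_tail \<phi> 0 n (complex_of_real a - 1)) * exp (H (a - 1/2) b - K - H (a + real n - 1/2) b)) \<longlonglongrightarrow>
         norm (BG (complex_of_real a)) * exp (H (a - 1/2) b - K - 0)"
        by (intro tendsto_intros BG_lim pos H0)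
      show "\<forall>\<^sub>F n in sequentially. norm (gauss_tail \<phi> 0 n (complex_of_real a - 1)) * exp (H (a - 1/2) b - K - H (a + real n - 1/2) b) \<le> norm (gauss_tail \<phi> 0 n (Complex a b - 1))"
        using eventually_ge_at_top[of 1] by eventually_elim (rule step)
    qed
    moreover have "norm (BG (complex_of_real a)) * exp (H (a - 1/2) b - K - 0) = c * exp (H (a - 1/2) b)"
    proof -
      have "exp (H (a - 1/2) b - K - 0) = exp (- K) * exp (H (a - 1/2) b)"
        unfolding exp_add[symmetric] by simp
      thus ?thesis by (simp only: c_def mult.assoc)
    qed
    ultimately show ?thesis by simp
  qed
  ultimately show ?thesis by blast
qed

text \<open>
  Both sides have the same derivative in \<open>x\<close>, by symmetry of \<open>\<phi>\<close>
  under conjugation, and vanish as \<open>x \<longlonglongrightarrow> \<infinity>\<close>.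
\<close>

lemma H_abs: "0 < x \<Longrightarrow> H x b = H x \<bar>b\<bar>"
proof -
  assume x: "0 < x"
  define g where "g y = H y b - H y \<bar>b\<bar>" for y
  have "norm (bern \<phi> (Complex y b)) = norm (bern \<phi> (Complex y \<bar>b\<bar>))" for y
    using bern_cnj[of "Complex y b"] by (cases "b \<ge> 0") (auto simp: complex_cnj)
  hence d: "(g has_real_derivative 0) (at y)" if "0 < y" for y
    unfolding g_def[abs_def] using DERIV_diff[OF H_deriv[OF that, of b] H_deriv[OF that, of "\<bar>b\<bar>"]] by simp
  have gy: "g x = g y" if "x < y" for y
  proof (rule sym[OF DERIV_isconst_end[OF that]])
    show "continuous_on {x..y} g"
    proof (rule continuous_at_imp_continuous_on, rule ballI)
      fix u assume "u \<in> {x..y}"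
      hence "0 < u" using x by auto
      thus "isCont g u" by (rule DERIV_isCont[OF d])
    qed
  qed (use d x in auto)
  have ev: "\<forall>\<^sub>F y in at_top. norm (g x) \<le> 4 / y * b\<^sup>2"
    using eventually_gt_at_top[of x]
  proof eventually_elim
    case (elim y)
    have "\<bar>g y\<bar> \<le> 2 / y * b\<^sup>2 + 2 / y * \<bar>b\<bar>\<^sup>2" using H_small[of y b] H_small[of y "\<bar>b\<bar>"] elim x unfolding g_def by linarith
    thus ?case using gy[OF elim] by simp
  qed
  have "norm (g x) \<le> 0"
    by (rule tendsto_lowerbound[where F="at_top :: real filter" and f="\<lambda>y. 4 / y * b\<^sup>2", OF _ ev]) (real_asymp, simp)
  thus ?thesis by (simp add: g_def)
qed

text \<open>
  For \<open>a \<ge> 1\<close>, compare \<open>H\<close> at \<open>a - 1/2\<close> with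
  \<open>H\<close> at \<open>1\<close>, which is minus the integral that defines
  \<open>Theta_upper\<close>; the logarithmic error is absorbed in \<open>d\<close>. For smaller
  \<open>a\<close>, the recursion costs one factor \<open>\<phi>(a + i b)\<close> of linear growth.
\<close>

theorem BG_decay:
  assumes a: "0 < a" and d: "0 < d"
  shows "\<exists>C. \<forall>b. norm (1 / BG (Complex a b)) \<le> C * exp ((Theta_upper \<phi> + d) * \<bar>b\<bar>)"
proof -
  have base: "\<exists>C. \<forall>b. norm (1 / BG (Complex a b)) \<le> C * exp ((Theta_upper \<phi> + d) * \<bar>b\<bar>)" if a: "1 \<le> a" and d: "0 < d" for a d
  proof -
    obtain c where c: "c > 0" "\<And>b. c * exp (H (a - 1/2) b) \<le> norm (BG (Complex a b))" using BG_lower_bound[OF a] by blast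
    obtain C where C: "\<And>b. b \<ge> 0 \<Longrightarrow> A\<^sub>\<phi> b \<le> C + (Theta_upper \<phi> + d / 2) * b" using A_phi_growth[of "d/2"] d by auto
    define m where "m = min (a - 1/2) 1"
    have m: "m > 0" using a by (simp add: m_def)
    \<comment> \<open>The distance between the abscissas a - 1/2 and 1.\<close>
    define k where "k = \<bar>a - 3/2\<bar>"
    have "\<exists>D. \<forall>b\<ge>0. k * ln (1 + b / m) \<le> D + d / 2 * b"
    proof -
      have "ln (1 + b / m) \<le> ln (2 * k / (d * m) + 1) + (1 + b / m) / (2 * k / (d * m) + 1)" if "b \<ge> 0" for b
      proof -
        define y where "y = 2 * k / (d * m) + 1"
        have y: "y > 0" using m d by (simp add: y_def k_def add_nonneg_pos)
        have p: "1 + b / m > 0" using m that by (simp add: add_pos_nonneg)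
        have "ln ((1 + b / m) / y) \<le> (1 + b / m) / y - 1" using p y by (intro ln_le_minus_one) simp
        thus ?thesis using p y unfolding y_def[symmetric] by (simp add: ln_divide_pos)
      qed
      hence "k * ln (1 + b / m) \<le> k * (ln (2 * k / (d * m) + 1) + 1) + d / 2 * b" if b: "b \<ge> 0" for b
      proof -
        \<comment> \<open>The tangent of ln at y has slope at most d / 2 after scaling by k / m.\<close>
        define y where "y = 2 * k / (d * m) + 1"
        have y: "y \<ge> 1" using m d by (simp add: y_def k_def)
        have k0: "k \<ge> 0" by (simp add: k_def)
        have 1: "ln (1 + b / m) \<le> ln y + (1 + b / m) / y" using \<open>\<And>b. b \<ge> 0 \<Longrightarrow> ln (1 + b / m) \<le> _\<close>[OF b] by (simp add: y_def)
        have "(1 + b / m) / y = 1 / y + b / (m * y)" using y m by (simp add: field_simps)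
        also have "\<dots> \<le> 1 + b / (m * y)" using y by simp
        finally have "k * ln (1 + b / m) \<le> k * (ln y + 1) + k * (b / (m * y))"
          using mult_left_mono[OF 1 k0] k0 by (smt (verit) mult_left_mono distrib_left)
        also have "k * (b / (m * y)) \<le> d / 2 * b"
        proof -
          have "m * y = 2 * k / d + m" using m d by (simp add: y_def field_simps)
          hence "d / 2 * (m * y) = k + d / 2 * m" using d by (simp add: field_simps)
          moreover have "0 \<le> d / 2 * m" using m d by simp
          ultimately have "k \<le> d / 2 * (m * y)" by linarith
          moreover have "0 < m * y" using m y by simp
          ultimately have "k / (m * y) \<le> d / 2" by (subst pos_divide_le_eq)
          from mult_right_mono[OF this b] show ?thesis by simp
        qed
        finally show ?thesis by (simp add: y_def)
      qed
      thus ?thesis by blast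
    qed
    then obtain D where D: "\<And>b. b \<ge> 0 \<Longrightarrow> k * ln (1 + b / m) \<le> D + d / 2 * b" by blast
    have "norm (1 / BG (Complex a b)) \<le> exp (C + D) / c * exp ((Theta_upper \<phi> + d) * \<bar>b\<bar>)" for b
    proof -
      have Hd: "- H (a - 1/2) b \<le> - H 1 b + k * ln (1 + \<bar>b\<bar> / m)"
      proof (cases "a - 1/2 \<le> 1")
        case True
        thus ?thesis using H_diff_bound[of "a - 1/2" 1 b] a by (simp add: m_def k_def min_def)
      next
        case False
        thus ?thesis using H_diff_bound[of 1 "a - 1/2" b] a by (simp add: m_def k_def min_def)
      qed
      also have "- H 1 b = A\<^sub>\<phi> \<bar>b\<bar>" using A_phi_H[of "\<bar>b\<bar>"] H_abs[of 1 b] by simp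
      also have "A\<^sub>\<phi> \<bar>b\<bar> + k * ln (1 + \<bar>b\<bar> / m) \<le> (C + (Theta_upper \<phi> + d / 2) * \<bar>b\<bar>) + (D + d / 2 * \<bar>b\<bar>)"
        by (intro add_mono C D) auto
      also have "\<dots> = (C + D) + (Theta_upper \<phi> + d) * \<bar>b\<bar>" by (simp add: algebra_simps)
      finally have "exp (- H (a - 1/2) b) \<le> exp (C + D) * exp ((Theta_upper \<phi> + d) * \<bar>b\<bar>)"
        unfolding exp_add[symmetric] by simp
      moreover have "norm (1 / BG (Complex a b)) \<le> 1 / (c * exp (H (a - 1/2) b))"
        using c(2)[of b] c(1) by (simp add: norm_divide frac_le)
      moreover have "1 / (c * exp (H (a - 1/2) b)) = exp (- H (a - 1/2) b) / c" by (simp add: exp_minus field_simps)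
      ultimately show ?thesis using c(1) by (simp add: divide_right_mono order_trans)
    qed
    thus ?thesis by blast
  qed
  show ?thesis
  proof (cases "1 \<le> a")
    case True
    thus ?thesis using base d by blast
  next
    case False
    obtain C where C: "\<And>b. norm (1 / BG (Complex (a + 1) b)) \<le> C * exp ((Theta_upper \<phi> + d / 2) * \<bar>b\<bar>)"
      using base[of "a + 1" "d / 2"] a d by auto
    define P where "P = \<phi>\<^sub>r a"
    have P: "P > 0" using a by (simp add: P_def phi_r_pos')
    define D where "D = P * (1 + 2 / (a * d))"
    have "norm (1 / BG (Complex a b)) \<le> D * C * exp ((Theta_upper \<phi> + d) * \<bar>b\<bar>)" for b
    proof -
      have "- a_star_bern \<phi> < ereal (Re (Complex a b))" using a by (intro pos_gt_a_star) simp
      from BG_rec[OF this] BG_nonzero[OF this] bern_nonzero[OF this]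
      have "1 / BG (Complex a b) = bern \<phi> (Complex a b) * (1 / BG (Complex (a + 1) b))"
        by (simp add: Complex_eq add_ac)
      hence "norm (1 / BG (Complex a b)) = norm (bern \<phi> (Complex a b)) * norm (1 / BG (Complex (a + 1) b))"
        by (simp add: norm_mult norm_divide)
      also have "\<dots> \<le> (D * exp (d / 2 * \<bar>b\<bar>)) * (C * exp ((Theta_upper \<phi> + d / 2) * \<bar>b\<bar>))"
      proof (intro mult_mono C)
        have "norm (bern \<phi> (Complex a b)) \<le> P * (1 + \<bar>b\<bar> / a)" using bern_growth[of "Complex a b"] a by (simp add: P_def)
        also have "1 + \<bar>b\<bar> / a \<le> (1 + 2 / (a * d)) * (1 + d / 2 * \<bar>b\<bar>)"
          using a d by (simp add: field_simps)
        also have "\<dots> \<le> (1 + 2 / (a * d)) * exp (d / 2 * \<bar>b\<bar>)"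
          using a d by (intro mult_left_mono exp_ge_add_one_self) auto
        finally show "norm (bern \<phi> (Complex a b)) \<le> D * exp (d / 2 * \<bar>b\<bar>)"
          using P by (simp add: D_def mult.assoc)
      qed (use P a d in \<open>auto simp: D_def intro!: mult_nonneg_nonneg\<close>)
      also have "\<dots> = D * C * exp ((Theta_upper \<phi> + d) * \<bar>b\<bar>)"
      proof -
        have "exp ((Theta_upper \<phi> + d) * \<bar>b\<bar>) = exp (d / 2 * \<bar>b\<bar>) * exp ((Theta_upper \<phi> + d / 2) * \<bar>b\<bar>)"
          unfolding exp_add[symmetric] by (simp add: algebra_simps)
        thus ?thesis by simp
      qed
      finally show ?thesis .
    qed
    thus ?thesis by blast
  qed
qed

end


section \<open>Mellin inversion\<close>

text \<open>
  Levy's inversion formula expresses the mass of an interval by an integral that is absolutely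
  convergent once the characteristic function is integrable, and that can be differentiated in the
  end point.
\<close>

lemma (in real_distribution) measure_Ioc_has_derivative:
  assumes int: "integrable lborel (char M)" and atoms: "\<And>x. measure M {x} = 0" and ax: "a < x"
  shows "((\<lambda>y. measure M {a<..y}) has_real_derivative
      Re (1 / (2 * pi) * (\<integral>t. iexp (- (t * x)) * char M t \<partial>lborel))) (at x)"
proof -
  define K where "K y t = (iexp (- (t * a)) - iexp (- (t * y))) / (\<i> * complex_of_real t)" for y t
  define D where "D y = (\<integral>t. K y t * char M t \<partial>lborel)" for y
  have Kb: "norm (K y t - K z t) \<le> \<bar>y - z\<bar>" if "t \<noteq> 0" for y z t
  proof -
    have "K y t - K z t = (iexp (t * (-z)) - iexp (t * (-y))) / (\<i> * complex_of_real t)"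
      by (simp add: K_def diff_divide_distrib)
    moreover have "norm ((iexp (t * (-z)) - iexp (t * (-y))) / (\<i> * complex_of_real t)) \<le> \<bar>y - z\<bar>"
    proof (cases "y \<ge> z")
      case True thus ?thesis using Levy_Inversion_aux2[of "-y" "-z" t] that by simp
    next
      case False
      have "norm ((iexp (t * (-z)) - iexp (t * (-y))) / (\<i> * complex_of_real t)) = norm ((iexp (t * (-y)) - iexp (t * (-z))) / (\<i> * complex_of_real t))"
        by (simp add: norm_divide norm_minus_commute)
      thus ?thesis using Levy_Inversion_aux2[of "-z" "-y" t] that False by simp
    qed
    ultimately show ?thesis by simp
  qed
  have Ka: "K a t = 0" for t by (simp add: K_def)
  have [measurable]: "K y \<in> borel_measurable borel" for y unfolding K_def by measurable
  have [measurable]: "char M \<in> borel_measurable borel" using int by auto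
  have AE0: "AE t in lborel. t \<noteq> (0::real)" by (rule AE_lborel_singleton)
  have KI: "integrable lborel (\<lambda>t. K y t * char M t)" for y
  proof (rule Bochner_Integration.integrable_bound[OF integrable_mult_right[OF integrable_norm[OF int], of "\<bar>y - a\<bar>"]])
    show "AE t in lborel. norm (K y t * char M t) \<le> norm (\<bar>y - a\<bar> * norm (char M t))"
      using AE0 by eventually_elim (use Kb[of _ y a] Ka in \<open>auto simp: norm_mult intro!: mult_right_mono\<close>)
  qed measurable
  have D: "complex_of_real (measure M {a<..y}) = 1 / (2 * pi) * D y" if y: "a \<le> y" for y
  proof -
    have "(\<lambda>T. 1 / (2 * pi) * (CLBINT t=-ereal (real T)..ereal (real T). K y t * char M t)) \<longlonglongrightarrow> complex_of_real (measure M {a<..y})"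
      unfolding K_def using Levy_Inversion[OF y atoms atoms] by simp
    moreover have "(\<lambda>T::nat. 1 / (2 * pi) * (CLBINT t=-ereal (real T)..ereal (real T). K y t * char M t)) \<longlonglongrightarrow> 1 / (2 * pi) * D y"
    proof -
      have "(\<lambda>T::nat. \<integral>t. indicator {- real T<..<real T} t *\<^sub>R (K y t * char M t) \<partial>lborel) \<longlonglongrightarrow> D y"
        unfolding D_def
      proof (rule integral_dominated_convergence[where w="\<lambda>t. norm (K y t * char M t)"])
        show "AE t in lborel. (\<lambda>T. indicator {- real T<..<real T} t *\<^sub>R (K y t * char M t)) \<longlonglongrightarrow> K y t * char M t"
        proof (intro AE_I2 tendsto_eventually)
          fix t :: real
          show "\<forall>\<^sub>F T in sequentially. indicator {- real T<..<real T} t *\<^sub>R (K y t * char M t) = K y t * char M t"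
            using eventually_gt_at_top[of "nat \<lceil>\<bar>t\<bar>\<rceil>"]
          proof eventually_elim
            case (elim T)
            hence "\<bar>t\<bar> < real T" by linarith
            thus ?case by (auto simp: indicator_def)
          qed
        qed
      qed (use KI in \<open>auto simp: indicator_def\<close>)
      moreover have "(CLBINT t=-ereal (real T)..ereal (real T). K y t * char M t) = (\<integral>t. indicator {- real T<..<real T} t *\<^sub>R (K y t * char M t) \<partial>lborel)" for T :: nat
        by (simp add: interval_lebesgue_integral_def einterval_eq set_lebesgue_integral_def)
      ultimately have "(\<lambda>T::nat. CLBINT t=-ereal (real T)..ereal (real T). K y t * char M t) \<longlonglongrightarrow> D y" by simp
      thus ?thesis by (rule tendsto_mult[OF tendsto_const])
    qed
    ultimately show ?thesis by (rule LIMSEQ_unique)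
  qed
  have Dd: "((\<lambda>y. (D y - D x) / complex_of_real (y - x)) \<longlongrightarrow> (\<integral>t. iexp (- (t * x)) * char M t \<partial>lborel)) (at x)"
    unfolding tendsto_at_iff_sequentially
  proof (intro allI impI)
    fix X :: "nat \<Rightarrow> real" assume X: "\<forall>i. X i \<in> UNIV - {x}" "X \<longlonglongrightarrow> x"
    have Xn: "X n \<noteq> x" for n using X(1) by auto
    have "(\<lambda>n. \<integral>t. (K (X n) t - K x t) / complex_of_real (X n - x) * char M t \<partial>lborel) \<longlonglongrightarrow>
        (\<integral>t. iexp (- (t * x)) * char M t \<partial>lborel)"
    proof (rule integral_dominated_convergence[where w="\<lambda>t. norm (char M t)"])
      show "AE t in lborel. (\<lambda>n. (K (X n) t - K x t) / complex_of_real (X n - x) * char M t) \<longlonglongrightarrow> iexp (- (t * x)) * char M t"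
        using AE0
      proof eventually_elim
        case (elim t)
        have "((\<lambda>y. (iexp (- (t * a)) - exp (- (\<i> * of_real t * y))) / (\<i> * complex_of_real t)) has_field_derivative
           exp (- (\<i> * of_real t * of_real x))) (at (complex_of_real x))"
          using elim by (auto intro!: derivative_eq_intros simp: divide_simps)
        hence "(\<lambda>n. ((iexp (- (t * a)) - exp (- (\<i> * of_real t * complex_of_real (X n)))) / (\<i> * complex_of_real t) -
             (iexp (- (t * a)) - exp (- (\<i> * of_real t * complex_of_real x))) / (\<i> * complex_of_real t)) /
             (complex_of_real (X n) - complex_of_real x)) \<longlonglongrightarrow> exp (- (\<i> * of_real t * of_real x))"
          unfolding has_field_derivative_iff tendsto_at_iff_sequentially
          using Xn tendsto_of_real[OF X(2), where ?'a=complex] by (auto simp: o_def dest!: spec[of _ "\<lambda>n. complex_of_real (X n)"])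
        hence "(\<lambda>n. (K (X n) t - K x t) / complex_of_real (X n - x)) \<longlonglongrightarrow> iexp (- (t * x))"
          by (simp add: K_def mult.assoc)
        thus ?case by (intro tendsto_mult tendsto_const)
      qed
      show "AE t in lborel. norm ((K (X n) t - K x t) / complex_of_real (X n - x) * char M t) \<le> norm (char M t)" for n
        using AE0
      proof eventually_elim
        case (elim t)
        have "norm ((K (X n) t - K x t) / complex_of_real (X n - x)) \<le> 1"
          using Kb[OF elim, of "X n" x] Xn[of n] by (simp add: norm_divide divide_simps flip: of_real_diff)
        thus ?case by (simp only: norm_mult) (simp add: mult_left_le_one_le)
      qed
    qed (use int in auto)
    moreover have "(\<integral>t. (K (X n) t - K x t) / complex_of_real (X n - x) * char M t \<partial>lborel) = (D (X n) - D x) / complex_of_real (X n - x)" for n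
    proof -
      have "(\<lambda>t. (K (X n) t - K x t) / complex_of_real (X n - x) * char M t) = (\<lambda>t. (K (X n) t * char M t - K x t * char M t) / complex_of_real (X n - x))"
        by (simp add: fun_eq_iff algebra_simps)
      thus ?thesis using KI unfolding D_def by simp
    qed
    ultimately show "((\<lambda>y. (D y - D x) / complex_of_real (y - x)) \<circ> X) \<longlonglongrightarrow> (\<integral>t. iexp (- (t * x)) * char M t \<partial>lborel)"
      using Xn by (simp add: o_def)
  qed
  have "((\<lambda>y. Re (1 / (2 * pi) * ((D y - D x) / complex_of_real (y - x)))) \<longlongrightarrow>
     Re (1 / (2 * pi) * (\<integral>t. iexp (- (t * x)) * char M t \<partial>lborel))) (at x)"
    by (intro tendsto_Re tendsto_mult tendsto_const Dd)
  moreover have "\<forall>\<^sub>F y in at x. Re (1 / (2 * pi) * ((D y - D x) / complex_of_real (y - x))) = (measure M {a<..y} - measure M {a<..x}) / (y - x)"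
  proof -
    have "\<forall>\<^sub>F y in at x. y > a" using ax by (rule order_tendstoD[OF tendsto_ident_at])
    thus ?thesis
    proof eventually_elim
      case (elim y)
      have "complex_of_real ((measure M {a<..y} - measure M {a<..x}) / (y - x)) = 1 / (2 * pi) * ((D y - D x) / complex_of_real (y - x))"
        using D[of y] D[of x] elim ax by (simp add: diff_divide_distrib algebra_simps)
      thus ?case by (metis Re_complex_of_real)
    qed
  qed
  ultimately show ?thesis unfolding has_field_derivative_iff by (rule Lim_transform_eventually)
qed

text \<open>
  Normalise \<open>t powr c * f t\<close> to a probability density and pass to \<open>x = ln
  t\<close>: the Mellin transform on the line of abscissa \<open>c\<close> becomes a characteristic
  function. The distribution function has two derivatives that must agree, one from continuity of
  \<open>f\<close> and one from Levy's inversion formula.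
\<close>

lemma mellin_inversion:
  fixes f :: "real \<Rightarrow> real" and \<M> :: "real \<Rightarrow> complex"
  assumes pos: "\<And>t. t > 0 \<Longrightarrow> f t > 0" and cont: "continuous_on {0<..} f"
    and mellin: "\<And>b. has_bochner_integral lborel
        (\<lambda>t. indicator {0<..} t *\<^sub>R (complex_of_real t powr Complex c b * complex_of_real (f t))) (\<M> b)"
    and int: "integrable lborel \<M>" and t: "t > 0"
  shows "complex_of_real (f t) =
      1 / (2 * pi) * (\<integral>b. complex_of_real t powr (- Complex c b - 1) * \<M> b \<partial>lborel)"
proof -
  define g where "g u = indicator {0<..} u * (u powr c * f u)" for u
  have gm[measurable]: "g \<in> borel_measurable borel"
  proof -
    have "(\<lambda>u. indicator {0<..} u *\<^sub>R (u powr c * f u)) \<in> borel_measurable borel"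
      by (intro borel_measurable_continuous_on_indicator) (auto intro!: continuous_intros cont)
    thus ?thesis by (simp add: g_def[abs_def])
  qed
  have gpos: "g u \<ge> 0" for u using pos[of u] by (auto simp: g_def indicator_def intro!: mult_nonneg_nonneg less_imp_le)
  have g0: "has_bochner_integral lborel (\<lambda>u. complex_of_real (g u)) (\<M> 0)"
  proof -
    have "(\<lambda>t. indicator {0<..} t *\<^sub>R (complex_of_real t powr Complex c 0 * complex_of_real (f t))) = (\<lambda>u. complex_of_real (g u))"
      by (auto simp: g_def fun_eq_iff indicator_def powr_of_real[symmetric] Complex_eq)
    thus ?thesis using mellin[of 0] by simp
  qed
  define C where "C = Re (\<M> 0)"
  have gC: "has_bochner_integral lborel g C" using has_bochner_integral_Re[OF g0] by (simp add: C_def)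
  have MC: "\<M> 0 = complex_of_real C"
    using has_bochner_integral_eq[OF g0 has_bochner_integral_of_real[OF gC]] .
  have C: "C > 0"
  proof -
    have "C \<ge> 0" using gC Bochner_Integration.integral_nonneg[of lborel g] gpos by (simp add: has_bochner_integral_iff)
    moreover have "C \<noteq> 0"
    proof
      assume "C = 0"
      hence "AE u in lborel. g u = 0" using gC gpos integral_nonneg_eq_0_iff_AE[of lborel g]
        by (auto simp: has_bochner_integral_iff)
      hence "AE u in lborel. u \<notin> {0<..<1::real}"
      proof eventually_elim
        case (elim u)
        thus ?case using pos[of u] by (auto simp: g_def)
      qed
      hence "emeasure lborel {0<..<1::real} = 0"
        by (subst (asm) AE_iff_measurable[where N="{0<..<1::real}"]) auto
      thus False by simp
    qed
    ultimately show ?thesis by simp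
  qed
  \<comment> \<open>The law with density u powr c * f u / C, and its image N on the logarithmic scale.\<close>
  define P where "P = density lborel (\<lambda>u. ennreal (g u / C))"
  define N where "N = distr P borel ln"
  have P: "prob_space P"
  proof
    have "emeasure P (space P) = (\<integral>\<^sup>+u. ennreal (g u / C) \<partial>lborel)"
      by (simp add: P_def emeasure_density)
    also have "\<dots> = ennreal (C / C)"
      using gC gpos C by (subst nn_integral_eq_integral) (auto simp: has_bochner_integral_iff)
    finally show "emeasure P (space P) = 1" using C by simp
  qed
  have [measurable_cong]: "sets P = sets borel" by (simp add: P_def)
  have N: "real_distribution N" unfolding N_def by (rule real_distribution_distr[OF P]) measurable
  interpret N: real_distribution N by fact
  have null: "emeasure P A = 0" if "A \<in> null_sets lborel" for A
    using that absolutely_continuousI_density[of "\<lambda>u. ennreal (g u / C)" lborel]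
    by (auto simp: absolutely_continuous_def P_def)
  have P0: "AE u in P. u > 0"
  proof -
    have m: "(\<lambda>u. ennreal (g u / C)) \<in> borel_measurable lborel" by measurable
    show ?thesis unfolding P_def AE_density[OF m] by (auto simp: g_def indicator_def)
  qed
  have mN: "measure N {a<..x} = integral {exp a..exp x} (\<lambda>u. u powr c * f u / C)" if "a \<le> x" for a x
  proof -
    have "measure N {a<..x} = measure P {exp a<..exp x}"
    proof -
      have "emeasure N {a<..x} = emeasure P (ln -` {a<..x} \<inter> space P)"
        unfolding N_def by (rule emeasure_distr) measurable
      also have "\<dots> = emeasure P {exp a<..exp x}"
      proof (rule emeasure_eq_AE)
        show "AE u in P. (u \<in> ln -` {a<..x} \<inter> space P) = (u \<in> {exp a<..exp x})"
          using P0
        proof eventually_elim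
          case (elim u)
          thus ?case using exp_less_cancel_iff[of a "ln u"] exp_le_cancel_iff[of "ln u" x] by (auto simp: P_def)
        qed
      qed measurable
      finally show ?thesis by (simp add: measure_def)
    qed
    also have "measure P {exp a<..exp x} = (\<integral>u. indicator {exp a<..exp x} u \<partial>P)" by simp
    also have "\<dots> = (\<integral>u. g u / C * indicator {exp a<..exp x} u \<partial>lborel)"
      unfolding P_def using gpos C by (subst integral_density) auto
    also have "\<dots> = (\<integral>u. g u / C * indicator {exp a..exp x} u \<partial>lborel)"
    proof (rule integral_cong_AE)
      show "AE u in lborel. g u / C * indicator {exp a<..exp x} u = g u / C * indicator {exp a..exp x} u"
        using AE_lborel_singleton[of "exp a"] by eventually_elim (auto simp: indicator_def)
    qed measurable
    also have "\<dots> = (LINT u:{exp a..exp x}|lborel. u powr c * f u / C)"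
      unfolding set_lebesgue_integral_def
      by (intro Bochner_Integration.integral_cong refl)
         (auto simp: indicator_def g_def dest: less_le_trans[OF exp_gt_zero])
    also have "\<dots> = integral {exp a..exp x} (\<lambda>u. u powr c * f u / C)"
    proof (rule set_borel_integral_eq_integral(2)[OF borel_integrable_atLeastAtMost'])
      have "{exp a..exp x} \<subseteq> {0<..}" by (auto intro: less_le_trans[OF exp_gt_zero])
      thus "continuous_on {exp a..exp x} (\<lambda>u. u powr c * f u / C)"
        using C by (auto intro!: continuous_intros continuous_on_subset[OF cont])
    qed
    finally show ?thesis .
  qed
  have atoms: "measure N {x} = 0" for x
  proof -
    have "emeasure N {x} = emeasure P (ln -` {x} \<inter> space P)"
      unfolding N_def by (rule emeasure_distr) measurable
    also have "\<dots> = emeasure P {exp x}"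
    proof (rule emeasure_eq_AE)
      show "AE u in P. (u \<in> ln -` {x} \<inter> space P) = (u \<in> {exp x})"
        using P0 by eventually_elim (auto simp: P_def)
    qed measurable
    also have "\<dots> = 0" by (rule null) (simp add: null_sets_def)
    finally show ?thesis by (simp add: measure_def)
  qed
  have char: "char N b = \<M> b / C" for b
  proof -
    have "char N b = (\<integral>u. iexp (b * ln u) \<partial>P)" unfolding char_def N_def by (subst integral_distr) auto
    also have "\<dots> = (\<integral>u. (g u / C) *\<^sub>R iexp (b * ln u) \<partial>lborel)"
      unfolding P_def using gpos C by (subst integral_density) auto
    also have "\<dots> = (\<integral>u. (indicator {0<..} u *\<^sub>R (complex_of_real u powr Complex c b * complex_of_real (f u))) / C \<partial>lborel)"
    proof (intro Bochner_Integration.integral_cong refl)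
      fix u :: real
      show "(g u / C) *\<^sub>R iexp (b * ln u) = (indicator {0<..} u *\<^sub>R (complex_of_real u powr Complex c b * complex_of_real (f u))) / C"
      proof (cases "u > 0")
        case True
        have "complex_of_real u powr Complex c b = complex_of_real (u powr c) * iexp (b * ln u)"
          using True by (simp add: powr_def Complex_eq exp_add[symmetric] Ln_of_real exp_of_real[symmetric] algebra_simps)
        thus ?thesis using True by (simp add: g_def scaleR_conv_of_real)
      qed (simp add: g_def)
    qed
    also have "\<dots> = \<M> b / C" using mellin[of b] by (simp add: has_bochner_integral_iff)
    finally show ?thesis .
  qed
  have ci: "integrable lborel (char N)" unfolding char[abs_def] using int by simp
  define x where "x = ln t"
  have ex: "exp x = t" using t by (simp add: x_def)
  define a where "a = x - 1"
  have "((\<lambda>y. integral {exp a..y} (\<lambda>u. u powr c * f u / C)) has_real_derivative t powr c * f t / C) (at t)"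
  proof -
    have "((\<lambda>y. integral {exp a..y} (\<lambda>u. u powr c * f u / C)) has_real_derivative t powr c * f t / C) (at t within {exp a..t+1})"
      by (rule integral_has_real_derivative)
         (use C ex in \<open>auto intro!: continuous_intros continuous_on_subset[OF cont] simp: a_def ex[symmetric] intro: less_le_trans[OF exp_gt_zero]\<close>)
    moreover have "exp a < t" unfolding ex[symmetric] a_def by simp
    ultimately show ?thesis by (subst (asm) at_within_Icc_at) auto
  qed
  hence "((\<lambda>y. integral {exp a..exp y} (\<lambda>u. u powr c * f u / C)) has_real_derivative t powr c * f t / C * t) (at x)"
    unfolding ex[symmetric] by (rule DERIV_chain2[OF _ DERIV_exp])
  moreover have "\<forall>\<^sub>F y in nhds x. integral {exp a..exp y} (\<lambda>u. u powr c * f u / C) = measure N {a<..y}"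
  proof -
    have "\<forall>\<^sub>F y in nhds x. y > a" using eventually_nhds_in_open[of "{a<..}" x] by (simp add: a_def)
    thus ?thesis by eventually_elim (simp add: mN)
  qed
  ultimately have d1: "((\<lambda>y. measure N {a<..y}) has_real_derivative t powr c * f t / C * t) (at x)"
    by (subst (asm) DERIV_cong_ev[OF refl _ refl])
  have d2: "((\<lambda>y. measure N {a<..y}) has_real_derivative
      Re (1 / (2 * pi) * (\<integral>b. iexp (- (b * x)) * char N b \<partial>lborel))) (at x)"
    by (rule N.measure_Ioc_has_derivative[OF ci atoms]) (simp add: a_def)
  have eq: "t powr c * f t / C * t = Re (1 / (2 * pi) * (\<integral>b. iexp (- (b * x)) * char N b \<partial>lborel))"
    using d1 d2 by (rule DERIV_unique)
  define J where "J = (\<integral>b. iexp (- (b * x)) * \<M> b \<partial>lborel)"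
  have J1: "(\<integral>b. iexp (- (b * x)) * char N b \<partial>lborel) = J / C"
    unfolding J_def char by simp
  have tb: "complex_of_real t powr (- Complex c b - 1) = complex_of_real (t powr (-c-1)) * iexp (- (b * x))" for b
    using t by (simp add: x_def powr_def Complex_eq exp_add[symmetric] Ln_of_real exp_of_real[symmetric] algebra_simps)
  have J2: "(\<integral>b. complex_of_real t powr (- Complex c b - 1) * \<M> b \<partial>lborel) = complex_of_real (t powr (-c-1)) * J"
    unfolding J_def tb mult.assoc by simp
  have cnj: "cnj (\<M> b) = \<M> (- b)" for b
  proof -
    have "has_bochner_integral lborel (\<lambda>u. cnj (indicator {0<..} u *\<^sub>R (complex_of_real u powr Complex c b * complex_of_real (f u)))) (cnj (\<M> b))"
      by (rule has_bochner_integral_cnj[OF mellin])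
    also have "(\<lambda>u. cnj (indicator {0<..} u *\<^sub>R (complex_of_real u powr Complex c b * complex_of_real (f u)))) =
       (\<lambda>u. indicator {0<..} u *\<^sub>R (complex_of_real u powr Complex c (-b) * complex_of_real (f u)))"
      by (auto simp: fun_eq_iff indicator_def cnj_powr complex_cnj) 
    finally show ?thesis using mellin[of "-b"] has_bochner_integral_eq by blast
  qed
  have "cnj J = (\<integral>b. cnj (iexp (- (b * x)) * \<M> b) \<partial>lborel)" unfolding J_def by (rule Bochner_Integration.integral_cnj[symmetric])
  also have "\<dots> = (\<integral>b. iexp (- ((- b) * x)) * \<M> (- b) \<partial>lborel)"
    by (simp add: cnj exp_cnj)
  also have "\<dots> = J" unfolding J_def
    using lborel_integral_real_affine[of "-1" "\<lambda>b. iexp (- (b * x)) * \<M> b" 0] by simp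
  finally have "J \<in> \<real>" by (simp add: complex_is_Real_iff complex_eq_iff)
  then obtain j where j: "J = complex_of_real j" by (auto elim: Reals_cases)
  have "t powr c * f t / C * t = j / (2 * pi * C)" using eq unfolding J1 j
    by (simp flip: of_real_divide of_real_mult)
  hence "f t = j / (2 * pi) * t powr (-c-1)"
    using C t by (simp add: powr_diff powr_minus field_simps)
  thus ?thesis unfolding J2 j by simp
qed


section \<open>Decay of the Mellin transform of the law\<close>

lemma not_nonpos_Int:
  assumes "Im z \<noteq> 0 \<or> 0 < Re z"
  shows "z \<notin> \<int>\<^sub>\<le>\<^sub>0"
proof
  assume "z \<in> \<int>\<^sub>\<le>\<^sub>0"
  then obtain n where "z = - of_nat n" by (elim nonpos_Ints_cases')
  thus False using assms by simp
qed

lemma norm_sin_ge: "(exp \<bar>Im z\<bar> - exp (- \<bar>Im z\<bar>)) / 2 \<le> norm (sin (z::complex))"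
proof -
  have "norm (sin z) = norm (exp (\<i> * z) - exp (- (\<i> * z))) / 2"
    by (simp add: sin_exp_eq norm_divide norm_mult)
  moreover have "\<bar>norm (exp (\<i> * z)) - norm (exp (- (\<i> * z)))\<bar> \<le> norm (exp (\<i> * z) - exp (- (\<i> * z)))"
    by (rule norm_triangle_ineq3)
  moreover have "\<bar>norm (exp (\<i> * z)) - norm (exp (- (\<i> * z)))\<bar> = \<bar>exp (- Im z) - exp (Im z)\<bar>"
    by simp
  moreover have "exp \<bar>Im z\<bar> - exp (- \<bar>Im z\<bar>) \<le> \<bar>exp (- Im z) - exp (Im z)\<bar>"
    by (cases "Im z \<ge> 0") auto
  ultimately show ?thesis by simp
qed

lemma integrable_exp_abs:
  assumes \<epsilon>: "0 < \<epsilon>"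
  shows "integrable lborel (\<lambda>b::real. exp (- \<epsilon> * \<bar>b\<bar>))"
proof -
  have i: "integrable lborel (\<lambda>x::real. inverse (1 + x\<^sup>2))"
    using integrable_inverse_1_plus_square by (simp add: set_integrable_def)
  show ?thesis
  proof (rule Bochner_Integration.integrable_bound[OF integrable_mult_right[OF i, of "1 + 2 / \<epsilon>\<^sup>2"]])
    show "AE b in lborel. norm (exp (- \<epsilon> * \<bar>b\<bar>)) \<le> norm ((1 + 2 / \<epsilon>\<^sup>2) * inverse (1 + b\<^sup>2))"
    proof (intro AE_I2)
      fix b :: real
      have "1 + \<epsilon> * \<bar>b\<bar> + (\<epsilon> * \<bar>b\<bar>)\<^sup>2 / 2 \<le> exp (\<epsilon> * \<bar>b\<bar>)" using \<epsilon> by (intro exp_lower_Taylor_quadratic) auto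
      hence q: "1 + \<epsilon>\<^sup>2 * b\<^sup>2 / 2 \<le> exp (\<epsilon> * \<bar>b\<bar>)" 
      proof -
        have "0 \<le> \<epsilon> * \<bar>b\<bar>" using \<epsilon> by simp
        moreover have "(\<epsilon> * \<bar>b\<bar>)\<^sup>2 = \<epsilon>\<^sup>2 * b\<^sup>2" by (simp add: power_mult_distrib)
        ultimately show ?thesis using \<open>1 + \<epsilon> * \<bar>b\<bar> + (\<epsilon> * \<bar>b\<bar>)\<^sup>2 / 2 \<le> exp (\<epsilon> * \<bar>b\<bar>)\<close> by linarith
      qed
      have "1 + b\<^sup>2 \<le> (1 + 2 / \<epsilon>\<^sup>2) * (1 + \<epsilon>\<^sup>2 * b\<^sup>2 / 2)"
      proof -
        have "(1 + 2 / \<epsilon>\<^sup>2) * (1 + \<epsilon>\<^sup>2 * b\<^sup>2 / 2) = 1 + b\<^sup>2 + (\<epsilon>\<^sup>2 * b\<^sup>2 / 2 + 2 / \<epsilon>\<^sup>2)" using \<epsilon> by (simp add: field_simps)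
        thus ?thesis by (simp add: add_nonneg_nonneg)
      qed
      also have "\<dots> \<le> (1 + 2 / \<epsilon>\<^sup>2) * exp (\<epsilon> * \<bar>b\<bar>)" by (intro mult_left_mono q) (simp add: add_nonneg_nonneg)
      finally have "(1 + b\<^sup>2) * exp (- \<epsilon> * \<bar>b\<bar>) \<le> (1 + 2 / \<epsilon>\<^sup>2) * exp (\<epsilon> * \<bar>b\<bar>) * exp (- \<epsilon> * \<bar>b\<bar>)" by (rule mult_right_mono) simp
      also have "\<dots> = 1 + 2 / \<epsilon>\<^sup>2" by (simp add: mult.assoc flip: exp_add)
      finally have "exp (- \<epsilon> * \<bar>b\<bar>) \<le> (1 + 2 / \<epsilon>\<^sup>2) * inverse (1 + b\<^sup>2)"
        by (simp add: field_simps add_pos_nonneg)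
      moreover have "0 \<le> (1 + 2 / \<epsilon>\<^sup>2) * inverse (1 + b\<^sup>2)" by (intro mult_nonneg_nonneg) (auto simp: add_nonneg_nonneg)
      ultimately show "norm (exp (- \<epsilon> * \<bar>b\<bar>)) \<le> norm ((1 + 2 / \<epsilon>\<^sup>2) * inverse (1 + b\<^sup>2))" by (simp only: real_norm_def abs_of_nonneg exp_ge_zero)
    qed
  qed measurable
qed

text \<open>
  On \<open>|b| \<le> 1\<close> a continuous function is bounded.
\<close>

lemma decay_everywhere:
  fixes h :: "real \<Rightarrow> complex"
  assumes c: "continuous_on UNIV h" and d: "\<And>b. 1 \<le> \<bar>b\<bar> \<Longrightarrow> norm (h b) \<le> C * exp (- \<kappa> * \<bar>b\<bar>)"
  shows "\<exists>C. \<forall>b. norm (h b) \<le> C * exp (- \<kappa> * \<bar>b\<bar>)"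
proof -
  have "compact (h ` {-1..1})" by (intro compact_continuous_image continuous_on_subset[OF c]) auto
  then obtain B where B: "\<And>b. b \<in> {-1..1} \<Longrightarrow> norm (h b) \<le> B" using compact_imp_bounded bounded_iff by (metis imageI)
  define D where "D = max C (\<bar>B\<bar> * exp \<bar>\<kappa>\<bar>)"
  have "norm (h b) \<le> D * exp (- \<kappa> * \<bar>b\<bar>)" for b
  proof (cases "1 \<le> \<bar>b\<bar>")
    case True
    have "C * exp (- \<kappa> * \<bar>b\<bar>) \<le> D * exp (- \<kappa> * \<bar>b\<bar>)" unfolding D_def by (intro mult_right_mono) auto
    thus ?thesis by (rule order_trans[OF d[OF True]])
  next
    case False
    have "\<kappa> * \<bar>b\<bar> \<le> \<bar>\<kappa>\<bar> * 1" using False by (intro mult_mono) auto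
    hence "1 \<le> exp \<bar>\<kappa>\<bar> * exp (- \<kappa> * \<bar>b\<bar>)" unfolding exp_add[symmetric] by simp
    from mult_left_mono[OF this abs_ge_zero[of B]]
    have "\<bar>B\<bar> \<le> \<bar>B\<bar> * exp \<bar>\<kappa>\<bar> * exp (- \<kappa> * \<bar>b\<bar>)" by (simp only: mult.assoc mult_1_right)
    moreover have "norm (h b) \<le> B" using False by (intro B) auto
    ultimately have "norm (h b) \<le> \<bar>B\<bar> * exp \<bar>\<kappa>\<bar> * exp (- \<kappa> * \<bar>b\<bar>)" by linarith
    also have "\<dots> \<le> D * exp (- \<kappa> * \<bar>b\<bar>)" unfolding D_def by (intro mult_right_mono) auto
    finally show ?thesis .
  qed
  thus ?thesis by blast
qed

context bernstein_function
begin

text \<open>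
  The Mellin transform of the law at \<open>\<beta> w\<close>; the factor \<open>\<Gamma>(1 -
  w)\<close> is the moment of order \<open>- w\<close> of the exponential variable.
\<close>

definition Mel :: "complex \<Rightarrow> complex" where "Mel w = Gamma (1 - w) * IM w"

lemma Mel_0: "Mel 0 = 1" by (simp add: Mel_def IM_0)

lemma Mel_continuous:
  assumes "- a_killed \<phi> < ereal (c + 1)" "c < 1"
  shows "continuous_on UNIV (\<lambda>b. Mel (Complex c b))"
proof -
  have "(\<lambda>w. Gamma (1 - w)) holomorphic_on {w. Re w < 1}"
  proof (intro holomorphic_intros)
    fix w :: complex assume "w \<in> {w. Re w < 1}"
    thus "1 - w \<notin> \<int>\<^sub>\<le>\<^sub>0" by (intro not_nonpos_Int) simp
  qed
  have cC: "continuous_on UNIV (\<lambda>b. Complex c b)" unfolding Complex_eq by (intro continuous_intros)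
  from holomorphic_on_imp_continuous_on[OF \<open>(\<lambda>w. Gamma (1 - w)) holomorphic_on {w. Re w < 1}\<close>]
  have "continuous_on UNIV (\<lambda>b. Gamma (1 - Complex c b))"
    by (rule continuous_on_compose2[OF _ cC]) (use assms in auto)
  moreover have "continuous_on UNIV (\<lambda>b. IM (Complex c b))"
    by (rule continuous_on_compose2[OF holomorphic_on_imp_continuous_on[OF IM_holomorphic] cC]) (use assms in auto)
  ultimately show ?thesis unfolding Mel_def by (rule continuous_on_mult)
qed

text \<open>
  By the reflection formula, \<open>Mel w = w * \<pi> / sin (\<pi> w) / W(w + 1)\<close>: the
  reciprocal of the sine decays at rate \<open>\<pi>\<close> and the reciprocal of \<open>W\<close>
  takes back at most \<open>Theta_upper\<close>.
\<close>

lemma Mel_decay_base: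
  assumes c: "-1 < c" "c < 1" and \<kappa>: "\<kappa> < pi - Theta_upper \<phi>"
  shows "\<exists>C. \<forall>b. 1 \<le> \<bar>b\<bar> \<longrightarrow> norm (Mel (Complex c b)) \<le> C * exp (- \<kappa> * \<bar>b\<bar>)"
proof -
  \<comment> \<open>Half of the slack pays for the factor w, the other half for the upper limit in Theta_upper.\<close>
  define d where "d = (pi - Theta_upper \<phi> - \<kappa>) / 2"
  have d: "0 < d" using \<kappa> by (simp add: d_def)
  obtain C where C: "\<And>b. norm (1 / BG (Complex (c + 1) b)) \<le> C * exp ((Theta_upper \<phi> + d) * \<bar>b\<bar>)"
    using BG_decay[of "c + 1" d] c d by auto
  have "norm (1 / BG (Complex (c + 1) 0)) \<le> C" using C[of 0] by simp
  hence C0: "0 \<le> C" using norm_ge_zero order_trans by blast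
  define D where "D = (1 + 1 / d) * pi * 4 * C"
  have "norm (Mel (Complex c b)) \<le> D * exp (- \<kappa> * \<bar>b\<bar>)" if b: "1 \<le> \<bar>b\<bar>" for b
  proof -
    define w where "w = Complex c b"
    have wn: "w \<notin> \<int>\<^sub>\<le>\<^sub>0" by (rule not_nonpos_Int) (use b in \<open>auto simp: w_def\<close>)
    have "IM w = Gamma (w + 1) / BG (w + 1)" using c by (intro IM_Gamma) (simp add: w_def)
    moreover have "Gamma (w + 1) = w * Gamma w" using wn by (rule Gamma_plus1)
    ultimately have "Mel w = w * (Gamma w * Gamma (1 - w)) * (1 / BG (w + 1))" by (simp add: Mel_def)
    also have "Gamma w * Gamma (1 - w) = of_real pi / sin (of_real pi * w)" by (rule Gamma_reflection_complex)
    finally have M: "norm (Mel w) = norm w * (pi / norm (sin (of_real pi * w))) * norm (1 / BG (w + 1))"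
      by (simp add: norm_mult norm_divide)
    have "exp (pi * \<bar>b\<bar>) / 4 \<le> (exp (pi * \<bar>b\<bar>) - exp (- (pi * \<bar>b\<bar>))) / 2"
    proof -
      have "1 \<le> pi * \<bar>b\<bar>" using b pi_gt3 mult_mono[of 1 pi 1 "\<bar>b\<bar>"] by simp
      hence E2: "2 \<le> exp (pi * \<bar>b\<bar>)" using exp_ge_add_one_self[of "pi * \<bar>b\<bar>"] by linarith
      have e1: "exp (- (pi * \<bar>b\<bar>)) \<le> 1" by simp
      have G: "E / 4 \<le> (E - e) / 2" if "2 \<le> E" "e \<le> 1" for E e :: real using that by (simp add: field_simps)
      show ?thesis by (rule G[OF E2 e1])
    qed
    also have "\<dots> \<le> norm (sin (of_real pi * w))"
      using norm_sin_ge[of "of_real pi * w"] by (simp add: w_def abs_mult)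
    finally have "exp (pi * \<bar>b\<bar>) / 4 \<le> norm (sin (of_real pi * w))" .
    have S: "pi / norm (sin (of_real pi * w)) \<le> pi * 4 * exp (- pi * \<bar>b\<bar>)"
    proof -
      have le: "exp (pi * \<bar>b\<bar>) / 4 \<le> norm (sin (of_real pi * w))" by fact
      have "0 < exp (pi * \<bar>b\<bar>) / 4" by simp
      hence "pi / norm (sin (of_real pi * w)) \<le> pi / (exp (pi * \<bar>b\<bar>) / 4)"
        using le by (intro divide_left_mono mult_pos_pos) auto
      also have "\<dots> = pi * 4 * (1 / exp (pi * \<bar>b\<bar>))" by simp
      also have "1 / exp (pi * \<bar>b\<bar>) = exp (- pi * \<bar>b\<bar>)" by (simp only: mult_minus_left exp_minus inverse_eq_divide)
      finally show ?thesis .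
    qed
    have W: "norm w \<le> (1 + 1 / d) * exp (d * \<bar>b\<bar>)"
    proof -
      have "norm w \<le> \<bar>c\<bar> + \<bar>b\<bar>" using cmod_le[of w] by (simp add: w_def)
      also have "\<dots> \<le> 1 + \<bar>b\<bar>" using c by simp
      also have "\<dots> \<le> (1 + 1 / d) * (1 + d * \<bar>b\<bar>)" using d by (simp add: field_simps)
      also have "\<dots> \<le> (1 + 1 / d) * exp (d * \<bar>b\<bar>)" using d by (intro mult_left_mono exp_ge_add_one_self) auto
      finally show ?thesis .
    qed
    have B: "norm (1 / BG (w + 1)) \<le> C * exp ((Theta_upper \<phi> + d) * \<bar>b\<bar>)"
      using C[of b] by (simp add: w_def Complex_eq add_ac)
    have "norm (Mel w) \<le> ((1 + 1 / d) * exp (d * \<bar>b\<bar>)) * (pi * 4 * exp (- pi * \<bar>b\<bar>)) * (C * exp ((Theta_upper \<phi> + d) * \<bar>b\<bar>))"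
      unfolding M using d C0 by (intro mult_mono W S B) auto
    also have "\<dots> = D * exp (d * \<bar>b\<bar> + - pi * \<bar>b\<bar> + (Theta_upper \<phi> + d) * \<bar>b\<bar>)"
      unfolding exp_add D_def by (simp add: mult_ac)
    also have "d * \<bar>b\<bar> + - pi * \<bar>b\<bar> + (Theta_upper \<phi> + d) * \<bar>b\<bar> = - \<kappa> * \<bar>b\<bar>"
      unfolding d_def by (simp add: field_simps)
    finally show ?thesis by (simp add: w_def)
  qed
  thus ?thesis by blast
qed

text \<open>
  Up to a factor linear in \<open>|z|\<close>, one integrable function dominates the integrands on
  the whole vertical line, even where \<open>\<phi>\<close> is negative on the real axis.
\<close>

lemma bern_linear_growth:
  assumes x: "- a_bern \<phi> < ereal x"
  shows "\<exists>K\<ge>0. \<forall>b. norm (bern \<phi> (Complex x b)) \<le> K * (1 + norm (Complex x b))"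
proof -
  obtain u where u: "u \<ge> 0" "- u < x" "bern_finite \<phi> (complex_of_real (- u))" using a_bern_witness[OF x] by blast
  define h where "h y = min 1 y + (exp (u * y) - 1)" for y :: real
  have hi: "integrable (levy \<phi>) h" unfolding h_def[abs_def] by (rule integrable_levy_exp[OF u(3,1)])
  have h0: "AE y in levy \<phi>. 0 \<le> h y" using AE_levy_pos by eventually_elim (use u in \<open>simp add: h_def\<close>)
  define J where "J = (\<integral>y. h y \<partial>levy \<phi>)"
  have J: "J \<ge> 0" unfolding J_def by (rule integral_nonneg_AE[OF h0])
  define K where "K = killing \<phi> + drift \<phi> + (exp u + 2) * J"
  have "norm (bern \<phi> z) \<le> K * (1 + norm z)" if z: "Re z = x" for z
  proof -
    have fz: "bern_finite \<phi> z" by (rule bern_finite_mono[OF u(3,1)]) (use u z in auto)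
    have "norm (\<integral>y. (1 - exp (- z * complex_of_real y)) \<partial>levy \<phi>) \<le> (\<integral>y. (norm z * exp u + 2) * h y \<partial>levy \<phi>)"
    proof (rule order_trans[OF integral_norm_bound integral_mono_AE])
      show "AE y in levy \<phi>. norm (1 - exp (- z * complex_of_real y)) \<le> (norm z * exp u + 2) * h y"
        using AE_levy_pos by eventually_elim (use u z one_minus_exp_bound[of u z] in \<open>auto simp: h_def\<close>)
    qed (use fz hi in \<open>auto simp: bern_finite_def\<close>)
    also have "\<dots> = (norm z * exp u + 2) * J" by (simp add: J_def)
    also have "\<dots> \<le> ((exp u + 2) * (1 + norm z)) * J"
      using J by (intro mult_right_mono) (auto simp: algebra_simps)
    finally have 1: "norm (\<integral>y. (1 - exp (- z * complex_of_real y)) \<partial>levy \<phi>) \<le> (exp u + 2) * J * (1 + norm z)" by (simp add: mult_ac)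
    have "norm (bern \<phi> z) \<le> norm (complex_of_real (killing \<phi>)) + norm (complex_of_real (drift \<phi>) * z) + norm (\<integral>y. (1 - exp (- z * complex_of_real y)) \<partial>levy \<phi>)"
      unfolding bern_def by (intro order_trans[OF norm_triangle_ineq] add_right_mono norm_triangle_ineq)
    also have "\<dots> \<le> killing \<phi> * (1 + norm z) + drift \<phi> * (1 + norm z) + (exp u + 2) * J * (1 + norm z)"
      using 1 killing_nonneg drift_nonneg by (intro add_mono) (auto simp: norm_mult algebra_simps)
    also have "\<dots> = K * (1 + norm z)" by (simp add: K_def algebra_simps)
    finally show ?thesis .
  qed
  moreover have "K \<ge> 0" using killing_nonneg drift_nonneg J by (simp add: K_def add_nonneg_nonneg)
  ultimately show ?thesis by (intro exI[of _ K]) simp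
qed

lemma Mel_rec:
  assumes "Im w \<noteq> 0"
  shows "Mel w = - w / (w + 1) * bern \<phi> (w + 1) * Mel (w + 1)"
proof -
  have n: "- w \<notin> \<int>\<^sub>\<le>\<^sub>0" "w + 1 \<noteq> 0" using assms by (auto simp: complex_eq_iff intro!: not_nonpos_Int)
  have "Gamma (1 - w) = - w * Gamma (- w)" using Gamma_plus1[OF n(1)] by (simp add: add.commute)
  moreover have "IM w = Q (w + 1) * IM (w + 1)" using IM_rec[of "w + 1"] by simp
  ultimately show ?thesis using n(2) by (simp add: Mel_def Q_eq)
qed

text \<open>
  Each step to the left through the recursion multiplies by a factor of at most linear growth, which
  an arbitrarily small part of the exponential rate absorbs. Points with \<open>|b| < 1\<close> are
  left to continuity, since the recursion has a singularity on the real axis.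
\<close>

lemma Mel_decay:
  assumes c: "- a_killed \<phi> < ereal (c + 1)" "c < 1" and \<kappa>: "\<kappa> < pi - Theta_upper \<phi>"
  shows "\<exists>C. \<forall>b. norm (Mel (Complex c b)) \<le> C * exp (- \<kappa> * \<bar>b\<bar>)"
proof -
  have "\<exists>C. \<forall>b. 1 \<le> \<bar>b\<bar> \<longrightarrow> norm (Mel (Complex c b)) \<le> C * exp (- \<kappa> * \<bar>b\<bar>)"
    if "- real n - 1 < c" "- a_killed \<phi> < ereal (c + 1)" "c < 1" "\<kappa> < pi - Theta_upper \<phi>" for n c \<kappa>
    using that
  proof (induction n arbitrary: c \<kappa>)
    case 0
    thus ?case by (intro Mel_decay_base) auto
  next
    case (Suc n)
    show ?case
    proof (cases "-1 < c")
      case True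
      thus ?thesis using Suc.prems by (intro Mel_decay_base) auto
    next
      case False
      define d where "d = (pi - Theta_upper \<phi> - \<kappa>) / 2"
      have d: "0 < d" using Suc.prems by (simp add: d_def)
      have c2: "- a_killed \<phi> < ereal (c + 1 + 1)" by (rule less_le_trans[OF Suc.prems(2)]) simp
      obtain C where C: "\<And>b. 1 \<le> \<bar>b\<bar> \<Longrightarrow> norm (Mel (Complex (c + 1) b)) \<le> C * exp (- (\<kappa> + d) * \<bar>b\<bar>)"
        using Suc.IH[of "c + 1" "\<kappa> + d"] Suc.prems c2 False d by (auto simp: d_def field_simps)
      obtain K where K: "K \<ge> 0" "\<And>b. norm (bern \<phi> (Complex (c + 1) b)) \<le> K * (1 + norm (Complex (c + 1) b))"
        using bern_linear_growth[OF gt_a_killed_a_bern[OF Suc.prems(2)]] by blast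
      have C0: "0 \<le> C"
      proof -
        have "0 \<le> norm (Mel (Complex (c + 1) 1))" by simp
        also have "\<dots> \<le> C * exp (- (\<kappa> + d) * \<bar>1\<bar>)" by (rule C) simp
        finally show ?thesis by (simp add: zero_le_mult_iff)
      qed
      define D where "D = 2 * K * ((1 + \<bar>c\<bar>) * (1 + 1 / d)) * C"
      have "norm (Mel (Complex c b)) \<le> D * exp (- \<kappa> * \<bar>b\<bar>)" if b: "1 \<le> \<bar>b\<bar>" for b
      proof -
        define w where "w = Complex c b"
        have w1: "w + 1 = Complex (c + 1) b" by (simp add: w_def complex_eq_iff)
        have n1: "1 \<le> norm (w + 1)" using b abs_Im_le_cmod[of "w + 1"] by (simp add: w_def)
        have "Mel w = - w / (w + 1) * bern \<phi> (w + 1) * Mel (w + 1)" using b by (intro Mel_rec) (auto simp: w_def)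
        hence "norm (Mel w) = norm w * (norm (bern \<phi> (w + 1)) / norm (w + 1)) * norm (Mel (w + 1))"
          by (simp add: norm_mult norm_divide)
        also have "\<dots> \<le> ((1 + \<bar>c\<bar>) * (1 + 1 / d) * exp (d * \<bar>b\<bar>)) * (2 * K) * (C * exp (- (\<kappa> + d) * \<bar>b\<bar>))"
        proof (intro mult_mono)
          have "norm w \<le> \<bar>c\<bar> + \<bar>b\<bar>" using cmod_le[of w] by (simp add: w_def)
          also have "\<dots> \<le> (1 + \<bar>c\<bar>) * (1 + \<bar>b\<bar>)" by (simp add: algebra_simps)
          also have "\<dots> \<le> (1 + \<bar>c\<bar>) * ((1 + 1 / d) * (1 + d * \<bar>b\<bar>))" using d by (intro mult_left_mono) (auto simp: field_simps)
          also have "\<dots> \<le> (1 + \<bar>c\<bar>) * ((1 + 1 / d) * exp (d * \<bar>b\<bar>))" using d by (intro mult_left_mono exp_ge_add_one_self) auto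
          finally show "norm w \<le> (1 + \<bar>c\<bar>) * (1 + 1 / d) * exp (d * \<bar>b\<bar>)" by (simp add: mult.assoc)
          have "norm (bern \<phi> (w + 1)) \<le> K * (1 + norm (w + 1))" using K(2)[of b] by (simp add: w1)
          also have "\<dots> \<le> K * (2 * norm (w + 1))" using K(1) n1 by (intro mult_left_mono) auto
          finally show "norm (bern \<phi> (w + 1)) / norm (w + 1) \<le> 2 * K" using n1 by (subst pos_divide_le_eq) (auto simp: mult_ac intro: less_le_trans[OF zero_less_one])
          show "norm (Mel (w + 1)) \<le> C * exp (- (\<kappa> + d) * \<bar>b\<bar>)" unfolding w1 by (rule C[OF b])
        qed (use d K C0 in auto)
        also have "\<dots> = D * exp (d * \<bar>b\<bar> + - (\<kappa> + d) * \<bar>b\<bar>)" unfolding exp_add D_def by (simp add: mult_ac)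
        also have "d * \<bar>b\<bar> + - (\<kappa> + d) * \<bar>b\<bar> = - \<kappa> * \<bar>b\<bar>" by (simp add: algebra_simps)
        finally show ?thesis by (simp add: w_def)
      qed
      thus ?thesis by blast
    qed
  qed
  note main = this
  obtain n :: nat where "- c - 1 < real n" using reals_Archimedean2 by blast
  hence "- real n - 1 < c" by linarith
  from main[OF this c \<kappa>] obtain C where "\<And>b. 1 \<le> \<bar>b\<bar> \<Longrightarrow> norm (Mel (Complex c b)) \<le> C * exp (- \<kappa> * \<bar>b\<bar>)" by blast
  from decay_everywhere[OF Mel_continuous[OF c] this] show ?thesis .
qed

end

lemma gamma_kernel_aux:
  assumes "Re w < 1"
  shows "(\<lambda>v. complex_of_real v powr (- w) * complex_of_real (exp (- v))) absolutely_integrable_on {0<..}"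
    and "integral {0<..} (\<lambda>v. complex_of_real v powr (- w) * complex_of_real (exp (- v))) = Gamma (1 - w)"
proof -
  have e: "(\<lambda>v. complex_of_real v powr (- w) * complex_of_real (exp (- v))) = (\<lambda>v. complex_of_real v powr ((1 - w) - 1) / of_real (exp v))"
    by (simp add: fun_eq_iff exp_minus field_simps)
  show "(\<lambda>v. complex_of_real v powr (- w) * complex_of_real (exp (- v))) absolutely_integrable_on {0<..}"
    unfolding e using absolutely_integrable_Gamma_integral[of "1 - w" 1] assms by simp
  have "((\<lambda>v. complex_of_real v powr ((1 - w) - 1) / of_real (exp v)) has_integral Gamma (1 - w)) {0..}"
    using assms by (intro Gamma_integral_complex) simp
  hence "((\<lambda>v. complex_of_real v powr ((1 - w) - 1) / of_real (exp v)) has_integral Gamma (1 - w)) {0<..}"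
    by (subst (asm) has_integral_spike_set_eq[of "{0..}" "{0<..}"]) (auto intro: negligible_subset[of "{0}"])
  thus "integral {0<..} (\<lambda>v. complex_of_real v powr (- w) * complex_of_real (exp (- v))) = Gamma (1 - w)"
    unfolding e by (rule integral_unique)
qed

text \<open>
  The substitution \<open>v = x t powr (- \<beta>)\<close> turns the integral into Euler's integral
  for \<open>\<Gamma>(1 - w)\<close>.
\<close>

lemma gamma_kernel:
  fixes x \<beta> :: real
  assumes x: "0 < x" and \<beta>: "0 < \<beta>" and w: "Re w < 1"
  shows "has_bochner_integral lborel (\<lambda>t. indicator {0<..} t *\<^sub>R (complex_of_real t powr (complex_of_real \<beta> * w) *
      complex_of_real (\<beta> * t powr (- \<beta> - 1) * (x * exp (- x * t powr (- \<beta>)))))) (complex_of_real x powr w * Gamma (1 - w))"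
proof -
  define g where "g t = x * t powr (- \<beta>)" for t
  define g' where "g' t = - (\<beta> * x * t powr (- \<beta> - 1))" for t
  define h where "h v = complex_of_real v powr (- w) * complex_of_real (exp (- v))" for v
  have dg: "(g has_field_derivative g' t) (at t within {0<..})" if "t \<in> {0<..}" for t
    unfolding g_def[abs_def] g'_def using that by (auto intro!: derivative_eq_intros)
  have inj: "inj_on g {0<..}"
  proof (rule inj_onI)
    fix s t :: real assume st: "s \<in> {0<..}" "t \<in> {0<..}" "g s = g t"
    hence "s powr (- \<beta>) = t powr (- \<beta>)" using x by (simp add: g_def)
    hence "(s powr (- \<beta>)) powr (- 1 / \<beta>) = (t powr (- \<beta>)) powr (- 1 / \<beta>)" by simp
    thus "s = t" using st \<beta> by (simp add: powr_powr)
  qed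
  have img: "g ` {0<..} = {0<..}"
  proof
    show "g ` {0<..} \<subseteq> {0<..}" using x by (auto simp: g_def)
    show "{0<..} \<subseteq> g ` {0<..}"
    proof
      fix v :: real assume v: "v \<in> {0<..}"
      have "g ((v / x) powr (- 1 / \<beta>)) = v" using v x \<beta> by (simp add: g_def powr_powr)
      thus "v \<in> g ` {0<..}" using v x by (intro image_eqI[of _ _ "(v / x) powr (- 1 / \<beta>)"]) auto
    qed
  qed
  note h = gamma_kernel_aux[OF w, folded h_def]
  have S: "{0<..} \<in> sets (lebesgue :: real measure)" by simp
  have part: "(\<lambda>t. \<bar>g' t\<bar> * p (h (g t))) absolutely_integrable_on {0<..} \<and> integral {0<..} (\<lambda>t. \<bar>g' t\<bar> * p (h (g t))) = p (Gamma (1 - w))"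
    if p: "bounded_linear p" for p :: "complex \<Rightarrow> real"
  proof -
    have "(\<lambda>v. p (h v)) absolutely_integrable_on {0<..}"
      using absolutely_integrable_linear[OF h(1) p] by (simp add: o_def)
    moreover have "integral {0<..} (\<lambda>v. p (h v)) = p (Gamma (1 - w))"
      using integral_linear[OF set_lebesgue_integral_eq_integral(1)[OF h(1)] p] h(2) by (simp add: o_def)
    ultimately show ?thesis
      using has_absolute_integral_change_of_variables_1'[OF S dg inj, of "\<lambda>v. p (h v)" "p (Gamma (1 - w))"] unfolding img by blast
  qed
  define k where "k t = indicator {0<..} t *\<^sub>R (complex_of_real \<bar>g' t\<bar> * h (g t))" for t
  have km[measurable]: "k \<in> borel_measurable borel" unfolding k_def h_def g_def g'_def by measurable
  have comp: "has_bochner_integral lborel (\<lambda>t. p (k t)) (p (Gamma (1 - w)))"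
    if p: "bounded_linear p" "\<And>r z. p (complex_of_real r * z) = r * p z" "\<And>r z. p (r *\<^sub>R z) = r * p z" for p :: "complex \<Rightarrow> real"
  proof -
    have m[measurable]: "p \<in> borel_measurable borel"
      by (intro borel_measurable_continuous_onI linear_continuous_on p)
    have e: "(\<lambda>t. p (k t)) = (\<lambda>t. indicator {0<..} t *\<^sub>R (\<bar>g' t\<bar> * p (h (g t))))" by (simp add: k_def p fun_eq_iff)
    have i: "integrable lebesgue (\<lambda>t. p (k t))" using part[OF p(1)] unfolding e set_integrable_def by simp
    have "integrable lborel (\<lambda>t. p (k t))" by (subst integrable_completion[symmetric]) (use i in measurable)
    moreover have "(\<integral>t. p (k t) \<partial>lborel) = p (Gamma (1 - w))"
    proof -
      have "(\<integral>t. p (k t) \<partial>lborel) = (\<integral>t. p (k t) \<partial>lebesgue)" by (rule integral_completion[symmetric]) measurable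
      also have "\<dots> = integral {0<..} (\<lambda>t. \<bar>g' t\<bar> * p (h (g t)))"
        unfolding e using set_lebesgue_integral_eq_integral(2)[of "{0<..}" "\<lambda>t. \<bar>g' t\<bar> * p (h (g t))"] part[OF p(1)]
        by (simp add: set_lebesgue_integral_def)
      finally show ?thesis using part[OF p(1)] by simp
    qed
    ultimately show ?thesis by (simp add: has_bochner_integral_iff)
  qed
  have hk: "has_bochner_integral lborel k (Gamma (1 - w))"
  proof -
    have "has_bochner_integral lborel (\<lambda>t. complex_of_real (Re (k t)) + \<i> * complex_of_real (Im (k t))) (complex_of_real (Re (Gamma (1 - w))) + \<i> * complex_of_real (Im (Gamma (1 - w))))"
      by (intro has_bochner_integral_add has_bochner_integral_mult_right has_bochner_integral_of_real comp bounded_linear_Re bounded_linear_Im) auto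
    thus ?thesis by (simp flip: complex_eq)
  qed
  have "(\<lambda>t. indicator {0<..} t *\<^sub>R (complex_of_real t powr (complex_of_real \<beta> * w) *
      complex_of_real (\<beta> * t powr (- \<beta> - 1) * (x * exp (- x * t powr (- \<beta>)))))) = (\<lambda>t. complex_of_real x powr w * k t)"
  proof
    fix t :: real
    show "indicator {0<..} t *\<^sub>R (complex_of_real t powr (complex_of_real \<beta> * w) *
      complex_of_real (\<beta> * t powr (- \<beta> - 1) * (x * exp (- x * t powr (- \<beta>))))) = complex_of_real x powr w * k t"
    proof (cases "0 < t")
      case True
      have lg: "ln (g t) = ln x - \<beta> * ln t" using True x by (simp add: g_def ln_mult_pos ln_powr)
      have gp: "g t > 0" using True x by (simp add: g_def)
      have "complex_of_real x powr w * complex_of_real (g t) powr (- w) = complex_of_real t powr (complex_of_real \<beta> * w)"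
        using True x gp by (simp add: powr_def Ln_of_real lg exp_add[symmetric] algebra_simps)
      moreover have "\<bar>g' t\<bar> = \<beta> * x * t powr (- \<beta> - 1)" using \<beta> x by (simp add: g'_def)
      moreover have "exp (- x * t powr (- \<beta>)) = exp (- g t)" by (simp add: g_def)
      ultimately show ?thesis using True unfolding k_def h_def by (simp add: mult_ac)
    qed (simp add: k_def)
  qed
  thus ?thesis using has_bochner_integral_mult_right[OF hk, of "complex_of_real x powr w"] by simp
qed


section \<open>Sectors\<close>

definition sector :: "real \<Rightarrow> complex set" where
  "sector \<theta> = {t. t \<noteq> 0 \<and> \<bar>Arg t\<bar> < \<theta>}"

lemma sector_not_nonpos: "\<theta> \<le> pi \<Longrightarrow> t \<in> sector \<theta> \<Longrightarrow> t \<notin> \<real>\<^sub>\<le>\<^sub>0"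
proof
  assume \<theta>: "\<theta> \<le> pi" and t: "t \<in> sector \<theta>" and "t \<in> \<real>\<^sub>\<le>\<^sub>0"
  then obtain x where x: "t = complex_of_real x" "x \<le> 0" by (auto elim!: nonpos_Reals_cases)
  hence "x < 0" using t by (auto simp: sector_def order_less_le)
  hence "Arg t = pi" using x by (simp add: Arg_of_real)
  thus False using t \<theta> by (simp add: sector_def)
qed

text \<open>
  In logarithmic coordinates a truncated sector is a convex half-strip.
\<close>

lemma sector_eq_exp:
  assumes "\<theta> \<le> pi"
  shows "{t \<in> sector \<theta>. r < ln (norm t)} = exp ` {z. r < Re z \<and> \<bar>Im z\<bar> < \<theta>}"
proof (intro equalityI subsetI)
  fix t assume t: "t \<in> {t \<in> sector \<theta>. r < ln (norm t)}"
  hence "t = exp (Ln t)" "\<bar>Im (Ln t)\<bar> < \<theta>" "r < Re (Ln t)" by (auto simp: sector_def Arg_eq_Im_Ln)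
  thus "t \<in> exp ` {z. r < Re z \<and> \<bar>Im z\<bar> < \<theta>}" by blast
next
  fix t assume "t \<in> exp ` {z. r < Re z \<and> \<bar>Im z\<bar> < \<theta>}"
  then obtain z where z: "t = exp z" "r < Re z" "\<bar>Im z\<bar> < \<theta>" by blast
  have "Ln (exp z) = z" using z assms by (intro Ln_exp) auto
  thus "t \<in> {t \<in> sector \<theta>. r < ln (norm t)}" using z by (simp add: sector_def Arg_eq_Im_Ln)
qed

lemma sector_eq_exp':
  assumes "\<theta> \<le> pi"
  shows "sector \<theta> = exp ` {z. \<bar>Im z\<bar> < \<theta>}"
proof (intro equalityI subsetI)
  fix t assume t: "t \<in> sector \<theta>"
  hence "t = exp (Ln t)" "\<bar>Im (Ln t)\<bar> < \<theta>" by (auto simp: sector_def Arg_eq_Im_Ln)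
  thus "t \<in> exp ` {z. \<bar>Im z\<bar> < \<theta>}" by blast
next
  fix t assume "t \<in> exp ` {z. \<bar>Im z\<bar> < \<theta>}"
  then obtain z where z: "t = exp z" "\<bar>Im z\<bar> < \<theta>" by blast
  have "Ln (exp z) = z" using z assms by (intro Ln_exp) auto
  thus "t \<in> sector \<theta>" using z by (simp add: sector_def Arg_eq_Im_Ln)
qed

lemma convex_strip: "convex {z. r < Re z \<and> \<bar>Im z\<bar> < \<theta>}" "convex {z. \<bar>Im z\<bar> < \<theta>}"
proof -
  have e: "{z. \<bar>Im z\<bar> < \<theta>} = {z. Im z < \<theta>} \<inter> {z. Im z > - \<theta>}" by auto
  show 1: "convex {z. \<bar>Im z\<bar> < \<theta>}"
    unfolding e by (intro convex_Int convex_halfspace_Im_lt convex_halfspace_Im_gt)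
  have "{z. r < Re z \<and> \<bar>Im z\<bar> < \<theta>} = {z. Re z > r} \<inter> {z. \<bar>Im z\<bar> < \<theta>}" by auto
  thus "convex {z. r < Re z \<and> \<bar>Im z\<bar> < \<theta>}" using 1 convex_halfspace_Re_gt by (auto intro: convex_Int)
qed

lemma connected_sector: "\<theta> \<le> pi \<Longrightarrow> connected (sector \<theta>)"
  by (simp add: sector_eq_exp' connected_continuous_image convex_connected convex_strip continuous_intros)

lemma open_sector:
  assumes "\<theta> \<le> pi"
  shows "open (sector \<theta>)"
proof -
  have "open ((- \<real>\<^sub>\<le>\<^sub>0) \<inter> (\<lambda>t. \<bar>Im (Ln t)\<bar>) -` {..<\<theta>})"
    by (intro continuous_open_preimage continuous_intros) auto
  moreover have "sector \<theta> = (- \<real>\<^sub>\<le>\<^sub>0) \<inter> (\<lambda>t. \<bar>Im (Ln t)\<bar>) -` {..<\<theta>}"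
  proof (rule set_eqI)
    fix x :: complex
    show "x \<in> sector \<theta> \<longleftrightarrow> x \<in> (- \<real>\<^sub>\<le>\<^sub>0) \<inter> (\<lambda>t. \<bar>Im (Ln t)\<bar>) -` {..<\<theta>}"
      using sector_not_nonpos[OF assms, of x] by (cases "x = 0") (auto simp: sector_def Arg_eq_Im_Ln)
  qed
  ultimately show ?thesis by simp
qed

lemma of_real_sector: "0 < x \<Longrightarrow> 0 < \<theta> \<Longrightarrow> complex_of_real x \<in> sector \<theta>"
  by (simp add: sector_def Arg_of_real)

lemma sector_continuation:
  assumes \<theta>: "0 < \<theta>" "\<theta> \<le> pi" and hol: "f holomorphic_on sector \<theta>" "g holomorphic_on sector \<theta>"
    and eq: "\<And>x. 0 < x \<Longrightarrow> f (complex_of_real x) = g (complex_of_real x)" and t: "t \<in> sector \<theta>"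
  shows "f t = g t"
proof -
  have "(\<lambda>t. f t - g t) t = 0"
  proof (rule analytic_continuation[where f="\<lambda>t. f t - g t" and S="sector \<theta>" and U="complex_of_real ` {0<..}" and \<xi>=1])
    show "(1::complex) islimpt complex_of_real ` {0<..}"
    proof (rule islimpt_sequential[THEN iffD2], intro exI conjI allI)
      fix n :: nat
      show "complex_of_real (1 + 1 / real (Suc n)) \<in> complex_of_real ` {0<..} - {1}"
        by (auto simp: add_pos_nonneg simp del: of_real_add)
      show "(\<lambda>n. complex_of_real (1 + 1 / real (Suc n))) \<longlonglongrightarrow> 1"
        using tendsto_of_real[OF tendsto_add[OF tendsto_const[of 1] LIMSEQ_Suc[OF lim_1_over_n[where ?'a=real]]], where ?'a=complex] by simp
    qed
    show "complex_of_real ` {0<..} \<subseteq> sector \<theta>" "1 \<in> sector \<theta>"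
      using of_real_sector[OF _ \<theta>(1)] of_real_sector[OF _ \<theta>(1), of 1] by auto
  qed (use assms open_sector connected_sector in \<open>auto intro!: holomorphic_intros\<close>)
  thus ?thesis by simp
qed

text \<open>
  The identity theorem on the half-strip.
\<close>

lemma sector_outside_continuation:
  assumes \<theta>: "0 < \<theta>" "\<theta> \<le> pi" and hol: "f holomorphic_on {t \<in> sector \<theta>. r < ln (norm t)}" "g holomorphic_on {t \<in> sector \<theta>. r < ln (norm t)}"
    and eq: "\<And>x. 0 < x \<Longrightarrow> r < ln x \<Longrightarrow> f (complex_of_real x) = g (complex_of_real x)" and t: "t \<in> sector \<theta>" "r < ln (norm t)"
  shows "f t = g t"
proof -
  define S where "S = {z. r < Re z \<and> \<bar>Im z\<bar> < \<theta>}"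
  have ex: "exp z \<in> {t \<in> sector \<theta>. r < ln (norm t)}" if "z \<in> S" for z
    using that unfolding sector_eq_exp[OF \<theta>(2)] S_def by blast
  have oS: "open S"
  proof -
    have "S = {z. Re z > r} \<inter> {z. Im z < \<theta>} \<inter> {z. Im z > - \<theta>}" by (auto simp: S_def)
    thus ?thesis by (auto intro!: open_Int open_halfspace_Re_gt open_halfspace_Im_lt open_halfspace_Im_gt)
  qed
  have "(\<lambda>z. f (exp z) - g (exp z)) (Ln t) = 0"
  proof (rule analytic_continuation[where f="\<lambda>z. f (exp z) - g (exp z)" and U="complex_of_real ` {r<..}" and \<xi>="complex_of_real (r + 1)" and S=S])
    have h: "(f \<circ> exp) holomorphic_on S" "(g \<circ> exp) holomorphic_on S"
      using ex by (auto intro!: holomorphic_on_compose_gen[OF _ hol(1)] holomorphic_on_compose_gen[OF _ hol(2)] holomorphic_intros)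
    show "(\<lambda>z. f (exp z) - g (exp z)) holomorphic_on S"
      using holomorphic_on_diff[OF h] by (simp add: o_def)
    show "complex_of_real (r + 1) islimpt complex_of_real ` {r<..}"
    proof (rule islimpt_sequential[THEN iffD2], intro exI conjI allI)
      fix n :: nat
      have "r + 1 + 1 / real (Suc n) > r" by (simp add: add_pos_nonneg)
      thus "complex_of_real (r + 1 + 1 / real (Suc n)) \<in> complex_of_real ` {r<..} - {complex_of_real (r + 1)}"
        by (auto simp del: of_real_add)
      show "(\<lambda>n. complex_of_real (r + 1 + 1 / real (Suc n))) \<longlonglongrightarrow> complex_of_real (r + 1)"
        using tendsto_of_real[OF tendsto_add[OF tendsto_const[of "r + 1"] LIMSEQ_Suc[OF lim_1_over_n[where ?'a=real]]], where ?'a=complex] by simp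
    qed
    fix z assume "z \<in> complex_of_real ` {r<..}"
    then obtain x where "z = complex_of_real x" "r < x" by auto
    thus "f (exp z) - g (exp z) = 0" using eq[of "exp x"] by (simp add: exp_of_real)
  qed (use oS convex_strip \<theta> t in \<open>auto simp: S_def sector_def Arg_eq_Im_Ln intro: convex_connected\<close>)
  thus ?thesis using t by (simp add: sector_def)
qed

lemma S_sector_eq:
  assumes "0 < \<beta>"
  shows "S_sector \<phi> \<beta> = sector (min (pi - Theta_upper \<phi>) ((pi - Theta_upper \<phi>) / \<beta>))"
  using assms by (auto simp: S_sector_def S_bern_def sector_def pos_less_divide_eq mult.commute)

context bernstein_function
begin

section \<open>The density\<close>

text \<open>
  Minus the derivative of the Laplace transform of the exponential functional.
\<close>

definition laplace_I :: "complex \<Rightarrow> complex" where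
  "laplace_I s = (\<integral>x. complex_of_real x * exp (- s * complex_of_real x) \<partial>\<mu>\<^sub>I)"

lemma integrable_I: "integrable \<mu>\<^sub>I (\<lambda>x. x)" and integral_I: "(\<integral>x. x \<partial>\<mu>\<^sub>I) = Re (IM 1)"
proof -
  have "- a_killed \<phi> < ereal (1 + 1)" by (rule pos_gt_a_killed) simp
  from \<mu>\<^sub>I_real_moment[OF this] have h: "has_bochner_integral \<mu>\<^sub>I (\<lambda>x. x powr 1) (Re (IM 1))" by simp
  have "has_bochner_integral \<mu>\<^sub>I (\<lambda>x. x) (Re (IM 1))"
    by (subst has_bochner_integral_cong_AE[of "\<lambda>x. x" _ "\<lambda>x. x powr 1"])
       (use h \<mu>\<^sub>I_pos real_distribution.events_eq_borel[OF \<mu>\<^sub>I_distribution] in \<open>auto elim!: eventually_mono cong: measurable_cong_sets\<close>)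
  thus "integrable \<mu>\<^sub>I (\<lambda>x. x)" "(\<integral>x. x \<partial>\<mu>\<^sub>I) = Re (IM 1)" by (auto simp: has_bochner_integral_iff)
qed

lemma laplace_I_bound:
  assumes "0 \<le> Re s"
  shows "integrable \<mu>\<^sub>I (\<lambda>x. complex_of_real x * exp (- s * complex_of_real x))"
    and "norm (laplace_I s) \<le> Re (IM 1)"
proof -
  interpret real_distribution \<mu>\<^sub>I by (rule \<mu>\<^sub>I_distribution)
  have b: "AE x in \<mu>\<^sub>I. norm (complex_of_real x * exp (- s * complex_of_real x)) \<le> x"
    using \<mu>\<^sub>I_pos
  proof eventually_elim
    case (elim x)
    have "x * exp (- Re s * x) \<le> x * 1" using elim assms by (intro mult_left_mono) auto
    thus ?case using elim by (simp add: norm_mult)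
  qed
  show i: "integrable \<mu>\<^sub>I (\<lambda>x. complex_of_real x * exp (- s * complex_of_real x))"
    by (rule Bochner_Integration.integrable_bound[OF integrable_I]) (use b in \<open>auto elim!: eventually_mono\<close>)
  have "norm (laplace_I s) \<le> (\<integral>x. x \<partial>\<mu>\<^sub>I)"
    unfolding laplace_I_def by (rule order_trans[OF integral_norm_bound integral_mono_AE[OF integrable_norm[OF i] integrable_I b]])
  thus "norm (laplace_I s) \<le> Re (IM 1)" by (simp add: integral_I)
qed

lemma laplace_I_holomorphic: "laplace_I holomorphic_on {s. 0 < Re s}"
  unfolding laplace_I_def[abs_def]
proof (rule holomorphic_on_integral)
  interpret real_distribution \<mu>\<^sub>I by (rule \<mu>\<^sub>I_distribution)
  show "(\<lambda>x. complex_of_real x * exp (- s * complex_of_real x)) \<in> borel_measurable \<mu>\<^sub>I" for s by measurable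
  fix s :: complex assume s: "s \<in> {s. 0 < Re s}"
  have sub: "cball s (Re s / 2) \<subseteq> {s. 0 < Re s}"
  proof
    fix w assume "w \<in> cball s (Re s / 2)"
    hence "\<bar>Re s - Re w\<bar> \<le> Re s / 2" using abs_Re_le_cmod[of "s - w"] by (simp add: dist_norm)
    thus "w \<in> {s. 0 < Re s}" unfolding mem_Collect_eq using s[simplified] by linarith
  qed
  have "AE x in \<mu>\<^sub>I. \<forall>w\<in>cball s (Re s / 2). norm (complex_of_real x * exp (- w * complex_of_real x)) \<le> x"
    using \<mu>\<^sub>I_pos
  proof eventually_elim
    case (elim x)
    show ?case
    proof
      fix w assume "w \<in> cball s (Re s / 2)"
      hence "0 < Re w" using sub by auto
      hence "x * exp (- Re w * x) \<le> x * 1" using elim by (intro mult_left_mono) auto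
      thus "norm (complex_of_real x * exp (- w * complex_of_real x)) \<le> x" using elim by (simp add: norm_mult)
    qed
  qed
  thus "\<exists>r>0. \<exists>B. cball s r \<subseteq> {s. 0 < Re s} \<and> integrable \<mu>\<^sub>I B \<and>
        (AE x in \<mu>\<^sub>I. \<forall>w\<in>cball s r. norm (complex_of_real x * exp (- w * complex_of_real x)) \<le> B x)"
    using sub s integrable_I by (intro exI[of _ "Re s / 2"] conjI exI[of _ "\<lambda>x. x"]) auto
qed (auto intro!: holomorphic_intros open_halfspace_Re_gt)

lemma laplace_I_real:
  assumes "0 < s"
  shows "laplace_I (complex_of_real s) = complex_of_real (\<integral>x. x * exp (- x * s) \<partial>\<mu>\<^sub>I)"
    and "0 < (\<integral>x. x * exp (- x * s) \<partial>\<mu>\<^sub>I)" and "integrable \<mu>\<^sub>I (\<lambda>x. x * exp (- x * s))"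
proof -
  interpret real_distribution \<mu>\<^sub>I by (rule \<mu>\<^sub>I_distribution)
  have e: "complex_of_real x * exp (- complex_of_real s * complex_of_real x) = complex_of_real (x * exp (- x * s))" for x
    by (simp add: mult.commute flip: exp_of_real)
  show "laplace_I (complex_of_real s) = complex_of_real (\<integral>x. x * exp (- x * s) \<partial>\<mu>\<^sub>I)"
    unfolding laplace_I_def e by (rule integral_complex_of_real)
  have "integrable \<mu>\<^sub>I (\<lambda>x. complex_of_real (x * exp (- x * s)))"
    using laplace_I_bound(1)[of "complex_of_real s"] assms unfolding e by simp
  from integrable_Re[OF this] show i: "integrable \<mu>\<^sub>I (\<lambda>x. x * exp (- x * s))" by simp
  have nn: "AE x in \<mu>\<^sub>I. 0 \<le> x * exp (- x * s)" using \<mu>\<^sub>I_pos by eventually_elim simp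
  have "(\<integral>x. x * exp (- x * s) \<partial>\<mu>\<^sub>I) \<noteq> 0"
  proof
    assume "(\<integral>x. x * exp (- x * s) \<partial>\<mu>\<^sub>I) = 0"
    hence "AE x in \<mu>\<^sub>I. x * exp (- x * s) = 0" using integral_nonneg_eq_0_iff_AE[OF i nn] by simp
    hence "AE x in \<mu>\<^sub>I. False" using \<mu>\<^sub>I_pos by eventually_elim simp
    thus False by simp
  qed
  thus "0 < (\<integral>x. x * exp (- x * s) \<partial>\<mu>\<^sub>I)" using integral_nonneg_AE[OF nn] by linarith
qed

text \<open>
  The density of \<open>(I / e) powr (1 / \<beta>)\<close>: it is the derivative in \<open>t\<close>
  of \<open>P(e \<ge> I t powr (- \<beta>)) = E(exp (- I t powr (- \<beta>)))\<close>.
\<close>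

definition dens :: "real \<Rightarrow> real \<Rightarrow> real" where
  "dens \<beta> t = (if 0 < t then \<beta> * t powr (- \<beta> - 1) * (\<integral>x. x * exp (- x * t powr (- \<beta>)) \<partial>\<mu>\<^sub>I) else 0)"

text \<open>
  The formula for the density continues to those complex \<open>t\<close> for which \<open>t powr (-
  \<beta>)\<close> has positive real part, where it comes with explicit bounds.
\<close>

definition dens_c :: "real \<Rightarrow> complex \<Rightarrow> complex" where
  "dens_c \<beta> t = complex_of_real \<beta> * t powr complex_of_real (- \<beta> - 1) * laplace_I (t powr complex_of_real (- \<beta>))"

lemma dens_c_real:
  assumes "0 < \<beta>" "0 < t"
  shows "dens_c \<beta> (complex_of_real t) = complex_of_real (dens \<beta> t)"
proof -
  have p: "complex_of_real t powr complex_of_real y = complex_of_real (t powr y)" for y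
    using assms by (intro powr_of_real) auto
  have "0 < t powr (- \<beta>)" using assms by simp
  from laplace_I_real(1)[OF this] show ?thesis
    using assms(2) unfolding dens_c_def dens_def p by (simp only: if_True of_real_mult mult.assoc)
qed

lemma dens_pos: "0 < \<beta> \<Longrightarrow> 0 < t \<Longrightarrow> 0 < dens \<beta> t"
  unfolding dens_def by (simp only: if_True) (intro mult_pos_pos laplace_I_real(2); simp)

text \<open>
  The half-angle \<open>\<pi> / (2 \<beta>)\<close> keeps \<open>t powr (- \<beta>)\<close> in the
  right half-plane.
\<close>

definition dom_c :: "real \<Rightarrow> complex set" where "dom_c \<beta> = sector (min pi (pi / (2 * \<beta>)))"

lemma Re_powr_pos:
  assumes "0 < \<beta>" "t \<in> dom_c \<beta>"
  shows "0 < Re (t powr complex_of_real (- \<beta>))"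
proof -
  have t: "t \<noteq> 0" "\<bar>Im (Ln t)\<bar> < pi / (2 * \<beta>)" using assms by (auto simp: dom_c_def sector_def Arg_eq_Im_Ln)
  have "\<bar>\<beta> * Im (Ln t)\<bar> < pi / 2" using t(2) assms(1) by (simp add: abs_mult pos_less_divide_eq mult_ac)
  hence "0 < cos (- \<beta> * Im (Ln t))" by (intro cos_gt_zero_pi) (auto simp: abs_less_iff)
  thus ?thesis using t(1) by (simp add: powr_def Re_exp)
qed

lemma dens_c_holomorphic: "0 < \<beta> \<Longrightarrow> dens_c \<beta> holomorphic_on dom_c \<beta>"
proof -
  assume \<beta>: "0 < \<beta>"
  have nn: "t \<notin> \<real>\<^sub>\<le>\<^sub>0" if "t \<in> dom_c \<beta>" for t
    using that sector_not_nonpos[of "min pi (pi / (2 * \<beta>))" t] by (simp add: dom_c_def)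
  have "(laplace_I \<circ> (\<lambda>t. t powr complex_of_real (- \<beta>))) holomorphic_on dom_c \<beta>"
    by (rule holomorphic_on_compose_gen[OF _ laplace_I_holomorphic]) (use nn Re_powr_pos[OF \<beta>] in \<open>auto intro!: holomorphic_intros\<close>)
  thus ?thesis unfolding dens_c_def[abs_def] using nn by (auto intro!: holomorphic_intros simp: o_def)
qed

lemma dens_c_bound:
  assumes "0 < \<beta>" "t \<in> dom_c \<beta>"
  shows "norm (dens_c \<beta> t) \<le> \<beta> * norm t powr (- \<beta> - 1) * Re (IM 1)"
proof -
  have "norm (t powr complex_of_real (- \<beta> - 1)) = norm t powr (- \<beta> - 1)"
    by (subst norm_powr_real_powr') simp_all
  thus ?thesis unfolding dens_c_def using assms(1) laplace_I_bound(2)[OF less_imp_le[OF Re_powr_pos[OF assms]]]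
    by (auto simp: norm_mult intro!: mult_left_mono)
qed

lemma dens_continuous: "0 < \<beta> \<Longrightarrow> continuous_on {0<..} (dens \<beta>)"
proof -
  assume \<beta>: "0 < \<beta>"
  have "continuous_on {0<..} (\<lambda>t. Re (dens_c \<beta> (complex_of_real t)))"
    by (intro continuous_intros continuous_on_compose2[OF holomorphic_on_imp_continuous_on[OF dens_c_holomorphic[OF \<beta>]]])
       (use \<beta> of_real_sector in \<open>auto simp: dom_c_def\<close>)
  thus ?thesis by (rule continuous_on_eq) (simp add: dens_c_real \<beta>)
qed

lemma dens_measurable [measurable]: "0 < \<beta> \<Longrightarrow> dens \<beta> \<in> borel_measurable borel"
proof -
  assume "0 < \<beta>"
  hence "(\<lambda>t. indicator {0<..} t *\<^sub>R dens \<beta> t) \<in> borel_measurable borel"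
    by (intro borel_measurable_continuous_on_indicator dens_continuous) auto
  also have "(\<lambda>t. indicator {0<..} t *\<^sub>R dens \<beta> t) = dens \<beta>" by (auto simp: dens_def fun_eq_iff indicator_def)
  finally show ?thesis .
qed

lemma dens_nonneg: "0 < \<beta> \<Longrightarrow> 0 \<le> dens \<beta> t"
  using dens_pos[of \<beta> t] by (cases "0 < t") (auto simp: dens_def)

end


section \<open>Derivatives along the positive axis\<close>

lemma real_deriv_of_holomorphic_step:
  assumes S: "open S" and g: "g holomorphic_on S" and sub: "\<And>t. t > 0 \<Longrightarrow> complex_of_real t \<in> S"
    and f: "\<And>t. t > 0 \<Longrightarrow> f t = Re (g (complex_of_real t))" and t: "t > 0"
  shows "(f has_real_derivative Re (deriv g (complex_of_real t))) (at t)"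
proof -
  have "(g has_field_derivative deriv g (complex_of_real t)) (at (complex_of_real t))"
    by (rule holomorphic_derivI[OF g S sub[OF t]])
  hence "((\<lambda>t. g (complex_of_real t)) has_vector_derivative deriv g (complex_of_real t)) (at t)"
    by (rule has_vector_derivative_real_field)
  from bounded_linear.has_vector_derivative[OF bounded_linear_Re this]
  have "((\<lambda>t. Re (g (complex_of_real t))) has_real_derivative Re (deriv g (complex_of_real t))) (at t)"
    by (simp add: has_real_derivative_iff_has_vector_derivative)
  thus ?thesis
    by (rule has_field_derivative_transform_within_open[where S="{0<..}"]) (use t f in auto)
qed

lemma real_deriv_of_holomorphic:
  assumes S: "open S" and g: "g holomorphic_on S" and sub: "\<And>t. t > 0 \<Longrightarrow> complex_of_real t \<in> S"
    and f: "\<And>t. t > 0 \<Longrightarrow> f t = Re (g (complex_of_real t))" and t: "t > 0"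
  shows "(deriv ^^ n) f t = Re ((deriv ^^ n) g (complex_of_real t))"
    and "(deriv ^^ n) f field_differentiable at t"
proof -
  have eq: "(deriv ^^ n) f t = Re ((deriv ^^ n) g (complex_of_real t))" if "t > 0" for t n
    using that
  proof (induction n arbitrary: t)
    case 0 thus ?case using f by simp
  next
    case (Suc n)
    have "((deriv ^^ n) f has_real_derivative Re (deriv ((deriv ^^ n) g) (complex_of_real t))) (at t)"
      by (rule real_deriv_of_holomorphic_step[OF S holomorphic_higher_deriv[OF g S] sub Suc.IH Suc.prems])
    thus ?case by (simp add: DERIV_imp_deriv)
  qed
  thus "(deriv ^^ n) f t = Re ((deriv ^^ n) g (complex_of_real t))" using t by blast
  have "((deriv ^^ n) f has_real_derivative Re (deriv ((deriv ^^ n) g) (complex_of_real t))) (at t)"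
    by (rule real_deriv_of_holomorphic_step[OF S holomorphic_higher_deriv[OF g S] sub eq t])
  thus "(deriv ^^ n) f field_differentiable at t" unfolding field_differentiable_def by blast
qed

section \<open>Existence and uniqueness of the law\<close>

lemma norm_powr_complex: "t \<noteq> 0 \<Longrightarrow> norm (t powr s) = exp (Re s * ln (norm t) - Im s * Arg t)"
  by (simp add: powr_def Arg_eq_Im_Ln)

text \<open>
  The purely imaginary moments are the characteristic function of \<open>ln F\<close>.
\<close>

lemma is_F_unique:
  assumes M: "is_F \<phi> \<beta> M (\<lambda>x::real. x)" and N: "is_F \<phi> \<beta> N (\<lambda>x::real. x)"
    and sets: "sets M = sets borel" "sets N = sets borel" and low: "0 < m_lower \<phi> \<beta>" and \<beta>: "0 < \<beta>"
  shows "M = N"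
proof -
  have key: "real_distribution (distr M borel ln) \<and> M = distr (distr M borel ln) borel exp \<and>
     (\<forall>b. char (distr M borel ln) b = Gamma (1 - Complex 0 b / complex_of_real \<beta>) * Gamma_over_W \<phi> (Complex 0 b / complex_of_real \<beta> + 1))"
    if M: "is_F \<phi> \<beta> M (\<lambda>x::real. x)" and s: "sets M = sets borel" for M
  proof (intro conjI allI)
    note [measurable_cong] = s
    interpret prob_space M using M by (simp add: is_F_def)
    have pos: "AE x in M. 0 < x" using M by (simp add: is_F_def)
    show "real_distribution (distr M borel ln)" by (intro real_distribution_distr prob_space_axioms) measurable
    have "distr (distr M borel ln) borel exp = distr M borel (\<lambda>x. exp (ln x))" by (subst distr_distr) (auto simp: o_def)
    also have "\<dots> = distr M borel (\<lambda>x. x)" by (rule distr_cong_AE) (use pos in \<open>auto elim!: eventually_mono\<close>)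
    also have "\<dots> = M" by (rule distr_id2[OF s[symmetric]])
    finally show "M = distr (distr M borel ln) borel exp" by simp
    fix b :: real
    have "- m_lower \<phi> \<beta> < 0" using low by (simp add: ereal_uminus_less_reorder)
    hence "(\<integral>x. complex_of_real x powr Complex 0 b \<partial>M) = Gamma (1 - Complex 0 b / complex_of_real \<beta>) * Gamma_over_W \<phi> (Complex 0 b / complex_of_real \<beta> + 1)"
      using M \<beta> unfolding is_F_def m_upper_def by (auto simp: zero_ereal_def)
    moreover have "char (distr M borel ln) b = (\<integral>x. complex_of_real x powr Complex 0 b \<partial>M)"
      unfolding char_def
    proof (subst integral_distr, measurable, rule integral_cong_AE)
      show "AE x in M. iexp (b * ln x) = complex_of_real x powr Complex 0 b"
        using pos by eventually_elim (simp add: powr_def Ln_of_real Complex_eq mult_ac)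
    qed measurable
    ultimately show "char (distr M borel ln) b = Gamma (1 - Complex 0 b / complex_of_real \<beta>) * Gamma_over_W \<phi> (Complex 0 b / complex_of_real \<beta> + 1)" by simp
  qed
  have "distr M borel ln = distr N borel ln"
    by (rule Levy_uniqueness) (use key[OF M sets(1)] key[OF N sets(2)] in auto)
  thus ?thesis using key[OF M sets(1)] key[OF N sets(2)] by metis
qed

context bernstein_function
begin

text \<open>
  The strips of the theorem in the variable \<open>w\<close> of \<open>Mel\<close>: \<open>w\<close>
  is \<open>z / \<beta>\<close> for the moments and \<open>z - 1 / \<beta>\<close> under the
  Mellin-Barnes integral.
\<close>

lemma mellin_strip_iff:
  assumes \<beta>: "0 < \<beta>"
  shows "- m_lower \<phi> \<beta> < ereal x \<longleftrightarrow> - a_killed \<phi> < ereal (x / \<beta> + 1)"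
    and "- ((m_lower \<phi> \<beta> - 1) / ereal \<beta>) < ereal x \<longleftrightarrow> - a_killed \<phi> < ereal (x - 1 / \<beta> + 1)"
    and "0 < m_lower \<phi> \<beta>"
    and "ereal x < (m_upper \<beta> + 1) / ereal \<beta> \<longleftrightarrow> x - 1 / \<beta> < 1"
proof -
  show "ereal x < (m_upper \<beta> + 1) / ereal \<beta> \<longleftrightarrow> x - 1 / \<beta> < 1"
    using \<beta> by (simp add: m_upper_def one_ereal_def field_simps)
  have "(- m_lower \<phi> \<beta> < ereal x \<longleftrightarrow> - a_killed \<phi> < ereal (x / \<beta> + 1)) \<and>
    (- ((m_lower \<phi> \<beta> - 1) / ereal \<beta>) < ereal x \<longleftrightarrow> - a_killed \<phi> < ereal (x - 1 / \<beta> + 1)) \<and> 0 < m_lower \<phi> \<beta>"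
  proof (cases "a_killed \<phi>")
    case (real r)
    hence "0 \<le> r" using a_killed_nonneg by simp
    hence "0 < \<beta> * (r + 1)" using \<beta> by (intro mult_pos_pos) auto
    thus ?thesis using real \<beta> by (simp add: m_lower_def one_ereal_def zero_ereal_def field_simps) auto
  qed (use a_killed_nonneg \<beta> in \<open>auto simp: m_lower_def one_ereal_def\<close>)
  thus "- m_lower \<phi> \<beta> < ereal x \<longleftrightarrow> - a_killed \<phi> < ereal (x / \<beta> + 1)"
    "- ((m_lower \<phi> \<beta> - 1) / ereal \<beta>) < ereal x \<longleftrightarrow> - a_killed \<phi> < ereal (x - 1 / \<beta> + 1)" "0 < m_lower \<phi> \<beta>" by blast+
qed

text \<open>
  Fubini's theorem and the Mellin transform of the kernel for a fixed value of the exponential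
  functional.
\<close>

lemma dens_mellin:
  assumes \<beta>: "0 < \<beta>" and w: "- a_killed \<phi> < ereal (Re w + 1)" "Re w < 1"
  shows "has_bochner_integral lborel
     (\<lambda>t. indicator {0<..} t *\<^sub>R (complex_of_real t powr (complex_of_real \<beta> * w) * complex_of_real (dens \<beta> t))) (Mel w)"
proof -
  interpret I: real_distribution \<mu>\<^sub>I by (rule \<mu>\<^sub>I_distribution)
  interpret P: pair_sigma_finite \<mu>\<^sub>I lborel ..
  define G where "G v x t = indicator {0<..} t *\<^sub>R (complex_of_real t powr (complex_of_real \<beta> * v) *
      complex_of_real (\<beta> * t powr (- \<beta> - 1) * (x * exp (- x * t powr (- \<beta>)))))" for v x t
  have Gm[measurable]: "case_prod (G w) \<in> borel_measurable (\<mu>\<^sub>I \<Otimes>\<^sub>M lborel)" unfolding G_def by measurable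
  have Gi: "has_bochner_integral lborel (G v x) (complex_of_real x powr v * Gamma (1 - v))" if "0 < x" "Re v < 1" for x v
    unfolding G_def[abs_def] by (rule gamma_kernel[OF that(1) \<beta> that(2)])
  define r where "r = complex_of_real (Re w)"
  have nG: "norm (G w x t) = Re (G r x t)" if "0 < x" for x t
  proof (cases "0 < t")
    case True
    have "complex_of_real t powr (complex_of_real \<beta> * r) = complex_of_real (t powr (\<beta> * Re w))"
      using True unfolding r_def of_real_mult[symmetric] by (intro powr_of_real) auto
    moreover have "norm (complex_of_real t powr (complex_of_real \<beta> * w)) = t powr (\<beta> * Re w)"
      using True by (simp add: norm_powr_pos)
    ultimately show ?thesis using True that \<beta> unfolding G_def norm_mult norm_scaleR norm_of_real by (simp add: abs_mult)
  qed (simp add: G_def)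
  have int: "integrable (\<mu>\<^sub>I \<Otimes>\<^sub>M lborel) (case_prod (G w))"
  proof (rule P.Fubini_integrable)
    have "has_bochner_integral \<mu>\<^sub>I (\<lambda>x. complex_of_real x powr r * Gamma (1 - r)) (IM r * Gamma (1 - r))"
      by (intro has_bochner_integral_mult_left \<mu>\<^sub>I_mellin) (use w in \<open>simp add: r_def\<close>)
    from has_bochner_integral_Re[OF this]
    have i: "integrable \<mu>\<^sub>I (\<lambda>x. Re (complex_of_real x powr r * Gamma (1 - r)))" by (simp add: has_bochner_integral_iff)
    have e: "AE x in \<mu>\<^sub>I. Re (complex_of_real x powr r * Gamma (1 - r)) = (\<integral>t. norm (case (x, t) of (x, t) \<Rightarrow> G w x t) \<partial>lborel)"
      using \<mu>\<^sub>I_pos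
    proof eventually_elim
      case (elim x)
      have "has_bochner_integral lborel (\<lambda>t. Re (G r x t)) (Re (complex_of_real x powr r * Gamma (1 - r)))"
        by (rule has_bochner_integral_Re[OF Gi[OF elim]]) (use w in \<open>simp add: r_def\<close>)
      thus ?case using nG[OF elim] by (simp add: has_bochner_integral_iff)
    qed
    show "integrable \<mu>\<^sub>I (\<lambda>x. \<integral>t. norm (case (x, t) of (x, t) \<Rightarrow> G w x t) \<partial>lborel)"
      by (rule integrable_cong_AE_imp[OF i]) (use e in \<open>auto elim!: eventually_mono\<close>)
    show "AE x in \<mu>\<^sub>I. integrable lborel (\<lambda>t. case (x, t) of (x, t) \<Rightarrow> G w x t)"
      using \<mu>\<^sub>I_pos by eventually_elim (use Gi w in \<open>auto simp: has_bochner_integral_iff\<close>)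
  qed measurable
  have "(\<integral>t. (\<integral>x. G w x t \<partial>\<mu>\<^sub>I) \<partial>lborel) = (\<integral>x. (\<integral>t. G w x t \<partial>lborel) \<partial>\<mu>\<^sub>I)"
    using P.integral_snd[OF int] P.integral_fst[OF int] by (simp add: case_prod_beta')
  also have "\<dots> = (\<integral>x. complex_of_real x powr w * Gamma (1 - w) \<partial>\<mu>\<^sub>I)"
  proof (rule integral_cong_AE)
    show "AE x in \<mu>\<^sub>I. (\<integral>t. G w x t \<partial>lborel) = complex_of_real x powr w * Gamma (1 - w)"
      using \<mu>\<^sub>I_pos by eventually_elim (use Gi w in \<open>auto simp: has_bochner_integral_iff\<close>)
  qed measurable
  also have "\<dots> = Mel w" using \<mu>\<^sub>I_mellin[OF w(1)] by (simp add: has_bochner_integral_iff Mel_def)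
  finally have "has_bochner_integral lborel (\<lambda>t. \<integral>x. G w x t \<partial>\<mu>\<^sub>I) (Mel w)"
    using P.integrable_snd[OF int] by (simp add: has_bochner_integral_iff)
  moreover have "(\<integral>x. G w x t \<partial>\<mu>\<^sub>I) = indicator {0<..} t *\<^sub>R (complex_of_real t powr (complex_of_real \<beta> * w) * complex_of_real (dens \<beta> t))" for t
  proof (cases "0 < t")
    case True
    have "(\<integral>x. G w x t \<partial>\<mu>\<^sub>I) = (\<integral>x. (complex_of_real t powr (complex_of_real \<beta> * w) * complex_of_real (\<beta> * t powr (- \<beta> - 1))) * complex_of_real (x * exp (- x * t powr (- \<beta>))) \<partial>\<mu>\<^sub>I)"
      using True by (intro Bochner_Integration.integral_cong refl) (simp add: G_def)
    also have "\<dots> = (complex_of_real t powr (complex_of_real \<beta> * w) * complex_of_real (\<beta> * t powr (- \<beta> - 1))) * (\<integral>x. complex_of_real (x * exp (- x * t powr (- \<beta>))) \<partial>\<mu>\<^sub>I)"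
      by (rule integral_mult_right_zero)
    also have "(\<integral>x. complex_of_real (x * exp (- x * t powr (- \<beta>))) \<partial>\<mu>\<^sub>I) = complex_of_real (\<integral>x. x * exp (- x * t powr (- \<beta>)) \<partial>\<mu>\<^sub>I)"
      by (rule integral_complex_of_real)
    finally show ?thesis using True by (simp add: dens_def)
  qed (simp add: G_def)
  ultimately show ?thesis by simp
qed

definition F_law :: "real \<Rightarrow> real measure" where
  "F_law \<beta> = density lborel (\<lambda>t. ennreal (dens \<beta> t))"

lemma F_law_is_F:
  assumes \<beta>: "0 < \<beta>"
  shows "is_F \<phi> \<beta> (F_law \<beta>) (\<lambda>x. x)"
  unfolding is_F_def
proof (intro conjI allI impI)
  note [measurable] = dens_measurable[OF \<beta>]
  have pos: "AE t in F_law \<beta>. 0 < t"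
  proof -
    have "0 < t" if "0 < ennreal (dens \<beta> t)" for t using that by (cases "0 < t") (auto simp: dens_def)
    hence "AE t in lborel. 0 < ennreal (dens \<beta> t) \<longrightarrow> 0 < t" by (intro AE_I2 impI)
    moreover have "(\<lambda>t. ennreal (dens \<beta> t)) \<in> borel_measurable lborel" by measurable
    ultimately show ?thesis unfolding F_law_def by (simp only: AE_density)
  qed
  have hb: "has_bochner_integral (F_law \<beta>) (\<lambda>t. complex_of_real t powr z) (Mel (z / complex_of_real \<beta>))"
    if z: "- m_lower \<phi> \<beta> < ereal (Re z)" "ereal (Re z) < m_upper \<beta>" for z
  proof -
    define w where "w = z / complex_of_real \<beta>"
    have zw: "z = complex_of_real \<beta> * w" using \<beta> by (simp add: w_def)
    have w: "- a_killed \<phi> < ereal (Re w + 1)" "Re w < 1"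
      using z mellin_strip_iff(1)[OF \<beta>, of "Re z"] \<beta> by (auto simp: w_def m_upper_def)
    have "(\<lambda>t. indicator {0<..} t *\<^sub>R (complex_of_real t powr (complex_of_real \<beta> * w) * complex_of_real (dens \<beta> t))) =
       (\<lambda>t. dens \<beta> t *\<^sub>R complex_of_real t powr z)"
      by (auto simp: fun_eq_iff indicator_def zw scaleR_conv_of_real dens_def)
    hence "has_bochner_integral lborel (\<lambda>t. dens \<beta> t *\<^sub>R complex_of_real t powr z) (Mel w)"
      using dens_mellin[OF \<beta> w] by simp
    thus ?thesis unfolding F_law_def w_def
      by (intro has_bochner_integral_density) (use dens_nonneg[OF \<beta>] in auto)
  qed
  show "prob_space (F_law \<beta>)"
  proof
    have "has_bochner_integral lborel (\<lambda>t. complex_of_real (dens \<beta> t)) 1"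
    proof -
      have "(\<lambda>t. indicator {0<..} t *\<^sub>R (complex_of_real t powr (complex_of_real \<beta> * 0) * complex_of_real (dens \<beta> t))) = (\<lambda>t. complex_of_real (dens \<beta> t))"
        by (auto simp: fun_eq_iff indicator_def dens_def)
      moreover have "- a_killed \<phi> < ereal (Re 0 + 1)" using pos_gt_a_killed[of 1] by simp
      ultimately show ?thesis using dens_mellin[OF \<beta>, of 0] by (simp add: Mel_0)
    qed
    from has_bochner_integral_Re[OF this] have h: "has_bochner_integral lborel (dens \<beta>) 1" by simp
    have "emeasure (F_law \<beta>) (space (F_law \<beta>)) = (\<integral>\<^sup>+t. ennreal (dens \<beta> t) \<partial>lborel)"
      by (simp add: F_law_def emeasure_density)
    also have "\<dots> = ennreal 1"
      using h dens_nonneg[OF \<beta>] by (subst nn_integral_eq_integral) (auto simp: has_bochner_integral_iff)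
    finally show "emeasure (F_law \<beta>) (space (F_law \<beta>)) = 1" by simp
  qed
  show "(\<lambda>x. x) \<in> borel_measurable (F_law \<beta>)" by (simp add: F_law_def)
  show "AE t in F_law \<beta>. 0 < t" by (rule pos)
  fix z assume "- m_lower \<phi> \<beta> < ereal (Re z) \<and> ereal (Re z) < m_upper \<beta>"
  hence z: "- m_lower \<phi> \<beta> < ereal (Re z)" "ereal (Re z) < m_upper \<beta>" by auto
  show "integrable (F_law \<beta>) (\<lambda>t. complex_of_real t powr z)" using hb[OF z] by (simp add: has_bochner_integral_iff)
  have "- a_killed \<phi> < ereal (Re (z / complex_of_real \<beta> + 1))" using z(1) mellin_strip_iff(1)[OF \<beta>, of "Re z"] by simp
  hence "Gamma_over_W \<phi> (z / complex_of_real \<beta> + 1) = IM (z / complex_of_real \<beta>)" by (simp only: Gamma_over_W_eq if_True) simp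
  thus "(\<integral>t. complex_of_real t powr z \<partial>F_law \<beta>) = Gamma (1 - z / complex_of_real \<beta>) * Gamma_over_W \<phi> (z / complex_of_real \<beta> + 1)"
    using hb[OF z] by (simp add: has_bochner_integral_iff Mel_def)
qed

section \<open>The Mellin-Barnes integral\<close>

text \<open>
  The Mellin-Barnes integrand in the variable \<open>w = z - 1 / \<beta>\<close>, on the line of
  abscissa \<open>c\<close>.
\<close>

definition MBG :: "real \<Rightarrow> real \<Rightarrow> complex \<Rightarrow> real \<Rightarrow> complex" where
  "MBG \<beta> c t b = t powr (- (complex_of_real \<beta> * Complex c b) - 1) * Mel (Complex c b)"

lemma MB_integrand_eq:
  assumes \<beta>: "0 < \<beta>" and c: "- a_killed \<phi> < ereal (c - 1 / \<beta> + 1)"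
  shows "MB_integrand \<phi> \<beta> t (Complex c b) = MBG \<beta> (c - 1 / \<beta>) t b"
proof -
  define w where "w = Complex (c - 1 / \<beta>) b"
  have z: "Complex c b = w + 1 / complex_of_real \<beta>" by (simp add: w_def complex_eq_iff Re_divide Im_divide power2_eq_square)
  have "Gamma_over_W \<phi> (w + 1) = IM w" using c by (subst Gamma_over_W_eq) (simp add: w_def)
  moreover have "- (w + 1 / complex_of_real \<beta>) * complex_of_real \<beta> = - (complex_of_real \<beta> * w) - 1" using \<beta> by (simp add: field_simps)
  ultimately show ?thesis unfolding MB_integrand_def MBG_def z w_def[symmetric] Mel_def by simp
qed

text \<open>
  The power of \<open>t\<close> grows at rate \<open>\<beta> |Arg t|\<close> along the line. Half of
  the gap between \<open>\<kappa>\<close> and \<open>\<pi> - Theta_upper \<phi>\<close> is given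
  away, so that the bound is uniform in \<open>t\<close> as long as \<open>\<beta> |Arg t| \<le>
  \<kappa>\<close>.
\<close>

lemma MBG_bound:
  assumes c: "- a_killed \<phi> < ereal (c + 1)" "c < 1" and \<beta>: "0 < \<beta>" and \<kappa>: "\<kappa> < pi - Theta_upper \<phi>"
  shows "\<exists>C\<ge>0. \<forall>t b. t \<noteq> 0 \<longrightarrow> \<beta> * \<bar>Arg t\<bar> \<le> \<kappa> \<longrightarrow>
     norm (MBG \<beta> c t b) \<le> C * norm t powr (- \<beta> * c - 1) * exp (- ((pi - Theta_upper \<phi> - \<kappa>) / 2) * \<bar>b\<bar>)"
proof -
  define e where "e = (pi - Theta_upper \<phi> - \<kappa>) / 2"
  have e: "0 < e" using \<kappa> by (simp add: e_def)
  obtain C where C: "\<And>b. norm (Mel (Complex c b)) \<le> C * exp (- (\<kappa> + e) * \<bar>b\<bar>)"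
    using Mel_decay[OF c, of "\<kappa> + e"] e by (auto simp: e_def field_simps)
  have "norm (Mel (Complex c 0)) \<le> C" using C[of 0] by simp
  hence C0: "0 \<le> C" using norm_ge_zero order_trans by blast
  have "norm (MBG \<beta> c t b) \<le> C * norm t powr (- \<beta> * c - 1) * exp (- e * \<bar>b\<bar>)"
    if t: "t \<noteq> 0" "\<beta> * \<bar>Arg t\<bar> \<le> \<kappa>" for t b
  proof -
    have "norm (t powr (- (complex_of_real \<beta> * Complex c b) - 1)) = exp ((- \<beta> * c - 1) * ln (norm t) + \<beta> * b * Arg t)"
      using t(1) by (simp add: norm_powr_complex)
    also have "\<dots> \<le> exp ((- \<beta> * c - 1) * ln (norm t) + \<kappa> * \<bar>b\<bar>)"
    proof -
      have "\<beta> * b * Arg t \<le> \<bar>\<beta> * b * Arg t\<bar>" by (rule abs_ge_self)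
      also have "\<dots> = (\<beta> * \<bar>Arg t\<bar>) * \<bar>b\<bar>" using \<beta> by (simp add: abs_mult)
      also have "\<dots> \<le> \<kappa> * \<bar>b\<bar>" by (intro mult_right_mono t) simp
      finally show ?thesis by simp
    qed
    also have "\<dots> = norm t powr (- \<beta> * c - 1) * exp (\<kappa> * \<bar>b\<bar>)" using t(1) by (simp add: exp_add powr_def)
    finally have "norm (MBG \<beta> c t b) \<le> (norm t powr (- \<beta> * c - 1) * exp (\<kappa> * \<bar>b\<bar>)) * (C * exp (- (\<kappa> + e) * \<bar>b\<bar>))"
      unfolding MBG_def norm_mult by (intro mult_mono C) auto
    also have "\<dots> = C * norm t powr (- \<beta> * c - 1) * exp (\<kappa> * \<bar>b\<bar> + - (\<kappa> + e) * \<bar>b\<bar>)" unfolding exp_add by (simp only: mult_ac)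
    also have "\<kappa> * \<bar>b\<bar> + - (\<kappa> + e) * \<bar>b\<bar> = - e * \<bar>b\<bar>" by (simp add: algebra_simps)
    finally show ?thesis .
  qed
  thus ?thesis using C0 unfolding e_def by blast
qed

lemma MBG_measurable:
  assumes "- a_killed \<phi> < ereal (c + 1)" "c < 1"
  shows "MBG \<beta> c t \<in> borel_measurable lborel"
proof -
  have [measurable]: "(\<lambda>b. Mel (Complex c b)) \<in> borel_measurable borel"
    by (rule borel_measurable_continuous_onI[OF Mel_continuous[OF assms]])
  have [measurable]: "(\<lambda>b. t powr (- (complex_of_real \<beta> * Complex c b) - 1)) \<in> borel_measurable borel"
    by (cases "t = 0") (auto intro!: borel_measurable_continuous_onI continuous_intros simp: powr_def Complex_eq)
  show ?thesis unfolding MBG_def[abs_def] by measurable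
qed

definition \<theta>\<^sub>S :: "real \<Rightarrow> real" where "\<theta>\<^sub>S \<beta> = min (pi - Theta_upper \<phi>) ((pi - Theta_upper \<phi>) / \<beta>)"

lemma theta_S: "0 < \<beta> \<Longrightarrow> 0 < \<theta>\<^sub>S \<beta>" "0 < \<beta> \<Longrightarrow> \<theta>\<^sub>S \<beta> \<le> pi" "0 < \<beta> \<Longrightarrow> S_sector \<phi> \<beta> = sector (\<theta>\<^sub>S \<beta>)"
proof -
  have "0 < pi - Theta_upper \<phi>" using Theta_le pi_gt_zero by linarith
  thus "0 < \<beta> \<Longrightarrow> 0 < \<theta>\<^sub>S \<beta>" by (simp add: \<theta>\<^sub>S_def)
  show "0 < \<beta> \<Longrightarrow> \<theta>\<^sub>S \<beta> \<le> pi" using Theta_nonneg by (simp add: \<theta>\<^sub>S_def min_def)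
qed (simp add: S_sector_eq \<theta>\<^sub>S_def)

lemma MBG_integrable:
  assumes c: "- a_killed \<phi> < ereal (c + 1)" "c < 1" and \<beta>: "0 < \<beta>" and t: "t \<in> sector (\<theta>\<^sub>S \<beta>)"
  shows "integrable lborel (MBG \<beta> c t)"
proof -
  define \<kappa> where "\<kappa> = \<beta> * \<bar>Arg t\<bar>"
  have t0: "t \<noteq> 0" using t by (simp add: sector_def)
  have \<kappa>: "\<kappa> < pi - Theta_upper \<phi>" using t \<beta> by (simp add: \<kappa>_def sector_def \<theta>\<^sub>S_def pos_less_divide_eq mult.commute)
  obtain C where C: "C \<ge> 0" "\<And>b. norm (MBG \<beta> c t b) \<le> C * norm t powr (- \<beta> * c - 1) * exp (- ((pi - Theta_upper \<phi> - \<kappa>) / 2) * \<bar>b\<bar>)"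
    using MBG_bound[OF c \<beta> \<kappa>] t0 unfolding \<kappa>_def by blast
  show ?thesis
  proof (rule Bochner_Integration.integrable_bound[OF integrable_mult_right[OF integrable_exp_abs]])
    show "0 < (pi - Theta_upper \<phi> - \<kappa>) / 2" using \<kappa> by simp
    show "AE b in lborel. norm (MBG \<beta> c t b) \<le> norm ((C * norm t powr (- \<beta> * c - 1)) * exp (- ((pi - Theta_upper \<phi> - \<kappa>) / 2) * \<bar>b\<bar>))"
      unfolding real_norm_def by (intro AE_I2 order_trans[OF C(2) abs_ge_self])
  qed (rule MBG_measurable[OF c])
qed

text \<open>
  On a closed disc inside the sector, \<open>|Arg t|\<close> attains its maximum, which gives one
  rate of decay for the whole disc.
\<close>

lemma MBG_holomorphic:
  assumes c: "- a_killed \<phi> < ereal (c + 1)" "c < 1" and \<beta>: "0 < \<beta>"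
  shows "(\<lambda>t. \<integral>b. MBG \<beta> c t b \<partial>lborel) holomorphic_on sector (\<theta>\<^sub>S \<beta>)"
proof (rule holomorphic_on_integral[OF open_sector])
  show "\<theta>\<^sub>S \<beta> \<le> pi" by (rule theta_S(2)[OF \<beta>])
  show "MBG \<beta> c t \<in> borel_measurable lborel" for t by (rule MBG_measurable[OF c])
  have nn: "t \<notin> \<real>\<^sub>\<le>\<^sub>0" if "t \<in> sector (\<theta>\<^sub>S \<beta>)" for t using sector_not_nonpos[OF theta_S(2)[OF \<beta>] that] .
  show "(\<lambda>t. MBG \<beta> c t b) holomorphic_on sector (\<theta>\<^sub>S \<beta>)" for b
    unfolding MBG_def using nn by (auto intro!: holomorphic_intros)
  fix t assume t: "t \<in> sector (\<theta>\<^sub>S \<beta>)"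
  obtain r where r: "r > 0" "cball t r \<subseteq> sector (\<theta>\<^sub>S \<beta>)"
    using open_sector[OF theta_S(2)[OF \<beta>]] t open_contains_cball by blast
  have cont: "continuous_on (cball t r) (\<lambda>s. \<bar>Arg s\<bar>)"
  proof -
    have "continuous_on (cball t r) (\<lambda>s. \<bar>Im (Ln s)\<bar>)" using r nn by (intro continuous_intros) auto
    thus ?thesis
      by (rule continuous_on_eq) (use r in \<open>auto simp: subset_iff sector_def Arg_eq_Im_Ln\<close>)
  qed
  obtain s0 where s0: "s0 \<in> cball t r" "\<And>s. s \<in> cball t r \<Longrightarrow> \<bar>Arg s\<bar> \<le> \<bar>Arg s0\<bar>"
    using continuous_attains_sup[OF compact_cball _ cont] r(1) by (metis cball_eq_empty less_imp_le not_less)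
  define \<kappa> where "\<kappa> = \<beta> * \<bar>Arg s0\<bar>"
  have \<kappa>: "\<kappa> < pi - Theta_upper \<phi>"
    using s0(1) r \<beta> by (auto simp: \<kappa>_def sector_def \<theta>\<^sub>S_def pos_less_divide_eq mult.commute subset_iff)
  obtain C where C: "C \<ge> 0" "\<And>s b. s \<noteq> 0 \<Longrightarrow> \<beta> * \<bar>Arg s\<bar> \<le> \<kappa> \<Longrightarrow> norm (MBG \<beta> c s b) \<le> C * norm s powr (- \<beta> * c - 1) * exp (- ((pi - Theta_upper \<phi> - \<kappa>) / 2) * \<bar>b\<bar>)"
    using MBG_bound[OF c \<beta> \<kappa>] by blast
  have "continuous_on (cball t r) (\<lambda>s. norm s powr (- \<beta> * c - 1))"
    using r by (intro continuous_intros) (auto simp: subset_iff sector_def)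
  from compact_continuous_image[OF this compact_cball] obtain B where B: "\<And>s. s \<in> cball t r \<Longrightarrow> norm (norm s powr (- \<beta> * c - 1)) \<le> B"
    using compact_imp_bounded bounded_iff by (metis imageI)
  show "\<exists>r>0. \<exists>B. cball t r \<subseteq> sector (\<theta>\<^sub>S \<beta>) \<and> integrable lborel B \<and>
      (AE b in lborel. \<forall>s\<in>cball t r. norm (MBG \<beta> c s b) \<le> B b)"
  proof (intro exI[of _ r] conjI exI[of _ "\<lambda>b. (C * B) * exp (- ((pi - Theta_upper \<phi> - \<kappa>) / 2) * \<bar>b\<bar>)"] AE_I2 ballI r)
    show "integrable lborel (\<lambda>b. (C * B) * exp (- ((pi - Theta_upper \<phi> - \<kappa>) / 2) * \<bar>b\<bar>))"
      by (intro integrable_mult_right integrable_exp_abs) (use \<kappa> in simp)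
    fix b s assume s: "s \<in> cball t r"
    have "norm (MBG \<beta> c s b) \<le> C * norm s powr (- \<beta> * c - 1) * exp (- ((pi - Theta_upper \<phi> - \<kappa>) / 2) * \<bar>b\<bar>)"
    proof (rule C(2))
      show "s \<noteq> 0" using s r by (auto simp: subset_iff sector_def)
      show "\<beta> * \<bar>Arg s\<bar> \<le> \<kappa>" unfolding \<kappa>_def using s0(2)[OF s] \<beta> by (intro mult_left_mono) auto
    qed
    also have "\<dots> \<le> (C * B) * exp (- ((pi - Theta_upper \<phi> - \<kappa>) / 2) * \<bar>b\<bar>)"
      using B[OF s] C(1) by (intro mult_right_mono mult_left_mono) auto
    finally show "norm (MBG \<beta> c s b) \<le> \<dots>" .
  qed
qed

lemma dens_mellin_barnes:
  assumes c: "- a_killed \<phi> < ereal (c + 1)" "c < 1" and \<beta>: "0 < \<beta>" and t: "0 < t"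
  shows "complex_of_real (dens \<beta> t) = complex_of_real (\<beta> / (2 * pi)) * (\<integral>b. MBG \<beta> c (complex_of_real t) b \<partial>lborel)"
proof -
  have e: "Complex (\<beta> * c) b = complex_of_real \<beta> * Complex c (b / \<beta>)" for b using \<beta> by (simp add: complex_eq_iff)
  define k where "k = (pi - Theta_upper \<phi>) / 2"
  have "0 < pi - Theta_upper \<phi>" using Theta_le pi_gt_zero by linarith
  hence k: "0 < k" "k < pi - Theta_upper \<phi>" by (simp_all add: k_def)
  obtain C where C: "\<And>b. norm (Mel (Complex c b)) \<le> C * exp (- k * \<bar>b\<bar>)" using Mel_decay[OF c k(2)] by blast
  have mi: "integrable lborel (\<lambda>b. Mel (Complex c (b / \<beta>)))"
  proof (rule Bochner_Integration.integrable_bound[where f="\<lambda>b. C * exp (- (k / \<beta>) * \<bar>b\<bar>)"])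
    show "integrable lborel (\<lambda>b. C * exp (- (k / \<beta>) * \<bar>b\<bar>))"
      by (intro integrable_mult_right integrable_exp_abs) (use k \<beta> in simp)
    have "continuous_on UNIV (\<lambda>b. Mel (Complex c (b / \<beta>)))"
      by (rule continuous_on_compose2[OF Mel_continuous[OF c]]) (use \<beta> in \<open>auto intro!: continuous_intros\<close>)
    thus "(\<lambda>b. Mel (Complex c (b / \<beta>))) \<in> borel_measurable lborel" by (simp add: borel_measurable_continuous_onI)
    have "norm (Mel (Complex c (b / \<beta>))) \<le> C * exp (- (k / \<beta>) * \<bar>b\<bar>)" for b using C[of "b / \<beta>"] \<beta> by simp
    thus "AE b in lborel. norm (Mel (Complex c (b / \<beta>))) \<le> norm (C * exp (- (k / \<beta>) * \<bar>b\<bar>))"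
      unfolding real_norm_def by (intro AE_I2 order_trans[OF _ abs_ge_self])
  qed
  have "complex_of_real (dens \<beta> t) = 1 / (2 * pi) * (\<integral>b. complex_of_real t powr (- Complex (\<beta> * c) b - 1) * Mel (Complex c (b / \<beta>)) \<partial>lborel)"
  proof (rule mellin_inversion[OF dens_pos[OF \<beta>] dens_continuous[OF \<beta>] _ mi t])
    fix b
    show "has_bochner_integral lborel (\<lambda>t. indicator {0<..} t *\<^sub>R (complex_of_real t powr Complex (\<beta> * c) b * complex_of_real (dens \<beta> t))) (Mel (Complex c (b / \<beta>)))"
      unfolding e by (rule dens_mellin[OF \<beta>]) (use c in auto)
  qed
  also have "(\<integral>b. complex_of_real t powr (- Complex (\<beta> * c) b - 1) * Mel (Complex c (b / \<beta>)) \<partial>lborel) = (\<integral>b. MBG \<beta> c (complex_of_real t) (b / \<beta>) \<partial>lborel)"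
    unfolding MBG_def e ..
  also have "\<dots> = \<bar>\<beta>\<bar> *\<^sub>R (\<integral>b. MBG \<beta> c (complex_of_real t) ((0 + \<beta> * b) / \<beta>) \<partial>lborel)"
    using \<beta> by (intro lborel_integral_real_affine) simp
  also have "(\<lambda>b. MBG \<beta> c (complex_of_real t) ((0 + \<beta> * b) / \<beta>)) = MBG \<beta> c (complex_of_real t)" using \<beta> by simp
  finally show ?thesis using \<beta> by (simp add: scaleR_conv_of_real)
qed

section \<open>Derivatives of the density at infinity\<close>

text \<open>
  The domain of \<open>dens_c\<close> is invariant under dilations, so it contains the disc of
  radius \<open>r t\<close> around \<open>t\<close> for a fixed \<open>r\<close>; there the function
  is of order \<open>t powr (- \<beta> - 1)\<close>, and Cauchy's inequality bounds every
  derivative.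
\<close>

lemma dens_C0_infty:
  assumes \<beta>: "0 < \<beta>"
  shows "dens \<beta> \<in> C0_infty"
proof -
  define \<theta> where "\<theta> = min pi (pi / (2 * \<beta>))"
  have \<theta>: "\<theta> \<le> pi" "0 < \<theta>" using \<beta> by (auto simp: \<theta>_def)
  have oD: "open (dom_c \<beta>)" unfolding dom_c_def by (rule open_sector) simp
  have rD: "complex_of_real t \<in> dom_c \<beta>" if "0 < t" for t
    unfolding dom_c_def using of_real_sector[OF that \<theta>(2)] by (simp add: \<theta>_def)
  have re: "dens \<beta> t = Re (dens_c \<beta> (complex_of_real t))" if "t > 0" for t by (simp add: dens_c_real[OF \<beta> that])
  have D: "(deriv ^^ n) (dens \<beta>) t = Re ((deriv ^^ n) (dens_c \<beta>) (complex_of_real t))"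
    "(deriv ^^ n) (dens \<beta>) field_differentiable at t" if "0 < t" for n t
    by (rule real_deriv_of_holomorphic[OF oD dens_c_holomorphic[OF \<beta>] rD re that]; assumption)+
  obtain r' where r': "r' > 0" "cball 1 r' \<subseteq> dom_c \<beta>"
    using oD rD[of 1] open_contains_cball[of "dom_c \<beta>"] by auto
  define r where "r = min r' (1 / 2)"
  have r: "r > 0" "r \<le> 1 / 2" "cball 1 r \<subseteq> dom_c \<beta>" using r' by (auto simp: r_def)
  define K where "K = Re (IM 1)"
  have K: "0 \<le> K" unfolding K_def by (rule order_trans[OF norm_ge_zero laplace_I_bound(2)[of 1]]) simp
  have lim: "((deriv ^^ n) (dens \<beta>) \<longlongrightarrow> 0) at_top" for n
  proof (rule Lim_null_comparison)
    show "\<forall>\<^sub>F t in at_top. norm ((deriv ^^ n) (dens \<beta>) t) \<le> fact n * (\<beta> * (t / 2) powr (- \<beta> - 1) * K) / r ^ n"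
      using eventually_ge_at_top[of 1]
    proof eventually_elim
      case (elim t)
      have t: "0 < t" using elim by simp
      have sub: "cball (complex_of_real t) (r * t) \<subseteq> dom_c \<beta>"
      proof
        fix x assume x: "x \<in> cball (complex_of_real t) (r * t)"
        define y where "y = x / complex_of_real t"
        have xy: "x = complex_of_real t * y" using t by (simp add: y_def)
        have "norm (complex_of_real t * (1 - y)) \<le> r * t" using x by (simp add: dist_norm xy algebra_simps)
        hence "norm (1 - y) \<le> r" using t by (simp add: norm_mult mult.commute)
        hence "y \<in> dom_c \<beta>" using r(3) by (auto simp: subset_iff dist_norm)
        thus "x \<in> dom_c \<beta>" using t unfolding dom_c_def sector_def xy by (simp add: Arg_times_of_real)
      qed
      have h: "dens_c \<beta> holomorphic_on cball (complex_of_real t) (r * t)"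
        by (rule holomorphic_on_subset[OF dens_c_holomorphic[OF \<beta>] sub])
      have "norm ((deriv ^^ n) (dens_c \<beta>) (complex_of_real t)) \<le> fact n * (\<beta> * (t / 2) powr (- \<beta> - 1) * K) / (r * t) ^ n"
      proof (rule Cauchy_inequality)
        show "dens_c \<beta> holomorphic_on ball (complex_of_real t) (r * t)" by (rule holomorphic_on_subset[OF h ball_subset_cball])
        show "continuous_on (cball (complex_of_real t) (r * t)) (dens_c \<beta>)" by (rule holomorphic_on_imp_continuous_on[OF h])
        show "0 < r * t" using r t by simp
        fix x assume x: "norm (complex_of_real t - x) = r * t"
        have xD: "x \<in> dom_c \<beta>" using x sub by (auto simp: subset_iff dist_norm)
        have "t - norm x \<le> r * t" using norm_triangle_ineq2[of "complex_of_real t" x] x t by simp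
        moreover have "r * t \<le> 1 / 2 * t" using r t by (intro mult_right_mono) auto
        ultimately have "t / 2 \<le> norm x" by simp
        hence "norm x powr (- \<beta> - 1) \<le> (t / 2) powr (- \<beta> - 1)" using t \<beta> by (intro powr_mono2') auto
        hence "\<beta> * norm x powr (- \<beta> - 1) * K \<le> \<beta> * (t / 2) powr (- \<beta> - 1) * K"
          using \<beta> K by (intro mult_right_mono mult_left_mono) auto
        thus "norm (dens_c \<beta> x) \<le> \<beta> * (t / 2) powr (- \<beta> - 1) * K"
          using dens_c_bound[OF \<beta> xD] unfolding K_def by linarith
      qed
      also have "\<dots> \<le> fact n * (\<beta> * (t / 2) powr (- \<beta> - 1) * K) / r ^ n"
      proof (rule divide_left_mono)
        have "r * 1 \<le> r * t" using r elim by (intro mult_left_mono) auto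
        thus "r ^ n \<le> (r * t) ^ n" using r by (intro power_mono) auto
      qed (use r t \<beta> K in auto)
      finally have "norm ((deriv ^^ n) (dens_c \<beta>) (complex_of_real t)) \<le> fact n * (\<beta> * (t / 2) powr (- \<beta> - 1) * K) / r ^ n" .
      thus ?case unfolding D(1)[OF t, of n] real_norm_def by (rule order_trans[OF abs_Re_le_cmod])
    qed
    have "((\<lambda>t. (t / 2) powr (- \<beta> - 1)) \<longlongrightarrow> 0) at_top"
    proof (rule tendsto_neg_powr)
      show "filterlim (\<lambda>t::real. t / 2) at_top at_top" by real_asymp
    qed (use \<beta> in simp)
    hence "((\<lambda>t. fact n * (\<beta> * (t / 2) powr (- \<beta> - 1) * K) / r ^ n) \<longlongrightarrow> fact n * (\<beta> * 0 * K) / r ^ n) at_top"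
      by (intro tendsto_intros) (use r in auto)
    thus "((\<lambda>t. fact n * (\<beta> * (t / 2) powr (- \<beta> - 1) * K) / r ^ n) \<longlongrightarrow> 0) at_top" by simp
  qed
  show ?thesis unfolding C0_infty_def using lim D(2) by blast
qed


section \<open>The power series\<close>

lemma bern_infty_tendsto: "((\<lambda>u. ereal (\<phi>\<^sub>r u)) \<longlongrightarrow> bern_infty \<phi>) at_top"
proof -
  have "((\<lambda>u. ereal (\<phi>\<^sub>r u)) \<longlongrightarrow> (SUP u\<in>{0<..}. ereal (\<phi>\<^sub>r u))) at_top"
  proof (rule increasing_tendsto)
    show "\<forall>\<^sub>F u in at_top. ereal (\<phi>\<^sub>r u) \<le> (SUP u\<in>{0<..}. ereal (\<phi>\<^sub>r u))"
      using eventually_gt_at_top[of 0] by eventually_elim (intro SUP_upper, simp)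
    fix y assume "y < (SUP u\<in>{0<..}. ereal (\<phi>\<^sub>r u))"
    then obtain u where u: "0 < u" "y < ereal (\<phi>\<^sub>r u)" by (auto simp: less_SUP_iff)
    show "\<forall>\<^sub>F u in at_top. y < ereal (\<phi>\<^sub>r u)"
      using eventually_ge_at_top[of u]
    proof eventually_elim
      case (elim v)
      have "ereal (\<phi>\<^sub>r u) \<le> ereal (\<phi>\<^sub>r v)" using phi_r_mono'[of u v] u elim by simp
      with u(2) show ?case by (rule less_le_trans)
    qed
  qed
  thus ?thesis unfolding bern_infty_def \<phi>\<^sub>r_def by (subst tendsto_Lim) simp_all
qed

lemma eventually_phi_r_gt:
  assumes "ereal r < bern_infty \<phi>"
  shows "\<forall>\<^sub>F n in sequentially. r < \<phi>\<^sub>r (real n)"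
  using eventually_compose_filterlim[OF order_tendstoD(1)[OF bern_infty_tendsto assms] filterlim_real_sequentially] by simp

lemma bern_infty_pos: "0 < bern_infty \<phi>"
proof -
  have "ereal (\<phi>\<^sub>r 1) \<le> bern_infty \<phi>"
  proof (rule tendsto_lowerbound[OF bern_infty_tendsto])
    show "\<forall>\<^sub>F u in at_top. ereal (\<phi>\<^sub>r 1) \<le> ereal (\<phi>\<^sub>r u)"
      using eventually_ge_at_top[of 1] by eventually_elim (simp add: phi_r_mono')
  qed simp
  moreover have "0 < ereal (\<phi>\<^sub>r 1)" using phi_r_pos'[of 1] by simp
  ultimately show ?thesis by (rule order.strict_trans2[rotated])
qed

lemma bern_infty_dense:
  assumes "ereal x < bern_infty \<phi>"
  obtains R where "x < R" "ereal R < bern_infty \<phi>"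
  using ereal_dense2[OF assms] by auto

text \<open>
  The coefficients are moments of the exponential functional divided by factorials, as in the
  expansion of \<open>E(I exp (- s I))\<close>.
\<close>

lemma I_coeff_IM: "I_coeff \<phi> n = IM (of_nat (n + 1)) / fact n"
proof -
  have "- a_star_bern \<phi> < ereal (Re (of_nat (n + 1)))" by (rule pos_gt_a_star) simp
  from BG_rec[OF this] have r: "BG (of_nat (n + 1) + 1) = bern \<phi> (of_nat (n + 1)) * BG (of_nat (n + 1))" .
  have g: "Gamma (of_nat (n + 1) + 1 :: complex) = fact (n + 1)"
    using Gamma_fact[of "n + 1", where ?'a=complex] by (simp add: add_ac)
  have f: "fact (n + 1) = (of_nat (n + 1) * fact n :: complex)"
    by (simp only: Suc_eq_plus1[symmetric] fact_Suc of_nat_mult)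
  have "IM (of_nat (n + 1)) = Gamma (of_nat (n + 1) + 1) / BG (of_nat (n + 1) + 1)"
    by (rule IM_Gamma) simp
  hence I: "IM (of_nat (n + 1)) = of_nat (n + 1) * fact n / (bern \<phi> (of_nat (n + 1)) * BG (of_nat (n + 1)))"
    unfolding r g f .
  have W: "W_bern \<phi> (of_nat (n + 1)) = BG (of_nat (n + 1))" by (rule W_bern_BG) simp
  have alg: "a / b * (1 / w) = a * c / (b * w) / c" if "c \<noteq> 0" for a b c w :: complex using that by simp
  show ?thesis unfolding I_coeff_def I W by (rule alg) simp
qed

lemma I_coeff_Suc:
  "I_coeff \<phi> (Suc n) = I_coeff \<phi> n * (of_nat (n + 2) / of_nat (n + 1) / bern \<phi> (of_nat (n + 2)))"
proof -
  have "- a_star_bern \<phi> < ereal (Re (of_nat (n + 1)))" by (rule pos_gt_a_star) simp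
  from BG_rec[OF this] have r: "BG (of_nat (n + 2)) = bern \<phi> (of_nat (n + 1)) * BG (of_nat (n + 1))"
    by (simp add: add_ac)
  have W: "W_bern \<phi> (of_nat (m + 1)) = BG (of_nat (m + 1))" for m by (rule W_bern_BG) simp
  have e: "Suc n + 1 = n + 2" by simp
  have c: "(of_nat (n + 1) :: complex) \<noteq> 0" unfolding of_nat_eq_0_iff by simp
  have alg: "a2 / f2 * (1 / (f1 * G)) = a1 / f1 * (1 / G) * (a2 / a1 / f2)" if "a1 \<noteq> 0" for a1 a2 f1 f2 G :: complex
    using that by simp
  show ?thesis unfolding I_coeff_def W e using W[of "Suc n"] unfolding e r by (simp only: alg[OF c])
qed

text \<open>
  The ratio of consecutive coefficients is \<open>(n + 2) / (n + 1) / \<phi>(n + 2)\<close>, and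
  \<open>\<phi>\<close> increases to \<open>\<phi>(\<infinity>)\<close>.
\<close>

lemma I_summable:
  assumes z: "ereal (norm z) < bern_infty \<phi>"
  shows "summable (\<lambda>n. norm (I_coeff \<phi> n * z ^ n))"
proof -
  obtain R where R: "norm z < R" "ereal R < bern_infty \<phi>" using bern_infty_dense[OF z] .
  have R0: "0 < R" using R(1) norm_ge_zero[of z] by linarith
  have "norm z / R < 1" using R R0 by simp
  then obtain c where c: "c < 1" "norm z / R < c" using dense by blast
  have "(\<lambda>n. real (n + 2) / real (n + 1) * (norm z / R)) \<longlonglongrightarrow> 1 * (norm z / R)"
    by (intro tendsto_mult tendsto_const) real_asymp
  hence "\<forall>\<^sub>F n in sequentially. real (n + 2) / real (n + 1) * (norm z / R) < c"
    using c(2) by (intro order_tendstoD) simp_all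
  moreover have "\<forall>\<^sub>F n in sequentially. R < \<phi>\<^sub>r (real (n + 2))"
    using eventually_phi_r_gt[OF R(2)]
    by (rule eventually_sequentially_seg[where P="\<lambda>n. R < \<phi>\<^sub>r (real n)" and k=2, THEN iffD2])
  ultimately have "\<forall>\<^sub>F n in sequentially. norm (norm (I_coeff \<phi> (Suc n) * z ^ Suc n)) \<le> c * norm (norm (I_coeff \<phi> n * z ^ n))"
  proof eventually_elim
    case (elim n)
    define A where "A = norm (I_coeff \<phi> n * z ^ n)"
    have "norm (I_coeff \<phi> (Suc n) * z ^ Suc n) = A * (real (n + 2) / real (n + 1) * (norm z / \<bar>\<phi>\<^sub>r (real (n + 2))\<bar>))"
      unfolding I_coeff_Suc A_def bern_of_nat norm_mult norm_divide norm_power norm_of_nat norm_of_real power_Suc by simp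
    also have "\<dots> \<le> A * (real (n + 2) / real (n + 1) * (norm z / R))"
      using elim(2) R0 by (intro mult_left_mono divide_left_mono) (auto simp: A_def)
    also have "\<dots> \<le> A * c" using elim(1) by (intro mult_left_mono) (auto simp: A_def)
    finally show ?case by (simp add: A_def mult.commute)
  qed
  then obtain N where "\<And>n. N \<le> n \<Longrightarrow> norm (norm (I_coeff \<phi> (Suc n) * z ^ Suc n)) \<le> c * norm (norm (I_coeff \<phi> n * z ^ n))"
    by (auto simp: eventually_sequentially)
  thus ?thesis by (rule summable_ratio_test[OF c(1)])
qed

lemma I_bern_holomorphic: "I_bern \<phi> holomorphic_on {z. ereal (norm z) < bern_infty \<phi>}"
  unfolding holomorphic_on_def
proof
  fix z :: complex assume "z \<in> {z. ereal (norm z) < bern_infty \<phi>}"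
  hence "ereal (norm z) < bern_infty \<phi>" by (rule CollectD)
  then obtain R where R: "norm z < R" "ereal R < bern_infty \<phi>" by (rule bern_infty_dense)
  have R0: "0 < R" using R(1) norm_ge_zero[of z] by linarith
  have "summable (\<lambda>n. I_coeff \<phi> n * complex_of_real R ^ n)"
    by (rule summable_norm_cancel[OF I_summable]) (use R(2) R0 in simp)
  moreover have "norm z < norm (complex_of_real R)" using R(1) R0 by simp
  ultimately have "((\<lambda>z. \<Sum>n. I_coeff \<phi> n * z ^ n) has_field_derivative (\<Sum>n. diffs (I_coeff \<phi>) n * z ^ n)) (at z)"
    by (rule termdiffs_strong)
  hence "I_bern \<phi> field_differentiable at z"
    unfolding I_bern_def[abs_def] field_differentiable_def by (rule exI)
  thus "I_bern \<phi> field_differentiable at z within {z. ereal (norm z) < bern_infty \<phi>}"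
    by (rule field_differentiable_at_within)
qed

lemma I_moment: "has_bochner_integral \<mu>\<^sub>I (\<lambda>x. complex_of_real (x ^ (n + 1))) (IM (of_nat (n + 1)))"
proof -
  have "- a_killed \<phi> < ereal (Re (of_nat (n + 1)) + 1)" by (rule pos_gt_a_killed) simp
  note h = \<mu>\<^sub>I_mellin[OF this]
  have "AE x in \<mu>\<^sub>I. complex_of_real x powr of_nat (n + 1) = complex_of_real (x ^ (n + 1))"
    using \<mu>\<^sub>I_pos
  proof eventually_elim
    case (elim x)
    have "complex_of_real x powr of_nat (n + 1) = complex_of_real x ^ (n + 1)"
      using elim by (intro powr_nat') simp_all
    thus ?case by (simp only: of_real_power)
  qed
  moreover have "(\<lambda>x. complex_of_real (x ^ (n + 1))) \<in> borel_measurable \<mu>\<^sub>I"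
    using real_distribution.events_eq_borel[OF \<mu>\<^sub>I_distribution] by (simp cong: measurable_cong_sets)
  ultimately show ?thesis
    using h by (subst has_bochner_integral_cong_AE[symmetric]) (auto simp: has_bochner_integral_iff)
qed

text \<open>
  Expectation and exponential series can be interchanged because the sum of the absolute values of
  the terms is the series itself at \<open>+ s\<close>.
\<close>

lemma laplace_I_series:
  assumes s: "0 < s" "ereal s < bern_infty \<phi>"
  shows "laplace_I (complex_of_real s) = I_bern \<phi> (- complex_of_real s)"
proof -
  define f where "f n x = complex_of_real ((- s) ^ n / fact n) * complex_of_real (x ^ (n + 1))" for n x
  have hb: "has_bochner_integral \<mu>\<^sub>I (f n) (I_coeff \<phi> n * (- complex_of_real s) ^ n)" for n
  proof -
    have "has_bochner_integral \<mu>\<^sub>I (f n) (complex_of_real ((- s) ^ n / fact n) * IM (of_nat (n + 1)))"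
      unfolding f_def by (intro has_bochner_integral_mult_right I_moment)
    thus ?thesis by (simp add: I_coeff_IM mult.commute)
  qed
  have ser: "(\<lambda>n. f n x) sums (complex_of_real x * exp (- complex_of_real s * complex_of_real x))" for x
  proof -
    have "(\<lambda>n. complex_of_real x * ((- complex_of_real s * complex_of_real x) ^ n /\<^sub>R fact n)) sums (complex_of_real x * exp (- complex_of_real s * complex_of_real x))"
      by (intro sums_mult exp_converges)
    moreover have "complex_of_real x * ((- complex_of_real s * complex_of_real x) ^ n /\<^sub>R fact n) = f n x" for n
      unfolding f_def power_mult_distrib by (simp add: scaleR_conv_of_real divide_inverse)
    ultimately show ?thesis by simp
  qed
  have ns: "summable (\<lambda>n. norm (f n x))" for x
  proof -
    have "summable (\<lambda>n. norm (complex_of_real x) * norm ((complex_of_real s * complex_of_real x) ^ n /\<^sub>R fact n))"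
      by (intro summable_mult summable_norm_exp)
    moreover have "norm (complex_of_real x) * norm ((complex_of_real s * complex_of_real x) ^ n /\<^sub>R fact n) = norm (f n x)" for n
      unfolding f_def power_mult_distrib by (simp add: norm_mult norm_power power_abs divide_inverse norm_inverse)
    ultimately show ?thesis by (simp only:)
  qed
  have nint: "(\<integral>x. norm (f n x) \<partial>\<mu>\<^sub>I) = s ^ n / fact n * Re (IM (of_nat (n + 1)))" for n
  proof -
    have "(\<integral>x. norm (f n x) \<partial>\<mu>\<^sub>I) = (\<integral>x. s ^ n / fact n * Re (complex_of_real (x ^ (n + 1))) \<partial>\<mu>\<^sub>I)"
    proof (rule integral_cong_AE)
      show "AE x in \<mu>\<^sub>I. norm (f n x) = s ^ n / fact n * Re (complex_of_real (x ^ (n + 1)))"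
        using \<mu>\<^sub>I_pos by eventually_elim (use s in \<open>simp add: f_def norm_mult norm_divide norm_power power_abs\<close>)
    qed (use real_distribution.events_eq_borel[OF \<mu>\<^sub>I_distribution] in \<open>simp_all add: f_def cong: measurable_cong_sets\<close>)
    also have "\<dots> = s ^ n / fact n * (\<integral>x. Re (complex_of_real (x ^ (n + 1))) \<partial>\<mu>\<^sub>I)" by (rule integral_mult_right_zero)
    also have "(\<integral>x. Re (complex_of_real (x ^ (n + 1))) \<partial>\<mu>\<^sub>I) = Re (IM (of_nat (n + 1)))"
      by (rule has_bochner_integral_integral_eq[OF has_bochner_integral_Re[OF I_moment]])
    finally show ?thesis .
  qed
  have sint: "summable (\<lambda>n. \<integral>x. norm (f n x) \<partial>\<mu>\<^sub>I)"
  proof (rule summable_comparison_test)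
    show "summable (\<lambda>n. norm (I_coeff \<phi> n * complex_of_real s ^ n))" by (rule I_summable) (use s in simp)
    have "norm (\<integral>x. norm (f n x) \<partial>\<mu>\<^sub>I) \<le> norm (I_coeff \<phi> n * complex_of_real s ^ n)" for n
    proof -
      have "norm (\<integral>x. norm (f n x) \<partial>\<mu>\<^sub>I) = s ^ n / fact n * \<bar>Re (IM (of_nat (n + 1)))\<bar>"
        unfolding nint using s by (simp add: abs_mult)
      also have "\<dots> \<le> s ^ n / fact n * norm (IM (of_nat (n + 1)))"
        using s by (intro mult_left_mono abs_Re_le_cmod) simp
      also have "\<dots> = norm (I_coeff \<phi> n * complex_of_real s ^ n)"
        using s by (simp add: I_coeff_IM norm_mult norm_divide norm_power)
      finally show ?thesis .
    qed
    thus "\<exists>N. \<forall>n\<ge>N. norm (\<integral>x. norm (f n x) \<partial>\<mu>\<^sub>I) \<le> norm (I_coeff \<phi> n * complex_of_real s ^ n)" by blast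
  qed
  have "laplace_I (complex_of_real s) = (\<integral>x. (\<Sum>n. f n x) \<partial>\<mu>\<^sub>I)"
    unfolding laplace_I_def using sums_unique[OF ser] by simp
  also have "\<dots> = (\<Sum>n. \<integral>x. f n x \<partial>\<mu>\<^sub>I)"
    by (rule integral_suminf) (use hb ns sint in \<open>auto simp: has_bochner_integral_iff\<close>)
  also have "\<dots> = I_bern \<phi> (- complex_of_real s)"
    unfolding I_bern_def by (simp only: has_bochner_integral_integral_eq[OF hb])
  finally show ?thesis .
qed

lemma expansion_radius_less:
  assumes \<beta>: "0 < \<beta>" and t: "expansion_radius \<phi> \<beta> < norm t"
  shows "ereal (norm (exp (\<i> * complex_of_real pi) * t powr complex_of_real (- \<beta>))) < bern_infty \<phi>"
proof -
  have n: "norm (exp (\<i> * complex_of_real pi) * t powr complex_of_real (- \<beta>)) = norm t powr (- \<beta>)"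
    by (simp add: norm_mult norm_powr_real_powr' exp_pi_i')
  show ?thesis
  proof (cases "bern_infty \<phi>")
    case (real B)
    hence B: "0 < B" using bern_infty_pos by simp
    have "B powr (- 1 / \<beta>) < norm t" using t real by (simp add: expansion_radius_def)
    hence "norm t powr (- \<beta>) < (B powr (- 1 / \<beta>)) powr (- \<beta>)"
      using B \<beta> by (intro powr_less_mono2_neg) auto
    also have "\<dots> = B" using B \<beta> by (simp add: powr_powr)
    finally show ?thesis unfolding n real by simp
  qed (use bern_infty_pos in auto)
qed

section \<open>The analytic extension of the density\<close>

text \<open>
  The abscissa \<open>0\<close> in the variable \<open>w\<close> belongs to every strip.
\<close>

definition dens_ext :: "real \<Rightarrow> complex \<Rightarrow> complex" where
  "dens_ext \<beta> t = complex_of_real (\<beta> / (2 * pi)) * (\<integral>b. MBG \<beta> 0 t b \<partial>lborel)"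

lemma zero_in_strip: "- a_killed \<phi> < ereal (0 + 1)" by (rule pos_gt_a_killed) simp

lemma dens_ext_holomorphic: "0 < \<beta> \<Longrightarrow> dens_ext \<beta> holomorphic_on sector (\<theta>\<^sub>S \<beta>)"
  unfolding dens_ext_def[abs_def] by (intro holomorphic_intros MBG_holomorphic zero_in_strip) simp_all

lemma dens_ext_real: "0 < \<beta> \<Longrightarrow> 0 < t \<Longrightarrow> dens_ext \<beta> (complex_of_real t) = complex_of_real (dens \<beta> t)"
  unfolding dens_ext_def using dens_mellin_barnes[OF zero_in_strip] by simp

text \<open>
  Both integrals are holomorphic on the sector and equal to the density on the positive axis; no
  contour has to be moved.
\<close>

lemma dens_ext_MBG:
  assumes c: "- a_killed \<phi> < ereal (c + 1)" "c < 1" and \<beta>: "0 < \<beta>" and t: "t \<in> sector (\<theta>\<^sub>S \<beta>)"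
  shows "dens_ext \<beta> t = complex_of_real (\<beta> / (2 * pi)) * (\<integral>b. MBG \<beta> c t b \<partial>lborel)"
proof (rule sector_continuation[OF theta_S(1)[OF \<beta>] theta_S(2)[OF \<beta>] dens_ext_holomorphic[OF \<beta>] _ _ t])
  show "(\<lambda>t. complex_of_real (\<beta> / (2 * pi)) * (\<integral>b. MBG \<beta> c t b \<partial>lborel)) holomorphic_on sector (\<theta>\<^sub>S \<beta>)"
    by (intro holomorphic_intros MBG_holomorphic c \<beta>)
  fix x :: real assume "0 < x"
  thus "dens_ext \<beta> (complex_of_real x) = complex_of_real (\<beta> / (2 * pi)) * (\<integral>b. MBG \<beta> c (complex_of_real x) b \<partial>lborel)"
    using dens_ext_real[OF \<beta>] dens_mellin_barnes[OF c \<beta>] by simp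
qed

text \<open>
  The identity theorem on the part of the sector outside a circle: on the axis both sides are the
  density.
\<close>

lemma dens_ext_expansion:
  assumes \<beta>: "0 < \<beta>" and t: "t \<in> sector (\<theta>\<^sub>S \<beta>)" "expansion_radius \<phi> \<beta> < norm t"
  shows "dens_ext \<beta> t = complex_of_real \<beta> * t powr complex_of_real (- \<beta> - 1) *
    I_bern \<phi> (exp (\<i> * complex_of_real pi) * t powr complex_of_real (- \<beta>))"
proof -
  \<comment> \<open>A circle strictly between the radius and t; its radius is positive even if the radius of expansion is 0.\<close>
  define \<rho> where "\<rho> = (expansion_radius \<phi> \<beta> + norm t) / 2"
  have "0 \<le> expansion_radius \<phi> \<beta>" by (simp add: expansion_radius_def)
  hence \<rho>: "0 < \<rho>" "expansion_radius \<phi> \<beta> < \<rho>" "\<rho> < norm t" using t by (auto simp: \<rho>_def)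
  define D where "D = {t \<in> sector (\<theta>\<^sub>S \<beta>). ln \<rho> < ln (norm t)}"
  have nn: "s \<notin> \<real>\<^sub>\<le>\<^sub>0" if "s \<in> D" for s
    using sector_not_nonpos[OF theta_S(2)[OF \<beta>], of s] that by (simp add: D_def)
  have gt: "expansion_radius \<phi> \<beta> < norm s" if "ln \<rho> < ln (norm s)" "s \<noteq> 0" for s :: complex
    using that \<rho> by simp
  show ?thesis
  proof (rule sector_outside_continuation[where r="ln \<rho>", OF theta_S(1)[OF \<beta>] theta_S(2)[OF \<beta>] _ _ _ t(1)])
    show "dens_ext \<beta> holomorphic_on {t \<in> sector (\<theta>\<^sub>S \<beta>). ln \<rho> < ln (norm t)}"
      by (rule holomorphic_on_subset[OF dens_ext_holomorphic[OF \<beta>]]) auto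
    have "(I_bern \<phi> \<circ> (\<lambda>t. exp (\<i> * complex_of_real pi) * t powr complex_of_real (- \<beta>))) holomorphic_on D"
    proof (rule holomorphic_on_compose_gen[OF _ I_bern_holomorphic])
      show "(\<lambda>t. exp (\<i> * complex_of_real pi) * t powr complex_of_real (- \<beta>)) holomorphic_on D"
        using nn by (auto intro!: holomorphic_intros)
      show "(\<lambda>t. exp (\<i> * complex_of_real pi) * t powr complex_of_real (- \<beta>)) ` D \<subseteq> {z. ereal (norm z) < bern_infty \<phi>}"
      proof (rule image_subsetI)
        fix s assume "s \<in> D"
        hence "expansion_radius \<phi> \<beta> < norm s" by (intro gt) (auto simp: D_def sector_def)
        from expansion_radius_less[OF \<beta> this]
        show "exp (\<i> * complex_of_real pi) * s powr complex_of_real (- \<beta>) \<in> {z. ereal (norm z) < bern_infty \<phi>}" by (rule CollectI)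
      qed
    qed
    hence "(\<lambda>t. complex_of_real \<beta> * t powr complex_of_real (- \<beta> - 1) *
        I_bern \<phi> (exp (\<i> * complex_of_real pi) * t powr complex_of_real (- \<beta>))) holomorphic_on D"
      using nn unfolding o_def by (intro holomorphic_intros) auto
    thus "(\<lambda>t. complex_of_real \<beta> * t powr complex_of_real (- \<beta> - 1) *
        I_bern \<phi> (exp (\<i> * complex_of_real pi) * t powr complex_of_real (- \<beta>)))
      holomorphic_on {t \<in> sector (\<theta>\<^sub>S \<beta>). ln \<rho> < ln (norm t)}" unfolding D_def .
    have "0 < norm t" using \<rho> by linarith
    thus "ln \<rho> < ln (norm t)" using \<rho> by simp
    fix x :: real assume x: "0 < x" "ln \<rho> < ln x"
    have p: "complex_of_real x powr complex_of_real (- \<beta>) = complex_of_real (x powr (- \<beta>))"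
      using x by (intro powr_of_real) auto
    have "expansion_radius \<phi> \<beta> < norm (complex_of_real x)" using x by (intro gt) auto
    from expansion_radius_less[OF \<beta> this] have "ereal (x powr (- \<beta>)) < bern_infty \<phi>"
      unfolding p by (simp add: norm_mult exp_pi_i')
    moreover have "0 < x powr (- \<beta>)" using x by simp
    ultimately have "laplace_I (complex_of_real (x powr (- \<beta>))) = I_bern \<phi> (- complex_of_real (x powr (- \<beta>)))"
      by (intro laplace_I_series)
    moreover have "exp (\<i> * complex_of_real pi) * complex_of_real (x powr (- \<beta>)) = - complex_of_real (x powr (- \<beta>))"
      by (simp add: exp_pi_i')
    ultimately show "dens_ext \<beta> (complex_of_real x) = complex_of_real \<beta> * complex_of_real x powr complex_of_real (- \<beta> - 1) *
        I_bern \<phi> (exp (\<i> * complex_of_real pi) * complex_of_real x powr complex_of_real (- \<beta>))"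
      unfolding dens_ext_real[OF \<beta> x(1)] dens_c_real[OF \<beta> x(1), symmetric] dens_c_def p by simp
  qed
qed

lemma dens_ext_vertical_integral:
  assumes \<beta>: "0 < \<beta>" and c: "- ((m_lower \<phi> \<beta> - 1) / ereal \<beta>) < ereal c" "ereal c < (m_upper \<beta> + 1) / ereal \<beta>"
    and t: "t \<in> sector (\<theta>\<^sub>S \<beta>)"
  shows "vertical_integrable c (MB_integrand \<phi> \<beta> t)"
    and "dens_ext \<beta> t = complex_of_real \<beta> / (2 * complex_of_real pi * \<i>) * vertical_integral c (MB_integrand \<phi> \<beta> t)"
proof -
  have c': "- a_killed \<phi> < ereal (c - 1 / \<beta> + 1)" "c - 1 / \<beta> < 1"
    using c mellin_strip_iff(2,4)[OF \<beta>] by blast+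
  note eq = MB_integrand_eq[OF \<beta> c'(1)]
  show "vertical_integrable c (MB_integrand \<phi> \<beta> t)"
    unfolding vertical_integrable_def eq by (rule MBG_integrable[OF c' \<beta> t])
  have "vertical_integral c (MB_integrand \<phi> \<beta> t) = (\<integral>b. MBG \<beta> (c - 1 / \<beta>) t b \<partial>lborel) * \<i>"
    unfolding vertical_integral_def eq by (rule integral_mult_left_zero)
  thus "dens_ext \<beta> t = complex_of_real \<beta> / (2 * complex_of_real pi * \<i>) * vertical_integral c (MB_integrand \<phi> \<beta> t)"
    unfolding dens_ext_MBG[OF c' \<beta> t] by simp
qed

end

section \<open>Existence, density and expansion of the law\<close>

theorem proposition1p3:
  fixes \<phi> :: bernstein and \<beta> :: real
  assumes "\<phi> \<in> Bernstein_functions" and "0 < \<beta>"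
  shows "\<exists>(M :: real measure) (F :: real \<Rightarrow> real).
     is_F \<phi> \<beta> M F \<and>
     (\<forall>\<nu> :: real measure. sets \<nu> = sets borel \<and> is_F \<phi> \<beta> \<nu> (\<lambda>x. x) \<longrightarrow> \<nu> = distr M borel F) \<and>
     (\<exists>(f :: real \<Rightarrow> real) (g :: complex \<Rightarrow> complex).
        (\<forall>t. 0 \<le> f t) \<and> (\<forall>t\<le>0. f t = 0) \<and>
        distributed M lborel F (\<lambda>t. ennreal (f t)) \<and>
        f \<in> C0_infty \<and>
        g holomorphic_on S_sector \<phi> \<beta> \<and>
        (\<forall>t>0. complex_of_real t \<in> S_sector \<phi> \<beta> \<and> g (complex_of_real t) = complex_of_real (f t)) \<and>
        (\<forall>c. - ((m_lower \<phi> \<beta> - 1) / ereal \<beta>) < ereal c \<and> ereal c < (m_upper \<beta> + 1) / ereal \<beta> \<longrightarrow>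
           (\<forall>t \<in> S_sector \<phi> \<beta>.
              vertical_integrable c (MB_integrand \<phi> \<beta> t) \<and>
              g t = complex_of_real \<beta> / (2 * complex_of_real pi * \<i>) *
                      vertical_integral c (MB_integrand \<phi> \<beta> t))) \<and>
        (\<forall>z. ereal (norm z) < bern_infty \<phi> \<longrightarrow> summable (\<lambda>n. I_coeff \<phi> n * z ^ n)) \<and>
        (\<forall>t \<in> S_sector \<phi> \<beta>. expansion_radius \<phi> \<beta> < norm t \<longrightarrow>
           g t = complex_of_real \<beta> * t powr complex_of_real (- \<beta> - 1) *
                   I_bern \<phi> (exp (\<i> * complex_of_real pi) * t powr complex_of_real (- \<beta>))))"
proof -
  interpret B: bernstein_function \<phi> by unfold_locales (rule assms(1))
  note \<beta> = assms(2)
  note S = B.theta_S(3)[OF \<beta>]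
  define M where "M = B.F_law \<beta>"
  have sets: "sets M = sets borel" "sets M = sets lborel" by (simp_all add: M_def B.F_law_def)
  have F: "is_F \<phi> \<beta> M (\<lambda>x. x)" unfolding M_def by (rule B.F_law_is_F[OF \<beta>])
  have id: "distr M borel (\<lambda>x. x) = M" "distr M lborel (\<lambda>x. x) = M"
    using distr_id2[OF sets(1)[symmetric]] distr_id2[OF sets(2)[symmetric]] by blast+
  have unique: "\<nu> = distr M borel (\<lambda>x. x)" if "sets \<nu> = sets borel" "is_F \<phi> \<beta> \<nu> (\<lambda>x. x)" for \<nu> :: "real measure"
    unfolding id by (rule is_F_unique[OF that(2) F that(1) sets(1) B.mellin_strip_iff(3)[OF \<beta>] \<beta>])
  have law: "distributed M lborel (\<lambda>x. x) (\<lambda>t. ennreal (B.dens \<beta> t))"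
    unfolding distributed_def id
  proof (intro conjI)
    show "M = density lborel (\<lambda>t. ennreal (B.dens \<beta> t))" by (simp add: M_def B.F_law_def)
    show "(\<lambda>t. ennreal (B.dens \<beta> t)) \<in> borel_measurable lborel"
      using B.dens_measurable[OF \<beta>] by simp
    show "(\<lambda>x. x) \<in> measurable M lborel" using sets(2) by (rule measurable_ident_sets)
  qed
  have summ: "summable (\<lambda>n. I_coeff \<phi> n * z ^ n)" if "ereal (norm z) < bern_infty \<phi>" for z
    by (rule summable_norm_cancel[OF B.I_summable[OF that]])
  have real: "complex_of_real t \<in> sector (B.\<theta>\<^sub>S \<beta>)" if "0 < t" for t
    by (rule of_real_sector[OF that B.theta_S(1)[OF \<beta>]])
  show ?thesis unfolding S
  proof (rule exI[of _ M], rule exI[of _ "\<lambda>x. x"],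
      intro conjI exI[of _ "B.dens \<beta>"] exI[of _ "B.dens_ext \<beta>"] allI impI ballI)
    show "is_F \<phi> \<beta> M (\<lambda>x. x)" by (rule F)
    show "\<nu> = distr M borel (\<lambda>x. x)" if "sets \<nu> = sets borel \<and> is_F \<phi> \<beta> \<nu> (\<lambda>x. x)" for \<nu> :: "real measure"
      using that by (intro unique) blast+
    show "0 \<le> B.dens \<beta> t" for t by (rule B.dens_nonneg[OF \<beta>])
    show "B.dens \<beta> t = 0" if "t \<le> 0" for t using that by (simp add: B.dens_def)
    show "distributed M lborel (\<lambda>x. x) (\<lambda>t. ennreal (B.dens \<beta> t))" by (rule law)
    show "B.dens \<beta> \<in> C0_infty" by (rule B.dens_C0_infty[OF \<beta>])
    show "B.dens_ext \<beta> holomorphic_on sector (B.\<theta>\<^sub>S \<beta>)" by (rule B.dens_ext_holomorphic[OF \<beta>])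
    show "complex_of_real t \<in> sector (B.\<theta>\<^sub>S \<beta>)" if "0 < t" for t by (rule real[OF that])
    show "B.dens_ext \<beta> (complex_of_real t) = complex_of_real (B.dens \<beta> t)" if "0 < t" for t
      by (rule B.dens_ext_real[OF \<beta> that])
    show "vertical_integrable c (MB_integrand \<phi> \<beta> t)"
      and "B.dens_ext \<beta> t = complex_of_real \<beta> / (2 * complex_of_real pi * \<i>) * vertical_integral c (MB_integrand \<phi> \<beta> t)"
      if "- ((m_lower \<phi> \<beta> - 1) / ereal \<beta>) < ereal c \<and> ereal c < (m_upper \<beta> + 1) / ereal \<beta>" "t \<in> sector (B.\<theta>\<^sub>S \<beta>)" for c t
      by (rule B.dens_ext_vertical_integral[OF \<beta> conjunct1[OF that(1)] conjunct2[OF that(1)] that(2)])+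
    show "summable (\<lambda>n. I_coeff \<phi> n * z ^ n)" if "ereal (norm z) < bern_infty \<phi>" for z by (rule summ[OF that])
    show "B.dens_ext \<beta> t = complex_of_real \<beta> * t powr complex_of_real (- \<beta> - 1) *
        I_bern \<phi> (exp (\<i> * complex_of_real pi) * t powr complex_of_real (- \<beta>))"
      if "t \<in> sector (B.\<theta>\<^sub>S \<beta>)" "expansion_radius \<phi> \<beta> < norm t" for t
      by (rule B.dens_ext_expansion[OF \<beta> that])
  qed
qed

end
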